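(* Let $(\mathcal{U},\mathcal{R})$ and $(\mathcal{V},\mathcal{S})$ be simplicial ringed spaces, let $f,g:(\mathcal{U},\mathcal{R})\to(\mathcal{V},\mathcal{S})$ be two simplicial maps, and let $h=\{h_i\}$ be a simplicial homotopy between $f$ and $g$. Then for any twisted complex $\mathcal{E}=(E^\bullet,a)$ on $(\mathcal{V},\mathcal{S})$, the degree $0$ morphism $\Phi_0(\mathcal{E}):f^*(\mathcal{E})\to g^*(\mathcal{E})$ in $\mathrm{Tw}(\mathcal{U},\mathcal{R})$ induced by $h$, with components $$\Phi_0(\mathcal{E})^{k,-k}=\sum_{i=0}^k(-1)^i h_i^*(a^{k+1,-k})\in\mathrm{Hom}^{-k}_{\mathcal{R}_k}(\tau_{k,0}^*f_0^*E,\rho_{k,0}^*g_0^*E),\qquad k\ge0,$$ is a weak equivalence.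
   Context: **Ringed spaces.** A ringed space is a topological space with a sheaf of (not necessarily commutative) rings; modules are left modules. For a morphism $f$ of ringed spaces, $f^*$ denotes pullback of modules and of module maps; the canonical isomorphisms $(f\circ g)^*\cong g^*f^*$ are treated as identities. A simplicial ringed space $(\mathcal{U},\mathcal{R})$ is a simplicial object $n\mapsto(U_n,\mathcal{R}_n)$ in ringed spaces, with faces $\partial_i$ and degeneracies $s_i$; a simplicial map is a morphism of simplicial objects. For $k\ge p$ put $\rho_{k,p}=\partial_{p+1}\circ\cdots\circ\partial_k$ and $\tau_{k,p}=\partial_0\circ\cdots\circ\partial_0$ ($k-p$ factors), both maps $(U_k,\mathcal{R}_k)\to(U_p,\mathcal{R}_p)$. **Bigraded maps.** For graded sheaves of $\mathcal{R}_0$-modules $E^\bullet,F^\bullet$ on $U_0$, an element $u^{p,q}$ of bidegree $(p,q)$ is an element of $\mathrm{Hom}^q_{\mathcal{R}_p}(\tau_{p,0}^*E,\rho_{p,0}^*F)$ (maps of graded sheaves raising degree by $q$); its total degree is $p+q$. For $u^{p,q}$ from $F$ to $G$ and $v^{r,s}$ from $E$ to $F$, the composition is $(u\cdot v)^{p+r,q+s}=(-1)^{qr}(\rho_{p+r,p}^*u^{p,q})\circ(\tau_{p+r,r}^*v^{r,s})$. The operator $\delta$ of bidegree $(1,0)$ is $(\delta u)^{p+1,q}=\sum_{j=1}^{p}(-1)^j\partial_j^*u^{p,q}$. **Twisted complexes.** A twisted complex on $(\mathcal{U},\mathcal{R})$ is a pair $\mathcal{E}=(E^\bullet,a)$, with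 $E^\bullet$ a graded sheaf of $\mathcal{R}_0$-modules on $U_0$ and $a=(a^{k,1-k})_{k\ge0}$, $a^{k,1-k}\in\mathrm{Hom}^{1-k}_{\mathcal{R}_k}(\tau_{k,0}^*E,\rho_{k,0}^*E)$, such that $\delta a+a\cdot a=0$ and $a^{1,0}$ is invertible up to homotopy (as a chain map $(\tau_{1,0}^*E,\tau_{1,0}^*a^{0,1})\to(\rho_{1,0}^*E,\rho_{1,0}^*a^{0,1})$). A degree $m$ morphism $\theta:(E,a)\to(F,b)$ is a family $\theta=(\theta^{k,m-k})_{k\ge0}$, $\theta^{k,m-k}\in\mathrm{Hom}^{m-k}_{\mathcal{R}_k}(\tau_{k,0}^*E,\rho_{k,0}^*F)$, with differential $d\theta=\delta\theta+b\cdot\theta-(-1)^m\theta\cdot a$ and composition $\cdot$. These form a dg-category $\mathrm{Tw}(\mathcal{U},\mathcal{R})$. **Pullback.** A simplicial map $f:(\mathcal{U},\mathcal{R})\to(\mathcal{V},\mathcal{S})$ induces a dg-functor $f^*:\mathrm{Tw}(\mathcal{V},\mathcal{S})\to\mathrm{Tw}(\mathcal{U},\mathcal{R})$, $f^*(E,a)=(f_0^*E,(f_k^*a^{k,1-k})_k)$, $(f^*\phi)^{k,m-k}=f_k^*\phi^{k,m-k}$. **Weak equivalence.** A morphism $\phi:(E^\bullet,a)\to(F^\bullet,b)$ in $\mathrm{Tw}(\mathcal{U},\mathcal{R})$ is a weak equivalence if it is of degree $0$, closed ($d\phi=0$), and its component $\phi^{0,0}:(E^\bullet,a^{0,1})\to(F^\bullet,b^{0,1})$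 is a quasi-isomorphism of complexes of $\mathcal{R}_0$-modules on $U_0$. **Simplicial homotopy.** A simplicial homotopy $h$ between $f,g:\mathcal{U}\to\mathcal{V}$ consists of morphisms of ringed spaces $h_i=h_i^p:U_p\to V_{p+1}$ for $p\geq 0$, $0\le i\le p$, such that: $\partial_0h_0=f_p$ and $\partial_{p+1}h_p=g_p$; $\partial_ih_j=h_{j-1}\partial_i$ if $i<j$, $\partial_ih_i=\partial_ih_{i-1}$ if $i=j\ne0$, $\partial_ih_j=h_j\partial_{i-1}$ if $i>j+1$; $s_ih_j=h_{j+1}s_i$ if $i\le j$, $s_ih_j=h_js_{i-1}$ if $i>j$. These give $\tau_{k+1,0}\circ h_i=f_0\circ\tau_{k,0}$ and $\rho_{k+1,0}\circ h_i=g_0\circ\rho_{k,0}$ for $0\le i\le k$, so that $h_i^*$ sends $\mathrm{Hom}_{\mathcal{S}_{k+1}}(\tau_{k+1,0}^*E,\rho_{k+1,0}^*F)$ to $\mathrm{Hom}_{\mathcal{R}_k}(\tau_{k,0}^*f_0^*E,\rho_{k,0}^*g_0^*F)$. *)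

theory Defs
  imports "HOL-Analysis.Abstract_Topology" "HOL-Algebra.Free_Abelian_Groups" "HOL-Algebra.AbelCoset" "HOL-Algebra.Module"
begin

section \<open>Sheaves and ringed spaces\<close>

text \<open>A presheaf of sets on a topology \<open>T\<close> consists of sets \<open>F U\<close> and
  restriction maps \<open>\<rho> U V : F U \<rightarrow> F V\<close> for open \<open>V \<subseteq> U\<close>; values of \<open>F\<close> and \<open>\<rho>\<close> at sets that are
  not open are irrelevant. A cover is a set \<open>C\<close> of open sets; compatible families indexed by
  other index sets are automatically functions of the member of the cover (restrict to
  \<open>U \<inter> U = U\<close>), so this is the usual sheaf condition. The empty cover is included.\<close>

definition set_sheaf ::
  "'x topology \<Rightarrow> ('x set \<Rightarrow> 'a set) \<Rightarrow> ('x set \<Rightarrow> 'x set \<Rightarrow> 'a \<Rightarrow> 'a) \<Rightarrow> bool" where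
  "set_sheaf T F \<rho> \<longleftrightarrow>
     (\<forall>U V. openin T U \<and> openin T V \<and> V \<subseteq> U \<longrightarrow> \<rho> U V \<in> F U \<rightarrow> F V) \<and>
     (\<forall>U. openin T U \<longrightarrow> (\<forall>s\<in>F U. \<rho> U U s = s)) \<and>
     (\<forall>U V W. openin T U \<and> openin T V \<and> openin T W \<and> W \<subseteq> V \<and> V \<subseteq> U \<longrightarrow>
        (\<forall>s\<in>F U. \<rho> V W (\<rho> U V s) = \<rho> U W s)) \<and>
     (\<forall>C s. (\<forall>U\<in>C. openin T U \<and> s U \<in> F U) \<and>
            (\<forall>U\<in>C. \<forall>V\<in>C. \<rho> U (U \<inter> V) (s U) = \<rho> V (U \<inter> V) (s V)) \<longrightarrow>
        (\<exists>!t. t \<in> F (\<Union>C) \<and> (\<forall>U\<in>C. \<rho> (\<Union>C) U t = s U)))"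

record ('x, 'r) rspace =
  rtop :: "'x topology"
  rsec :: "'x set \<Rightarrow> 'r ring"
  rres :: "'x set \<Rightarrow> 'x set \<Rightarrow> 'r \<Rightarrow> 'r"

definition ringed_space :: "('x, 'r) rspace \<Rightarrow> bool" where
  "ringed_space X \<longleftrightarrow>
     set_sheaf (rtop X) (\<lambda>U. carrier (rsec X U)) (rres X) \<and>
     (\<forall>U. openin (rtop X) U \<longrightarrow> ring (rsec X U)) \<and>
     (\<forall>U V. openin (rtop X) U \<and> openin (rtop X) V \<and> V \<subseteq> U \<longrightarrow>
        rres X U V \<in> ring_hom (rsec X U) (rsec X V))"

text \<open>A morphism carries its source and target. The map on points and the comorphisms
  \<open>comor f V : S(V) \<rightarrow> R(f\<^sup>-\<^sup>1 V)\<close> are required to be \<open>undefined\<close> outside their domains, so that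
  equality of morphisms is equality in HOL.\<close>

record ('x, 'r, 'y, 's) rs_mor =
  src :: "('x, 'r) rspace"
  tgt :: "('y, 's) rspace"
  pt :: "'x \<Rightarrow> 'y"
  comor :: "'y set \<Rightarrow> 's \<Rightarrow> 'r"

definition preim :: "('x, 'r, 'y, 's) rs_mor \<Rightarrow> 'y set \<Rightarrow> 'x set" where
  "preim f V = {x \<in> topspace (rtop (src f)). pt f x \<in> V}"

definition rs_morphism :: "('x, 'r, 'y, 's) rs_mor \<Rightarrow> bool" where
  "rs_morphism f \<longleftrightarrow>
     ringed_space (src f) \<and> ringed_space (tgt f) \<and>
     continuous_map (rtop (src f)) (rtop (tgt f)) (pt f) \<and>
     pt f \<in> extensional (topspace (rtop (src f))) \<and>
     (\<forall>V. openin (rtop (tgt f)) V \<longrightarrow>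
        comor f V \<in> ring_hom (rsec (tgt f) V) (rsec (src f) (preim f V)) \<and>
        comor f V \<in> extensional (carrier (rsec (tgt f) V))) \<and>
     (\<forall>V. \<not> openin (rtop (tgt f)) V \<longrightarrow> comor f V = (\<lambda>_. undefined)) \<and>
     (\<forall>V W. openin (rtop (tgt f)) V \<and> openin (rtop (tgt f)) W \<and> W \<subseteq> V \<longrightarrow>
        (\<forall>s\<in>carrier (rsec (tgt f) V).
           comor f W (rres (tgt f) V W s) =
           rres (src f) (preim f V) (preim f W) (comor f V s)))"

definition mor :: "('x, 'r) rspace \<Rightarrow> ('y, 's) rspace \<Rightarrow> ('x, 'r, 'y, 's) rs_mor set" where
  "mor X Y = {f. rs_morphism f \<and> src f = X \<and> tgt f = Y}"

definition id_mor :: "('x, 'r) rspace \<Rightarrow> ('x, 'r, 'x, 'r) rs_mor" where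
  "id_mor X =
     \<lparr>src = X, tgt = X,
      pt = restrict (\<lambda>x. x) (topspace (rtop X)),
      comor = (\<lambda>V. if openin (rtop X) V then restrict (\<lambda>s. s) (carrier (rsec X V))
                   else (\<lambda>_. undefined))\<rparr>"

definition mor_comp ::
  "('y, 's, 'z, 't) rs_mor \<Rightarrow> ('x, 'r, 'y, 's) rs_mor \<Rightarrow> ('x, 'r, 'z, 't) rs_mor"
  (infixl \<open>\<circ>\<^sub>R\<close> 55) where
  "f \<circ>\<^sub>R g =
     \<lparr>src = src g, tgt = tgt f,
      pt = restrict (\<lambda>x. pt f (pt g x)) (topspace (rtop (src g))),
      comor = (\<lambda>V. if openin (rtop (tgt f)) V
                   then restrict (\<lambda>s. comor g (preim f V) (comor f V s)) (carrier (rsec (tgt f) V))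
                   else (\<lambda>_. undefined))\<rparr>"


section \<open>Sheaves of left modules\<close>

text \<open>The locale \<open>module\<close> of HOL-Algebra requires a commutative ring. As there, the
  multiplicative fields that the record type \<open>module\<close> inherits from \<open>ring\<close> are meaningless
  for modules.\<close>

locale left_module = R?: ring R + M?: abelian_group M
  for R :: "('r, 'c) ring_scheme" (structure) and M :: "('r, 'm, 'd) module_scheme" (structure) +
  assumes smult_closed:
      "\<lbrakk> a \<in> carrier R; x \<in> carrier M \<rbrakk> \<Longrightarrow> a \<odot>\<^bsub>M\<^esub> x \<in> carrier M"
    and smult_l_distr:
      "\<lbrakk> a \<in> carrier R; b \<in> carrier R; x \<in> carrier M \<rbrakk> \<Longrightarrow>
       (a \<oplus>\<^bsub>R\<^esub> b) \<odot>\<^bsub>M\<^esub> x = a \<odot>\<^bsub>M\<^esub> x \<oplus>\<^bsub>M\<^esub> b \<odot>\<^bsub>M\<^esub> x"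
    and smult_r_distr:
      "\<lbrakk> a \<in> carrier R; x \<in> carrier M; y \<in> carrier M \<rbrakk> \<Longrightarrow>
       a \<odot>\<^bsub>M\<^esub> (x \<oplus>\<^bsub>M\<^esub> y) = a \<odot>\<^bsub>M\<^esub> x \<oplus>\<^bsub>M\<^esub> a \<odot>\<^bsub>M\<^esub> y"
    and smult_assoc:
      "\<lbrakk> a \<in> carrier R; b \<in> carrier R; x \<in> carrier M \<rbrakk> \<Longrightarrow>
       (a \<otimes>\<^bsub>R\<^esub> b) \<odot>\<^bsub>M\<^esub> x = a \<odot>\<^bsub>M\<^esub> (b \<odot>\<^bsub>M\<^esub> x)"
    and smult_one: "x \<in> carrier M \<Longrightarrow> \<one>\<^bsub>R\<^esub> \<odot>\<^bsub>M\<^esub> x = x"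

record ('x, 'r, 'm) msheaf =
  msec :: "'x set \<Rightarrow> ('r, 'm) module"
  mres :: "'x set \<Rightarrow> 'x set \<Rightarrow> 'm \<Rightarrow> 'm"

definition sheaf_of_modules :: "('x, 'r) rspace \<Rightarrow> ('x, 'r, 'm) msheaf \<Rightarrow> bool" where
  "sheaf_of_modules X M \<longleftrightarrow>
     ringed_space X \<and>
     set_sheaf (rtop X) (\<lambda>U. carrier (msec M U)) (mres M) \<and>
     (\<forall>U. openin (rtop X) U \<longrightarrow> left_module (rsec X U) (msec M U)) \<and>
     (\<forall>U V. openin (rtop X) U \<and> openin (rtop X) V \<and> V \<subseteq> U \<longrightarrow>
        (\<forall>s\<in>carrier (msec M U). \<forall>t\<in>carrier (msec M U).
           mres M U V (s \<oplus>\<^bsub>msec M U\<^esub> t) = mres M U V s \<oplus>\<^bsub>msec M V\<^esub> mres M U V t) \<and>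
        (\<forall>r\<in>carrier (rsec X U). \<forall>s\<in>carrier (msec M U).
           mres M U V (r \<odot>\<^bsub>msec M U\<^esub> s) = rres X U V r \<odot>\<^bsub>msec M V\<^esub> mres M U V s))"

text \<open>Maps \<open>M \<rightarrow> N\<close> of sheaves are families indexed by open sets, again \<open>undefined\<close> outside
  their domains.\<close>

definition on_sections ::
  "('x, 'r) rspace \<Rightarrow> ('x, 'r, 'm) msheaf \<Rightarrow> ('x set \<Rightarrow> 'm \<Rightarrow> 'n) \<Rightarrow> 'x set \<Rightarrow> 'm \<Rightarrow> 'n" where
  "on_sections X M u =
     (\<lambda>W. if openin (rtop X) W then restrict (u W) (carrier (msec M W)) else (\<lambda>_. undefined))"

definition mod_hom ::
  "('x, 'r) rspace \<Rightarrow> ('x, 'r, 'm) msheaf \<Rightarrow> ('x, 'r, 'n) msheaf \<Rightarrow> ('x set \<Rightarrow> 'm \<Rightarrow> 'n) set" where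
  "mod_hom X M N =
     {u. on_sections X M u = u \<and>
         (\<forall>U. openin (rtop X) U \<longrightarrow>
            u U \<in> carrier (msec M U) \<rightarrow> carrier (msec N U) \<and>
            (\<forall>s\<in>carrier (msec M U). \<forall>t\<in>carrier (msec M U).
               u U (s \<oplus>\<^bsub>msec M U\<^esub> t) = u U s \<oplus>\<^bsub>msec N U\<^esub> u U t) \<and>
            (\<forall>r\<in>carrier (rsec X U). \<forall>s\<in>carrier (msec M U).
               u U (r \<odot>\<^bsub>msec M U\<^esub> s) = r \<odot>\<^bsub>msec N U\<^esub> u U s)) \<and>
         (\<forall>U V. openin (rtop X) U \<and> openin (rtop X) V \<and> V \<subseteq> U \<longrightarrow>
            (\<forall>s\<in>carrier (msec M U). u V (mres M U V s) = mres N U V (u U s)))}"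

definition mod_iso ::
  "('x, 'r) rspace \<Rightarrow> ('x, 'r, 'm) msheaf \<Rightarrow> ('x, 'r, 'n) msheaf \<Rightarrow> ('x set \<Rightarrow> 'm \<Rightarrow> 'n) \<Rightarrow> bool" where
  "mod_iso X M N u \<longleftrightarrow>
     u \<in> mod_hom X M N \<and>
     (\<forall>U. openin (rtop X) U \<longrightarrow> bij_betw (u U) (carrier (msec M U)) (carrier (msec N U)))"

definition mod_id :: "('x, 'r) rspace \<Rightarrow> ('x, 'r, 'm) msheaf \<Rightarrow> 'x set \<Rightarrow> 'm \<Rightarrow> 'm" where
  "mod_id X M = on_sections X M (\<lambda>W s. s)"

text \<open>\<open>mod_comp X M v u\<close> is \<open>v\<close> after \<open>u\<close>, where \<open>M\<close> is the domain of \<open>u\<close>; \<open>mod_inv X M N u\<close> is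
  the inverse of an isomorphism \<open>u : M \<rightarrow> N\<close>.\<close>

definition mod_comp ::
  "('x, 'r) rspace \<Rightarrow> ('x, 'r, 'm) msheaf \<Rightarrow> ('x set \<Rightarrow> 'n \<Rightarrow> 'p) \<Rightarrow> ('x set \<Rightarrow> 'm \<Rightarrow> 'n)
   \<Rightarrow> 'x set \<Rightarrow> 'm \<Rightarrow> 'p" where
  "mod_comp X M v u = on_sections X M (\<lambda>W s. v W (u W s))"

definition mod_inv ::
  "('x, 'r) rspace \<Rightarrow> ('x, 'r, 'm) msheaf \<Rightarrow> ('x, 'r, 'n) msheaf \<Rightarrow> ('x set \<Rightarrow> 'm \<Rightarrow> 'n)
   \<Rightarrow> 'x set \<Rightarrow> 'n \<Rightarrow> 'm" where
  "mod_inv X M N u = on_sections X N (\<lambda>W. inv_into (carrier (msec M W)) (u W))"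


section \<open>Stalks\<close>

text \<open>A germ is an equivalence class of pairs (open neighbourhood, section). The operations on
  germs are unions over representatives, in the style of \<open>set_add\<close> for cosets: all
  representatives give the same germ.\<close>

definition germ ::
  "'x topology \<Rightarrow> ('x set \<Rightarrow> 'a set) \<Rightarrow> ('x set \<Rightarrow> 'x set \<Rightarrow> 'a \<Rightarrow> 'a) \<Rightarrow> 'x \<Rightarrow> 'x set \<Rightarrow> 'a
   \<Rightarrow> ('x set \<times> 'a) set" where
  "germ T F \<rho> x U s =
     {(V, t). openin T V \<and> x \<in> V \<and> t \<in> F V \<and>
              (\<exists>W. openin T W \<and> x \<in> W \<and> W \<subseteq> U \<inter> V \<and> \<rho> U W s = \<rho> V W t)}"

definition rgerm :: "('x, 'r) rspace \<Rightarrow> 'x \<Rightarrow> 'x set \<Rightarrow> 'r \<Rightarrow> ('x set \<times> 'r) set" where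
  "rgerm X = germ (rtop X) (\<lambda>U. carrier (rsec X U)) (rres X)"

definition mgerm ::
  "('x, 'r) rspace \<Rightarrow> ('x, 'r, 'm) msheaf \<Rightarrow> 'x \<Rightarrow> 'x set \<Rightarrow> 'm \<Rightarrow> ('x set \<times> 'm) set" where
  "mgerm X M = germ (rtop X) (\<lambda>U. carrier (msec M U)) (mres M)"

definition stalk_ring :: "('x, 'r) rspace \<Rightarrow> 'x \<Rightarrow> ('x set \<times> 'r) set ring" where
  "stalk_ring X x =
     \<lparr>carrier = {rgerm X x U r |U r. openin (rtop X) U \<and> x \<in> U \<and> r \<in> carrier (rsec X U)},
      monoid.mult = (\<lambda>a b. \<Union>(U, r)\<in>a. \<Union>(V, s)\<in>b.
        rgerm X x (U \<inter> V) (rres X U (U \<inter> V) r \<otimes>\<^bsub>rsec X (U \<inter> V)\<^esub> rres X V (U \<inter> V) s)),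
      one = rgerm X x (topspace (rtop X)) \<one>\<^bsub>rsec X (topspace (rtop X))\<^esub>,
      zero = rgerm X x (topspace (rtop X)) \<zero>\<^bsub>rsec X (topspace (rtop X))\<^esub>,
      add = (\<lambda>a b. \<Union>(U, r)\<in>a. \<Union>(V, s)\<in>b.
        rgerm X x (U \<inter> V) (rres X U (U \<inter> V) r \<oplus>\<^bsub>rsec X (U \<inter> V)\<^esub> rres X V (U \<inter> V) s))\<rparr>"

definition stalk_mod ::
  "('x, 'r) rspace \<Rightarrow> ('x, 'r, 'm) msheaf \<Rightarrow> 'x \<Rightarrow> (('x set \<times> 'r) set, ('x set \<times> 'm) set) module" where
  "stalk_mod X M x =
     \<lparr>carrier = {mgerm X M x U s |U s. openin (rtop X) U \<and> x \<in> U \<and> s \<in> carrier (msec M U)},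
      monoid.mult = undefined,
      one = undefined,
      zero = mgerm X M x (topspace (rtop X)) \<zero>\<^bsub>msec M (topspace (rtop X))\<^esub>,
      add = (\<lambda>a b. \<Union>(U, s)\<in>a. \<Union>(V, t)\<in>b.
        mgerm X M x (U \<inter> V) (mres M U (U \<inter> V) s \<oplus>\<^bsub>msec M (U \<inter> V)\<^esub> mres M V (U \<inter> V) t)),
      smult = (\<lambda>a b. \<Union>(U, r)\<in>a. \<Union>(V, t)\<in>b.
        mgerm X M x (U \<inter> V) (rres X U (U \<inter> V) r \<odot>\<^bsub>msec M (U \<inter> V)\<^esub> mres M V (U \<inter> V) t))\<rparr>"

text \<open>The ring homomorphism \<open>S\<^bsub>f(x)\<^esub> \<rightarrow> R\<^bsub>x\<^esub>\<close> on stalks, and the map on stalks at \<open>x\<close> induced by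
  a map of (pre)sheaves of modules into \<open>N\<close>.\<close>

definition stalk_comor ::
  "('x, 'r, 'y, 's) rs_mor \<Rightarrow> 'x \<Rightarrow> ('y set \<times> 's) set \<Rightarrow> ('x set \<times> 'r) set" where
  "stalk_comor f x a = (\<Union>(V, s)\<in>a. rgerm (src f) x (preim f V) (comor f V s))"

definition stalk_map ::
  "('x, 'r) rspace \<Rightarrow> ('x, 'r, 'n) msheaf \<Rightarrow> ('x set \<Rightarrow> 'm \<Rightarrow> 'n) \<Rightarrow> 'x
   \<Rightarrow> ('x set \<times> 'm) set \<Rightarrow> ('x set \<times> 'n) set" where
  "stalk_map X N u x a = (\<Union>(V, s)\<in>a. mgerm X N x V (u V s))"


section \<open>Extension of scalars over noncommutative rings\<close>

text \<open>For a ring homomorphism \<open>\<phi> : S \<rightarrow> R\<close> and a left \<open>S\<close>-module \<open>M\<close>, the left \<open>R\<close>-module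
  \<open>R \<otimes>\<^bsub>S\<^esub> M\<close> is the free abelian group on pairs modulo the usual relations.\<close>

type_synonym ('r, 'm) tensor = "(('r \<times> 'm) \<Rightarrow>\<^sub>0 int) set"

definition tensor_rels ::
  "'r ring \<Rightarrow> 's ring \<Rightarrow> ('s \<Rightarrow> 'r) \<Rightarrow> ('s, 'm) module \<Rightarrow> (('r \<times> 'm) \<Rightarrow>\<^sub>0 int) set" where
  "tensor_rels R S \<phi> M =
     {frag_of (r \<oplus>\<^bsub>R\<^esub> r', m) - frag_of (r, m) - frag_of (r', m) |r r' m.
        r \<in> carrier R \<and> r' \<in> carrier R \<and> m \<in> carrier M} \<union>
     {frag_of (r, m \<oplus>\<^bsub>M\<^esub> m') - frag_of (r, m) - frag_of (r, m') |r m m'.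
        r \<in> carrier R \<and> m \<in> carrier M \<and> m' \<in> carrier M} \<union>
     {frag_of (r \<otimes>\<^bsub>R\<^esub> \<phi> s, m) - frag_of (r, s \<odot>\<^bsub>M\<^esub> m) |r s m.
        r \<in> carrier R \<and> s \<in> carrier S \<and> m \<in> carrier M}"

definition tensor_ker ::
  "'r ring \<Rightarrow> 's ring \<Rightarrow> ('s \<Rightarrow> 'r) \<Rightarrow> ('s, 'm) module \<Rightarrow> (('r \<times> 'm) \<Rightarrow>\<^sub>0 int) set" where
  "tensor_ker R S \<phi> M =
     generate (free_Abelian_group (carrier R \<times> carrier M)) (tensor_rels R S \<phi> M)"

definition tensor_grp ::
  "'r ring \<Rightarrow> 's ring \<Rightarrow> ('s \<Rightarrow> 'r) \<Rightarrow> ('s, 'm) module \<Rightarrow> ('r, 'm) tensor monoid" where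
  "tensor_grp R S \<phi> M =
     free_Abelian_group (carrier R \<times> carrier M) Mod tensor_ker R S \<phi> M"

definition tens ::
  "'r ring \<Rightarrow> 's ring \<Rightarrow> ('s \<Rightarrow> 'r) \<Rightarrow> ('s, 'm) module \<Rightarrow> 'r \<Rightarrow> 'm \<Rightarrow> ('r, 'm) tensor" where
  "tens R S \<phi> M r m =
     tensor_ker R S \<phi> M #>\<^bsub>free_Abelian_group (carrier R \<times> carrier M)\<^esub> frag_of (r, m)"

text \<open>The additive map into \<open>T\<close> on tensors that is determined by a balanced map \<open>\<beta>\<close> on pairs:
  apply the linear extension of \<open>\<beta>\<close> to any representative.\<close>

definition tensor_lift ::
  "('t, 'b) ring_scheme \<Rightarrow> ('r \<times> 'm \<Rightarrow> 't) \<Rightarrow> ('r, 'm) tensor \<Rightarrow> 't" where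
  "tensor_lift T \<beta> A =
     (THE v. \<forall>c\<in>A. v = (\<Oplus>\<^bsub>T\<^esub>p\<in>Poly_Mapping.keys c. [Poly_Mapping.lookup c p] \<cdot>\<^bsub>T\<^esub> \<beta> p))"

definition tensor_ab ::
  "'r ring \<Rightarrow> 's ring \<Rightarrow> ('s \<Rightarrow> 'r) \<Rightarrow> ('s, 'm) module \<Rightarrow> ('r, 'm) tensor ring" where
  "tensor_ab R S \<phi> M =
     \<lparr>carrier = carrier (tensor_grp R S \<phi> M), monoid.mult = undefined, one = undefined,
      zero = \<one>\<^bsub>tensor_grp R S \<phi> M\<^esub>, add = (\<otimes>\<^bsub>tensor_grp R S \<phi> M\<^esub>)\<rparr>"

definition ext_scalars ::
  "'r ring \<Rightarrow> 's ring \<Rightarrow> ('s \<Rightarrow> 'r) \<Rightarrow> ('s, 'm) module \<Rightarrow> ('r, ('r, 'm) tensor) module" where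
  "ext_scalars R S \<phi> M =
     ring.extend (tensor_ab R S \<phi> M)
       \<lparr>smult = (\<lambda>r. tensor_lift (tensor_ab R S \<phi> M)
          (\<lambda>(r', m). tens R S \<phi> M (r \<otimes>\<^bsub>R\<^esub> r') m))\<rparr>"


section \<open>Pullback of modules\<close>

text \<open>For \<open>f : (X,R) \<rightarrow> (Y,S)\<close> and an \<open>S\<close>-module \<open>M\<close>, the sheaf
  \<open>f\<^sup>*M = R \<otimes>\<^bsub>f\<^sup>-\<^sup>1S\<^esub> f\<^sup>-\<^sup>1M\<close> is the sheafification of the tensor product presheaf. Its stalk at \<open>x\<close> is
  \<open>R\<^bsub>x\<^esub> \<otimes>\<^bsub>S\<^bsub>f(x)\<^esub>\<^esub> M\<^bsub>f(x)\<^esub>\<close>, and it is given here, as a sheafification, by the functions into the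
  stalks that are locally induced by finite sums \<open>\<Sum> r\<^bsub>i\<^esub> \<otimes> m\<^bsub>i\<^esub>\<close> of sections.\<close>

type_synonym ('x, 'r, 'y, 'm) pb = "'x \<Rightarrow> (('x set \<times> 'r) set, ('y set \<times> 'm) set) tensor"

definition pb_stalk ::
  "('x, 'r, 'y, 's) rs_mor \<Rightarrow> ('y, 's, 'm) msheaf \<Rightarrow> 'x
   \<Rightarrow> (('x set \<times> 'r) set, (('x set \<times> 'r) set, ('y set \<times> 'm) set) tensor) module" where
  "pb_stalk f M x =
     ext_scalars (stalk_ring (src f) x) (stalk_ring (tgt f) (pt f x)) (stalk_comor f x)
       (stalk_mod (tgt f) M (pt f x))"

definition pb_tens ::
  "('x, 'r, 'y, 's) rs_mor \<Rightarrow> ('y, 's, 'm) msheaf \<Rightarrow> 'x \<Rightarrow> ('x set \<times> 'r) set \<Rightarrow> ('y set \<times> 'm) set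
   \<Rightarrow> (('x set \<times> 'r) set, ('y set \<times> 'm) set) tensor" where
  "pb_tens f M x =
     tens (stalk_ring (src f) x) (stalk_ring (tgt f) (pt f x)) (stalk_comor f x)
       (stalk_mod (tgt f) M (pt f x))"

definition pullback ::
  "('x, 'r, 'y, 's) rs_mor \<Rightarrow> ('y, 's, 'm) msheaf \<Rightarrow> ('x, 'r, ('x, 'r, 'y, 'm) pb) msheaf" where
  "pullback f M =
     \<lparr>msec = (\<lambda>W.
        \<lparr>carrier =
           {s \<in> (\<Pi>\<^sub>E x\<in>W. carrier (pb_stalk f M x)).
              \<forall>x\<in>W. \<exists>W' V (n::nat) r m.
                openin (rtop (src f)) W' \<and> x \<in> W' \<and> W' \<subseteq> W \<and>
                openin (rtop (tgt f)) V \<and> W' \<subseteq> preim f V \<and>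
                (\<forall>i<n. r i \<in> carrier (rsec (src f) W') \<and> m i \<in> carrier (msec M V)) \<and>
                (\<forall>y\<in>W'. s y =
                   (\<Oplus>\<^bsub>pb_stalk f M y\<^esub>i\<in>{..<n}.
                      pb_tens f M y (rgerm (src f) y W' (r i)) (mgerm (tgt f) M (pt f y) V (m i))))},
         monoid.mult = undefined,
         one = undefined,
         zero = (\<lambda>x\<in>W. \<zero>\<^bsub>pb_stalk f M x\<^esub>),
         add = (\<lambda>s t. \<lambda>x\<in>W. s x \<oplus>\<^bsub>pb_stalk f M x\<^esub> t x),
         smult = (\<lambda>r s. \<lambda>x\<in>W. rgerm (src f) x W r \<odot>\<^bsub>pb_stalk f M x\<^esub> s x)\<rparr>),
      mres = (\<lambda>W W' s. restrict s W')\<rparr>"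

text \<open>\<open>f\<^sup>*u : f\<^sup>*M \<rightarrow> f\<^sup>*N\<close>, which is \<open>r \<otimes> m \<mapsto> r \<otimes> u m\<close> on stalks.\<close>

definition pullback_map ::
  "('x, 'r, 'y, 's) rs_mor \<Rightarrow> ('y, 's, 'm) msheaf \<Rightarrow> ('y, 's, 'n) msheaf \<Rightarrow> ('y set \<Rightarrow> 'm \<Rightarrow> 'n)
   \<Rightarrow> 'x set \<Rightarrow> ('x, 'r, 'y, 'm) pb \<Rightarrow> ('x, 'r, 'y, 'n) pb" where
  "pullback_map f M N u =
     on_sections (src f) (pullback f M) (\<lambda>W s. \<lambda>x\<in>W.
       tensor_lift (pb_stalk f N x)
         (\<lambda>(r, m). pb_tens f N x r (stalk_map (tgt f) N u (pt f x) m)) (s x))"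

text \<open>The canonical isomorphism \<open>g\<^sup>* f\<^sup>* M \<cong> (f \<circ> g)\<^sup>* M\<close>: on stalks,
  \<open>r \<otimes> (r' \<otimes> m) \<mapsto> r g\<^sup>#(r') \<otimes> m\<close>. An element of the stalk of \<open>f\<^sup>* M\<close> at \<open>y\<close> is a germ of
  functions into the modules \<open>pb_stalk f M\<close>, and \<open>germ_eval y\<close> takes its value at \<open>y\<close>.\<close>

definition germ_eval :: "'x \<Rightarrow> ('x set \<times> ('x \<Rightarrow> 'a)) set \<Rightarrow> 'a" where
  "germ_eval y c = (THE v. \<forall>(V, s)\<in>c. v = s y)"

definition can_comp ::
  "('y, 's, 'z, 't) rs_mor \<Rightarrow> ('x, 'r, 'y, 's) rs_mor \<Rightarrow> ('z, 't, 'm) msheaf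
   \<Rightarrow> 'x set \<Rightarrow> ('x, 'r, 'y, ('y, 's, 'z, 'm) pb) pb \<Rightarrow> ('x, 'r, 'z, 'm) pb" where
  "can_comp f g M =
     on_sections (src g) (pullback g (pullback f M)) (\<lambda>W s. \<lambda>x\<in>W.
       tensor_lift (pb_stalk (f \<circ>\<^sub>R g) M x)
         (\<lambda>(r, c). r \<odot>\<^bsub>pb_stalk (f \<circ>\<^sub>R g) M x\<^esub>
            tensor_lift (pb_stalk (f \<circ>\<^sub>R g) M x)
              (\<lambda>(r', m). pb_tens (f \<circ>\<^sub>R g) M x (stalk_comor g x r') m)
              (germ_eval (pt g x) c))
         (s x))"

text \<open>The canonical isomorphism \<open>M \<cong> id\<^sup>* M\<close>, \<open>m \<mapsto> 1 \<otimes> m\<close>.\<close>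

definition can_id ::
  "('x, 'r) rspace \<Rightarrow> ('x, 'r, 'm) msheaf \<Rightarrow> 'x set \<Rightarrow> 'm \<Rightarrow> ('x, 'r, 'x, 'm) pb" where
  "can_id X M =
     on_sections X M (\<lambda>W s. \<lambda>x\<in>W. pb_tens (id_mor X) M x \<one>\<^bsub>stalk_ring X x\<^esub> (mgerm X M x W s))"


section \<open>Graded sheaves of modules\<close>

type_synonym ('x, 'r, 'm) gmod = "int \<Rightarrow> ('x, 'r, 'm) msheaf"
type_synonym ('x, 'm, 'n) gmap = "int \<Rightarrow> 'x set \<Rightarrow> 'm \<Rightarrow> 'n"

definition gpullback ::
  "('x, 'r, 'y, 's) rs_mor \<Rightarrow> ('y, 's, 'm) gmod \<Rightarrow> ('x, 'r, ('x, 'r, 'y, 'm) pb) gmod" where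
  "gpullback f E = (\<lambda>n. pullback f (E n))"

text \<open>The abelian group \<open>Hom\<^sup>q(E,F)\<close> of maps raising degrees by \<open>q\<close>.\<close>

definition gHom ::
  "('x, 'r) rspace \<Rightarrow> ('x, 'r, 'm) gmod \<Rightarrow> ('x, 'r, 'n) gmod \<Rightarrow> int \<Rightarrow> ('x, 'm, 'n) gmap ring" where
  "gHom X E F q =
     \<lparr>carrier = {u. \<forall>n. u n \<in> mod_hom X (E n) (F (n + q))},
      monoid.mult = undefined,
      one = undefined,
      zero = (\<lambda>n. on_sections X (E n) (\<lambda>W s. \<zero>\<^bsub>msec (F (n + q)) W\<^esub>)),
      add = (\<lambda>u v n. on_sections X (E n) (\<lambda>W s. u n W s \<oplus>\<^bsub>msec (F (n + q)) W\<^esub> v n W s))\<rparr>"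

text \<open>\<open>gcomp X E s u v\<close> is \<open>u\<close> after \<open>v\<close>, where \<open>E\<close> is the domain of \<open>v\<close> and \<open>s\<close> is the degree
  of \<open>v\<close>.\<close>

definition gcomp ::
  "('x, 'r) rspace \<Rightarrow> ('x, 'r, 'm) gmod \<Rightarrow> int \<Rightarrow> ('x, 'n, 'p) gmap \<Rightarrow> ('x, 'm, 'n) gmap
   \<Rightarrow> ('x, 'm, 'p) gmap" where
  "gcomp X E s u v = (\<lambda>n. mod_comp X (E n) (u (n + s)) (v n))"

definition gid :: "('x, 'r) rspace \<Rightarrow> ('x, 'r, 'm) gmod \<Rightarrow> ('x, 'm, 'm) gmap" where
  "gid X E = (\<lambda>n. mod_id X (E n))"

definition cochain_complex ::
  "('x, 'r) rspace \<Rightarrow> ('x, 'r, 'm) gmod \<Rightarrow> ('x, 'm, 'm) gmap \<Rightarrow> bool" where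
  "cochain_complex X A d \<longleftrightarrow>
     (\<forall>n. sheaf_of_modules X (A n)) \<and> d \<in> carrier (gHom X A A 1) \<and>
     gcomp X A 1 d d = \<zero>\<^bsub>gHom X A A 2\<^esub>"

definition chain_map ::
  "('x, 'r) rspace \<Rightarrow> ('x, 'r, 'm) gmod \<Rightarrow> ('x, 'm, 'm) gmap
   \<Rightarrow> ('x, 'r, 'n) gmod \<Rightarrow> ('x, 'n, 'n) gmap \<Rightarrow> ('x, 'm, 'n) gmap \<Rightarrow> bool" where
  "chain_map X A dA B dB \<phi> \<longleftrightarrow>
     cochain_complex X A dA \<and> cochain_complex X B dB \<and> \<phi> \<in> carrier (gHom X A B 0) \<and>
     gcomp X A 0 dB \<phi> = gcomp X A 1 \<phi> dA"

definition chain_homotopic ::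
  "('x, 'r) rspace \<Rightarrow> ('x, 'r, 'm) gmod \<Rightarrow> ('x, 'm, 'm) gmap
   \<Rightarrow> ('x, 'r, 'n) gmod \<Rightarrow> ('x, 'n, 'n) gmap \<Rightarrow> ('x, 'm, 'n) gmap \<Rightarrow> ('x, 'm, 'n) gmap \<Rightarrow> bool" where
  "chain_homotopic X A dA B dB \<phi> \<psi> \<longleftrightarrow>
     (\<exists>\<eta>\<in>carrier (gHom X A B (- 1)).
        \<phi> \<ominus>\<^bsub>gHom X A B 0\<^esub> \<psi> = gcomp X A (- 1) dB \<eta> \<oplus>\<^bsub>gHom X A B 0\<^esub> gcomp X A 1 \<eta> dA)"

definition homotopy_invertible ::
  "('x, 'r) rspace \<Rightarrow> ('x, 'r, 'm) gmod \<Rightarrow> ('x, 'm, 'm) gmap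
   \<Rightarrow> ('x, 'r, 'n) gmod \<Rightarrow> ('x, 'n, 'n) gmap \<Rightarrow> ('x, 'm, 'n) gmap \<Rightarrow> bool" where
  "homotopy_invertible X A dA B dB \<phi> \<longleftrightarrow>
     chain_map X A dA B dB \<phi> \<and>
     (\<exists>\<psi>. chain_map X B dB A dA \<psi> \<and>
          chain_homotopic X A dA A dA (gcomp X A 0 \<psi> \<phi>) (gid X A) \<and>
          chain_homotopic X B dB B dB (gcomp X B 0 \<phi> \<psi>) (gid X B))"


section \<open>Cohomology sheaves and quasi-isomorphisms\<close>

definition cohom_presheaf ::
  "('x, 'r) rspace \<Rightarrow> ('x, 'r, 'm) gmod \<Rightarrow> ('x, 'm, 'm) gmap \<Rightarrow> int \<Rightarrow> ('x, 'r, 'm set) msheaf" where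
  "cohom_presheaf X A d n =
     (let cl = (\<lambda>W s. d (n - 1) W ` carrier (msec (A (n - 1)) W) +>\<^bsub>msec (A n) W\<^esub> s) in
     \<lparr>msec = (\<lambda>W.
        \<lparr>carrier = {cl W s |s. s \<in> carrier (msec (A n) W) \<and> d n W s = \<zero>\<^bsub>msec (A (n + 1)) W\<^esub>},
         monoid.mult = undefined,
         one = undefined,
         zero = cl W \<zero>\<^bsub>msec (A n) W\<^esub>,
         add = set_add (msec (A n) W),
         smult = (\<lambda>r K. \<Union>s\<in>K. cl W (r \<odot>\<^bsub>msec (A n) W\<^esub> s))\<rparr>),
      mres = (\<lambda>W W' K. \<Union>s\<in>K. cl W' (mres (A n) W W' s))\<rparr>)"

definition sheafify ::
  "('x, 'r) rspace \<Rightarrow> ('x, 'r, 'm) msheaf \<Rightarrow> ('x, 'r, 'x \<Rightarrow> ('x set \<times> 'm) set) msheaf" where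
  "sheafify X M =
     \<lparr>msec = (\<lambda>W.
        \<lparr>carrier =
           {s \<in> (\<Pi>\<^sub>E x\<in>W. carrier (stalk_mod X M x)).
              \<forall>x\<in>W. \<exists>W' m. openin (rtop X) W' \<and> x \<in> W' \<and> W' \<subseteq> W \<and> m \<in> carrier (msec M W') \<and>
                (\<forall>y\<in>W'. s y = mgerm X M y W' m)},
         monoid.mult = undefined,
         one = undefined,
         zero = (\<lambda>x\<in>W. \<zero>\<^bsub>stalk_mod X M x\<^esub>),
         add = (\<lambda>s t. \<lambda>x\<in>W. s x \<oplus>\<^bsub>stalk_mod X M x\<^esub> t x),
         smult = (\<lambda>r s. \<lambda>x\<in>W. rgerm X x W r \<odot>\<^bsub>stalk_mod X M x\<^esub> s x)\<rparr>),
      mres = (\<lambda>W W' s. restrict s W')\<rparr>"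

definition cohom_sheaf ::
  "('x, 'r) rspace \<Rightarrow> ('x, 'r, 'm) gmod \<Rightarrow> ('x, 'm, 'm) gmap \<Rightarrow> int
   \<Rightarrow> ('x, 'r, 'x \<Rightarrow> ('x set \<times> 'm set) set) msheaf" where
  "cohom_sheaf X A d n = sheafify X (cohom_presheaf X A d n)"

text \<open>The map \<open>H\<^sup>n(A) \<rightarrow> H\<^sup>n(B)\<close> of cohomology sheaves induced by a map \<open>\<phi> : A \<rightarrow> B\<close> of complexes.\<close>

definition cohom_map ::
  "('x, 'r) rspace \<Rightarrow> ('x, 'r, 'm) gmod \<Rightarrow> ('x, 'm, 'm) gmap
   \<Rightarrow> ('x, 'r, 'n) gmod \<Rightarrow> ('x, 'n, 'n) gmap \<Rightarrow> ('x, 'm, 'n) gmap \<Rightarrow> int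
   \<Rightarrow> 'x set \<Rightarrow> ('x \<Rightarrow> ('x set \<times> 'm set) set) \<Rightarrow> ('x \<Rightarrow> ('x set \<times> 'n set) set)" where
  "cohom_map X A dA B dB \<phi> n =
     on_sections X (cohom_sheaf X A dA n) (\<lambda>W s. \<lambda>x\<in>W.
       stalk_map X (cohom_presheaf X B dB n)
         (\<lambda>V K. \<Union>c\<in>K. dB (n - 1) V ` carrier (msec (B (n - 1)) V) +>\<^bsub>msec (B n) V\<^esub> \<phi> n V c)
         x (s x))"

definition quasi_isomorphism ::
  "('x, 'r) rspace \<Rightarrow> ('x, 'r, 'm) gmod \<Rightarrow> ('x, 'm, 'm) gmap
   \<Rightarrow> ('x, 'r, 'n) gmod \<Rightarrow> ('x, 'n, 'n) gmap \<Rightarrow> ('x, 'm, 'n) gmap \<Rightarrow> bool" where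
  "quasi_isomorphism X A dA B dB \<phi> \<longleftrightarrow>
     chain_map X A dA B dB \<phi> \<and>
     (\<forall>n. mod_iso X (cohom_sheaf X A dA n) (cohom_sheaf X B dB n) (cohom_map X A dA B dB \<phi> n))"


section \<open>Simplicial ringed spaces\<close>

text \<open>\<open>face U n i : U\<^bsub>n+1\<^esub> \<rightarrow> U\<^bsub>n\<^esub>\<close> for \<open>i \<le> n+1\<close> and \<open>degen U n i : U\<^bsub>n\<^esub> \<rightarrow> U\<^bsub>n+1\<^esub>\<close> for \<open>i \<le> n\<close>. That
  all \<open>U\<^bsub>n\<^esub>\<close> have points and sections in the same types is no restriction, because the spaces and
  sets of sections are subsets of these types.\<close>

record ('x, 'r) simplicial_rs =
  obj :: "nat \<Rightarrow> ('x, 'r) rspace"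
  face :: "nat \<Rightarrow> nat \<Rightarrow> ('x, 'r, 'x, 'r) rs_mor"
  degen :: "nat \<Rightarrow> nat \<Rightarrow> ('x, 'r, 'x, 'r) rs_mor"

definition simplicial_ringed_space :: "('x, 'r) simplicial_rs \<Rightarrow> bool" where
  "simplicial_ringed_space U \<longleftrightarrow>
     (\<forall>n. ringed_space (obj U n)) \<and>
     (\<forall>n i. i \<le> Suc n \<longrightarrow> face U n i \<in> mor (obj U (Suc n)) (obj U n)) \<and>
     (\<forall>n i. i \<le> n \<longrightarrow> degen U n i \<in> mor (obj U n) (obj U (Suc n))) \<and>
     (\<forall>n i j. i < j \<and> j \<le> n + 2 \<longrightarrow>
        face U n i \<circ>\<^sub>R face U (Suc n) j = face U n (j - 1) \<circ>\<^sub>R face U (Suc n) i) \<and>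
     (\<forall>n i j. i \<le> j \<and> j \<le> n \<longrightarrow>
        degen U (Suc n) i \<circ>\<^sub>R degen U n j = degen U (Suc n) (Suc j) \<circ>\<^sub>R degen U n i) \<and>
     (\<forall>n i j. j \<le> n \<and> (i = j \<or> i = Suc j) \<longrightarrow>
        face U n i \<circ>\<^sub>R degen U n j = id_mor (obj U n)) \<and>
     (\<forall>n i j. i < j \<and> j \<le> Suc n \<longrightarrow>
        face U (Suc n) i \<circ>\<^sub>R degen U (Suc n) j = degen U n (j - 1) \<circ>\<^sub>R face U n i) \<and>
     (\<forall>n i j. Suc j < i \<and> i \<le> n + 2 \<longrightarrow>
        face U (Suc n) i \<circ>\<^sub>R degen U (Suc n) j = degen U n j \<circ>\<^sub>R face U n (i - 1))"

definition simplicial_map ::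
  "('u, 'r) simplicial_rs \<Rightarrow> ('v, 's) simplicial_rs \<Rightarrow> (nat \<Rightarrow> ('u, 'r, 'v, 's) rs_mor) \<Rightarrow> bool" where
  "simplicial_map U V f \<longleftrightarrow>
     (\<forall>n. f n \<in> mor (obj U n) (obj V n)) \<and>
     (\<forall>n i. i \<le> Suc n \<longrightarrow> face V n i \<circ>\<^sub>R f (Suc n) = f n \<circ>\<^sub>R face U n i) \<and>
     (\<forall>n i. i \<le> n \<longrightarrow> degen V n i \<circ>\<^sub>R f n = f (Suc n) \<circ>\<^sub>R degen U n i)"

text \<open>\<open>h p i : U\<^bsub>p\<^esub> \<rightarrow> V\<^bsub>p+1\<^esub>\<close> for \<open>i \<le> p\<close>.\<close>

definition simplicial_homotopy ::
  "('u, 'r) simplicial_rs \<Rightarrow> ('v, 's) simplicial_rs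
   \<Rightarrow> (nat \<Rightarrow> ('u, 'r, 'v, 's) rs_mor) \<Rightarrow> (nat \<Rightarrow> ('u, 'r, 'v, 's) rs_mor)
   \<Rightarrow> (nat \<Rightarrow> nat \<Rightarrow> ('u, 'r, 'v, 's) rs_mor) \<Rightarrow> bool" where
  "simplicial_homotopy U V f g h \<longleftrightarrow>
     (\<forall>p i. i \<le> p \<longrightarrow> h p i \<in> mor (obj U p) (obj V (Suc p))) \<and>
     (\<forall>p. face V p 0 \<circ>\<^sub>R h p 0 = f p) \<and>
     (\<forall>p. face V p (Suc p) \<circ>\<^sub>R h p p = g p) \<and>
     (\<forall>p i j. i < j \<and> j \<le> Suc p \<longrightarrow>
        face V (Suc p) i \<circ>\<^sub>R h (Suc p) j = h p (j - 1) \<circ>\<^sub>R face U p i) \<and>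
     (\<forall>p i. i \<noteq> 0 \<and> i \<le> p \<longrightarrow> face V p i \<circ>\<^sub>R h p i = face V p i \<circ>\<^sub>R h p (i - 1)) \<and>
     (\<forall>p i j. Suc j < i \<and> i \<le> p + 2 \<longrightarrow>
        face V (Suc p) i \<circ>\<^sub>R h (Suc p) j = h p j \<circ>\<^sub>R face U p (i - 1)) \<and>
     (\<forall>p i j. i \<le> j \<and> j \<le> p \<longrightarrow>
        degen V (Suc p) i \<circ>\<^sub>R h p j = h (Suc p) (Suc j) \<circ>\<^sub>R degen U p i) \<and>
     (\<forall>p i j. j < i \<and> j \<le> p \<and> i \<le> Suc p \<longrightarrow>
        degen V (Suc p) i \<circ>\<^sub>R h p j = h (Suc p) j \<circ>\<^sub>R degen U p (i - 1))"

text \<open>\<open>rho U k p\<close> and \<open>tau U k p\<close> are the maps \<open>\<rho>\<^bsub>k,p\<^esub>, \<tau>\<^bsub>k,p\<^esub> : U\<^bsub>k\<^esub> \<rightarrow> U\<^bsub>p\<^esub>\<close>; only \<open>p \<le> k\<close> is meaningful.\<close>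

fun rho :: "('x, 'r) simplicial_rs \<Rightarrow> nat \<Rightarrow> nat \<Rightarrow> ('x, 'r, 'x, 'r) rs_mor" where
  "rho U 0 p = id_mor (obj U 0)"
| "rho U (Suc k) p =
     (if p \<le> k then rho U k p \<circ>\<^sub>R face U k (Suc k) else id_mor (obj U (Suc k)))"

fun tau :: "('x, 'r) simplicial_rs \<Rightarrow> nat \<Rightarrow> nat \<Rightarrow> ('x, 'r, 'x, 'r) rs_mor" where
  "tau U 0 p = id_mor (obj U 0)"
| "tau U (Suc k) p =
     (if p \<le> k then tau U k p \<circ>\<^sub>R face U k 0 else id_mor (obj U (Suc k)))"


section \<open>Pullback of graded maps between pullbacks\<close>

text \<open>For \<open>\<phi> : X \<rightarrow> Y\<close>, \<open>\<alpha>, \<beta> : Y \<rightarrow> Z\<close> and \<open>u : \<alpha>\<^sup>*E \<rightarrow> \<beta>\<^sup>*F\<close> of degree \<open>q\<close>, this is \<open>\<phi>\<^sup>*u\<close> regarded as a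
  map \<open>(\<alpha> \<circ> \<phi>)\<^sup>*E \<rightarrow> (\<beta> \<circ> \<phi>)\<^sup>*F\<close> through the canonical isomorphisms.\<close>

definition gpull ::
  "('x, 'r, 'y, 's) rs_mor \<Rightarrow> ('y, 's, 'z, 't) rs_mor \<Rightarrow> ('y, 's, 'z, 't) rs_mor
   \<Rightarrow> ('z, 't, 'm) gmod \<Rightarrow> ('z, 't, 'n) gmod \<Rightarrow> int
   \<Rightarrow> ('y, ('y, 's, 'z, 'm) pb, ('y, 's, 'z, 'n) pb) gmap
   \<Rightarrow> ('x, ('x, 'r, 'z, 'm) pb, ('x, 'r, 'z, 'n) pb) gmap" where
  "gpull \<phi> \<alpha> \<beta> E F q u = (\<lambda>n.
     mod_comp (src \<phi>) (pullback (\<alpha> \<circ>\<^sub>R \<phi>) (E n))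
       (can_comp \<beta> \<phi> (F (n + q)))
       (mod_comp (src \<phi>) (pullback (\<alpha> \<circ>\<^sub>R \<phi>) (E n))
         (pullback_map \<phi> (pullback \<alpha> (E n)) (pullback \<beta> (F (n + q))) (u n))
         (mod_inv (src \<phi>) (pullback \<phi> (pullback \<alpha> (E n))) (pullback (\<alpha> \<circ>\<^sub>R \<phi>) (E n))
           (can_comp \<alpha> \<phi> (E n)))))"

text \<open>For \<open>\<alpha>, \<beta> : X \<rightarrow> Y\<close>, \<open>\<gamma>, \<gamma>' : Y \<rightarrow> Z\<close> and \<open>u : (\<gamma> \<circ> \<alpha>)\<^sup>*E \<rightarrow> (\<gamma>' \<circ> \<beta>)\<^sup>*F\<close> of degree \<open>q\<close>, this is \<open>u\<close>
  regarded as a map \<open>\<alpha>\<^sup>*\<gamma>\<^sup>*E \<rightarrow> \<beta>\<^sup>*\<gamma>'\<^sup>*F\<close>.\<close>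

definition gunfold ::
  "('y, 's, 'z, 't) rs_mor \<Rightarrow> ('y, 's, 'z, 't) rs_mor
   \<Rightarrow> ('x, 'r, 'y, 's) rs_mor \<Rightarrow> ('x, 'r, 'y, 's) rs_mor
   \<Rightarrow> ('z, 't, 'm) gmod \<Rightarrow> ('z, 't, 'n) gmod \<Rightarrow> int
   \<Rightarrow> ('x, ('x, 'r, 'z, 'm) pb, ('x, 'r, 'z, 'n) pb) gmap
   \<Rightarrow> ('x, ('x, 'r, 'y, ('y, 's, 'z, 'm) pb) pb, ('x, 'r, 'y, ('y, 's, 'z, 'n) pb) pb) gmap" where
  "gunfold \<gamma> \<gamma>' \<alpha> \<beta> E F q u = (\<lambda>n.
     mod_comp (src \<alpha>) (pullback \<alpha> (pullback \<gamma> (E n)))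
       (mod_inv (src \<alpha>) (pullback \<beta> (pullback \<gamma>' (F (n + q)))) (pullback (\<gamma>' \<circ>\<^sub>R \<beta>) (F (n + q)))
         (can_comp \<gamma>' \<beta> (F (n + q))))
       (mod_comp (src \<alpha>) (pullback \<alpha> (pullback \<gamma> (E n))) (u n) (can_comp \<gamma> \<alpha> (E n))))"

text \<open>A map \<open>id\<^sup>*E \<rightarrow> id\<^sup>*F\<close> of degree \<open>q\<close> regarded as a map \<open>E \<rightarrow> F\<close>.\<close>

definition gunfold_id ::
  "('x, 'r) rspace \<Rightarrow> ('x, 'r, 'm) gmod \<Rightarrow> ('x, 'r, 'n) gmod \<Rightarrow> int
   \<Rightarrow> ('x, ('x, 'r, 'x, 'm) pb, ('x, 'r, 'x, 'n) pb) gmap \<Rightarrow> ('x, 'm, 'n) gmap" where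
  "gunfold_id X E F q u = (\<lambda>n.
     mod_comp X (E n)
       (mod_inv X (F (n + q)) (pullback (id_mor X) (F (n + q))) (can_id X (F (n + q))))
       (mod_comp X (E n) (u n) (can_id X (E n))))"


section \<open>Twisted complexes\<close>

text \<open>A family \<open>\<theta>\<close> of total degree \<open>m\<close> is given by \<open>\<theta> k = \<theta>\<^bsup>k,m-k\<^esup>\<close>.\<close>

type_synonym ('x, 'r, 'm, 'n) tw_family =
  "nat \<Rightarrow> ('x, ('x, 'r, 'x, 'm) pb, ('x, 'r, 'x, 'n) pb) gmap"

type_synonym ('x, 'r, 'm) twisted = "('x, 'r, 'm) gmod \<times> ('x, 'r, 'm, 'm) tw_family"

text \<open>\<open>Hom\<^sup>q\<^bsub>R\<^bsub>k\<^esub>\<^esub>(\<tau>\<^bsub>k,0\<^esub>\<^sup>*E, \<rho>\<^bsub>k,0\<^esub>\<^sup>*F)\<close>.\<close>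

definition tw_Hom ::
  "('x, 'r) simplicial_rs \<Rightarrow> ('x, 'r, 'm) gmod \<Rightarrow> ('x, 'r, 'n) gmod \<Rightarrow> nat \<Rightarrow> int
   \<Rightarrow> ('x, ('x, 'r, 'x, 'm) pb, ('x, 'r, 'x, 'n) pb) gmap ring" where
  "tw_Hom U E F k q = gHom (obj U k) (gpullback (tau U k 0) E) (gpullback (rho U k 0) F) q"

definition tw_families ::
  "('x, 'r) simplicial_rs \<Rightarrow> ('x, 'r, 'm) gmod \<Rightarrow> ('x, 'r, 'n) gmod \<Rightarrow> int
   \<Rightarrow> ('x, 'r, 'm, 'n) tw_family set" where
  "tw_families U E F m = {\<theta>. \<forall>k. \<theta> k \<in> carrier (tw_Hom U E F k (m - int k))}"

definition sgn_pow :: "int \<Rightarrow> int" where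
  "sgn_pow z = (if even z then 1 else - 1)"

text \<open>The degree \<open>m\<close> of \<open>\<theta>\<close> is an argument of the operators below. All simplicial identities such
  as \<open>\<tau>\<^bsub>p,0\<^esub> \<circ> \<partial>\<^bsub>j\<^esub> = \<tau>\<^bsub>p+1,0\<^esub>\<close> hold as equalities of morphisms, so \<open>gpull\<close> lands in the right group.\<close>

definition tw_delta ::
  "('x, 'r) simplicial_rs \<Rightarrow> ('x, 'r, 'm) gmod \<Rightarrow> ('x, 'r, 'n) gmod \<Rightarrow> int
   \<Rightarrow> ('x, 'r, 'm, 'n) tw_family \<Rightarrow> ('x, 'r, 'm, 'n) tw_family" where
  "tw_delta U E F m \<theta> k =
     (case k of
        0 \<Rightarrow> \<zero>\<^bsub>tw_Hom U E F 0 (m + 1)\<^esub>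
      | Suc p \<Rightarrow>
          (\<Oplus>\<^bsub>tw_Hom U E F (Suc p) (m - int p)\<^esub>j\<in>{1..p}.
             [sgn_pow (int j)] \<cdot>\<^bsub>tw_Hom U E F (Suc p) (m - int p)\<^esub>
               gpull (face U p j) (tau U p 0) (rho U p 0) E F (m - int p) (\<theta> p)))"

text \<open>\<open>tw_comp U E F G m l u v\<close> is \<open>u \<cdot> v\<close> for \<open>u\<close> from \<open>F\<close> to \<open>G\<close> of degree \<open>m\<close> and \<open>v\<close> from \<open>E\<close> to
  \<open>F\<close> of degree \<open>l\<close>; the sign is \<open>(-1)\<^bsup>qr\<^esup>\<close> with \<open>q = m - p\<close> and \<open>r = k - p\<close>.\<close>

definition tw_comp ::
  "('x, 'r) simplicial_rs \<Rightarrow> ('x, 'r, 'm) gmod \<Rightarrow> ('x, 'r, 'n) gmod \<Rightarrow> ('x, 'r, 'o) gmod \<Rightarrow> int \<Rightarrow> int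
   \<Rightarrow> ('x, 'r, 'n, 'o) tw_family \<Rightarrow> ('x, 'r, 'm, 'n) tw_family \<Rightarrow> ('x, 'r, 'm, 'o) tw_family" where
  "tw_comp U E F G m l u v k =
     (\<Oplus>\<^bsub>tw_Hom U E G k (m + l - int k)\<^esub>p\<in>{0..k}.
        [sgn_pow ((m - int p) * int (k - p))] \<cdot>\<^bsub>tw_Hom U E G k (m + l - int k)\<^esub>
          gcomp (obj U k) (gpullback (tau U k 0) E) (l - int (k - p))
            (gpull (rho U k p) (tau U p 0) (rho U p 0) F G (m - int p) (u p))
            (gpull (tau U k (k - p)) (tau U (k - p) 0) (rho U (k - p) 0) E F
               (l - int (k - p)) (v (k - p))))"

definition twisted_complex :: "('x, 'r) simplicial_rs \<Rightarrow> ('x, 'r, 'm) twisted \<Rightarrow> bool" where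
  "twisted_complex U \<E> \<longleftrightarrow> (case \<E> of (E, a) \<Rightarrow>
     (\<forall>n. sheaf_of_modules (obj U 0) (E n)) \<and>
     a \<in> tw_families U E E 1 \<and>
     (\<forall>k. tw_delta U E E 1 a k \<oplus>\<^bsub>tw_Hom U E E k (2 - int k)\<^esub> tw_comp U E E E 1 1 a a k
          = \<zero>\<^bsub>tw_Hom U E E k (2 - int k)\<^esub>) \<and>
     homotopy_invertible (obj U 1)
       (gpullback (tau U 1 0) E) (gpull (tau U 1 0) (tau U 0 0) (rho U 0 0) E E 1 (a 0))
       (gpullback (rho U 1 0) E) (gpull (rho U 1 0) (tau U 0 0) (rho U 0 0) E E 1 (a 0))
       (a 1))"

definition tw_diff ::
  "('x, 'r) simplicial_rs \<Rightarrow> ('x, 'r, 'm) twisted \<Rightarrow> ('x, 'r, 'n) twisted \<Rightarrow> int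
   \<Rightarrow> ('x, 'r, 'm, 'n) tw_family \<Rightarrow> ('x, 'r, 'm, 'n) tw_family" where
  "tw_diff U \<E> \<F> m \<theta> k = (case (\<E>, \<F>) of ((E, a), (F, b)) \<Rightarrow>
     (tw_delta U E F m \<theta> k \<oplus>\<^bsub>tw_Hom U E F k (m + 1 - int k)\<^esub> tw_comp U E F F 1 m b \<theta> k)
     \<ominus>\<^bsub>tw_Hom U E F k (m + 1 - int k)\<^esub>
     [sgn_pow m] \<cdot>\<^bsub>tw_Hom U E F k (m + 1 - int k)\<^esub> tw_comp U E E F m 1 \<theta> a k)"

text \<open>A weak equivalence is a morphism in \<open>Tw(U,R)\<close>, so both ends are required to be objects of
  this category.\<close>

definition weak_equivalence ::
  "('x, 'r) simplicial_rs \<Rightarrow> ('x, 'r, 'm) twisted \<Rightarrow> ('x, 'r, 'n) twisted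
   \<Rightarrow> ('x, 'r, 'm, 'n) tw_family \<Rightarrow> bool" where
  "weak_equivalence U \<E> \<F> \<phi> \<longleftrightarrow> (case (\<E>, \<F>) of ((E, a), (F, b)) \<Rightarrow>
     twisted_complex U \<E> \<and> twisted_complex U \<F> \<and>
     \<phi> \<in> tw_families U E F 0 \<and>
     (\<forall>k. tw_diff U \<E> \<F> 0 \<phi> k = \<zero>\<^bsub>tw_Hom U E F k (1 - int k)\<^esub>) \<and>
     quasi_isomorphism (obj U 0)
       E (gunfold_id (obj U 0) E E 1 (a 0))
       F (gunfold_id (obj U 0) F F 1 (b 0))
       (gunfold_id (obj U 0) E F 0 (\<phi> 0)))"

text \<open>\<open>f\<^sup>*(E,a) = (f\<^bsub>0\<^esub>\<^sup>*E, (f\<^bsub>k\<^esub>\<^sup>*a\<^bsup>k,1-k\<^esup>)\<^bsub>k\<^esub>)\<close>, using \<open>\<tau>\<^bsub>k,0\<^esub> \<circ> f\<^bsub>k\<^esub> = f\<^bsub>0\<^esub> \<circ> \<tau>\<^bsub>k,0\<^esub>\<close> and likewise for \<open>\<rho>\<close>.\<close>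

definition tw_pullback ::
  "('u, 'r) simplicial_rs \<Rightarrow> ('v, 's) simplicial_rs \<Rightarrow> (nat \<Rightarrow> ('u, 'r, 'v, 's) rs_mor)
   \<Rightarrow> ('v, 's, 'm) twisted \<Rightarrow> ('u, 'r, ('u, 'r, 'v, 'm) pb) twisted" where
  "tw_pullback U V f \<E> = (case \<E> of (E, a) \<Rightarrow>
     (gpullback (f 0) E,
      \<lambda>k. gunfold (f 0) (f 0) (tau U k 0) (rho U k 0) E E (1 - int k)
            (gpull (f k) (tau V k 0) (rho V k 0) E E (1 - int k) (a k))))"

text \<open>The family \<open>\<Phi>\<^bsub>0\<^esub>(\<E>)\<close>, using \<open>\<tau>\<^bsub>k+1,0\<^esub> \<circ> h\<^bsub>i\<^esub> = f\<^bsub>0\<^esub> \<circ> \<tau>\<^bsub>k,0\<^esub>\<close> and \<open>\<rho>\<^bsub>k+1,0\<^esub> \<circ> h\<^bsub>i\<^esub> = g\<^bsub>0\<^esub> \<circ> \<rho>\<^bsub>k,0\<^esub>\<close>.\<close>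

definition Phi0 ::
  "('u, 'r) simplicial_rs \<Rightarrow> ('v, 's) simplicial_rs
   \<Rightarrow> (nat \<Rightarrow> ('u, 'r, 'v, 's) rs_mor) \<Rightarrow> (nat \<Rightarrow> ('u, 'r, 'v, 's) rs_mor)
   \<Rightarrow> (nat \<Rightarrow> nat \<Rightarrow> ('u, 'r, 'v, 's) rs_mor) \<Rightarrow> ('v, 's, 'm) twisted
   \<Rightarrow> ('u, 'r, ('u, 'r, 'v, 'm) pb, ('u, 'r, 'v, 'm) pb) tw_family" where
  "Phi0 U V f g h \<E> k = (case \<E> of (E, a) \<Rightarrow>
     (\<Oplus>\<^bsub>tw_Hom U (gpullback (f 0) E) (gpullback (g 0) E) k (- int k)\<^esub>i\<in>{0..k}.
        [sgn_pow (int i)] \<cdot>\<^bsub>tw_Hom U (gpullback (f 0) E) (gpullback (g 0) E) k (- int k)\<^esub>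
          gunfold (f 0) (g 0) (tau U k 0) (rho U k 0) E E (- int k)
            (gpull (h k i) (tau V (Suc k) 0) (rho V (Suc k) 0) E E (- int k) (a (Suc k)))))"

end

theory Submission
  imports Defs
begin

text \<open>A map between pullback sheaves is determined by linear maps on the modules \<open>R\<^sub>x \<otimes> M\<^bsub>f(x)\<^esub>\<close>, where the
 canonical isomorphisms become explicit; this shows that transporting graded maps along morphisms of
 ringed spaces is additive, functorial and compatible with composition. The simplicial and homotopy
 identities then carry over to the twisted data, and the alternating sum over \<open>i\<close> of the pullbacks of
 the Maurer-Cartan equation along \<open>h\<^sub>i\<close> says that \<open>\<Phi>\<^sub>0\<close> is closed. Since \<open>\<tau>\<^bsub>1,0\<^esub> \<circ> h\<^sub>0 = f\<^sub>0\<close> and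
 \<open>\<rho>\<^bsub>1,0\<^esub> \<circ> h\<^sub>0 = g\<^sub>0\<close>, its component \<open>h\<^sub>0\<^sup>*a\<^bsup>1,0\<^esup>\<close> is the pullback of a homotopy equivalence, hence a
 quasi-isomorphism.\<close>

text \<open>Pullback of modules need not be left exact, so it need not preserve quasi-isomorphisms.
  It is additive and respects composition, and any such operation preserves homotopy equivalences.
  Therefore invertibility of \<open>a 1\<close> up to homotopy is what gets transported, and it is
  converted into a statement on cohomology sheaves only after the pullback along
  \<open>h 0 0\<close> has been taken.

  The isomorphisms between \<open>(f \<circ> g)\<^sup>*\<close> and
  \<open>g\<^sup>* f\<^sup>*\<close> are genuine maps here, and the definitions of
  \<open>gpull\<close> and \<open>gunfold\<close> contain inverses of them. Chasing diagrams of such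
  maps is avoided as follows. Elements of the form \<open>1 \<otimes> e\<close> generate the fibres
  of a pullback, and on them a transported map fits into a commuting square that contains no
  inverse. The square determines the map, so an identity between transported maps is proved by
  verifying a square.

  The signs are isolated in two lemmas on double sums in a free abelian group; they encode how the
  simplices of a prism share faces and how a product is cut at a vertex.\<close>

notation (input) mor_comp (infixl \<open>oo\<close> 55)

abbreviation "Sec M W \<equiv> carrier (msec M W)"
abbreviation "Rsec X W \<equiv> carrier (rsec X W)"
abbreviation "Stk f M x \<equiv> carrier (pb_stalk f M x)"
abbreviation "Pts X \<equiv> topspace (rtop X)"

section \<open>Linear extension and extension of scalars\<close>

text \<open>The sum inside \<open>tensor_lift\<close>, taken out so that it can be studied on the
  free abelian group before relations are divided out. With the identity for \<beta> it evaluates a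
  formal combination of elements of \<open>T\<close>; the signed sums near the end are compared in
  that form.\<close>

definition lin_ext :: "('t, 'b) ring_scheme \<Rightarrow> ('p \<Rightarrow> 't) \<Rightarrow> ('p \<Rightarrow>\<^sub>0 int) \<Rightarrow> 't" where
 "lin_ext T \<beta> c =
   (\<Oplus>\<^bsub>T\<^esub>p\<in>Poly_Mapping.keys c. [Poly_Mapping.lookup c p] \<cdot>\<^bsub>T\<^esub> \<beta> p)"

definition add_hom :: "('a, 'c) ring_scheme \<Rightarrow> ('b, 'd) ring_scheme \<Rightarrow> ('a \<Rightarrow> 'b) \<Rightarrow> bool" where
 "add_hom M N h \<longleftrightarrow> h \<in> carrier M \<rightarrow> carrier N \<and>
   (\<forall>x\<in>carrier M. \<forall>y\<in>carrier M. h (x \<oplus>\<^bsub>M\<^esub> y) = h x \<oplus>\<^bsub>N\<^esub> h y)"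

context abelian_group
begin

lemma uminus_zero [simp]: "\<ominus> \<zero> = \<zero>"
 using add.inv_one by simp

lemma int_mult_closed [simp, intro]: "x \<in> carrier G \<Longrightarrow> [(k::int)] \<cdot> x \<in> carrier G"
 using add.int_pow_closed by blast

lemma int_mult_add: "x \<in> carrier G \<Longrightarrow> [(j + k::int)] \<cdot> x = [j] \<cdot> x \<oplus> [k] \<cdot> x"
 using add.int_pow_mult by blast

lemma int_mult_0 [simp]: "[(0::int)] \<cdot> x = \<zero>"
 by (simp add: add_pow_def)

text \<open>Keys outside the support have coefficient 0 and contribute nothing. So combinations with
  different supports, or with cancellation in their sum, can be evaluated over one common index
  set.\<close>

lemma lin_ext_superset:
 assumes "finite K" and "Poly_Mapping.keys c \<subseteq> K" and "\<beta> \<in> K \<rightarrow> carrier G"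
 shows "lin_ext G \<beta> c = (\<Oplus>p\<in>K. [Poly_Mapping.lookup c p] \<cdot> \<beta> p)"
 unfolding lin_ext_def
 by (rule add.finprod_mono_neutral_cong_left) (use assms in \<open>auto simp: in_keys_iff\<close>)

lemma lin_ext_closed [intro]:
 "\<beta> \<in> Poly_Mapping.keys c \<rightarrow> carrier G \<Longrightarrow> lin_ext G \<beta> c \<in> carrier G"
 unfolding lin_ext_def by (rule finsum_closed) auto

lemma lin_ext_0 [simp]: "lin_ext G \<beta> 0 = \<zero>"
 by (simp add: lin_ext_def)

lemma lin_ext_frag_of [simp]: "\<beta> p \<in> carrier G \<Longrightarrow> lin_ext G \<beta> (frag_of p) = \<beta> p"
 by (simp add: lin_ext_def)

lemma lin_ext_add:
 assumes "\<beta> \<in> Poly_Mapping.keys c \<rightarrow> carrier G" "\<beta> \<in> Poly_Mapping.keys d \<rightarrow> carrier G"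
 shows "lin_ext G \<beta> (c + d) = lin_ext G \<beta> c \<oplus> lin_ext G \<beta> d"
proof -
 let ?K = "Poly_Mapping.keys c \<union> Poly_Mapping.keys d"
 have \<beta>: "\<beta> \<in> ?K \<rightarrow> carrier G" using assms by auto
 have "lin_ext G \<beta> (c + d) = (\<Oplus>p\<in>?K. [Poly_Mapping.lookup (c + d) p] \<cdot> \<beta> p)"
  using \<beta> keys_add[of c d] by (intro lin_ext_superset) auto
 also have "\<dots> = (\<Oplus>p\<in>?K. [Poly_Mapping.lookup c p] \<cdot> \<beta> p \<oplus> [Poly_Mapping.lookup d p] \<cdot> \<beta> p)"
  using \<beta> by (intro finsum_cong') (auto simp: lookup_add int_mult_add Pi_iff)
 also have "\<dots> = lin_ext G \<beta> c \<oplus> lin_ext G \<beta> d"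
  using \<beta> by (subst finsum_addf) (auto simp: lin_ext_superset[of ?K])
 finally show ?thesis .
qed

lemma lin_ext_uminus:
 assumes "\<beta> \<in> Poly_Mapping.keys c \<rightarrow> carrier G"
 shows "lin_ext G \<beta> (- c) = \<ominus> lin_ext G \<beta> c"
proof -
 have "lin_ext G \<beta> (- c) \<oplus> lin_ext G \<beta> c = \<zero>"
  using lin_ext_add[of \<beta> "- c" c] assms by simp
 then show ?thesis
  using assms by (metis add.inv_equality keys_minus lin_ext_closed)
qed

lemma lin_ext_diff:
 assumes "\<beta> \<in> Poly_Mapping.keys c \<rightarrow> carrier G" "\<beta> \<in> Poly_Mapping.keys d \<rightarrow> carrier G"
 shows "lin_ext G \<beta> (c - d) = lin_ext G \<beta> c \<ominus> lin_ext G \<beta> d"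
 using lin_ext_add[of \<beta> c "- d"] assms by (simp add: lin_ext_uminus a_minus_def)

lemma lin_ext_sum:
 assumes "finite I" and "\<And>i. i \<in> I \<Longrightarrow> \<beta> \<in> Poly_Mapping.keys (c i) \<rightarrow> carrier G"
 shows "lin_ext G \<beta> (\<Sum>i\<in>I. c i) = (\<Oplus>i\<in>I. lin_ext G \<beta> (c i))"
 using assms
proof (induction I rule: finite_induct)
 case (insert i I)
 have "\<beta> \<in> Poly_Mapping.keys (\<Sum>i\<in>I. c i) \<rightarrow> carrier G"
  using keys_sum[of c I] insert.prems by fastforce
 then show ?case
  using insert by (simp add: lin_ext_add lin_ext_closed)
qed simp

lemma lin_ext_cmul:
 assumes "\<beta> \<in> Poly_Mapping.keys c \<rightarrow> carrier G"
 shows "lin_ext G \<beta> (frag_cmul k c) = [k] \<cdot> lin_ext G \<beta> c"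
proof -
 have 1: "lin_ext G \<beta> (frag_cmul (int n) c) = [int n] \<cdot> lin_ext G \<beta> c" for n
 proof (induction n)
  case (Suc n)
  have "frag_cmul (int (Suc n)) c = c + frag_cmul (int n) c"
   using frag_cmul_distrib[of 1 "int n" c] by simp
  then show ?case
   using Suc assms keys_cmul[of "int n" c] int_mult_add[of "lin_ext G \<beta> c" 1 "int n"]
   by (simp add: lin_ext_add Pi_iff subset_iff lin_ext_closed)
 qed simp
 show ?thesis
 proof (cases "k \<ge> 0")
  case True then show ?thesis using 1[of "nat k"] by simp
 next
  case False
  have "lin_ext G \<beta> (frag_cmul k c) = lin_ext G \<beta> (- frag_cmul (int (nat (- k))) c)"
   using False by simp
  also have "\<dots> = \<ominus> ([int (nat (- k))] \<cdot> lin_ext G \<beta> c)"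
   using assms keys_cmul[of "int (nat (- k))" c] 1[of "nat (- k)"]
   by (subst lin_ext_uminus) (auto simp del: minus_frag_cmul)
  also have "\<dots> = [k] \<cdot> lin_ext G \<beta> c"
   using False add.int_pow_neg[OF lin_ext_closed[OF assms], of "- k"] by simp
  finally show ?thesis .
 qed
qed

end

text \<open>Restriction of sections, evaluation at a point, passage to germs and transport of maps
  are all of this kind, and each has to be moved past finite sums.\<close>

locale add_group_hom = A: abelian_group A + B: abelian_group B
 for A :: "('a, 'c) ring_scheme" and B :: "('b, 'd) ring_scheme" +
 fixes h
 assumes hom: "add_hom A B h"
begin

lemma closed [simp, intro]: "x \<in> carrier A \<Longrightarrow> h x \<in> carrier B"
 using hom by (auto simp: add_hom_def)

lemma add [simp]: "x \<in> carrier A \<Longrightarrow> y \<in> carrier A \<Longrightarrow> h (x \<oplus>\<^bsub>A\<^esub> y) = h x \<oplus>\<^bsub>B\<^esub> h y"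
 using hom by (auto simp: add_hom_def)

lemma zero [simp]: "h \<zero>\<^bsub>A\<^esub> = \<zero>\<^bsub>B\<^esub>"
 using add[of "\<zero>\<^bsub>A\<^esub>" "\<zero>\<^bsub>A\<^esub>"] B.add.l_cancel_one' by fastforce

lemma uminus [simp]: "x \<in> carrier A \<Longrightarrow> h (\<ominus>\<^bsub>A\<^esub> x) = \<ominus>\<^bsub>B\<^esub> h x"
 using add[of "\<ominus>\<^bsub>A\<^esub> x" x] by (metis A.a_inv_closed A.l_neg B.minus_equality closed zero)

lemma minus [simp]: "x \<in> carrier A \<Longrightarrow> y \<in> carrier A \<Longrightarrow> h (x \<ominus>\<^bsub>A\<^esub> y) = h x \<ominus>\<^bsub>B\<^esub> h y"
 by (simp add: a_minus_def)

lemma finsum: "f \<in> I \<rightarrow> carrier A \<Longrightarrow> h (\<Oplus>\<^bsub>A\<^esub>i\<in>I. f i) = (\<Oplus>\<^bsub>B\<^esub>i\<in>I. h (f i))"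
proof (induction I rule: infinite_finite_induct)
 case (insert i I)
 then show ?case by (simp add: Pi_iff)
qed auto

lemma int_mult: "x \<in> carrier A \<Longrightarrow> h ([(k::int)] \<cdot>\<^bsub>A\<^esub> x) = [k] \<cdot>\<^bsub>B\<^esub> h x"
proof -
 assume x: "x \<in> carrier A"
 have 1: "h ([int n] \<cdot>\<^bsub>A\<^esub> x) = [int n] \<cdot>\<^bsub>B\<^esub> h x" for n
 proof (induction n)
  case (Suc n)
  then show ?case
   using x A.int_mult_add[of x 1 "int n"] B.int_mult_add[of "h x" 1 "int n"] by simp
 qed simp
 show ?thesis
 proof (cases "k \<ge> 0")
  case True then show ?thesis using 1[of "nat k"] by simp
 next
  case False
  have "[k] \<cdot>\<^bsub>A\<^esub> x = \<ominus>\<^bsub>A\<^esub> ([int (nat (- k))] \<cdot>\<^bsub>A\<^esub> x)"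
   "[k] \<cdot>\<^bsub>B\<^esub> h x = \<ominus>\<^bsub>B\<^esub> ([int (nat (- k))] \<cdot>\<^bsub>B\<^esub> h x)"
   using False x A.add.int_pow_neg[of x "- k"] B.add.int_pow_neg[of "h x" "- k"] by simp_all
  then show ?thesis
   using 1[of "nat (- k)"] x by (simp del: int_nat_eq)
 qed
qed

end

text \<open>The quotient of a free abelian group comes in multiplicative notation, whereas modules
  use the additive fields of a ring record.\<close>

lemma abelian_group_of_comm_group:
 assumes "comm_group H" "carrier A = carrier H" "add A = monoid.mult H" "zero A = \<one>\<^bsub>H\<^esub>"
 shows "abelian_group A"
proof -
 interpret comm_group H by (rule assms)
 show ?thesis
  by (rule abelian_groupI) (use assms m_assoc m_comm l_inv_ex in auto)
qed

section \<open>Extension of scalars and its universal property\<close>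

locale scalar_ext = R: ring R + SM: left_module S M
 for R :: "'r ring" and S :: "'s ring" and \<phi> and M :: "('s, 'm) module" +
 assumes \<phi>_hom: "\<phi> \<in> ring_hom S R"
begin

abbreviation "FG \<equiv> free_Abelian_group (carrier R \<times> carrier M)"
abbreviation "K \<equiv> tensor_ker R S \<phi> M"
abbreviation "T \<equiv> ext_scalars R S \<phi> M"
abbreviation tns (infixl \<open>\<otimes>\<otimes>\<close> 70) where "r \<otimes>\<otimes> m \<equiv> tens R S \<phi> M r m"

lemma \<phi>_closed [simp, intro]: "s \<in> carrier S \<Longrightarrow> \<phi> s \<in> carrier R"
 using \<phi>_hom by (auto simp: ring_hom_def)

sublocale FG: comm_group FG
 by (rule abelian_free_Abelian_group)

lemma keys_diff3: "Poly_Mapping.keys (a - b - c) \<subseteq> Poly_Mapping.keys a \<union> Poly_Mapping.keys b \<union> Poly_Mapping.keys c"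
 using keys_diff[of "a - b" c] keys_diff[of a b] by auto

lemma rels_closed: "tensor_rels R S \<phi> M \<subseteq> carrier FG"
proof -
 have 2: "frag_of a - frag_of b \<in> carrier FG"
  if "a \<in> carrier R \<times> carrier M" "b \<in> carrier R \<times> carrier M" for a b
  using that keys_diff[of "frag_of a" "frag_of b"] by (auto simp: keys_frag_of)
 have 3: "frag_of a - frag_of b - frag_of c \<in> carrier FG"
  if "a \<in> carrier R \<times> carrier M" "b \<in> carrier R \<times> carrier M" "c \<in> carrier R \<times> carrier M" for a b c
  using that keys_diff3[of "frag_of a" "frag_of b" "frag_of c"] by (auto simp: keys_frag_of)
 show ?thesis
  unfolding tensor_rels_def by (auto simp del: carrier_free_Abelian_group_iff intro!: 2 3 SM.smult_closed)
qed

lemma ker_subgroup: "subgroup K FG"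
 unfolding tensor_ker_def by (rule FG.generate_is_subgroup[OF rels_closed])

sublocale K: normal K FG
 using ker_subgroup FG.normal_iff_subgroup by blast

lemma T_simps [simp]:
 "carrier T = carrier (FG Mod K)" "add T = monoid.mult (FG Mod K)" "zero T = K"
 "smult T r = tensor_lift (tensor_ab R S \<phi> M) (\<lambda>(r', m). (r \<otimes>\<^bsub>R\<^esub> r') \<otimes>\<otimes> m)"
 by (auto simp: ext_scalars_def tensor_ab_def tensor_grp_def FactGroup_def ring.defs)

lemma tensor_ab_simps [simp]:
 "carrier (tensor_ab R S \<phi> M) = carrier T" "add (tensor_ab R S \<phi> M) = add T"
 "zero (tensor_ab R S \<phi> M) = zero T"
 by (auto simp: tensor_ab_def tensor_grp_def FactGroup_def)

lemma abelian_group_ext_scalars: "abelian_group T"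
 and abelian_group_tensor_ab: "abelian_group (tensor_ab R S \<phi> M)"
proof -
 have *: "comm_group (FG Mod K)" "zero T = \<one>\<^bsub>FG Mod K\<^esub>"
  using FG.abelian_FactGroup[OF ker_subgroup] by (simp_all add: FactGroup_def)
 show "abelian_group T"
  by (rule abelian_group_of_comm_group[OF *(1)]) (use *(2) in simp_all)
 show "abelian_group (tensor_ab R S \<phi> M)"
  by (rule abelian_group_of_comm_group[OF *(1)]) (use *(2) in simp_all)
qed

sublocale T: abelian_group T
 by (rule abelian_group_ext_scalars)

declare T_simps [simp del]

lemma frag_in: "r \<in> carrier R \<Longrightarrow> m \<in> carrier M \<Longrightarrow> frag_of (r, m) \<in> carrier FG"
 by (simp add: keys_frag_of)

lemma coset_closed: "c \<in> carrier FG \<Longrightarrow> K #>\<^bsub>FG\<^esub> c \<in> carrier T"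
 by (auto simp: T_simps FactGroup_def RCOSETS_def)

lemma coset_add: "c \<in> carrier FG \<Longrightarrow> d \<in> carrier FG \<Longrightarrow> K #>\<^bsub>FG\<^esub> (c + d) = (K #>\<^bsub>FG\<^esub> c) \<oplus>\<^bsub>T\<^esub> (K #>\<^bsub>FG\<^esub> d)"
 using K.rcos_sum[of c d] by (simp add: T_simps FactGroup_def)

lemma coset_eq: "c \<in> carrier FG \<Longrightarrow> d \<in> carrier FG \<Longrightarrow> c - d \<in> K \<Longrightarrow> K #>\<^bsub>FG\<^esub> c = K #>\<^bsub>FG\<^esub> d"
proof -
 assume a: "c \<in> carrier FG" "d \<in> carrier FG" "c - d \<in> K"
 have "c = (c - d) \<otimes>\<^bsub>FG\<^esub> d" by simp
 then have "c \<in> K #>\<^bsub>FG\<^esub> d" using a unfolding r_coset_def by blast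
 then show ?thesis
  using FG.repr_independence[OF _ a(2) ker_subgroup] by metis
qed

lemma rel_in_ker: "c \<in> tensor_rels R S \<phi> M \<Longrightarrow> c \<in> K"
 unfolding tensor_ker_def by (rule generate.incl)

lemma tens_closed [simp, intro]: "r \<in> carrier R \<Longrightarrow> m \<in> carrier M \<Longrightarrow> r \<otimes>\<otimes> m \<in> carrier T"
 unfolding tens_def by (rule coset_closed[OF frag_in])

lemma tens_add_left:
 assumes "r \<in> carrier R" "r' \<in> carrier R" "m \<in> carrier M"
 shows "(r \<oplus>\<^bsub>R\<^esub> r') \<otimes>\<otimes> m = r \<otimes>\<otimes> m \<oplus>\<^bsub>T\<^esub> r' \<otimes>\<otimes> m"
proof -
 have "frag_of (r \<oplus>\<^bsub>R\<^esub> r', m) - (frag_of (r, m) + frag_of (r', m)) \<in> K"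
  unfolding diff_diff_add[symmetric]
  by (rule rel_in_ker) (use assms in \<open>unfold tensor_rels_def, blast\<close>)
 then show ?thesis
  unfolding tens_def using assms
  by (subst coset_add[OF frag_in frag_in, symmetric])
   (simp_all only:, rule coset_eq[OF frag_in FG.m_closed[OF frag_in frag_in, simplified mult_free_Abelian_group]], auto)
qed

lemma tens_add_right:
 assumes "r \<in> carrier R" "m \<in> carrier M" "m' \<in> carrier M"
 shows "r \<otimes>\<otimes> (m \<oplus>\<^bsub>M\<^esub> m') = r \<otimes>\<otimes> m \<oplus>\<^bsub>T\<^esub> r \<otimes>\<otimes> m'"
proof -
 have "frag_of (r, m \<oplus>\<^bsub>M\<^esub> m') - (frag_of (r, m) + frag_of (r, m')) \<in> K"
  unfolding diff_diff_add[symmetric]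
  by (rule rel_in_ker) (use assms in \<open>unfold tensor_rels_def, blast\<close>)
 then show ?thesis
  unfolding tens_def using assms
  by (subst coset_add[OF frag_in frag_in, symmetric])
   (simp_all only:, rule coset_eq[OF frag_in FG.m_closed[OF frag_in frag_in, simplified mult_free_Abelian_group]], auto)
qed

lemma tens_balanced:
 assumes "r \<in> carrier R" "s \<in> carrier S" "m \<in> carrier M"
 shows "(r \<otimes>\<^bsub>R\<^esub> \<phi> s) \<otimes>\<otimes> m = r \<otimes>\<otimes> (s \<odot>\<^bsub>M\<^esub> m)"
proof -
 have "frag_of (r \<otimes>\<^bsub>R\<^esub> \<phi> s, m) - frag_of (r, s \<odot>\<^bsub>M\<^esub> m) \<in> K"
  by (rule rel_in_ker) (use assms in \<open>unfold tensor_rels_def, blast\<close>)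
 then show ?thesis
  unfolding tens_def using assms by (intro coset_eq frag_in) (auto intro: SM.smult_closed)
qed

lemma tens_zero_left [simp]: "m \<in> carrier M \<Longrightarrow> \<zero>\<^bsub>R\<^esub> \<otimes>\<otimes> m = \<zero>\<^bsub>T\<^esub>"
 using tens_add_left[of "\<zero>\<^bsub>R\<^esub>" "\<zero>\<^bsub>R\<^esub>" m] T.add.l_cancel_one' by fastforce

lemma tens_uminus_left: "r \<in> carrier R \<Longrightarrow> m \<in> carrier M \<Longrightarrow> (\<ominus>\<^bsub>R\<^esub> r) \<otimes>\<otimes> m = \<ominus>\<^bsub>T\<^esub> (r \<otimes>\<otimes> m)"
 using tens_add_left[of "\<ominus>\<^bsub>R\<^esub> r" r m] R.l_neg[of r]
 by (metis R.a_inv_closed T.minus_equality tens_closed tens_zero_left)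

text \<open>An element of the tensor product is a signed sum of pure tensors, and the signs can be
  absorbed because \<open>- (r \<otimes> m) = (- r) \<otimes> m\<close>. Hence sums of pure tensors
  already exhaust it.\<close>

lemma ext_scalars_induct [consumes 1, case_names zero tens add]:
 assumes "e \<in> carrier T" and "P \<zero>\<^bsub>T\<^esub>"
  and "\<And>r m. r \<in> carrier R \<Longrightarrow> m \<in> carrier M \<Longrightarrow> P (r \<otimes>\<otimes> m)"
  and "\<And>a b. a \<in> carrier T \<Longrightarrow> b \<in> carrier T \<Longrightarrow> P a \<Longrightarrow> P b \<Longrightarrow> P (a \<oplus>\<^bsub>T\<^esub> b)"
 shows "P e"
proof -
 obtain c where c: "Poly_Mapping.keys c \<subseteq> carrier R \<times> carrier M" "e = K #>\<^bsub>FG\<^esub> c"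
  using assms(1) by (auto simp: T_simps FactGroup_def RCOSETS_def)
 \<comment> \<open>\<open>frag_induction\<close> builds combinations by differences, while
   \<open>P\<close> is only known to be closed under sums; so the claim is strengthened to an
   element together with its negative.\<close>
 have "P (K #>\<^bsub>FG\<^esub> c) \<and> P (\<ominus>\<^bsub>T\<^esub> (K #>\<^bsub>FG\<^esub> c)) \<and> Poly_Mapping.keys c \<subseteq> carrier R \<times> carrier M"
  using c(1)
 proof (induction rule: frag_induction)
  case zero
  have "K #>\<^bsub>FG\<^esub> 0 = \<zero>\<^bsub>T\<^esub>"
   using FG.coset_join2[OF _ ker_subgroup, of 0] K.one_closed by (simp add: T_simps)
  then show ?case using assms(2) by simp
 next
  case (one x)
  then show ?case
   using assms(3)[of "fst x" "snd x"] assms(3)[of "\<ominus>\<^bsub>R\<^esub> fst x" "snd x"]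
   by (auto simp: tens_uminus_left) (simp_all add: tens_def)
 next
  case (diff a b)
  have ab: "a \<in> carrier FG" "b \<in> carrier FG" "- b \<in> carrier FG" using diff by auto
  have m: "K #>\<^bsub>FG\<^esub> (- b) = \<ominus>\<^bsub>T\<^esub> (K #>\<^bsub>FG\<^esub> b)"
  proof -
   have "(K #>\<^bsub>FG\<^esub> (- b)) \<oplus>\<^bsub>T\<^esub> (K #>\<^bsub>FG\<^esub> b) = \<zero>\<^bsub>T\<^esub>"
    using coset_add[OF ab(3) ab(2)] FG.coset_join2[OF _ ker_subgroup, of 0] K.one_closed
    by (simp add: T_simps)
   then show ?thesis
    using T.minus_equality coset_closed ab by metis
  qed
  have e: "K #>\<^bsub>FG\<^esub> (a - b) = (K #>\<^bsub>FG\<^esub> a) \<oplus>\<^bsub>T\<^esub> \<ominus>\<^bsub>T\<^esub> (K #>\<^bsub>FG\<^esub> b)"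
   using coset_add[OF ab(1) ab(3)] m by simp
  have "\<ominus>\<^bsub>T\<^esub> (K #>\<^bsub>FG\<^esub> (a - b)) = (\<ominus>\<^bsub>T\<^esub> (K #>\<^bsub>FG\<^esub> a)) \<oplus>\<^bsub>T\<^esub> (K #>\<^bsub>FG\<^esub> b)"
   using ab coset_closed by (simp add: e T.minus_add del: carrier_free_Abelian_group_iff)
  then show ?case
   using diff e assms(4) coset_closed ab keys_diff[of a b]
   by (auto simp del: carrier_free_Abelian_group_iff)
 qed
 then show ?thesis using c by simp
qed

text \<open>The universal property of the tensor product for additive maps. The linear extension of
  \<beta> is a homomorphism on the free group that kills the three kinds of relations, hence the
  subgroup generated by them. So it is constant on cosets, and the definite description in
  \<open>tensor_lift\<close> denotes that constant.\<close>

lemma tensor_lift: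
 assumes A: "abelian_group A" and cl: "\<And>r m. r \<in> carrier R \<Longrightarrow> m \<in> carrier M \<Longrightarrow> \<beta> (r, m) \<in> carrier A"
  and add1: "\<And>r r' m. r \<in> carrier R \<Longrightarrow> r' \<in> carrier R \<Longrightarrow> m \<in> carrier M \<Longrightarrow>
   \<beta> (r \<oplus>\<^bsub>R\<^esub> r', m) = \<beta> (r, m) \<oplus>\<^bsub>A\<^esub> \<beta> (r', m)"
  and add2: "\<And>r m m'. r \<in> carrier R \<Longrightarrow> m \<in> carrier M \<Longrightarrow> m' \<in> carrier M \<Longrightarrow>
   \<beta> (r, m \<oplus>\<^bsub>M\<^esub> m') = \<beta> (r, m) \<oplus>\<^bsub>A\<^esub> \<beta> (r, m')"
  and bal: "\<And>r s m. r \<in> carrier R \<Longrightarrow> s \<in> carrier S \<Longrightarrow> m \<in> carrier M \<Longrightarrow>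
   \<beta> (r \<otimes>\<^bsub>R\<^esub> \<phi> s, m) = \<beta> (r, s \<odot>\<^bsub>M\<^esub> m)"
 shows "add_hom T A (tensor_lift A \<beta>)"
  and "\<And>r m. r \<in> carrier R \<Longrightarrow> m \<in> carrier M \<Longrightarrow> tensor_lift A \<beta> (r \<otimes>\<otimes> m) = \<beta> (r, m)"
proof -
 interpret A: abelian_group A by (rule A)
 let ?h = "lin_ext A \<beta>"
 have b: "\<beta> \<in> Poly_Mapping.keys c \<rightarrow> carrier A" if "c \<in> carrier FG" for c
  using that cl by auto
 have hcl: "?h c \<in> carrier A" if "c \<in> carrier FG" for c
  using b[OF that] by blast
 have hom: "?h \<in> hom FG (add_monoid A)"
  using hcl by (auto simp: hom_def A.lin_ext_add b simp del: carrier_free_Abelian_group_iff)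
 interpret h: group_hom FG "add_monoid A" ?h
  by unfold_locales (rule hom)
 have "tensor_rels R S \<phi> M \<subseteq> kernel FG (add_monoid A) ?h"
 proof
  fix c assume c: "c \<in> tensor_rels R S \<phi> M"
  have cc: "c \<in> carrier FG" using c rels_closed by blast
  have 3: "?h (frag_of x - frag_of y - frag_of z) = \<zero>\<^bsub>A\<^esub>"
   if "x \<in> carrier R \<times> carrier M" "y \<in> carrier R \<times> carrier M" "z \<in> carrier R \<times> carrier M"
    "\<beta> x = \<beta> y \<oplus>\<^bsub>A\<^esub> \<beta> z" for x y z
  proof -
   have "?h (frag_of x - frag_of y - frag_of z) = ?h (frag_of x - (frag_of y + frag_of z))"
    by (simp add: algebra_simps)
   also have "\<dots> = \<beta> x \<ominus>\<^bsub>A\<^esub> (\<beta> y \<oplus>\<^bsub>A\<^esub> \<beta> z)"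
    using that cl keys_add[of "frag_of y" "frag_of z"]
    by (subst A.lin_ext_diff) (auto simp: A.lin_ext_add keys_frag_of)
   also have "\<dots> = \<zero>\<^bsub>A\<^esub>" using that cl by (auto simp: a_minus_def A.r_neg)
   finally show ?thesis .
  qed
  have 2: "?h (frag_of x - frag_of y) = \<zero>\<^bsub>A\<^esub>"
   if "x \<in> carrier R \<times> carrier M" "y \<in> carrier R \<times> carrier M" "\<beta> x = \<beta> y" for x y
   using that cl by (subst A.lin_ext_diff) (auto simp: keys_frag_of a_minus_def A.r_neg)
  have "?h c = \<zero>\<^bsub>A\<^esub>"
   using c unfolding tensor_rels_def
   by (auto intro!: 3 2 simp: add1 add2 bal SM.smult_closed)
  then show "c \<in> kernel FG (add_monoid A) ?h"
   using cc by (simp add: kernel_def)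
 qed
 then have ker: "K \<subseteq> kernel FG (add_monoid A) ?h"
  unfolding tensor_ker_def by (intro FG.generate_subgroup_incl h.subgroup_kernel)
 have val: "tensor_lift A \<beta> (K #>\<^bsub>FG\<^esub> c) = ?h c" if c: "c \<in> carrier FG" for c
 proof -
  have eq: "?h d = ?h c" if "d \<in> K #>\<^bsub>FG\<^esub> c" for d
  proof -
   obtain k where k: "k \<in> K" "d = k + c" using \<open>d \<in> _\<close> by (auto simp: r_coset_def)
   then have "k \<in> carrier FG" "?h k = \<zero>\<^bsub>A\<^esub>" using ker K.subset by (auto simp: kernel_def)
   then show ?thesis
    using k(2) A.lin_ext_add[OF b[of k] b[of c]] hcl[OF c] c by simp
  qed
  have "c \<in> K #>\<^bsub>FG\<^esub> c" using FG.rcos_self[OF c ker_subgroup] .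
  then show ?thesis
   unfolding tensor_lift_def lin_ext_def[symmetric]
   by (intro the_equality) (metis eq)+
 qed
 show "tensor_lift A \<beta> (r \<otimes>\<otimes> m) = \<beta> (r, m)" if "r \<in> carrier R" "m \<in> carrier M" for r m
  unfolding tens_def val[OF frag_in[OF that]] using cl[OF that] by (rule A.lin_ext_frag_of)
 have rep: "\<exists>c\<in>carrier FG. e = K #>\<^bsub>FG\<^esub> c" if "e \<in> carrier T" for e
  using that by (auto simp: T_simps FactGroup_def RCOSETS_def)
 show "add_hom T A (tensor_lift A \<beta>)"
  unfolding add_hom_def
 proof (intro conjI ballI)
  show "tensor_lift A \<beta> \<in> carrier T \<rightarrow> carrier A"
   using rep val hcl by fastforce
  fix x y assume "x \<in> carrier T" "y \<in> carrier T"
  then obtain c d where cd: "c \<in> carrier FG" "d \<in> carrier FG" "x = K #>\<^bsub>FG\<^esub> c" "y = K #>\<^bsub>FG\<^esub> d"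
   using rep by meson
  show "tensor_lift A \<beta> (x \<oplus>\<^bsub>T\<^esub> y) = tensor_lift A \<beta> x \<oplus>\<^bsub>A\<^esub> tensor_lift A \<beta> y"
   using cd val[OF FG.m_closed[OF cd(1,2)]]
   by (simp add: coset_add[symmetric] val A.lin_ext_add b del: carrier_free_Abelian_group_iff)
 qed
qed

lemma add_hom_ext:
 assumes "add_hom T A u" "add_hom T A v" "abelian_group A"
  and "\<And>r m. r \<in> carrier R \<Longrightarrow> m \<in> carrier M \<Longrightarrow> u (r \<otimes>\<otimes> m) = v (r \<otimes>\<otimes> m)"
  and "e \<in> carrier T"
 shows "u e = v e"
proof -
 interpret u: add_group_hom T A u
  by (intro add_group_hom.intro add_group_hom_axioms.intro T.abelian_group_axioms assms)
 interpret v: add_group_hom T A v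
  by (intro add_group_hom.intro add_group_hom_axioms.intro T.abelian_group_axioms assms)
 show ?thesis
  using assms(5) by (induction rule: ext_scalars_induct) (auto simp: assms(4))
qed

text \<open>Multiplying the first factor by \<open>r\<close> on the left is balanced, because the
  relations act on that factor from the right.\<close>

lemma smult_hom:
 assumes "r \<in> carrier R"
 shows "add_hom T T (smult T r)"
  and smult_tens: "\<And>r' m. r' \<in> carrier R \<Longrightarrow> m \<in> carrier M \<Longrightarrow> r \<odot>\<^bsub>T\<^esub> (r' \<otimes>\<otimes> m) = (r \<otimes>\<^bsub>R\<^esub> r') \<otimes>\<otimes> m"
proof -
 \<comment> \<open>\<open>smult\<close> is defined by a lift into the bare additive group
   \<open>tensor_ab\<close>, which has the same carrier and addition as \<open>T\<close>.\<close>
 have 1: "add_hom T (tensor_ab R S \<phi> M) (smult T r)" and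
  2: "\<And>r' m. r' \<in> carrier R \<Longrightarrow> m \<in> carrier M \<Longrightarrow> r \<odot>\<^bsub>T\<^esub> (r' \<otimes>\<otimes> m) = (r \<otimes>\<^bsub>R\<^esub> r') \<otimes>\<otimes> m"
  unfolding T_simps(4)
  by (use assms tensor_lift[OF abelian_group_tensor_ab,
     where \<beta> = "\<lambda>(r', m). (r \<otimes>\<^bsub>R\<^esub> r') \<otimes>\<otimes> m"]
    in \<open>auto simp: R.r_distr tens_add_left tens_add_right tens_balanced R.m_assoc[symmetric]\<close>)
 show "add_hom T T (smult T r)" using 1 by (simp add: add_hom_def)
 show "\<And>r' m. r' \<in> carrier R \<Longrightarrow> m \<in> carrier M \<Longrightarrow> r \<odot>\<^bsub>T\<^esub> (r' \<otimes>\<otimes> m) = (r \<otimes>\<^bsub>R\<^esub> r') \<otimes>\<otimes> m"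
  by (rule 2)
qed

lemma add_hom_comp: "add_hom A B u \<Longrightarrow> add_hom B C v \<Longrightarrow> add_hom A C (\<lambda>x. v (u x))"
 unfolding add_hom_def by (auto simp: Pi_iff)

text \<open>The axioms that involve a single tensor are equalities of additive maps of it, so they
  are checked on pure tensors.\<close>

lemma left_module_ext_scalars: "left_module R T"
proof (intro left_module.intro left_module_axioms.intro R.ring_axioms abelian_group_ext_scalars)
 fix a b x y assume a: "a \<in> carrier R" and x: "x \<in> carrier T"
 show 1: "a \<odot>\<^bsub>T\<^esub> x \<in> carrier T"
  using smult_hom(1)[OF a] x by (auto simp: add_hom_def)
 show "a \<odot>\<^bsub>T\<^esub> (x \<oplus>\<^bsub>T\<^esub> y) = a \<odot>\<^bsub>T\<^esub> x \<oplus>\<^bsub>T\<^esub> a \<odot>\<^bsub>T\<^esub> y" if "y \<in> carrier T"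
  using smult_hom(1)[OF a] x that by (auto simp: add_hom_def)
 show "(a \<otimes>\<^bsub>R\<^esub> b) \<odot>\<^bsub>T\<^esub> x = a \<odot>\<^bsub>T\<^esub> (b \<odot>\<^bsub>T\<^esub> x)" if b: "b \<in> carrier R"
  by (rule add_hom_ext[OF smult_hom(1) add_hom_comp[OF smult_hom(1)[OF b] smult_hom(1)[OF a]]
     abelian_group_ext_scalars _ x]) (use a b in \<open>auto simp: smult_tens R.m_assoc\<close>)
 show "(a \<oplus>\<^bsub>R\<^esub> b) \<odot>\<^bsub>T\<^esub> x = a \<odot>\<^bsub>T\<^esub> x \<oplus>\<^bsub>T\<^esub> b \<odot>\<^bsub>T\<^esub> x" if b: "b \<in> carrier R"
 proof -
  have "add_hom T T (\<lambda>x. a \<odot>\<^bsub>T\<^esub> x \<oplus>\<^bsub>T\<^esub> b \<odot>\<^bsub>T\<^esub> x)"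
   using smult_hom(1)[OF a] smult_hom(1)[OF b] unfolding add_hom_def
   by (auto simp: Pi_iff T.a_ac)
  from add_hom_ext[OF smult_hom(1) this abelian_group_ext_scalars _ x] show ?thesis
   using a b by (auto simp: smult_tens R.l_distr tens_add_left)
 qed
next
 fix x assume x: "x \<in> carrier T"
 have "add_hom T T (\<lambda>x. x)" by (simp add: add_hom_def)
 from add_hom_ext[OF smult_hom(1) this abelian_group_ext_scalars _ x]
 show "\<one>\<^bsub>R\<^esub> \<odot>\<^bsub>T\<^esub> x = x" by (auto simp: smult_tens)
qed

sublocale T: left_module R T
 by (rule left_module_ext_scalars)

end

section \<open>Germs and stalks\<close>

text \<open>The cohomology presheaf, whose stalks enter the definition of a quasi-isomorphism, need
  not satisfy gluing; germs are therefore treated for presheaves.\<close>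

locale presheaf =
 fixes T :: "'x topology" and F :: "'x set \<Rightarrow> 'a set" and \<rho> :: "'x set \<Rightarrow> 'x set \<Rightarrow> 'a \<Rightarrow> 'a"
 assumes res_closed: "openin T U \<Longrightarrow> openin T V \<Longrightarrow> V \<subseteq> U \<Longrightarrow> s \<in> F U \<Longrightarrow> \<rho> U V s \<in> F V"
  and res_id: "openin T U \<Longrightarrow> s \<in> F U \<Longrightarrow> \<rho> U U s = s"
  and res_res: "openin T U \<Longrightarrow> openin T V \<Longrightarrow> openin T W \<Longrightarrow> W \<subseteq> V \<Longrightarrow> V \<subseteq> U \<Longrightarrow> s \<in> F U \<Longrightarrow>
   \<rho> V W (\<rho> U V s) = \<rho> U W s"
begin

lemma germ_eqI:
 assumes "openin T U" "openin T V" "openin T W" "x \<in> W" "W \<subseteq> U" "W \<subseteq> V" "s \<in> F U" "t \<in> F V"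
  "\<rho> U W s = \<rho> V W t"
 shows "germ T F \<rho> x U s = germ T F \<rho> x V t"
proof -
 \<comment> \<open>One inclusion, stated for arbitrary data so that exchanging the two sections
   gives the other one. A neighbourhood that witnesses membership for \<open>s\<close> is shrunk to
   its intersection with \<open>W\<close>.\<close>
 have *: "(V', t') \<in> germ T F \<rho> x V t"
  if o: "openin T U" "openin T V" "s \<in> F U" "t \<in> F V" "W \<subseteq> U" "W \<subseteq> V" "\<rho> U W s = \<rho> V W t"
   and m: "(V', t') \<in> germ T F \<rho> x U s" for U V s t V' t'
 proof -
  obtain W' where W': "openin T W'" "x \<in> W'" "W' \<subseteq> U \<inter> V'" "\<rho> U W' s = \<rho> V' W' t'"
   and V': "openin T V'" "x \<in> V'" "t' \<in> F V'"
   using m by (auto simp: germ_def)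
  have o': "openin T (W \<inter> W')" using assms W' by auto
  have "\<rho> V (W \<inter> W') t = \<rho> W (W \<inter> W') (\<rho> V W t)"
   using o assms(3) o' by (subst res_res) auto
  also have "\<dots> = \<rho> U (W \<inter> W') s"
   unfolding o(7)[symmetric] using o assms(3) o' by (subst res_res) auto
  also have "\<dots> = \<rho> W' (W \<inter> W') (\<rho> U W' s)"
   using o W' o' by (subst res_res) auto
  also have "\<dots> = \<rho> V' (W \<inter> W') t'"
   unfolding W'(4) using V' W' o' by (subst res_res) auto
  finally have e: "\<rho> V (W \<inter> W') t = \<rho> V' (W \<inter> W') t'" .
  have "W \<inter> W' \<subseteq> V \<inter> V'" "x \<in> W \<inter> W'" using W' o(6) assms(4) by auto
  then have "\<exists>W. openin T W \<and> x \<in> W \<and> W \<subseteq> V \<inter> V' \<and> \<rho> V W t = \<rho> V' W t'"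
   using e o' by metis
  then show ?thesis using V' by (simp add: germ_def)
 qed
 show ?thesis
  using *[OF assms(1,2,7,8,5,6,9)] *[OF assms(2,1,8,7,6,5) assms(9)[symmetric]] by auto
qed

lemma germ_self: "openin T U \<Longrightarrow> x \<in> U \<Longrightarrow> s \<in> F U \<Longrightarrow> (U, s) \<in> germ T F \<rho> x U s"
 by (auto simp: germ_def)

lemma germ_eqD:
 assumes "germ T F \<rho> x U s = germ T F \<rho> x V t" "openin T V" "x \<in> V" "t \<in> F V"
 obtains W where "openin T W" "x \<in> W" "W \<subseteq> U" "W \<subseteq> V" "\<rho> U W s = \<rho> V W t"
proof -
 have "(V, t) \<in> germ T F \<rho> x U s" using germ_self assms by simp
 then show ?thesis using that by (auto simp: germ_def)
qed

lemma mem_germ: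
 assumes "(V, t) \<in> germ T F \<rho> x U s" "openin T U" "s \<in> F U"
 shows "openin T V" "x \<in> V" "t \<in> F V" "germ T F \<rho> x V t = germ T F \<rho> x U s"
proof -
 show *: "openin T V" "x \<in> V" "t \<in> F V" using assms by (auto simp: germ_def)
 obtain W where "openin T W" "x \<in> W" "W \<subseteq> U \<inter> V" "\<rho> U W s = \<rho> V W t"
  using assms by (auto simp: germ_def)
 then show "germ T F \<rho> x V t = germ T F \<rho> x U s"
  using germ_eqI[of V U W x t s] * assms by simp
qed

lemma germ_res:
 assumes "openin T U" "openin T V" "V \<subseteq> U" "x \<in> V" "s \<in> F U"
 shows "germ T F \<rho> x V (\<rho> U V s) = germ T F \<rho> x U s"
 by (rule germ_eqI[of V U V]) (use assms in \<open>auto simp: res_closed res_res\<close>)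

text \<open>The operations on germs are unions over all representatives. If each representative
  contributes the same set, the union is that set, because a germ contains at least one
  representative.\<close>

lemma UN_germ:
 assumes "openin T U" "x \<in> U" "s \<in> F U"
  and "\<And>V t. openin T V \<Longrightarrow> x \<in> V \<Longrightarrow> t \<in> F V \<Longrightarrow> germ T F \<rho> x V t = germ T F \<rho> x U s \<Longrightarrow> g V t = c"
 shows "(\<Union>(V, t)\<in>germ T F \<rho> x U s. g V t) = c"
proof -
 have "g V t = c" if "(V, t) \<in> germ T F \<rho> x U s" for V t
  using mem_germ[OF that assms(1,3)] assms(4) by blast
 then show ?thesis using germ_self[OF assms(1-3)] by fastforce
qed

end

text \<open>Addition, multiplication and scalar action on stalks are handled at once, which is why
  there are three presheaves. Other representatives agree with the given ones on neighbourhoods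
  \<open>W1\<close> and \<open>W2\<close>; as \<open>bop\<close> commutes with restriction, the two
  results agree on \<open>W1 \<inter> W2\<close>.\<close>

lemma germ_binop:
 assumes "presheaf T F \<rho>" "presheaf T G \<sigma>" "presheaf T H \<tau>"
  and cl: "\<And>U a b. openin T U \<Longrightarrow> a \<in> F U \<Longrightarrow> b \<in> G U \<Longrightarrow> bop U a b \<in> H U"
  and nat: "\<And>U V a b. openin T U \<Longrightarrow> openin T V \<Longrightarrow> V \<subseteq> U \<Longrightarrow> a \<in> F U \<Longrightarrow> b \<in> G U \<Longrightarrow>
    \<tau> U V (bop U a b) = bop V (\<rho> U V a) (\<sigma> U V b)"
  and U: "openin T U" "x \<in> U" "a \<in> F U" and V: "openin T V" "x \<in> V" "b \<in> G V"
 shows "(\<Union>(U', a')\<in>germ T F \<rho> x U a. \<Union>(V', b')\<in>germ T G \<sigma> x V b.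
      germ T H \<tau> x (U' \<inter> V') (bop (U' \<inter> V') (\<rho> U' (U' \<inter> V') a') (\<sigma> V' (U' \<inter> V') b')))
     = germ T H \<tau> x (U \<inter> V) (bop (U \<inter> V) (\<rho> U (U \<inter> V) a) (\<sigma> V (U \<inter> V) b))"
proof -
 interpret F: presheaf T F \<rho> by fact
 interpret G: presheaf T G \<sigma> by fact
 interpret H: presheaf T H \<tau> by fact
 show ?thesis
 proof (rule F.UN_germ[OF U], rule G.UN_germ[OF V])
  fix U' a' V' b'
  assume U': "openin T U'" "x \<in> U'" "a' \<in> F U'" "germ T F \<rho> x U' a' = germ T F \<rho> x U a"
   and V': "openin T V'" "x \<in> V'" "b' \<in> G V'" "germ T G \<sigma> x V' b' = germ T G \<sigma> x V b"
  obtain W1 where W1: "openin T W1" "x \<in> W1" "W1 \<subseteq> U'" "W1 \<subseteq> U" "\<rho> U' W1 a' = \<rho> U W1 a"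
   using F.germ_eqD[OF U'(4) U] .
  obtain W2 where W2: "openin T W2" "x \<in> W2" "W2 \<subseteq> V'" "W2 \<subseteq> V" "\<sigma> V' W2 b' = \<sigma> V W2 b"
   using G.germ_eqD[OF V'(4) V] .
  let ?W = "W1 \<inter> W2"
  have o: "openin T ?W" "openin T (U \<inter> V)" "openin T (U' \<inter> V')" using W1 W2 U V U' V' by auto
  have r1: "\<rho> U' ?W a' = \<rho> U ?W a"
   using F.res_res[of U' W1 ?W a'] F.res_res[of U W1 ?W a] U U' W1 o by simp
  have r2: "\<sigma> V' ?W b' = \<sigma> V ?W b"
   using G.res_res[of V' W2 ?W b'] G.res_res[of V W2 ?W b] V V' W2 o by simp
  show "germ T H \<tau> x (U' \<inter> V') (bop (U' \<inter> V') (\<rho> U' (U' \<inter> V') a') (\<sigma> V' (U' \<inter> V') b'))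
     = germ T H \<tau> x (U \<inter> V) (bop (U \<inter> V) (\<rho> U (U \<inter> V) a) (\<sigma> V (U \<inter> V) b))"
  proof (rule H.germ_eqI[OF o(3) o(2) o(1)])
   show "\<tau> (U' \<inter> V') ?W (bop (U' \<inter> V') (\<rho> U' (U' \<inter> V') a') (\<sigma> V' (U' \<inter> V') b')) =
    \<tau> (U \<inter> V) ?W (bop (U \<inter> V) (\<rho> U (U \<inter> V) a) (\<sigma> V (U \<inter> V) b))"
   proof -
    have e: "\<rho> (U' \<inter> V') ?W (\<rho> U' (U' \<inter> V') a') = \<rho> U' ?W a'" "\<rho> (U \<inter> V) ?W (\<rho> U (U \<inter> V) a) = \<rho> U ?W a"
     "\<sigma> (U' \<inter> V') ?W (\<sigma> V' (U' \<inter> V') b') = \<sigma> V' ?W b'" "\<sigma> (U \<inter> V) ?W (\<sigma> V (U \<inter> V) b) = \<sigma> V ?W b"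
     by (rule F.res_res G.res_res; use o U V U' V' W1(3,4) W2(3,4) in auto)+
    show ?thesis
     using o U V U' V' W1(3,4) W2(3,4) r1 r2
     by (subst (1 2) nat) (auto simp: F.res_closed G.res_closed e)
   qed
  qed (use W1 W2 U V U' V' o in \<open>auto intro!: cl F.res_closed G.res_closed\<close>)
 qed
qed

lemma set_sheaf_presheaf:
 assumes "set_sheaf T F \<rho>"
 shows "presheaf T F \<rho>"
proof
 note a = assms[unfolded set_sheaf_def]
 show "\<rho> U V s \<in> F V" if "openin T U" "openin T V" "V \<subseteq> U" "s \<in> F U" for U V s
  using conjunct1[OF a, rule_format, of U V] that by (simp add: Pi_iff)
 show "\<rho> U U s = s" if "openin T U" "s \<in> F U" for U s
  using conjunct1[OF conjunct2[OF a]] that by simp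
 show "\<rho> V W (\<rho> U V s) = \<rho> U W s"
  if "openin T U" "openin T V" "openin T W" "W \<subseteq> V" "V \<subseteq> U" "s \<in> F U" for U V W s
  using conjunct1[OF conjunct2[OF conjunct2[OF a]], rule_format, of U V W s] that by simp
qed

lemma stalk_ring_ops:
 "add (stalk_ring X x) = (\<lambda>a b. \<Union>(U, r)\<in>a. \<Union>(V, s)\<in>b.
    rgerm X x (U \<inter> V) (rres X U (U \<inter> V) r \<oplus>\<^bsub>rsec X (U \<inter> V)\<^esub> rres X V (U \<inter> V) s))"
 "monoid.mult (stalk_ring X x) = (\<lambda>a b. \<Union>(U, r)\<in>a. \<Union>(V, s)\<in>b.
    rgerm X x (U \<inter> V) (rres X U (U \<inter> V) r \<otimes>\<^bsub>rsec X (U \<inter> V)\<^esub> rres X V (U \<inter> V) s))"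
 unfolding stalk_ring_def ring.select_convs monoid.select_convs by (rule refl)+

lemma stalk_mod_ops:
 "add (stalk_mod X M x) = (\<lambda>a b. \<Union>(U, s)\<in>a. \<Union>(V, t)\<in>b.
    mgerm X M x (U \<inter> V) (mres M U (U \<inter> V) s \<oplus>\<^bsub>msec M (U \<inter> V)\<^esub> mres M V (U \<inter> V) t))"
 "smult (stalk_mod X M x) = (\<lambda>a b. \<Union>(U, r)\<in>a. \<Union>(V, t)\<in>b.
    mgerm X M x (U \<inter> V) (rres X U (U \<inter> V) r \<odot>\<^bsub>msec M (U \<inter> V)\<^esub> mres M V (U \<inter> V) t))"
 unfolding stalk_mod_def ring.select_convs monoid.select_convs module.select_convs by (rule refl)+

definition lin_map :: "('r, 'c) ring_scheme \<Rightarrow> ('r, 'a, 'd) module_scheme \<Rightarrow> ('r, 'b, 'e) module_scheme \<Rightarrow> ('a \<Rightarrow> 'b) \<Rightarrow> bool" where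
 "lin_map R M N h \<longleftrightarrow> add_hom M N h \<and> (\<forall>r\<in>carrier R. \<forall>m\<in>carrier M. h (r \<odot>\<^bsub>M\<^esub> m) = r \<odot>\<^bsub>N\<^esub> h m)"

section \<open>Stalks of the structure sheaf\<close>

locale rsp = fixes X :: "('x, 'r) rspace" assumes ringed: "ringed_space X"
begin

abbreviation "opn \<equiv> openin (rtop X)"

sublocale r: presheaf "rtop X" "\<lambda>U. Rsec X U" "rres X"
 using ringed set_sheaf_presheaf by (auto simp: ringed_space_def)

lemma ring_sec: "opn U \<Longrightarrow> ring (rsec X U)"
 using ringed by (auto simp: ringed_space_def)

lemma res_hom: "opn U \<Longrightarrow> opn V \<Longrightarrow> V \<subseteq> U \<Longrightarrow> rres X U V \<in> ring_hom (rsec X U) (rsec X V)"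
 using ringed by (auto simp: ringed_space_def)

lemma sec_closed:
 assumes "opn U" "a \<in> Rsec X U" "b \<in> Rsec X U"
 shows "a \<oplus>\<^bsub>rsec X U\<^esub> b \<in> Rsec X U" "a \<otimes>\<^bsub>rsec X U\<^esub> b \<in> Rsec X U"
 using ring.ring_simprules(1,5)[OF ring_sec[OF assms(1)]] assms by simp_all

lemma res_add: "opn U \<Longrightarrow> opn V \<Longrightarrow> V \<subseteq> U \<Longrightarrow> a \<in> Rsec X U \<Longrightarrow> b \<in> Rsec X U \<Longrightarrow>
  rres X U V (a \<oplus>\<^bsub>rsec X U\<^esub> b) = rres X U V a \<oplus>\<^bsub>rsec X V\<^esub> rres X U V b"
 using ring_hom_add[OF res_hom] by blast

lemma res_mult: "opn U \<Longrightarrow> opn V \<Longrightarrow> V \<subseteq> U \<Longrightarrow> a \<in> Rsec X U \<Longrightarrow> b \<in> Rsec X U \<Longrightarrow>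
  rres X U V (a \<otimes>\<^bsub>rsec X U\<^esub> b) = rres X U V a \<otimes>\<^bsub>rsec X V\<^esub> rres X U V b"
 using ring_hom_mult[OF res_hom] by blast

lemma opn_top [simp]: "opn (Pts X)" by simp

lemma opn_top_sub: "opn U \<Longrightarrow> U \<subseteq> Pts X" by (rule openin_subset)

lemma res_zero: "opn U \<Longrightarrow> opn V \<Longrightarrow> V \<subseteq> U \<Longrightarrow> rres X U V \<zero>\<^bsub>rsec X U\<^esub> = \<zero>\<^bsub>rsec X V\<^esub>"
 using ring_hom_zero[OF res_hom] ring_sec by blast

end

locale rsp_pt = rsp + fixes x assumes x_in: "x \<in> Pts X"
begin

abbreviation "nb U \<equiv> opn U \<and> x \<in> U"
abbreviation "g \<equiv> rgerm X x"
abbreviation "St \<equiv> stalk_ring X x"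

lemma carrierE:
 assumes "a \<in> carrier St" obtains U r where "nb U" "r \<in> Rsec X U" "a = g U r"
 using assms by (auto simp: stalk_ring_def)

lemma g_in [simp, intro]: "nb U \<Longrightarrow> r \<in> Rsec X U \<Longrightarrow> g U r \<in> carrier St"
 by (auto simp: stalk_ring_def)

lemma g_res: "nb U \<Longrightarrow> nb V \<Longrightarrow> V \<subseteq> U \<Longrightarrow> r \<in> Rsec X U \<Longrightarrow> g V (rres X U V r) = g U r"
 unfolding rgerm_def by (rule r.germ_res) auto

lemma g_add:
 assumes "nb U" "r \<in> Rsec X U" "s \<in> Rsec X U"
 shows "g U r \<oplus>\<^bsub>St\<^esub> g U s = g U (r \<oplus>\<^bsub>rsec X U\<^esub> s)"
proof -
 have "g U r \<oplus>\<^bsub>St\<^esub> g U s = g (U \<inter> U) (rres X U (U \<inter> U) r \<oplus>\<^bsub>rsec X (U \<inter> U)\<^esub> rres X U (U \<inter> U) s)"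
  unfolding stalk_ring_ops rgerm_def
  by (rule germ_binop[OF r.presheaf_axioms r.presheaf_axioms r.presheaf_axioms, of "\<lambda>U. add (rsec X U)" U x r U s])
   (simp_all add: assms r.presheaf_axioms sec_closed res_add res_mult)
 then show ?thesis using assms by (simp add: r.res_id)
qed

lemma g_mult:
 assumes "nb U" "r \<in> Rsec X U" "s \<in> Rsec X U"
 shows "g U r \<otimes>\<^bsub>St\<^esub> g U s = g U (r \<otimes>\<^bsub>rsec X U\<^esub> s)"
proof -
 have "g U r \<otimes>\<^bsub>St\<^esub> g U s = g (U \<inter> U) (rres X U (U \<inter> U) r \<otimes>\<^bsub>rsec X (U \<inter> U)\<^esub> rres X U (U \<inter> U) s)"
  unfolding stalk_ring_ops rgerm_def
  by (rule germ_binop[OF r.presheaf_axioms r.presheaf_axioms r.presheaf_axioms, of "\<lambda>U. monoid.mult (rsec X U)" U x r U s])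
   (simp_all add: assms r.presheaf_axioms sec_closed res_add res_mult)
 then show ?thesis using assms by (simp add: r.res_id)
qed

lemma g_zero: "nb U \<Longrightarrow> g U \<zero>\<^bsub>rsec X U\<^esub> = \<zero>\<^bsub>St\<^esub>"
 using g_res[of "Pts X" U "\<zero>\<^bsub>rsec X (Pts X)\<^esub>"] x_in ring_sec opn_top_sub[of U]
  ring.ring_simprules(2)[OF ring_sec[OF opn_top]] res_zero
 by (simp add: stalk_ring_def)

lemma g_one: "nb U \<Longrightarrow> g U \<one>\<^bsub>rsec X U\<^esub> = \<one>\<^bsub>St\<^esub>"
 using g_res[of "Pts X" U "\<one>\<^bsub>rsec X (Pts X)\<^esub>"] x_in ring_sec opn_top_sub[of U]
  ring.ring_simprules(6)[OF ring_sec[OF opn_top]] ring_hom_one[OF res_hom, of "Pts X" U]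
 by (simp add: stalk_ring_def)

text \<open>Intersecting the domains puts three germs over one open set, where a ring axiom of the
  stalk becomes the same axiom in a single ring of sections.\<close>

lemma common3:
 assumes "a \<in> carrier St" "b \<in> carrier St" "c \<in> carrier St"
 obtains U r s t where "nb U" "r \<in> Rsec X U" "s \<in> Rsec X U" "t \<in> Rsec X U"
  "a = g U r" "b = g U s" "c = g U t"
proof -
 obtain U1 r1 U2 r2 U3 r3 where *: "nb U1" "r1 \<in> Rsec X U1" "a = g U1 r1"
  "nb U2" "r2 \<in> Rsec X U2" "b = g U2 r2" "nb U3" "r3 \<in> Rsec X U3" "c = g U3 r3"
  using carrierE[OF assms(1)] carrierE[OF assms(2)] carrierE[OF assms(3)] by metis
 let ?U = "U1 \<inter> U2 \<inter> U3"
 have U: "nb ?U" "?U \<subseteq> U1" "?U \<subseteq> U2" "?U \<subseteq> U3" using * by auto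
 show ?thesis
  by (rule that[of ?U "rres X U1 ?U r1" "rres X U2 ?U r2" "rres X U3 ?U r3"])
   (use U * g_res r.res_closed in presburger)+
qed

lemma ring_stalk: "ring St"
proof (rule ringI)
 show "abelian_group St"
 proof (rule abelian_groupI)
  fix a b c assume abc: "a \<in> carrier St" "b \<in> carrier St" "c \<in> carrier St"
  obtain U r s t where *: "nb U" "r \<in> Rsec X U" "s \<in> Rsec X U" "t \<in> Rsec X U"
   "a = g U r" "b = g U s" "c = g U t" using common3[OF abc] .
  interpret R: ring "rsec X U" using * ring_sec by auto
  show "a \<oplus>\<^bsub>St\<^esub> b \<oplus>\<^bsub>St\<^esub> c = a \<oplus>\<^bsub>St\<^esub> (b \<oplus>\<^bsub>St\<^esub> c)" using * by (simp add: g_add R.a_assoc)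
 next
  fix a b assume "a \<in> carrier St" "b \<in> carrier St"
  then obtain U r s where *: "nb U" "r \<in> Rsec X U" "s \<in> Rsec X U"
   "a = g U r" "b = g U s" using common3[of a b b] by metis
  interpret R: ring "rsec X U" using * ring_sec by auto
  show "a \<oplus>\<^bsub>St\<^esub> b \<in> carrier St" "a \<oplus>\<^bsub>St\<^esub> b = b \<oplus>\<^bsub>St\<^esub> a" "\<zero>\<^bsub>St\<^esub> \<oplus>\<^bsub>St\<^esub> a = a"
   using * g_zero[of U, symmetric] by (simp_all add: g_add R.a_comm)
  show "\<exists>y\<in>carrier St. y \<oplus>\<^bsub>St\<^esub> a = \<zero>\<^bsub>St\<^esub>"
   by (rule bexI[of _ "g U (\<ominus>\<^bsub>rsec X U\<^esub> r)"]) (use * in \<open>simp_all add: g_add R.l_neg g_zero\<close>)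
 next
  show "\<zero>\<^bsub>St\<^esub> \<in> carrier St"
   using g_in[OF _ ring.ring_simprules(2)[OF ring_sec[OF opn_top]]] x_in by (simp add: g_zero)
 qed
 show "monoid St"
 proof (rule monoidI)
  fix a b c assume abc: "a \<in> carrier St" "b \<in> carrier St" "c \<in> carrier St"
  obtain U r s t where *: "nb U" "r \<in> Rsec X U" "s \<in> Rsec X U" "t \<in> Rsec X U"
   "a = g U r" "b = g U s" "c = g U t" using common3[OF abc] .
  interpret R: ring "rsec X U" using * ring_sec by auto
  show "a \<otimes>\<^bsub>St\<^esub> b \<otimes>\<^bsub>St\<^esub> c = a \<otimes>\<^bsub>St\<^esub> (b \<otimes>\<^bsub>St\<^esub> c)" using * by (simp add: g_mult R.m_assoc)
 next
  fix a b assume "a \<in> carrier St" "b \<in> carrier St"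
  then obtain U r s where *: "nb U" "r \<in> Rsec X U" "s \<in> Rsec X U"
   "a = g U r" "b = g U s" using common3[of a b b] by metis
  interpret R: ring "rsec X U" using * ring_sec by auto
  show "a \<otimes>\<^bsub>St\<^esub> b \<in> carrier St" "\<one>\<^bsub>St\<^esub> \<otimes>\<^bsub>St\<^esub> a = a" "a \<otimes>\<^bsub>St\<^esub> \<one>\<^bsub>St\<^esub> = a"
   using * g_one[of U, symmetric] by (simp_all add: g_mult)
 next
  show "\<one>\<^bsub>St\<^esub> \<in> carrier St"
   using g_in[OF _ ring.ring_simprules(6)[OF ring_sec[OF opn_top]]] x_in by (simp add: g_one)
 qed
 fix a b c assume abc: "a \<in> carrier St" "b \<in> carrier St" "c \<in> carrier St"
 obtain U r s t where *: "nb U" "r \<in> Rsec X U" "s \<in> Rsec X U" "t \<in> Rsec X U"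
  "a = g U r" "b = g U s" "c = g U t" using common3[OF abc] .
 interpret R: ring "rsec X U" using * ring_sec by auto
 show "(a \<oplus>\<^bsub>St\<^esub> b) \<otimes>\<^bsub>St\<^esub> c = a \<otimes>\<^bsub>St\<^esub> c \<oplus>\<^bsub>St\<^esub> b \<otimes>\<^bsub>St\<^esub> c"
  "c \<otimes>\<^bsub>St\<^esub> (a \<oplus>\<^bsub>St\<^esub> b) = c \<otimes>\<^bsub>St\<^esub> a \<oplus>\<^bsub>St\<^esub> c \<otimes>\<^bsub>St\<^esub> b"
  using * by (simp_all add: g_mult g_add R.l_distr R.r_distr)
qed

sublocale St: ring St by (rule ring_stalk)

end

section \<open>Presheaves of modules, their stalks and stalk maps\<close>

locale mpre = rsp X for X :: "('x, 'r) rspace" +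
 fixes M :: "('x, 'r, 'm) msheaf"
 assumes m_presheaf: "presheaf (rtop X) (\<lambda>U. Sec M U) (mres M)"
  and left_module_sec: "openin (rtop X) U \<Longrightarrow> left_module (rsec X U) (msec M U)"
  and mres_add: "openin (rtop X) U \<Longrightarrow> openin (rtop X) V \<Longrightarrow> V \<subseteq> U \<Longrightarrow> s \<in> Sec M U \<Longrightarrow> t \<in> Sec M U \<Longrightarrow>
   mres M U V (s \<oplus>\<^bsub>msec M U\<^esub> t) = mres M U V s \<oplus>\<^bsub>msec M V\<^esub> mres M U V t"
  and mres_smult: "openin (rtop X) U \<Longrightarrow> openin (rtop X) V \<Longrightarrow> V \<subseteq> U \<Longrightarrow> a \<in> Rsec X U \<Longrightarrow> t \<in> Sec M U \<Longrightarrow>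
   mres M U V (a \<odot>\<^bsub>msec M U\<^esub> t) = rres X U V a \<odot>\<^bsub>msec M V\<^esub> mres M U V t"
begin

sublocale m: presheaf "rtop X" "\<lambda>U. Sec M U" "mres M"
 by (rule m_presheaf)

lemma mres_zero:
 assumes "opn U" "opn V" "V \<subseteq> U"
 shows "mres M U V \<zero>\<^bsub>msec M U\<^esub> = \<zero>\<^bsub>msec M V\<^esub>"
proof -
 interpret U: left_module "rsec X U" "msec M U" by (rule left_module_sec[OF assms(1)])
 interpret V: left_module "rsec X V" "msec M V" by (rule left_module_sec[OF assms(2)])
 interpret h: add_group_hom "msec M U" "msec M V" "mres M U V"
  by unfold_locales (auto simp: add_hom_def m.res_closed mres_add assms)
 show ?thesis by simp
qed

end

lemma sheaf_of_modules_mpre: "sheaf_of_modules X M \<Longrightarrow> mpre X M"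
 unfolding sheaf_of_modules_def mpre_def mpre_axioms_def rsp_def
 by (auto dest: set_sheaf_presheaf)

locale mpre_pt = mpre X M + rsp_pt X x for X :: "('x, 'r) rspace" and M :: "('x, 'r, 'm) msheaf" and x
begin

abbreviation "mg \<equiv> mgerm X M x"
abbreviation "SM \<equiv> stalk_mod X M x"

lemma mcarrierE:
 assumes "a \<in> carrier SM" obtains U r where "nb U" "r \<in> Sec M U" "a = mg U r"
 using assms by (auto simp: stalk_mod_def)

lemma mg_in [simp, intro]: "nb U \<Longrightarrow> r \<in> Sec M U \<Longrightarrow> mg U r \<in> carrier SM"
 by (auto simp: stalk_mod_def)

lemma mg_res: "nb U \<Longrightarrow> nb V \<Longrightarrow> V \<subseteq> U \<Longrightarrow> r \<in> Sec M U \<Longrightarrow> mg V (mres M U V r) = mg U r"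
 unfolding mgerm_def by (rule m.germ_res) auto

lemma mg_add:
 assumes "nb U" "r \<in> Sec M U" "s \<in> Sec M U"
 shows "mg U r \<oplus>\<^bsub>SM\<^esub> mg U s = mg U (r \<oplus>\<^bsub>msec M U\<^esub> s)"
proof -
 have "mg U r \<oplus>\<^bsub>SM\<^esub> mg U s = mg (U \<inter> U) (mres M U (U \<inter> U) r \<oplus>\<^bsub>msec M (U \<inter> U)\<^esub> mres M U (U \<inter> U) s)"
  unfolding stalk_mod_ops mgerm_def
 proof (rule germ_binop[OF m.presheaf_axioms m.presheaf_axioms m.presheaf_axioms, of "\<lambda>U. add (msec M U)" U x r U s])
  fix U a b assume U: "opn U" "a \<in> Sec M U" "b \<in> Sec M U"
  interpret U: left_module "rsec X U" "msec M U" by (rule left_module_sec[OF U(1)])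
  show "a \<oplus>\<^bsub>msec M U\<^esub> b \<in> Sec M U" using U by simp
 qed (use assms in \<open>auto simp: mres_add m.presheaf_axioms\<close>)
 then show ?thesis using assms by (simp add: m.res_id)
qed

lemma mg_smult:
 assumes "nb U" "r \<in> Rsec X U" "s \<in> Sec M U"
 shows "g U r \<odot>\<^bsub>SM\<^esub> mg U s = mg U (r \<odot>\<^bsub>msec M U\<^esub> s)"
proof -
 have "g U r \<odot>\<^bsub>SM\<^esub> mg U s = mg (U \<inter> U) (rres X U (U \<inter> U) r \<odot>\<^bsub>msec M (U \<inter> U)\<^esub> mres M U (U \<inter> U) s)"
  unfolding stalk_mod_ops mgerm_def rgerm_def
 proof (rule germ_binop[OF r.presheaf_axioms m.presheaf_axioms m.presheaf_axioms, of "\<lambda>U. smult (msec M U)" U x r U s])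
  fix U a b assume U: "opn U" "a \<in> Rsec X U" "b \<in> Sec M U"
  interpret U: left_module "rsec X U" "msec M U" by (rule left_module_sec[OF U(1)])
  show "a \<odot>\<^bsub>msec M U\<^esub> b \<in> Sec M U" using U U.smult_closed by simp
 qed (use assms in \<open>auto simp: mres_smult m.presheaf_axioms r.presheaf_axioms\<close>)
 then show ?thesis using assms by (simp add: m.res_id r.res_id)
qed

lemma mg_zero: "nb U \<Longrightarrow> mg U \<zero>\<^bsub>msec M U\<^esub> = \<zero>\<^bsub>SM\<^esub>"
proof -
 assume U: "nb U"
 interpret T: left_module "rsec X (Pts X)" "msec M (Pts X)"
  by (rule left_module_sec) simp
 show ?thesis
  using mg_res[of "Pts X" U "\<zero>\<^bsub>msec M (Pts X)\<^esub>"] x_in opn_top_sub[of U] U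
   mres_zero[of "Pts X" U]
  by (simp add: stalk_mod_def)
qed

text \<open>Two scalars and three elements cover every module axiom; axioms with fewer variables
  repeat an argument or insert zero.\<close>

lemma mcommon:
 assumes "a \<in> carrier St" "b \<in> carrier St" "m \<in> carrier SM" "n \<in> carrier SM" "p \<in> carrier SM"
 obtains U r s t u v where "nb U" "r \<in> Rsec X U" "s \<in> Rsec X U"
  "t \<in> Sec M U" "u \<in> Sec M U" "v \<in> Sec M U"
  "a = g U r" "b = g U s" "m = mg U t" "n = mg U u" "p = mg U v"
proof -
 obtain U0 r s where 0: "nb U0" "r \<in> Rsec X U0" "s \<in> Rsec X U0" "a = g U0 r" "b = g U0 s"
  using common3[of a b b] assms by metis
 obtain U1 r1 U2 r2 U3 r3 where *: "nb U1" "r1 \<in> Sec M U1" "m = mg U1 r1"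
  "nb U2" "r2 \<in> Sec M U2" "n = mg U2 r2" "nb U3" "r3 \<in> Sec M U3" "p = mg U3 r3"
  using assms mcarrierE by metis
 let ?U = "U0 \<inter> U1 \<inter> U2 \<inter> U3"
 have U: "nb ?U" "?U \<subseteq> U0" "?U \<subseteq> U1" "?U \<subseteq> U2" "?U \<subseteq> U3" using 0 * by auto
 show ?thesis
  by (rule that[of ?U "rres X U0 ?U r" "rres X U0 ?U s" "mres M U1 ?U r1" "mres M U2 ?U r2" "mres M U3 ?U r3"])
   (use U 0 * g_res mg_res r.res_closed m.res_closed in presburger)+
qed

lemma left_module_stalk: "left_module St SM"
proof (intro left_module.intro left_module_axioms.intro ring_stalk abelian_groupI)
 fix m n p assume "m \<in> carrier SM" "n \<in> carrier SM" "p \<in> carrier SM"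
 then obtain U t u v where *: "nb U"
  "t \<in> Sec M U" "u \<in> Sec M U" "v \<in> Sec M U"
  "m = mg U t" "n = mg U u" "p = mg U v" using mcommon[OF St.zero_closed St.zero_closed] by metis
 interpret U: left_module "rsec X U" "msec M U" using left_module_sec * by auto
 show "m \<oplus>\<^bsub>SM\<^esub> n \<oplus>\<^bsub>SM\<^esub> p = m \<oplus>\<^bsub>SM\<^esub> (n \<oplus>\<^bsub>SM\<^esub> p)"
  using * by (simp add: mg_add U.M.a_assoc)
next
 fix m n assume "m \<in> carrier SM" "n \<in> carrier SM"
 then obtain U t u where *: "nb U"
  "t \<in> Sec M U" "u \<in> Sec M U"
  "m = mg U t" "n = mg U u" using mcommon[OF St.zero_closed St.zero_closed, of m n n] by metis
 interpret U: left_module "rsec X U" "msec M U" using left_module_sec * by auto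
 show "m \<oplus>\<^bsub>SM\<^esub> n \<in> carrier SM" "m \<oplus>\<^bsub>SM\<^esub> n = n \<oplus>\<^bsub>SM\<^esub> m" "\<zero>\<^bsub>SM\<^esub> \<oplus>\<^bsub>SM\<^esub> m = m"
  using * mg_zero[of U, symmetric] by (simp_all add: mg_add U.M.a_comm)
 show "\<exists>y\<in>carrier SM. y \<oplus>\<^bsub>SM\<^esub> m = \<zero>\<^bsub>SM\<^esub>"
  by (rule bexI[of _ "mg U (\<ominus>\<^bsub>msec M U\<^esub> t)"]) (use * in \<open>simp_all add: mg_add U.M.l_neg mg_zero\<close>)
next
 interpret T: left_module "rsec X (Pts X)" "msec M (Pts X)"
  by (rule left_module_sec) simp
 show "\<zero>\<^bsub>SM\<^esub> \<in> carrier SM"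
  using mg_in[OF _ T.M.zero_closed] x_in by (simp add: mg_zero)
next
 fix a b m n assume "a \<in> carrier St" "b \<in> carrier St" "m \<in> carrier SM"
 then obtain U r s t where *: "nb U" "r \<in> Rsec X U" "s \<in> Rsec X U"
  "t \<in> Sec M U" "a = g U r" "b = g U s" "m = mg U t" using mcommon[of a b m m m] by metis
 interpret U: left_module "rsec X U" "msec M U" using left_module_sec * by auto
 show "(a \<oplus>\<^bsub>St\<^esub> b) \<odot>\<^bsub>SM\<^esub> m = a \<odot>\<^bsub>SM\<^esub> m \<oplus>\<^bsub>SM\<^esub> b \<odot>\<^bsub>SM\<^esub> m"
  "(a \<otimes>\<^bsub>St\<^esub> b) \<odot>\<^bsub>SM\<^esub> m = a \<odot>\<^bsub>SM\<^esub> (b \<odot>\<^bsub>SM\<^esub> m)"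
  using * by (simp_all add: g_add g_mult mg_smult mg_add U.smult_closed U.smult_l_distr U.smult_assoc)
next
 fix a m n assume "a \<in> carrier St" "m \<in> carrier SM" "n \<in> carrier SM"
 then obtain U r t u where *: "nb U" "r \<in> Rsec X U"
  "t \<in> Sec M U" "u \<in> Sec M U" "a = g U r" "m = mg U t" "n = mg U u"
  using mcommon[of a a m n n] by metis
 interpret U: left_module "rsec X U" "msec M U" using left_module_sec * by auto
 show "a \<odot>\<^bsub>SM\<^esub> (m \<oplus>\<^bsub>SM\<^esub> n) = a \<odot>\<^bsub>SM\<^esub> m \<oplus>\<^bsub>SM\<^esub> a \<odot>\<^bsub>SM\<^esub> n"
  using * by (simp_all add: mg_smult mg_add U.smult_closed U.smult_r_distr)
next
 fix a m assume "a \<in> carrier St" "m \<in> carrier SM"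
 then obtain U r t where *: "nb U" "r \<in> Rsec X U"
  "t \<in> Sec M U" "a = g U r" "m = mg U t"
  using mcommon[of a a m m m] by metis
 interpret U: left_module "rsec X U" "msec M U" using left_module_sec * by auto
 show "a \<odot>\<^bsub>SM\<^esub> m \<in> carrier SM" 
  using * by (simp add: mg_smult U.smult_closed)
next
 fix m assume "m \<in> carrier SM"
 then obtain U t where *: "nb U" "t \<in> Sec M U" "m = mg U t"
  using mcarrierE by metis
 interpret U: left_module "rsec X U" "msec M U" using left_module_sec * by auto
 show "\<one>\<^bsub>St\<^esub> \<odot>\<^bsub>SM\<^esub> m = m"
  using * by (simp add: g_one[of U, symmetric] mg_smult U.smult_one)
qed

sublocale SM: left_module St SM by (rule left_module_stalk)

end

text \<open>\<open>mod_hom\<close> without the convention on values outside the domain. Pointwise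
  formulas are first shown to be of this kind and are normalised by \<open>on_sections\<close>
  afterwards.\<close>

definition presheaf_hom ::
 "('x, 'r) rspace \<Rightarrow> ('x, 'r, 'm) msheaf \<Rightarrow> ('x, 'r, 'n) msheaf \<Rightarrow> ('x set \<Rightarrow> 'm \<Rightarrow> 'n) \<Rightarrow> bool" where
 "presheaf_hom X M N u \<longleftrightarrow>
   (\<forall>U. openin (rtop X) U \<longrightarrow> lin_map (rsec X U) (msec M U) (msec N U) (u U)) \<and>
   (\<forall>U V. openin (rtop X) U \<and> openin (rtop X) V \<and> V \<subseteq> U \<longrightarrow>
      (\<forall>s\<in>Sec M U. u V (mres M U V s) = mres N U V (u U s)))"

lemma mod_hom_iff: "u \<in> mod_hom X M N \<longleftrightarrow> on_sections X M u = u \<and> presheaf_hom X M N u"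
 unfolding mod_hom_def presheaf_hom_def lin_map_def add_hom_def by auto

lemma stalk_map:
 assumes "mpre X M" "mpre X N" "presheaf_hom X M N u" "x \<in> Pts X"
 shows stalk_map_mgerm: "\<And>U s. openin (rtop X) U \<Longrightarrow> x \<in> U \<Longrightarrow> s \<in> Sec M U \<Longrightarrow>
   stalk_map X N u x (mgerm X M x U s) = mgerm X N x U (u U s)"
  and lin_map_stalk_map: "lin_map (stalk_ring X x) (stalk_mod X M x) (stalk_mod X N x) (stalk_map X N u x)"
proof -
 interpret M: mpre_pt X M x using assms(1,4) by (auto simp: mpre_pt_def mpre_def rsp_pt_def rsp_pt_axioms_def)
 interpret N: mpre_pt X N x using assms(2,4) by (auto simp: mpre_pt_def mpre_def rsp_pt_def rsp_pt_axioms_def)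
 have u: "u U s \<in> Sec N U" if "M.opn U" "s \<in> Sec M U" for U s
  using assms(3) that by (auto simp: presheaf_hom_def lin_map_def add_hom_def)
 have nat: "u V (mres M U V s) = mres N U V (u U s)"
  if "M.opn U" "M.opn V" "V \<subseteq> U" "s \<in> Sec M U" for U V s
  using assms(3) that unfolding presheaf_hom_def by blast
 have lin: "u U (s \<oplus>\<^bsub>msec M U\<^esub> t) = u U s \<oplus>\<^bsub>msec N U\<^esub> u U t"
   "r \<in> Rsec X U \<Longrightarrow> u U (r \<odot>\<^bsub>msec M U\<^esub> s) = r \<odot>\<^bsub>msec N U\<^esub> u U s"
  if "M.opn U" "s \<in> Sec M U" "t \<in> Sec M U" for U s t r
  using assms(3) that by (simp_all add: presheaf_hom_def lin_map_def add_hom_def)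
 show 1: "stalk_map X N u x (mgerm X M x U s) = mgerm X N x U (u U s)"
  if U: "M.opn U" "x \<in> U" "s \<in> Sec M U" for U s
  unfolding stalk_map_def mgerm_def
 proof (rule M.m.UN_germ[OF U])
  fix V t assume V: "M.opn V" "x \<in> V" "t \<in> Sec M V"
   "germ (rtop X) (\<lambda>U. Sec M U) (mres M) x V t = germ (rtop X) (\<lambda>U. Sec M U) (mres M) x U s"
  obtain W where W: "M.opn W" "x \<in> W" "W \<subseteq> V" "W \<subseteq> U" "mres M V W t = mres M U W s"
   using M.m.germ_eqD[OF V(4) U] .
  show "germ (rtop X) (\<lambda>U. Sec N U) (mres N) x V (u V t) = germ (rtop X) (\<lambda>U. Sec N U) (mres N) x U (u U s)"
  proof (rule N.m.germ_eqI[of V U W])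
   show "mres N V W (u V t) = mres N U W (u U s)"
    using nat[of V W t] nat[of U W s] U V W by simp
  qed (use U V W u in auto)
 qed
 show "lin_map (stalk_ring X x) (stalk_mod X M x) (stalk_mod X N x) (stalk_map X N u x)"
  unfolding lin_map_def add_hom_def
 proof (intro conjI ballI)
  show "stalk_map X N u x \<in> carrier M.SM \<rightarrow> carrier N.SM"
  proof
   fix a assume "a \<in> carrier M.SM"
   from M.mcarrierE[OF this] obtain U s where "M.nb U" "s \<in> Sec M U" "a = mgerm X M x U s" .
   then show "stalk_map X N u x a \<in> carrier N.SM" using 1 u by simp
  qed
  fix m n assume "m \<in> carrier M.SM" "n \<in> carrier M.SM"
  then obtain U t v where *: "M.nb U"
   "t \<in> Sec M U" "v \<in> Sec M U"
   "m = mgerm X M x U t" "n = mgerm X M x U v" using M.mcommon[OF M.St.zero_closed M.St.zero_closed, of m n n] by metis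
  interpret U: left_module "rsec X U" "msec M U" using M.left_module_sec * by auto
  show "stalk_map X N u x (m \<oplus>\<^bsub>M.SM\<^esub> n) = stalk_map X N u x m \<oplus>\<^bsub>N.SM\<^esub> stalk_map X N u x n"
   using * by (simp add: M.mg_add N.mg_add 1 u lin)
 next
  fix a m assume "a \<in> carrier M.St" "m \<in> carrier M.SM"
  then obtain U r t where *: "M.nb U" "r \<in> Rsec X U"
   "t \<in> Sec M U" "a = rgerm X x U r" "m = mgerm X M x U t"
   using M.mcommon[of a a m m m] by metis
  interpret U: left_module "rsec X U" "msec M U" using M.left_module_sec * by auto
  show "stalk_map X N u x (a \<odot>\<^bsub>M.SM\<^esub> m) = a \<odot>\<^bsub>N.SM\<^esub> stalk_map X N u x m"
   using * U.smult_closed by (simp add: M.mg_smult N.mg_smult 1 u lin)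
 qed
qed

section \<open>Morphisms of ringed spaces and their effect on stalks\<close>

locale rsm = fixes f :: "('x, 'r, 'y, 's) rs_mor" assumes mor: "rs_morphism f"
begin

abbreviation "X \<equiv> src f"
abbreviation "Y \<equiv> tgt f"

sublocale X: rsp X + Y: rsp Y
 using mor by (auto simp: rs_morphism_def rsp_def)

lemma preim_open: "Y.opn V \<Longrightarrow> X.opn (preim f V)"
 using mor by (auto simp: rs_morphism_def preim_def continuous_map_def)

lemma pt_in: "x \<in> Pts X \<Longrightarrow> pt f x \<in> Pts Y"
 using mor by (auto simp: rs_morphism_def continuous_map_def)

lemma preim_iff: "x \<in> preim f V \<longleftrightarrow> x \<in> Pts X \<and> pt f x \<in> V"
 by (auto simp: preim_def)

lemma comor_hom: "Y.opn V \<Longrightarrow> comor f V \<in> ring_hom (rsec Y V) (rsec X (preim f V))"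
 using mor by (auto simp: rs_morphism_def)

lemma preim_mono: "V \<subseteq> W \<Longrightarrow> preim f V \<subseteq> preim f W"
 by (auto simp: preim_def)

lemma comor_closed: "Y.opn V \<Longrightarrow> s \<in> Rsec Y V \<Longrightarrow> comor f V s \<in> Rsec X (preim f V)"
 using ring_hom_closed[OF comor_hom] .

lemma comor_res: "Y.opn V \<Longrightarrow> Y.opn W \<Longrightarrow> W \<subseteq> V \<Longrightarrow> s \<in> Rsec Y V \<Longrightarrow>
 comor f W (rres Y V W s) = rres X (preim f V) (preim f W) (comor f V s)"
 using mor by (auto simp: rs_morphism_def)

end

locale rsm_pt = rsm f for f :: "('x, 'r, 'y, 's) rs_mor" + fixes x assumes x_in: "x \<in> Pts (src f)"
begin

sublocale X: rsp_pt X x by unfold_locales (rule x_in)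
sublocale Y: rsp_pt Y "pt f x" by unfold_locales (rule pt_in[OF x_in])

lemma stalk_comor_rgerm:
 assumes U: "Y.opn V" "pt f x \<in> V" "s \<in> Rsec Y V"
 shows "stalk_comor f x (rgerm Y (pt f x) V s) = rgerm X x (preim f V) (comor f V s)"
 unfolding stalk_comor_def rgerm_def
proof (rule Y.r.UN_germ[OF U])
 fix V' t assume V: "Y.opn V'" "pt f x \<in> V'" "t \<in> Rsec Y V'"
  "germ (rtop Y) (\<lambda>U. Rsec Y U) (rres Y) (pt f x) V' t = germ (rtop Y) (\<lambda>U. Rsec Y U) (rres Y) (pt f x) V s"
 obtain W where W: "Y.opn W" "pt f x \<in> W" "W \<subseteq> V'" "W \<subseteq> V" "rres Y V' W t = rres Y V W s"
  using Y.r.germ_eqD[OF V(4) U] .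
 show "germ (rtop X) (\<lambda>U. Rsec X U) (rres X) x (preim f V') (comor f V' t) =
   germ (rtop X) (\<lambda>U. Rsec X U) (rres X) x (preim f V) (comor f V s)"
  by (rule X.r.germ_eqI[of _ _ "preim f W"])
   (use U V W comor_res[of V' W t] comor_res[of V W s] x_in in \<open>simp_all add: preim_open preim_iff comor_closed preim_mono\<close>)
qed

lemma stalk_comor_hom: "stalk_comor f x \<in> ring_hom (stalk_ring Y (pt f x)) (stalk_ring X x)"
proof (rule ring_hom_memI)
 have pn: "X.nb (preim f U)" if "Y.nb U" for U using that preim_open x_in by (auto simp: preim_iff)
 have cc: "comor f U r \<in> Rsec X (preim f U)" if "Y.nb U" "r \<in> Rsec Y U" for U r
  using comor_closed that by simp
 show "stalk_comor f x a \<in> carrier X.St" if a: "a \<in> carrier Y.St" for a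
 proof -
  obtain U s where "Y.nb U" "s \<in> Rsec Y U" "a = rgerm Y (pt f x) U s"
   using Y.carrierE[OF a] .
  then show ?thesis using pn cc by (simp add: stalk_comor_rgerm)
 qed
 fix a b assume "a \<in> carrier Y.St" "b \<in> carrier Y.St"
 then obtain U r s where *: "Y.nb U" "r \<in> Rsec Y U" "s \<in> Rsec Y U"
   "a = rgerm Y (pt f x) U r" "b = rgerm Y (pt f x) U s" using Y.common3[of a b b] by metis
 interpret U: ring "rsec Y U" using Y.ring_sec * by auto
 show "stalk_comor f x (a \<otimes>\<^bsub>Y.St\<^esub> b) = stalk_comor f x a \<otimes>\<^bsub>X.St\<^esub> stalk_comor f x b"
  "stalk_comor f x (a \<oplus>\<^bsub>Y.St\<^esub> b) = stalk_comor f x a \<oplus>\<^bsub>X.St\<^esub> stalk_comor f x b"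
  using * pn[of U] cc[of U] ring_hom_add[OF comor_hom[of U], of r s] ring_hom_mult[OF comor_hom[of U], of r s]
  by (simp_all add: Y.g_add Y.g_mult X.g_add X.g_mult stalk_comor_rgerm)
next
 let ?T = "Pts Y"
 have T: "Y.nb ?T" by (simp add: pt_in[OF x_in])
 interpret U: ring "rsec Y ?T" using Y.ring_sec by auto
 show "stalk_comor f x \<one>\<^bsub>Y.St\<^esub> = \<one>\<^bsub>X.St\<^esub>"
  using T x_in preim_open[of ?T] ring_hom_one[OF comor_hom[of ?T]]
  by (simp add: Y.g_one[OF T, symmetric] stalk_comor_rgerm X.g_one preim_iff)
qed

end

section \<open>Pullback sheaves and their stalks\<close>

lemma (in left_module) smult_zero_right [simp]: "a \<in> carrier R \<Longrightarrow> a \<odot>\<^bsub>M\<^esub> \<zero>\<^bsub>M\<^esub> = \<zero>\<^bsub>M\<^esub>"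
 using smult_r_distr[of a "\<zero>\<^bsub>M\<^esub>" "\<zero>\<^bsub>M\<^esub>"] smult_closed[of a "\<zero>\<^bsub>M\<^esub>"] M.add.l_cancel_one' by fastforce

lemma (in left_module) smult_zero_left [simp]: "x \<in> carrier M \<Longrightarrow> \<zero>\<^bsub>R\<^esub> \<odot>\<^bsub>M\<^esub> x = \<zero>\<^bsub>M\<^esub>"
 using smult_l_distr[of "\<zero>\<^bsub>R\<^esub>" "\<zero>\<^bsub>R\<^esub>" x] smult_closed[of "\<zero>\<^bsub>R\<^esub>" x] M.add.l_cancel_one' by fastforce

lemma (in left_module) smult_minus_one: "x \<in> carrier M \<Longrightarrow> (\<ominus>\<^bsub>R\<^esub> \<one>\<^bsub>R\<^esub>) \<odot>\<^bsub>M\<^esub> x = \<ominus>\<^bsub>M\<^esub> x"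
proof -
 assume x: "x \<in> carrier M"
 have "(\<ominus>\<^bsub>R\<^esub> \<one>\<^bsub>R\<^esub>) \<odot>\<^bsub>M\<^esub> x \<oplus>\<^bsub>M\<^esub> x = (\<ominus>\<^bsub>R\<^esub> \<one>\<^bsub>R\<^esub> \<oplus>\<^bsub>R\<^esub> \<one>\<^bsub>R\<^esub>) \<odot>\<^bsub>M\<^esub> x"
  using x by (simp add: smult_l_distr smult_one)
 then have "(\<ominus>\<^bsub>R\<^esub> \<one>\<^bsub>R\<^esub>) \<odot>\<^bsub>M\<^esub> x \<oplus>\<^bsub>M\<^esub> x = \<zero>\<^bsub>M\<^esub>" using x by (simp add: R.l_neg)
 then show ?thesis using x by (metis M.minus_equality R.a_inv_closed R.one_closed smult_closed)
qed

lemma (in left_module) add_hom_smult: "a \<in> carrier R \<Longrightarrow> add_hom M M (smult M a)"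
 by (auto simp: add_hom_def smult_closed smult_r_distr)

text \<open>For the sum of two sections of a pullback: both are local sums of tensors, and the two
  lists of tensors are concatenated.\<close>

lemma (in abelian_group) finsum_append:
 fixes n k :: nat
 assumes "\<And>i. i < n \<Longrightarrow> u i \<in> carrier G" "\<And>i. i < k \<Longrightarrow> v i \<in> carrier G"
 shows "(\<Oplus>i\<in>{..<n + k}. if i < n then u i else v (i - n)) = (\<Oplus>i\<in>{..<n}. u i) \<oplus> (\<Oplus>i\<in>{..<k}. v i)"
 using assms(2)
proof (induction k)
 case 0
 have "(\<Oplus>i\<in>{..<n}. if i < n then u i else v (i - n)) = (\<Oplus>i\<in>{..<n}. u i)"
  using assms by (intro finsum_cong') auto
 then show ?case using assms by (auto intro!: r_zero[symmetric] finsum_closed)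
next
 case (Suc k)
 have c: "(\<lambda>i. if i < n then u i else v (i - n)) \<in> {..<n + k} \<rightarrow> carrier G"
  using assms(1) Suc.prems by auto
 have u: "(\<Oplus>i\<in>{..<n}. u i) \<in> carrier G" and v: "(\<Oplus>i\<in>{..<k}. v i) \<in> carrier G"
  using assms(1) Suc.prems by (auto intro!: finsum_closed)
 have vk: "v k \<in> carrier G" using Suc.prems by simp
 have "(\<Oplus>i\<in>{..<n + Suc k}. if i < n then u i else v (i - n)) =
   v k \<oplus> (\<Oplus>i\<in>{..<n + k}. if i < n then u i else v (i - n))"
  using c vk by (simp add: lessThan_Suc)
 also have "\<dots> = v k \<oplus> ((\<Oplus>i\<in>{..<n}. u i) \<oplus> (\<Oplus>i\<in>{..<k}. v i))"
  using Suc by simp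
 also have "\<dots> = (\<Oplus>i\<in>{..<n}. u i) \<oplus> (v k \<oplus> (\<Oplus>i\<in>{..<k}. v i))"
  using u v vk by (rule_tac a_lcomm)
 also have "v k \<oplus> (\<Oplus>i\<in>{..<k}. v i) = (\<Oplus>i\<in>{..<Suc k}. v i)"
  using Suc.prems vk by (subst lessThan_Suc, subst finsum_insert) auto
 finally show ?case .
qed

section \<open>The pullback as a sheaf of modules\<close>

locale pb_pre = rsm f + M: mpre "tgt f" M
 for f :: "('x, 'r, 'y, 's) rs_mor" and M :: "('y, 's, 'm) msheaf"
begin
abbreviation "PB \<equiv> pullback f M"
end

locale pb_pt = pb_pre f M + rsm_pt f x
 for f :: "('x, 'r, 'y, 's) rs_mor" and M :: "('y, 's, 'm) msheaf" and x
begin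

sublocale M: mpre_pt "tgt f" M "pt f x" ..

sublocale E: scalar_ext "stalk_ring (src f) x" "stalk_ring (tgt f) (pt f x)" "stalk_comor f x"
  "stalk_mod (tgt f) M (pt f x)"
 by unfold_locales (rule stalk_comor_hom)

abbreviation "P \<equiv> pb_stalk f M x"
abbreviation pt_tens (infixl \<open>\<otimes>\<otimes>\<close> 70) where "r \<otimes>\<otimes> m \<equiv> pb_tens f M x r m"

lemmas P_left_module = E.left_module_ext_scalars[folded pb_stalk_def]

sublocale P: left_module "stalk_ring (src f) x" P
 by (rule P_left_module)

lemmas pt_closed [simp, intro] = E.tens_closed[folded pb_tens_def pb_stalk_def]
lemmas pt_add_left = E.tens_add_left[folded pb_tens_def pb_stalk_def]
lemmas pt_add_right = E.tens_add_right[folded pb_tens_def pb_stalk_def]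
lemmas pt_balanced = E.tens_balanced[folded pb_tens_def pb_stalk_def]
lemmas pt_induct [consumes 1, case_names zero tens add] = E.ext_scalars_induct[folded pb_tens_def pb_stalk_def]
lemmas pt_lift = E.tensor_lift[folded pb_tens_def pb_stalk_def]
lemmas pt_ext = E.add_hom_ext[folded pb_tens_def pb_stalk_def]
lemmas pt_smult = E.smult_tens[folded pb_tens_def pb_stalk_def]

lemma pt_smult_one: "r \<in> carrier X.St \<Longrightarrow> m \<in> carrier M.SM \<Longrightarrow> r \<otimes>\<otimes> m = r \<odot>\<^bsub>P\<^esub> (\<one>\<^bsub>X.St\<^esub> \<otimes>\<otimes> m)"
 by (simp add: pt_smult)

lemma pt_lin_ext:
 assumes "lin_map X.St P N u" "lin_map X.St P N v" "left_module X.St N"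
  and eq: "\<And>m. m \<in> carrier M.SM \<Longrightarrow> u (\<one>\<^bsub>X.St\<^esub> \<otimes>\<otimes> m) = v (\<one>\<^bsub>X.St\<^esub> \<otimes>\<otimes> m)"
  and "e \<in> carrier P"
 shows "u e = v e"
proof (rule pt_ext[OF _ _ left_module.axioms(2)[OF assms(3)] _ assms(5)])
 show "add_hom P N u" "add_hom P N v" using assms by (auto simp: lin_map_def)
 fix r m assume "r \<in> carrier X.St" "m \<in> carrier M.SM"
 then show "u (r \<otimes>\<otimes> m) = v (r \<otimes>\<otimes> m)"
  using assms(1,2) eq by (simp add: pt_smult_one[of r m] lin_map_def)
qed

end

context pb_pre
begin

lemma pt_locale: "x \<in> Pts X \<Longrightarrow> pb_pt f M x"
 by (intro pb_pt.intro rsm_pt.intro rsm_pt_axioms.intro pb_pre_axioms rsm_axioms)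

lemma pt_in_open: "X.opn W \<Longrightarrow> x \<in> W \<Longrightarrow> x \<in> Pts X"
 using X.opn_top_sub by blast

lemma left_module_P: "x \<in> Pts X \<Longrightarrow> left_module (stalk_ring X x) (pb_stalk f M x)"
 using pb_pt.P_left_module[OF pt_locale] .

lemma abelian_group_P: "x \<in> Pts X \<Longrightarrow> abelian_group (pb_stalk f M x)"
 using left_module.axioms(2)[OF left_module_P] .

text \<open>The existential in \<open>pullback\<close> with its witnesses as arguments. The base
  point is left out, so that one representation serves all points of \<open>W'\<close>.\<close>

definition lrep where
 "lrep W' V (n::nat) r m s \<longleftrightarrow>
  X.opn W' \<and> Y.opn V \<and> W' \<subseteq> preim f V \<and>
  (\<forall>i<n. r i \<in> Rsec X W' \<and> m i \<in> Sec M V) \<and>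
  (\<forall>y\<in>W'. s y = (\<Oplus>\<^bsub>pb_stalk f M y\<^esub>i\<in>{..<n}.
    pb_tens f M y (rgerm X y W' (r i)) (mgerm Y M (pt f y) V (m i))))"

lemma sec_iff: "s \<in> Sec PB W \<longleftrightarrow> s \<in> (\<Pi>\<^sub>E x\<in>W. Stk f M x) \<and>
  (\<forall>x\<in>W. \<exists>W' V n r m. x \<in> W' \<and> W' \<subseteq> W \<and> lrep W' V n r m s)"
 unfolding pullback_def msheaf.select_convs partial_object.select_convs lrep_def by blast

lemma msec_simps [simp]:
 "zero (msec PB W) = (\<lambda>x\<in>W. \<zero>\<^bsub>pb_stalk f M x\<^esub>)"
 "add (msec PB W) = (\<lambda>s t. \<lambda>x\<in>W. s x \<oplus>\<^bsub>pb_stalk f M x\<^esub> t x)"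
 "smult (msec PB W) = (\<lambda>r s. \<lambda>x\<in>W. rgerm X x W r \<odot>\<^bsub>pb_stalk f M x\<^esub> s x)"
 "mres PB W W' s = restrict s W'"
 by (simp_all add: pullback_def)

lemma sec_val: "s \<in> Sec PB W \<Longrightarrow> x \<in> W \<Longrightarrow> s x \<in> Stk f M x"
 by (auto simp: sec_iff)

lemma sec_eqI: "s \<in> Sec PB W \<Longrightarrow> t \<in> Sec PB W \<Longrightarrow> (\<And>y. y \<in> W \<Longrightarrow> s y = t y) \<Longrightarrow> s = t"
 unfolding sec_iff by (auto intro: PiE_ext)

text \<open>Two representations can be combined only over a common pair of open sets, upstairs and
  downstairs. Restricting the sections does not change the germs in the sums.\<close>

lemma lrep_shrink:
 assumes l: "lrep W V n r m s" and "X.opn W'" "Y.opn V'" "W' \<subseteq> W" "V' \<subseteq> V" "W' \<subseteq> preim f V'"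
 shows "lrep W' V' n (\<lambda>i. rres X W W' (r i)) (\<lambda>i. mres M V V' (m i)) s"
proof (unfold lrep_def, intro conjI assms allI impI ballI)
 fix i assume "i < n"
 then show "rres X W W' (r i) \<in> Rsec X W'" "mres M V V' (m i) \<in> Sec M V'"
  using assms(2-) l unfolding lrep_def by (auto intro: X.r.res_closed M.m.res_closed)
next
 fix y assume y: "y \<in> W'"
 have yX: "y \<in> Pts X" using y assms(2) by (rule pt_in_open[rotated])
 interpret pb_pt f M y by (rule pt_locale[OF yX])
 have "y \<in> preim f V'" using y assms(6) by blast
 then have y2: "pt f y \<in> V'" "pt f y \<in> V" using assms(5) by (auto simp: preim_iff)
 have o: "X.opn W" "Y.opn V" and rm: "\<And>i. i < n \<Longrightarrow> r i \<in> Rsec X W" "\<And>i. i < n \<Longrightarrow> m i \<in> Sec M V"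
  using l unfolding lrep_def by auto
 have yW: "y \<in> W" using y assms by blast
 have e: "rgerm X y W' (rres X W W' (r i)) = rgerm X y W (r i)"
   "mgerm Y M (pt f y) V' (mres M V V' (m i)) = mgerm Y M (pt f y) V (m i)"
   "rgerm X y W (r i) \<in> carrier X.St" "mgerm Y M (pt f y) V (m i) \<in> carrier M.SM" if "i < n" for i
  using assms(2-) o rm[OF that] y y2 yW by (simp_all add: X.g_res M.mg_res)
 have "s y = (\<Oplus>\<^bsub>P\<^esub>i\<in>{..<n}. pb_tens f M y (rgerm X y W (r i)) (mgerm Y M (pt f y) V (m i)))"
  using l yW unfolding lrep_def by blast
 also have "\<dots> = (\<Oplus>\<^bsub>P\<^esub>i\<in>{..<n}. pb_tens f M y (rgerm X y W' (rres X W W' (r i))) (mgerm Y M (pt f y) V' (mres M V V' (m i))))"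
  by (rule P.M.add.finprod_cong'[OF refl]) (simp_all add: e Pi_iff)
 finally show "s y = (\<Oplus>\<^bsub>P\<^esub>i\<in>{..<n}. pb_tens f M y (rgerm X y W' (rres X W W' (r i))) (mgerm Y M (pt f y) V' (mres M V V' (m i))))" .
qed

text \<open>Being locally a sum of tensors can be tested on a neighbourhood of each point. This
  locality gives the gluing axiom, and later it reduces the construction of sections to local
  formulas.\<close>

lemma sec_localI:
 assumes "t \<in> extensional W"
  and loc: "\<And>x. x \<in> W \<Longrightarrow> \<exists>W' t'. X.opn W' \<and> x \<in> W' \<and> W' \<subseteq> W \<and> t' \<in> Sec PB W' \<and> (\<forall>y\<in>W'. t y = t' y)"
 shows "t \<in> Sec PB W"
 unfolding sec_iff
proof (intro conjI ballI)
 show "t \<in> (\<Pi>\<^sub>E x\<in>W. Stk f M x)"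
 proof (rule PiE_I)
  fix x assume "x \<in> W"
  then obtain W' t' where "x \<in> W'" "t' \<in> Sec PB W'" "\<forall>y\<in>W'. t y = t' y" using loc by metis
  then show "t x \<in> Stk f M x" by (simp add: sec_val)
 next
  fix x assume "x \<notin> W" then show "t x = undefined" using assms(1) by (simp add: extensional_def)
 qed
 fix x assume "x \<in> W"
 then obtain W' t' where W': "X.opn W'" "x \<in> W'" "W' \<subseteq> W" "t' \<in> Sec PB W'" "\<forall>y\<in>W'. t y = t' y" using loc by metis
 then obtain W'' V n r m where *: "x \<in> W''" "W'' \<subseteq> W'" "lrep W'' V n r m t'" unfolding sec_iff by blast
 have "lrep W'' V n r m t" using *(2,3) W'(5) unfolding lrep_def by (simp add: subset_iff)
 then show "\<exists>W' V n r m. x \<in> W' \<and> W' \<subseteq> W \<and> lrep W' V n r m t" using * W'(3) by (meson subset_trans)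
qed

lemma sec_res:
 assumes "s \<in> Sec PB W" "X.opn W'" "W' \<subseteq> W"
 shows "restrict s W' \<in> Sec PB W'"
 unfolding sec_iff
proof (intro conjI ballI)
 show "restrict s W' \<in> (\<Pi>\<^sub>E x\<in>W'. Stk f M x)"
  using assms sec_val by (intro restrict_PiE_iff[THEN iffD2]) blast
 fix x assume x: "x \<in> W'"
 then obtain W1 V n r m where *: "x \<in> W1" "W1 \<subseteq> W" "lrep W1 V n r m s" using assms unfolding sec_iff by blast
 have o: "X.opn (W1 \<inter> W')" "W1 \<inter> W' \<subseteq> W1" "W1 \<inter> W' \<subseteq> preim f V" using * assms unfolding lrep_def by auto
 have "lrep (W1 \<inter> W') V n (\<lambda>i. rres X W1 (W1 \<inter> W') (r i)) (\<lambda>i. mres M V V (m i)) s"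
  by (rule lrep_shrink[OF *(3) o(1) _ o(2) subset_refl o(3)]) (use * in \<open>simp add: lrep_def\<close>)
 then have "lrep (W1 \<inter> W') V n (\<lambda>i. rres X W1 (W1 \<inter> W') (r i)) (\<lambda>i. mres M V V (m i)) (restrict s W')"
  by (simp add: lrep_def)
 moreover have "x \<in> W1 \<inter> W'" "W1 \<inter> W' \<subseteq> W'" using x * by auto
 ultimately show "\<exists>W'a V n r m. x \<in> W'a \<and> W'a \<subseteq> W' \<and> lrep W'a V n r m (restrict s W')" by meson
qed

lemma sec_add:
 assumes "X.opn W" "s \<in> Sec PB W" "t \<in> Sec PB W"
 shows "(\<lambda>x\<in>W. s x \<oplus>\<^bsub>pb_stalk f M x\<^esub> t x) \<in> Sec PB W"
 unfolding sec_iff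
proof (intro conjI ballI)
 show "(\<lambda>x\<in>W. s x \<oplus>\<^bsub>pb_stalk f M x\<^esub> t x) \<in> (\<Pi>\<^sub>E x\<in>W. Stk f M x)"
 proof (rule restrict_PiE_iff[THEN iffD2], rule ballI)
  fix x assume x: "x \<in> W"
  interpret pb_pt f M x by (rule pt_locale[OF pt_in_open[OF assms(1) x]])
  show "s x \<oplus>\<^bsub>P\<^esub> t x \<in> carrier P" using sec_val assms x by simp
 qed
 fix x assume x: "x \<in> W"
 obtain W1 V1 n1 r1 m1 where 1: "x \<in> W1" "W1 \<subseteq> W" "lrep W1 V1 n1 r1 m1 s"
  using assms x unfolding sec_iff by blast
 obtain W2 V2 n2 r2 m2 where 2: "x \<in> W2" "W2 \<subseteq> W" "lrep W2 V2 n2 r2 m2 t"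
  using assms x unfolding sec_iff by blast
 define W' where "W' = W1 \<inter> W2"
 define V' where "V' = V1 \<inter> V2"
 have o: "X.opn W'" "Y.opn V'" "W' \<subseteq> W1" "W' \<subseteq> W2" "V' \<subseteq> V1" "V' \<subseteq> V2" "W' \<subseteq> preim f V'" "x \<in> W'" "W' \<subseteq> W"
  using 1 2 unfolding W'_def V'_def lrep_def by (auto simp: preim_def)
 obtain r1 m1 where 1: "lrep W' V' n1 r1 m1 s" using lrep_shrink[OF 1(3) o(1,2,3,5,7)] by (rule that)
 obtain r2 m2 where 2: "lrep W' V' n2 r2 m2 t" using lrep_shrink[OF 2(3) o(1,2,4,6,7)] by (rule that)
 \<comment> \<open>Both representations now live over \<open>W'\<close> and \<open>V'\<close>; their
   lists of tensors are joined, the second one shifted by \<open>n1\<close>.\<close>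
 let ?r = "\<lambda>i. if i < n1 then r1 i else r2 (i - n1)"
 let ?m = "\<lambda>i. if i < n1 then m1 i else m2 (i - n1)"
 have "lrep W' V' (n1 + n2) ?r ?m (\<lambda>x\<in>W. s x \<oplus>\<^bsub>pb_stalk f M x\<^esub> t x)"
 proof (unfold lrep_def, intro conjI o allI impI ballI)
  fix i assume "i < n1 + n2"
  then show "?r i \<in> Rsec X W'" "?m i \<in> Sec M V'" using 1 2 unfolding lrep_def by auto
 next
  fix y assume y: "y \<in> W'"
  interpret pb_pt f M y by (rule pt_locale[OF pt_in_open[OF o(1) y]])
  let ?u = "\<lambda>i. pb_tens f M y (rgerm X y W' (r1 i)) (mgerm Y M (pt f y) V' (m1 i))"
  let ?v = "\<lambda>i. pb_tens f M y (rgerm X y W' (r2 i)) (mgerm Y M (pt f y) V' (m2 i))"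
  have py: "pt f y \<in> V'" using y o by (auto simp: preim_iff)
  have c: "?u i \<in> carrier P" if "i < n1" for i
   using 1 that y py o(1,2) unfolding lrep_def by (intro pt_closed) auto
  have d: "?v i \<in> carrier P" if "i < n2" for i
   using 2 that y py o(1,2) unfolding lrep_def by (intro pt_closed) auto
  have "(\<lambda>x\<in>W. s x \<oplus>\<^bsub>pb_stalk f M x\<^esub> t x) y = s y \<oplus>\<^bsub>P\<^esub> t y" using y o by auto
  also have "\<dots> = (\<Oplus>\<^bsub>P\<^esub>i\<in>{..<n1}. ?u i) \<oplus>\<^bsub>P\<^esub> (\<Oplus>\<^bsub>P\<^esub>i\<in>{..<n2}. ?v i)"
   using 1 2 y unfolding lrep_def by simp
  also have "\<dots> = (\<Oplus>\<^bsub>P\<^esub>i\<in>{..<n1 + n2}. if i < n1 then ?u i else ?v (i - n1))"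
   by (rule P.M.finsum_append[symmetric]) (use c d in auto)
  also have "\<dots> = (\<Oplus>\<^bsub>P\<^esub>i\<in>{..<n1 + n2}. pb_tens f M y (rgerm X y W' (?r i)) (mgerm Y M (pt f y) V' (?m i)))"
   by (rule P.M.add.finprod_cong') (use c d in auto)
  finally show "(\<lambda>x\<in>W. s x \<oplus>\<^bsub>pb_stalk f M x\<^esub> t x) y =
    (\<Oplus>\<^bsub>P\<^esub>i\<in>{..<n1 + n2}. pb_tens f M y (rgerm X y W' (?r i)) (mgerm Y M (pt f y) V' (?m i)))" .
 qed
 then show "\<exists>W' V n r m. x \<in> W' \<and> W' \<subseteq> W \<and> lrep W' V n r m (\<lambda>x\<in>W. s x \<oplus>\<^bsub>pb_stalk f M x\<^esub> t x)"
  using o(8,9) by blast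
qed

lemma sec_smult:
 assumes "X.opn W" "a \<in> Rsec X W" "s \<in> Sec PB W"
 shows "(\<lambda>x\<in>W. rgerm X x W a \<odot>\<^bsub>pb_stalk f M x\<^esub> s x) \<in> Sec PB W"
 unfolding sec_iff
proof (intro conjI ballI)
 show "(\<lambda>x\<in>W. rgerm X x W a \<odot>\<^bsub>pb_stalk f M x\<^esub> s x) \<in> (\<Pi>\<^sub>E x\<in>W. Stk f M x)"
 proof (rule restrict_PiE_iff[THEN iffD2], rule ballI)
  fix x assume x: "x \<in> W"
  interpret pb_pt f M x by (rule pt_locale[OF pt_in_open[OF assms(1) x]])
  show "rgerm X x W a \<odot>\<^bsub>P\<^esub> s x \<in> carrier P" using sec_val assms x by (intro P.smult_closed) auto
 qed
 fix x assume x: "x \<in> W"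
 obtain W' V n r m where 1: "x \<in> W'" "W' \<subseteq> W" "lrep W' V n r m s"
  using assms x unfolding sec_iff by blast
 let ?a = "rres X W W' a"
 have o: "X.opn W'" "Y.opn V" "W' \<subseteq> preim f V" and
  rm: "\<And>i. i < n \<Longrightarrow> r i \<in> Rsec X W'" "\<And>i. i < n \<Longrightarrow> m i \<in> Sec M V" using 1(3) unfolding lrep_def by auto
 have a: "?a \<in> Rsec X W'" by (rule X.r.res_closed[OF assms(1) o(1) 1(2) assms(2)])
 \<comment> \<open>The scalar is absorbed by the coefficients:
   \<open>a (r \<otimes> m) = (a r) \<otimes> m\<close>.\<close>
 have "lrep W' V n (\<lambda>i. ?a \<otimes>\<^bsub>rsec X W'\<^esub> r i) m (\<lambda>x\<in>W. rgerm X x W a \<odot>\<^bsub>pb_stalk f M x\<^esub> s x)"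
 proof (unfold lrep_def, intro conjI o allI impI ballI)
  fix i assume i: "i < n"
  show "?a \<otimes>\<^bsub>rsec X W'\<^esub> r i \<in> Rsec X W'" by (rule X.sec_closed(2)[OF o(1) a rm(1)[OF i]])
  show "m i \<in> Sec M V" by (rule rm(2)[OF i])
 next
  fix y assume y: "y \<in> W'"
  interpret pb_pt f M y by (rule pt_locale[OF pt_in_open[OF o(1) y]])
  have yW: "y \<in> W" using 1 y by blast
  have py: "pt f y \<in> V" using y o by (auto simp: preim_iff)
  let ?u = "\<lambda>i. pb_tens f M y (rgerm X y W' (r i)) (mgerm Y M (pt f y) V (m i))"
  have c: "rgerm X y W' (r i) \<in> carrier X.St" "mgerm Y M (pt f y) V (m i) \<in> carrier M.SM" if "i < n" for i
   using rm that y py o(1,2) by auto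
  have ac: "rgerm X y W' ?a \<in> carrier X.St" using a y o by simp
  interpret h: add_group_hom P P "smult P (rgerm X y W' ?a)"
   by (intro add_group_hom.intro add_group_hom_axioms.intro P.add_hom_smult ac) unfold_locales
  have "(\<lambda>x\<in>W. rgerm X x W a \<odot>\<^bsub>pb_stalk f M x\<^esub> s x) y = rgerm X y W' ?a \<odot>\<^bsub>P\<^esub> s y"
   using yW X.g_res[of W W' a] assms y o 1 by simp
  also have "s y = (\<Oplus>\<^bsub>P\<^esub>i\<in>{..<n}. ?u i)" using 1(3) y unfolding lrep_def by blast
  also have "rgerm X y W' ?a \<odot>\<^bsub>P\<^esub> \<dots> = (\<Oplus>\<^bsub>P\<^esub>i\<in>{..<n}. rgerm X y W' ?a \<odot>\<^bsub>P\<^esub> ?u i)"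
   by (rule h.finsum) (use c in auto)
  also have "\<dots> = (\<Oplus>\<^bsub>P\<^esub>i\<in>{..<n}. pb_tens f M y (rgerm X y W' (?a \<otimes>\<^bsub>rsec X W'\<^esub> r i)) (mgerm Y M (pt f y) V (m i)))"
  proof (rule P.M.add.finprod_cong')
   fix i assume i: "i \<in> {..<n}"
   show "rgerm X y W' ?a \<odot>\<^bsub>P\<^esub> ?u i = pb_tens f M y (rgerm X y W' (?a \<otimes>\<^bsub>rsec X W'\<^esub> r i)) (mgerm Y M (pt f y) V (m i))"
    using i c ac a rm y o by (subst pt_smult) (simp_all add: X.g_mult)
  qed (use c rm X.sec_closed[OF o(1) a] y o in auto)
  finally show "(\<lambda>x\<in>W. rgerm X x W a \<odot>\<^bsub>pb_stalk f M x\<^esub> s x) y =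
    (\<Oplus>\<^bsub>P\<^esub>i\<in>{..<n}. pb_tens f M y (rgerm X y W' (?a \<otimes>\<^bsub>rsec X W'\<^esub> r i)) (mgerm Y M (pt f y) V (m i)))" .
 qed
 then show "\<exists>W' V n r m. x \<in> W' \<and> W' \<subseteq> W \<and> lrep W' V n r m (\<lambda>x\<in>W. rgerm X x W a \<odot>\<^bsub>pb_stalk f M x\<^esub> s x)"
  using 1 by blast
qed

lemma sec_zero: "X.opn W \<Longrightarrow> (\<lambda>x\<in>W. \<zero>\<^bsub>pb_stalk f M x\<^esub>) \<in> Sec PB W"
 unfolding sec_iff
proof (intro conjI ballI)
 assume W: "X.opn W"
 show "(\<lambda>x\<in>W. \<zero>\<^bsub>pb_stalk f M x\<^esub>) \<in> (\<Pi>\<^sub>E x\<in>W. Stk f M x)"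
  using abelian_group.axioms(1)[OF abelian_group_P[OF pt_in_open[OF W]]]
  by (intro restrict_PiE_iff[THEN iffD2]) (auto intro: abelian_monoid.zero_closed)
 fix x assume x: "x \<in> W"
 \<comment> \<open>The empty sum represents zero on all of \<open>W\<close>, with the whole space as
   the open set downstairs.\<close>
 have "lrep W (Pts Y) 0 r m (\<lambda>x\<in>W. \<zero>\<^bsub>pb_stalk f M x\<^esub>)" for r m
 proof (unfold lrep_def, intro conjI W allI impI ballI)
  show "W \<subseteq> preim f (Pts Y)"
   using pt_in_open[OF W] pt_in by (auto simp: preim_iff)
  fix y assume y: "y \<in> W"
  interpret pb_pt f M y by (rule pt_locale[OF pt_in_open[OF W y]])
  show "(\<lambda>x\<in>W. \<zero>\<^bsub>pb_stalk f M x\<^esub>) y = (\<Oplus>\<^bsub>P\<^esub>i\<in>{..<0}. pb_tens f M y (rgerm X y W (r i)) (mgerm Y M (pt f y) (Pts Y) (m i)))"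
   using y by simp
 qed auto
 then show "\<exists>W' V n r m. x \<in> W' \<and> W' \<subseteq> W \<and> lrep W' V n r m (\<lambda>x\<in>W. \<zero>\<^bsub>pb_stalk f M x\<^esub>)"
  using x by blast
qed

text \<open>The section \<open>1 \<otimes> m\<close>, that is, the image of \<open>m\<close> under
  the unit \<open>M \<rightarrow> f\<^sub>* f\<^sup>* M\<close> of the adjunction. Such sections
  generate the pullback locally.\<close>

definition usec where
 "usec V m = (\<lambda>y\<in>preim f V. pb_tens f M y \<one>\<^bsub>stalk_ring X y\<^esub> (mgerm Y M (pt f y) V m))"

lemma usec_val: "y \<in> preim f V \<Longrightarrow> usec V m y = pb_tens f M y \<one>\<^bsub>stalk_ring X y\<^esub> (mgerm Y M (pt f y) V m)"
 by (simp add: usec_def)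

lemma usec_closed:
 assumes "Y.opn V" "m \<in> Sec M V"
 shows "usec V m \<in> Sec PB (preim f V)"
 unfolding sec_iff
proof (intro conjI ballI)
 have o: "X.opn (preim f V)" by (rule preim_open[OF assms(1)])
 have *: "usec V m y \<in> Stk f M y \<and> rgerm X y (preim f V) \<one>\<^bsub>rsec X (preim f V)\<^esub> = \<one>\<^bsub>stalk_ring X y\<^esub> \<and>
   (\<Oplus>\<^bsub>pb_stalk f M y\<^esub>i\<in>{..<(1::nat)}. pb_tens f M y (rgerm X y (preim f V) \<one>\<^bsub>rsec X (preim f V)\<^esub>) (mgerm Y M (pt f y) V m)) = usec V m y"
  if y: "y \<in> preim f V" for y
 proof -
  interpret pb_pt f M y by (rule pt_locale[OF pt_in_open[OF o y]])
  have "pt f y \<in> V" using y by (simp add: preim_iff)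
  then have c: "usec V m y \<in> carrier P"
   using assms y by (simp add: usec_val)
  have g: "rgerm X y (preim f V) \<one>\<^bsub>rsec X (preim f V)\<^esub> = \<one>\<^bsub>stalk_ring X y\<^esub>" using o y by (simp add: X.g_one)
  have "{..<(1::nat)} = {0}" by auto
  then have "(\<Oplus>\<^bsub>P\<^esub>i\<in>{..<(1::nat)}. usec V m y) = usec V m y"
   using c by simp
  then show ?thesis using c g y by (simp only: usec_val)
 qed
 show "usec V m \<in> (\<Pi>\<^sub>E x\<in>preim f V. Stk f M x)"
  by (rule PiE_I) (use * in \<open>blast, simp add: usec_def\<close>)
 have 1: "\<one>\<^bsub>rsec X (preim f V)\<^esub> \<in> Rsec X (preim f V)"
  using ring.ring_simprules(6)[OF X.ring_sec[OF o]] .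
 have "lrep (preim f V) V 1 (\<lambda>i. \<one>\<^bsub>rsec X (preim f V)\<^esub>) (\<lambda>i. m) (usec V m)"
  unfolding lrep_def by (intro conjI o assms subset_refl allI impI ballI 1) (use * in metis)
 then show "\<exists>W' Va n r ma. x \<in> W' \<and> W' \<subseteq> preim f V \<and> lrep W' Va n r ma (usec V m)" if "x \<in> preim f V" for x
  using that by blast
qed

lemma presheaf_PB: "presheaf (rtop X) (\<lambda>U. Sec PB U) (mres PB)"
proof
 fix U s assume "X.opn U" "s \<in> Sec PB U"
 then show "mres PB U U s = s" unfolding sec_iff by (auto intro: PiE_restrict)
next
 fix U V s assume "X.opn U" "X.opn V" "V \<subseteq> U" "s \<in> Sec PB U"
 then show "mres PB U V s \<in> Sec PB V" by (simp add: sec_res)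
next
 fix U V W s assume "X.opn U" "X.opn V" "X.opn W" "W \<subseteq> V"
 then show "mres PB V W (mres PB U V s) = mres PB U W s" by (simp add: restrict_restrict Int_absorb1)
qed

lemma left_module_PB:
 assumes W: "X.opn W"
 shows "left_module (rsec X W) (msec PB W)"
proof (intro left_module.intro left_module_axioms.intro X.ring_sec[OF W] abelian_groupI)
 note simps = restrict_apply' restrict_ext
 have lm: "left_module (stalk_ring X y) (pb_stalk f M y)" "rsp_pt X y" if "y \<in> W" for y
  using left_module_P[OF pt_in_open[OF W that]] pt_in_open[OF W that]
  by (auto intro: rsp_pt.intro rsp_pt_axioms.intro X.rsp_axioms)
 show "\<zero>\<^bsub>msec PB W\<^esub> \<in> Sec PB W" using sec_zero[OF W] by simp
 fix s t u assume s: "s \<in> Sec PB W"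
 show "\<zero>\<^bsub>msec PB W\<^esub> \<oplus>\<^bsub>msec PB W\<^esub> s = s"
 proof (rule sec_eqI[OF _ s])
  show "\<zero>\<^bsub>msec PB W\<^esub> \<oplus>\<^bsub>msec PB W\<^esub> s \<in> Sec PB W" using sec_add[OF W sec_zero[OF W] s] by simp
  fix y assume y: "y \<in> W"
  interpret left_module "stalk_ring X y" "pb_stalk f M y" by (rule lm[OF y])
  show "(\<zero>\<^bsub>msec PB W\<^esub> \<oplus>\<^bsub>msec PB W\<^esub> s) y = s y" using y sec_val[OF s y] by simp
 qed
 show "\<one>\<^bsub>rsec X W\<^esub> \<odot>\<^bsub>msec PB W\<^esub> s = s"
 proof (rule sec_eqI[OF _ s])
  show "\<one>\<^bsub>rsec X W\<^esub> \<odot>\<^bsub>msec PB W\<^esub> s \<in> Sec PB W"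
   using sec_smult[OF W ring.ring_simprules(6)[OF X.ring_sec[OF W]] s] by simp
  fix y assume y: "y \<in> W"
  interpret left_module "stalk_ring X y" "pb_stalk f M y" by (rule lm[OF y])
  interpret rsp_pt X y by (rule lm[OF y])
  show "(\<one>\<^bsub>rsec X W\<^esub> \<odot>\<^bsub>msec PB W\<^esub> s) y = s y" using y sec_val[OF s y] W by (simp add: g_one smult_one)
 qed
 \<comment> \<open>Negation is multiplication by the section \<open>-1\<close> of the structure
   sheaf, so closure under scalars provides it.\<close>
 have minus: "(\<lambda>x\<in>W. \<ominus>\<^bsub>pb_stalk f M x\<^esub> s x) \<in> Sec PB W"
 proof -
  interpret RW: ring "rsec X W" by (rule X.ring_sec[OF W])
  have "(\<lambda>x\<in>W. \<ominus>\<^bsub>pb_stalk f M x\<^esub> s x) = (\<lambda>x\<in>W. rgerm X x W (\<ominus>\<^bsub>rsec X W\<^esub> \<one>\<^bsub>rsec X W\<^esub>) \<odot>\<^bsub>pb_stalk f M x\<^esub> s x)"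
  proof (rule restrict_ext)
   fix y assume y: "y \<in> W"
   interpret left_module "stalk_ring X y" "pb_stalk f M y" by (rule lm[OF y])
   interpret rsp_pt X y by (rule lm[OF y])
   have "g W (\<ominus>\<^bsub>rsec X W\<^esub> \<one>\<^bsub>rsec X W\<^esub>) \<oplus>\<^bsub>St\<^esub> \<one>\<^bsub>St\<^esub> = \<zero>\<^bsub>St\<^esub>"
    using W y by (simp add: g_one[of W, symmetric] g_add RW.l_neg g_zero)
   then have "g W (\<ominus>\<^bsub>rsec X W\<^esub> \<one>\<^bsub>rsec X W\<^esub>) = \<ominus>\<^bsub>St\<^esub> \<one>\<^bsub>St\<^esub>"
    using W y R.minus_equality by simp
   then show "\<ominus>\<^bsub>pb_stalk f M y\<^esub> s y = rgerm X y W (\<ominus>\<^bsub>rsec X W\<^esub> \<one>\<^bsub>rsec X W\<^esub>) \<odot>\<^bsub>pb_stalk f M y\<^esub> s y"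
    using sec_val[OF s y] by (simp add: smult_minus_one)
  qed
  then show ?thesis using sec_smult[OF W _ s] by simp
 qed
 show "\<exists>y\<in>Sec PB W. y \<oplus>\<^bsub>msec PB W\<^esub> s = \<zero>\<^bsub>msec PB W\<^esub>"
 proof (rule bexI[OF _ minus])
  show "(\<lambda>x\<in>W. \<ominus>\<^bsub>pb_stalk f M x\<^esub> s x) \<oplus>\<^bsub>msec PB W\<^esub> s = \<zero>\<^bsub>msec PB W\<^esub>"
   unfolding msec_simps
  proof (rule restrict_ext)
   fix y assume y: "y \<in> W"
   interpret left_module "stalk_ring X y" "pb_stalk f M y" by (rule lm[OF y])
   show "(\<lambda>x\<in>W. \<ominus>\<^bsub>pb_stalk f M x\<^esub> s x) y \<oplus>\<^bsub>pb_stalk f M y\<^esub> s y = \<zero>\<^bsub>pb_stalk f M y\<^esub>"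
    using y sec_val[OF s y] by (simp add: M.l_neg)
  qed
 qed
 show "a \<odot>\<^bsub>msec PB W\<^esub> s \<in> Sec PB W" if "a \<in> Rsec X W" for a
  using sec_smult[OF W that s] by simp
 show "(a \<otimes>\<^bsub>rsec X W\<^esub> b) \<odot>\<^bsub>msec PB W\<^esub> s = a \<odot>\<^bsub>msec PB W\<^esub> (b \<odot>\<^bsub>msec PB W\<^esub> s)"
  "(a \<oplus>\<^bsub>rsec X W\<^esub> b) \<odot>\<^bsub>msec PB W\<^esub> s = a \<odot>\<^bsub>msec PB W\<^esub> s \<oplus>\<^bsub>msec PB W\<^esub> b \<odot>\<^bsub>msec PB W\<^esub> s"
  if ab: "a \<in> Rsec X W" "b \<in> Rsec X W" for a b
  unfolding msec_simps
 proof (rule_tac [!] restrict_ext)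
  fix y assume y: "y \<in> W"
  interpret left_module "stalk_ring X y" "pb_stalk f M y" by (rule lm[OF y])
  interpret rsp_pt X y by (rule lm[OF y])
  have c: "g W a \<in> carrier St" "g W b \<in> carrier St" "s y \<in> Stk f M y" using ab W y sec_val[OF s y] by auto
  show "rgerm X y W (a \<otimes>\<^bsub>rsec X W\<^esub> b) \<odot>\<^bsub>pb_stalk f M y\<^esub> s y =
    rgerm X y W a \<odot>\<^bsub>pb_stalk f M y\<^esub> (\<lambda>x\<in>W. rgerm X x W b \<odot>\<^bsub>pb_stalk f M x\<^esub> s x) y"
   "rgerm X y W (a \<oplus>\<^bsub>rsec X W\<^esub> b) \<odot>\<^bsub>pb_stalk f M y\<^esub> s y =
     (\<lambda>x\<in>W. rgerm X x W a \<odot>\<^bsub>pb_stalk f M x\<^esub> s x) y \<oplus>\<^bsub>pb_stalk f M y\<^esub>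
     (\<lambda>x\<in>W. rgerm X x W b \<odot>\<^bsub>pb_stalk f M x\<^esub> s x) y"
   using W y ab c smult_assoc smult_l_distr by (simp_all add: g_mult[symmetric] g_add[symmetric])
 qed
 assume t: "t \<in> Sec PB W"
 show "s \<oplus>\<^bsub>msec PB W\<^esub> t \<in> Sec PB W" using sec_add[OF W s t] by simp
 show "s \<oplus>\<^bsub>msec PB W\<^esub> t = t \<oplus>\<^bsub>msec PB W\<^esub> s"
  unfolding msec_simps
 proof (rule restrict_ext)
  fix y assume y: "y \<in> W"
  interpret left_module "stalk_ring X y" "pb_stalk f M y" by (rule lm[OF y])
  show "s y \<oplus>\<^bsub>pb_stalk f M y\<^esub> t y = t y \<oplus>\<^bsub>pb_stalk f M y\<^esub> s y"
   using sec_val[OF s y] sec_val[OF t y] by (rule M.a_comm)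
 qed
 show "a \<odot>\<^bsub>msec PB W\<^esub> (s \<oplus>\<^bsub>msec PB W\<^esub> t) = a \<odot>\<^bsub>msec PB W\<^esub> s \<oplus>\<^bsub>msec PB W\<^esub> a \<odot>\<^bsub>msec PB W\<^esub> t"
  if a: "a \<in> Rsec X W" for a
  unfolding msec_simps
 proof (rule restrict_ext)
  fix y assume y: "y \<in> W"
  interpret left_module "stalk_ring X y" "pb_stalk f M y" by (rule lm[OF y])
  interpret rsp_pt X y by (rule lm[OF y])
  have c: "g W a \<in> carrier St" using a W y by auto
  show "rgerm X y W a \<odot>\<^bsub>pb_stalk f M y\<^esub> (\<lambda>x\<in>W. s x \<oplus>\<^bsub>pb_stalk f M x\<^esub> t x) y =
   (\<lambda>x\<in>W. rgerm X x W a \<odot>\<^bsub>pb_stalk f M x\<^esub> s x) y \<oplus>\<^bsub>pb_stalk f M y\<^esub>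
   (\<lambda>x\<in>W. rgerm X x W a \<odot>\<^bsub>pb_stalk f M x\<^esub> t x) y"
   using y smult_r_distr[OF c sec_val[OF s y] sec_val[OF t y]] by simp
 qed
 assume u: "u \<in> Sec PB W"
 show "s \<oplus>\<^bsub>msec PB W\<^esub> t \<oplus>\<^bsub>msec PB W\<^esub> u = s \<oplus>\<^bsub>msec PB W\<^esub> (t \<oplus>\<^bsub>msec PB W\<^esub> u)"
  unfolding msec_simps
 proof (rule restrict_ext)
  fix y assume y: "y \<in> W"
  interpret left_module "stalk_ring X y" "pb_stalk f M y" by (rule lm[OF y])
  show "(\<lambda>x\<in>W. s x \<oplus>\<^bsub>pb_stalk f M x\<^esub> t x) y \<oplus>\<^bsub>pb_stalk f M y\<^esub> u y =
   s y \<oplus>\<^bsub>pb_stalk f M y\<^esub> (\<lambda>x\<in>W. t x \<oplus>\<^bsub>pb_stalk f M x\<^esub> u x) y"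
   using y M.a_assoc[OF sec_val[OF s y] sec_val[OF t y] sec_val[OF u y]] by simp
 qed
qed

lemma mpre_PB: "mpre X PB"
proof (intro mpre.intro mpre_axioms.intro X.rsp_axioms presheaf_PB left_module_PB)
 fix U V s t a assume U: "X.opn U" "X.opn V" "V \<subseteq> U"
 show "mres PB U V (s \<oplus>\<^bsub>msec PB U\<^esub> t) = mres PB U V s \<oplus>\<^bsub>msec PB V\<^esub> mres PB U V t"
  unfolding msec_simps by (rule ext) (use U in \<open>auto simp: restrict_def\<close>)
 show "mres PB U V (a \<odot>\<^bsub>msec PB U\<^esub> t) = rres X U V a \<odot>\<^bsub>msec PB V\<^esub> mres PB U V t" if a: "a \<in> Rsec X U"
  unfolding msec_simps
 proof (rule ext)
  fix y
  have "rgerm X y V (rres X U V a) = rgerm X y U a" if "y \<in> V"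
  proof -
   interpret rsp_pt X y using pt_in_open[OF U(2) that] by (intro rsp_pt.intro rsp_pt_axioms.intro X.rsp_axioms)
   show ?thesis using U a that by (simp add: g_res subsetD)
  qed
  then show "restrict (\<lambda>x\<in>U. rgerm X x U a \<odot>\<^bsub>pb_stalk f M x\<^esub> t x) V y = (\<lambda>x\<in>V. rgerm X x V (rres X U V a) \<odot>\<^bsub>pb_stalk f M x\<^esub> restrict t V x) y"
   using U by (auto simp: restrict_def)
 qed
qed

sublocale PB: mpre X PB by (rule mpre_PB)

lemma sheaf_PB: "sheaf_of_modules X PB"
 unfolding sheaf_of_modules_def
proof (intro conjI)
 show "set_sheaf (rtop X) (\<lambda>U. Sec PB U) (mres PB)"
  unfolding set_sheaf_def
 proof (intro conjI allI impI ballI)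
  fix C s assume a: "(\<forall>U\<in>C. X.opn U \<and> s U \<in> Sec PB U) \<and>
    (\<forall>U\<in>C. \<forall>V\<in>C. mres PB U (U \<inter> V) (s U) = mres PB V (U \<inter> V) (s V))"
  have C: "X.opn U" "s U \<in> Sec PB U" if "U \<in> C" for U using a that by auto
  have compat: "s U y = s V y" if "U \<in> C" "V \<in> C" "y \<in> U" "y \<in> V" for U V y
  proof -
   have "mres PB U (U \<inter> V) (s U) = mres PB V (U \<inter> V) (s V)" using a that by blast
   from fun_cong[OF this, of y] show ?thesis using that by simp
  qed
  \<comment> \<open>Any member of the cover that contains \<open>y\<close> gives the same value at
    \<open>y\<close>, by \<open>compat\<close>; so the choice is immaterial.\<close>
  define t where "t = (\<lambda>y\<in>\<Union>C. s (SOME U. U \<in> C \<and> y \<in> U) y)"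
  have tU: "t y = s U y" if "U \<in> C" "y \<in> U" for U y
  proof -
   have "(SOME U. U \<in> C \<and> y \<in> U) \<in> C \<and> y \<in> (SOME U. U \<in> C \<and> y \<in> U)"
    using that by (intro someI[of "\<lambda>U. U \<in> C \<and> y \<in> U" U]) simp
   then have "s (SOME U. U \<in> C \<and> y \<in> U) y = s U y" using that by (intro compat) blast+
   then show ?thesis using that unfolding t_def by (subst restrict_apply') blast+
  qed
  have t: "t \<in> Sec PB (\<Union>C)"
  proof (rule sec_localI)
   show "t \<in> extensional (\<Union>C)" by (simp add: t_def)
   fix x assume "x \<in> \<Union>C"
   then obtain U where U: "U \<in> C" "x \<in> U" by blast
   show "\<exists>W' t'. X.opn W' \<and> x \<in> W' \<and> W' \<subseteq> \<Union>C \<and> t' \<in> Sec PB W' \<and> (\<forall>y\<in>W'. t y = t' y)"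
    by (rule exI[of _ U], rule exI[of _ "s U"]) (use U C tU in auto)
  qed
  show "\<exists>!t. t \<in> Sec PB (\<Union>C) \<and> (\<forall>U\<in>C. mres PB (\<Union>C) U t = s U)"
  proof (rule ex1I[of _ t])
   show "t \<in> Sec PB (\<Union>C) \<and> (\<forall>U\<in>C. mres PB (\<Union>C) U t = s U)"
   proof (intro conjI t ballI)
    fix U assume U: "U \<in> C"
    have "restrict t U \<in> Sec PB U" by (rule sec_res[OF t]) (use C U in auto)
    then show "mres PB (\<Union>C) U t = s U"
     using sec_eqI[OF _ C(2)[OF U], of "restrict t U"] tU U by simp
   qed
   fix t' assume t': "t' \<in> Sec PB (\<Union>C) \<and> (\<forall>U\<in>C. mres PB (\<Union>C) U t' = s U)"
   show "t' = t"
   proof (rule sec_eqI[OF _ t])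
    fix y assume "y \<in> \<Union>C"
    then obtain U where U: "U \<in> C" "y \<in> U" by blast
    then have "restrict t' U y = s U y" using t' by simp
    then show "t' y = t y" using U tU by simp
   qed (use t' in simp)
  qed
 next
  fix U V assume "X.opn U \<and> X.opn V \<and> V \<subseteq> U"
  then show "mres PB U V \<in> Sec PB U \<rightarrow> Sec PB V" by (intro funcsetI PB.m.res_closed) auto
 next
  fix U s assume "X.opn U" "s \<in> Sec PB U" then show "mres PB U U s = s" by (rule PB.m.res_id)
 next
  fix U V W s assume "X.opn U \<and> X.opn V \<and> X.opn W \<and> W \<subseteq> V \<and> V \<subseteq> U" "s \<in> Sec PB U"
  then show "mres PB V W (mres PB U V s) = mres PB U W s" by (intro PB.m.res_res) auto
 qed
 show "\<forall>U. X.opn U \<longrightarrow> left_module (rsec X U) (msec PB U)"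
  using PB.left_module_sec by simp
 show "\<forall>U V. X.opn U \<and> X.opn V \<and> V \<subseteq> U \<longrightarrow>
    (\<forall>s\<in>Sec PB U. \<forall>t\<in>Sec PB U.
      mres PB U V (s \<oplus>\<^bsub>msec PB U\<^esub> t) = mres PB U V s \<oplus>\<^bsub>msec PB V\<^esub> mres PB U V t) \<and>
    (\<forall>r\<in>Rsec X U. \<forall>s\<in>Sec PB U.
      mres PB U V (r \<odot>\<^bsub>msec PB U\<^esub> s) = rres X U V r \<odot>\<^bsub>msec PB V\<^esub> mres PB U V s)"
  by (intro allI impI conjI ballI PB.mres_add PB.mres_smult; elim conjE; assumption)
qed (rule X.ringed)

lemma eval_hom:
 assumes "X.opn W" "y \<in> W"
 shows "add_group_hom (msec PB W) (pb_stalk f M y) (\<lambda>s. s y)"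
proof (intro add_group_hom.intro add_group_hom_axioms.intro)
 show "abelian_group (msec PB W)" using left_module.axioms(2)[OF PB.left_module_sec[OF assms(1)]] .
 show "abelian_group (pb_stalk f M y)" using abelian_group_P[OF pt_in_open[OF assms]] .
 show "add_hom (msec PB W) (pb_stalk f M y) (\<lambda>s. s y)"
  using assms(2) sec_val[OF _ assms(2)] by (simp add: add_hom_def Pi_iff)
qed

text \<open>The pointwise representation is turned into an equation in the module of sections over
  \<open>W'\<close>, with unit sections as generators. A map that is linear on sections or on all
  fibres is thereby controlled by its effect on unit sections.\<close>

lemma sec_repr:
 assumes "X.opn W" "s \<in> Sec PB W" "x \<in> W"
 obtains W' V n r m where "X.opn W'" "x \<in> W'" "W' \<subseteq> W" "Y.opn V" "W' \<subseteq> preim f V"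
  "\<forall>i<n::nat. r i \<in> Rsec X W' \<and> m i \<in> Sec M V"
  "restrict s W' = (\<Oplus>\<^bsub>msec PB W'\<^esub>i\<in>{..<n}. r i \<odot>\<^bsub>msec PB W'\<^esub> restrict (usec V (m i)) W')"
proof -
 obtain W' V n r m where *: "x \<in> W'" "W' \<subseteq> W" "lrep W' V n r m s" using assms unfolding sec_iff by blast
 have o: "X.opn W'" "Y.opn V" "W' \<subseteq> preim f V" and
  rm: "\<And>i. i < n \<Longrightarrow> r i \<in> Rsec X W'" "\<And>i. i < n \<Longrightarrow> m i \<in> Sec M V" using *(3) unfolding lrep_def by auto
 interpret L: left_module "rsec X W'" "msec PB W'" by (rule PB.left_module_sec[OF o(1)])
 have u: "restrict (usec V (m i)) W' \<in> Sec PB W'" if "i < n" for i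
  using sec_res[OF usec_closed[OF o(2) rm(2)[OF that]] o(1,3)] .
 have ru: "(\<lambda>i. r i \<odot>\<^bsub>msec PB W'\<^esub> restrict (usec V (m i)) W') \<in> {..<n} \<rightarrow> Sec PB W'"
  by (intro funcsetI L.smult_closed rm u) simp_all
 have "restrict s W' = (\<Oplus>\<^bsub>msec PB W'\<^esub>i\<in>{..<n}. r i \<odot>\<^bsub>msec PB W'\<^esub> restrict (usec V (m i)) W')"
 proof (rule sec_eqI[OF sec_res[OF assms(2) o(1) *(2)]])
  show "(\<Oplus>\<^bsub>msec PB W'\<^esub>i\<in>{..<n}. r i \<odot>\<^bsub>msec PB W'\<^esub> restrict (usec V (m i)) W') \<in> Sec PB W'"
   using L.M.finsum_closed[OF ru] .
  fix y assume y: "y \<in> W'"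
  interpret pb_pt f M y by (rule pt_locale[OF pt_in_open[OF o(1) y]])
  interpret ev: add_group_hom "msec PB W'" P "\<lambda>s. s y" by (rule eval_hom[OF o(1) y])
  have py: "pt f y \<in> V" "y \<in> preim f V" using y o by (auto simp: preim_iff)
  have c: "rgerm X y W' (r i) \<in> carrier X.St" "mgerm Y M (pt f y) V (m i) \<in> carrier M.SM" if "i < n" for i
   using rm that y py o(1,2) by auto
  have "restrict s W' y = (\<Oplus>\<^bsub>P\<^esub>i\<in>{..<n}. pb_tens f M y (rgerm X y W' (r i)) (mgerm Y M (pt f y) V (m i)))"
   using * y unfolding lrep_def by simp
  also have "\<dots> = (\<Oplus>\<^bsub>P\<^esub>i\<in>{..<n}. (r i \<odot>\<^bsub>msec PB W'\<^esub> restrict (usec V (m i)) W') y)"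
  proof (rule P.M.add.finprod_cong'[OF refl])
   show "(\<lambda>i. (r i \<odot>\<^bsub>msec PB W'\<^esub> restrict (usec V (m i)) W') y) \<in> {..<n} \<rightarrow> carrier P"
    by (rule funcsetI, rule ev.closed, rule funcset_mem[OF ru])
   fix i assume i: "i \<in> {..<n}"
   then have "pb_tens f M y (rgerm X y W' (r i)) (mgerm Y M (pt f y) V (m i)) = rgerm X y W' (r i) \<odot>\<^bsub>P\<^esub> usec V (m i) y"
    unfolding usec_val[OF py(2)] using c by (intro pt_smult_one) auto
   then show "pb_tens f M y (rgerm X y W' (r i)) (mgerm Y M (pt f y) V (m i)) = (r i \<odot>\<^bsub>msec PB W'\<^esub> restrict (usec V (m i)) W') y"
    using y by simp
  qed
  also have "\<dots> = (\<Oplus>\<^bsub>msec PB W'\<^esub>i\<in>{..<n}. r i \<odot>\<^bsub>msec PB W'\<^esub> restrict (usec V (m i)) W') y"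
   by (rule ev.finsum[OF ru, symmetric])
  finally show "restrict s W' y = (\<Oplus>\<^bsub>msec PB W'\<^esub>i\<in>{..<n}. r i \<odot>\<^bsub>msec PB W'\<^esub> restrict (usec V (m i)) W') y" .
 qed
 then show ?thesis using that[OF o(1) *(1,2) o(2,3), of n r m] rm by blast
qed

end

section \<open>Maps between pullbacks on stalks\<close>

lemma on_sections_apply:
 "openin (rtop X) W \<Longrightarrow> s \<in> Sec M W \<Longrightarrow> on_sections X M u W s = u W s"
 by (simp add: on_sections_def)

lemma on_sections_idem: "on_sections X M (on_sections X M u) = on_sections X M u"
 by (auto simp: on_sections_def fun_eq_iff)

lemma on_sections_cong:
 "(\<And>W s. openin (rtop X) W \<Longrightarrow> s \<in> Sec M W \<Longrightarrow> u W s = v W s) \<Longrightarrow> on_sections X M u = on_sections X M v"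
 by (auto simp: on_sections_def fun_eq_iff)

lemma mod_hom_ext:
 assumes "u \<in> mod_hom X M N" "v \<in> mod_hom X M N'"
  and "\<And>W s. openin (rtop X) W \<Longrightarrow> s \<in> Sec M W \<Longrightarrow> u W s = v W s"
 shows "u = v"
proof -
 have "u = on_sections X M u" "v = on_sections X M v" using assms by (simp_all add: mod_hom_iff)
 then show ?thesis using on_sections_cong[of X M u v] assms(3) by metis
qed

lemma presheaf_homD:
 assumes "presheaf_hom X M N u" "openin (rtop X) W"
 shows "s \<in> Sec M W \<Longrightarrow> u W s \<in> Sec N W"
  and "s \<in> Sec M W \<Longrightarrow> t \<in> Sec M W \<Longrightarrow> u W (s \<oplus>\<^bsub>msec M W\<^esub> t) = u W s \<oplus>\<^bsub>msec N W\<^esub> u W t"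
  and "s \<in> Sec M W \<Longrightarrow> r \<in> Rsec X W \<Longrightarrow> u W (r \<odot>\<^bsub>msec M W\<^esub> s) = r \<odot>\<^bsub>msec N W\<^esub> u W s"
  and "s \<in> Sec M W \<Longrightarrow> openin (rtop X) V \<Longrightarrow> V \<subseteq> W \<Longrightarrow> u V (mres M W V s) = mres N W V (u W s)"
 using assms unfolding presheaf_hom_def lin_map_def add_hom_def by (simp_all add: Pi_iff)

lemma presheaf_homI:
 assumes "\<And>W s. openin (rtop X) W \<Longrightarrow> s \<in> Sec M W \<Longrightarrow> u W s \<in> Sec N W"
  and "\<And>W s t. openin (rtop X) W \<Longrightarrow> s \<in> Sec M W \<Longrightarrow> t \<in> Sec M W \<Longrightarrow> u W (s \<oplus>\<^bsub>msec M W\<^esub> t) = u W s \<oplus>\<^bsub>msec N W\<^esub> u W t"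
  and "\<And>W s r. openin (rtop X) W \<Longrightarrow> s \<in> Sec M W \<Longrightarrow> r \<in> Rsec X W \<Longrightarrow> u W (r \<odot>\<^bsub>msec M W\<^esub> s) = r \<odot>\<^bsub>msec N W\<^esub> u W s"
  and "\<And>W s V. openin (rtop X) W \<Longrightarrow> s \<in> Sec M W \<Longrightarrow> openin (rtop X) V \<Longrightarrow> V \<subseteq> W \<Longrightarrow> u V (mres M W V s) = mres N W V (u W s)"
 shows "presheaf_hom X M N u"
 using assms unfolding presheaf_hom_def lin_map_def add_hom_def by (simp add: Pi_iff)

lemma mod_homD: "u \<in> mod_hom X M N \<Longrightarrow> presheaf_hom X M N u"
 by (simp add: mod_hom_iff)

lemma (in mpre) sec_closed_M:
 assumes "opn W"
 shows "s \<in> Sec M W \<Longrightarrow> t \<in> Sec M W \<Longrightarrow> s \<oplus>\<^bsub>msec M W\<^esub> t \<in> Sec M W"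
  and "s \<in> Sec M W \<Longrightarrow> a \<in> Rsec X W \<Longrightarrow> a \<odot>\<^bsub>msec M W\<^esub> s \<in> Sec M W"
  and "\<zero>\<^bsub>msec M W\<^esub> \<in> Sec M W"
proof -
 interpret left_module "rsec X W" "msec M W" by (rule left_module_sec[OF assms])
 show "s \<in> Sec M W \<Longrightarrow> t \<in> Sec M W \<Longrightarrow> s \<oplus>\<^bsub>msec M W\<^esub> t \<in> Sec M W"
  "s \<in> Sec M W \<Longrightarrow> a \<in> Rsec X W \<Longrightarrow> a \<odot>\<^bsub>msec M W\<^esub> s \<in> Sec M W"
  "\<zero>\<^bsub>msec M W\<^esub> \<in> Sec M W"
  by (simp_all add: smult_closed)
qed

lemma (in mpre) on_sections_hom:
 assumes "presheaf_hom X M N u" shows "on_sections X M u \<in> mod_hom X M N"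
proof -
 have "presheaf_hom X M N (on_sections X M u)"
  by (rule presheaf_homI)
   (use presheaf_homD[OF assms] in \<open>simp_all add: on_sections_apply sec_closed_M m.res_closed\<close>)
 then show ?thesis by (simp add: mod_hom_iff on_sections_idem)
qed

lemma (in mpre) mod_comp_hom:
 assumes "u \<in> mod_hom X M N" "v \<in> mod_hom X N L"
 shows "mod_comp X M v u \<in> mod_hom X M L"
 unfolding mod_comp_def
 by (intro on_sections_hom presheaf_homI)
  (simp_all add: presheaf_homD[OF mod_homD[OF assms(1)]] presheaf_homD[OF mod_homD[OF assms(2)]])

lemma mod_comp_apply:
 "openin (rtop X) W \<Longrightarrow> s \<in> Sec M W \<Longrightarrow> mod_comp X M v u W s = v W (u W s)"
 by (simp add: mod_comp_def on_sections_apply)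

text \<open>The inverse is linear and natural because \<open>u\<close> is injective over every open
  set: the two sides of each identity have the same image under \<open>u\<close>.\<close>

lemma (in mpre) mod_inv:
 assumes "mod_iso X M N u" "mpre X N"
 shows mod_inv_hom: "mod_inv X M N u \<in> mod_hom X N M"
  and mod_inv_right: "\<And>W t. opn W \<Longrightarrow> t \<in> Sec N W \<Longrightarrow> u W (mod_inv X M N u W t) = t"
  and mod_inv_left: "\<And>W s. opn W \<Longrightarrow> s \<in> Sec M W \<Longrightarrow> mod_inv X M N u W (u W s) = s"
proof -
 interpret N: mpre X N by fact
 have u: "presheaf_hom X M N u" using assms(1) by (simp add: mod_iso_def mod_homD)
 have bij: "bij_betw (u W) (Sec M W) (Sec N W)" if "opn W" for W
  using assms(1) that by (simp add: mod_iso_def)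
 note ud = presheaf_homD[OF u]
 define v where "v = (\<lambda>W. inv_into (Sec M W) (u W))"
 have vc: "v W t \<in> Sec M W" and uv: "u W (v W t) = t" if "opn W" "t \<in> Sec N W" for W t
  using that bij[OF that(1)] unfolding v_def bij_betw_def by (auto intro: inv_into_into f_inv_into_f)
 have vu: "v W (u W s) = s" if "opn W" "s \<in> Sec M W" for W s
  using that bij[OF that(1)] unfolding v_def bij_betw_def by (auto intro: inv_into_f_f)
 have inj: "s = t" if "opn W" "s \<in> Sec M W" "t \<in> Sec M W" "u W s = u W t" for W s t
  using that vu by metis
 have "presheaf_hom X N M v"
 proof (rule presheaf_homI)
  fix W s t assume W: "opn W" and s: "s \<in> Sec N W" and t: "t \<in> Sec N W"
  show "v W (s \<oplus>\<^bsub>msec N W\<^esub> t) = v W s \<oplus>\<^bsub>msec M W\<^esub> v W t"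
   by (rule inj[OF W]) (simp_all add: W s t vc uv ud sec_closed_M N.sec_closed_M)
 next
  fix W s r assume W: "opn W" and s: "s \<in> Sec N W" and r: "r \<in> Rsec X W"
  show "v W (r \<odot>\<^bsub>msec N W\<^esub> s) = r \<odot>\<^bsub>msec M W\<^esub> v W s"
   by (rule inj[OF W]) (simp_all add: W s r vc uv ud sec_closed_M N.sec_closed_M)
 next
  fix W s V assume W: "opn W" and s: "s \<in> Sec N W" and V: "opn V" "V \<subseteq> W"
  show "v V (mres N W V s) = mres M W V (v W s)"
   by (rule inj[OF V(1)]) (simp_all add: W s V vc uv ud m.res_closed N.m.res_closed)
 qed (rule vc)
 then show "mod_inv X M N u \<in> mod_hom X N M"
  unfolding mod_inv_def v_def by (rule N.on_sections_hom)
 show "\<And>W t. opn W \<Longrightarrow> t \<in> Sec N W \<Longrightarrow> u W (mod_inv X M N u W t) = t"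
  using uv by (simp add: mod_inv_def on_sections_apply v_def)
 show "\<And>W s. opn W \<Longrightarrow> s \<in> Sec M W \<Longrightarrow> mod_inv X M N u W (u W s) = s"
  using vu ud by (simp add: mod_inv_def on_sections_apply v_def)
qed

context pb_pre
begin

lemma usec_res:
 assumes "Y.opn V" "Y.opn W" "W \<subseteq> V" "m \<in> Sec M V"
 shows "restrict (usec V m) (preim f W) = usec W (mres M V W m)"
 unfolding usec_def
proof (rule ext)
 fix y
 have "mgerm Y M (pt f y) W (mres M V W m) = mgerm Y M (pt f y) V m" if y: "y \<in> preim f W"
 proof -
  interpret pb_pt f M y by (rule pt_locale[OF pt_in_open[OF preim_open[OF assms(2)] y]])
  have "pt f y \<in> W" using y by (simp add: preim_iff)
  then show ?thesis using assms by (intro M.mg_res) auto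
 qed
 moreover have "y \<in> preim f V" if "y \<in> preim f W" using that assms by (auto simp: preim_iff)
 ultimately show "restrict (\<lambda>y\<in>preim f V. pb_tens f M y \<one>\<^bsub>stalk_ring X y\<^esub> (mgerm Y M (pt f y) V m)) (preim f W) y =
  (\<lambda>y\<in>preim f W. pb_tens f M y \<one>\<^bsub>stalk_ring X y\<^esub> (mgerm Y M (pt f y) W (mres M V W m))) y"
  by (simp add: restrict_def)
qed

lemma usec_add:
 assumes "Y.opn V" "m \<in> Sec M V" "m' \<in> Sec M V"
 shows "usec V (m \<oplus>\<^bsub>msec M V\<^esub> m') = usec V m \<oplus>\<^bsub>msec PB (preim f V)\<^esub> usec V m'"
 unfolding msec_simps
proof (unfold usec_def, rule restrict_ext)
 fix y assume y: "y \<in> preim f V"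
 interpret pb_pt f M y by (rule pt_locale[OF pt_in_open[OF preim_open[OF assms(1)] y]])
 have "Y.opn V \<and> pt f y \<in> V" using y assms by (simp add: preim_iff)
 then show "pb_tens f M y \<one>\<^bsub>X.St\<^esub> (M.mg V (m \<oplus>\<^bsub>msec M V\<^esub> m')) =
   (\<lambda>y\<in>preim f V. pb_tens f M y \<one>\<^bsub>stalk_ring X y\<^esub> (mgerm Y M (pt f y) V m)) y \<oplus>\<^bsub>P\<^esub>
   (\<lambda>y\<in>preim f V. pb_tens f M y \<one>\<^bsub>stalk_ring X y\<^esub> (mgerm Y M (pt f y) V m')) y"
  using y assms by (simp add: M.mg_add[symmetric] pt_add_right)
qed

text \<open>At each point a scalar from downstairs crosses the tensor sign and becomes the germ of
  its image under the comorphism.\<close>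

lemma usec_smult:
 assumes "Y.opn V" "m \<in> Sec M V" "a \<in> Rsec Y V"
 shows "usec V (a \<odot>\<^bsub>msec M V\<^esub> m) = comor f V a \<odot>\<^bsub>msec PB (preim f V)\<^esub> usec V m"
 unfolding msec_simps
proof (unfold usec_def, rule restrict_ext)
 fix y assume y: "y \<in> preim f V"
 interpret pb_pt f M y by (rule pt_locale[OF pt_in_open[OF preim_open[OF assms(1)] y]])
 have nb: "Y.opn V \<and> pt f y \<in> V" using y assms by (simp add: preim_iff)
 have c: "rgerm Y (pt f y) V a \<in> carrier (stalk_ring Y (pt f y))" "mgerm Y M (pt f y) V m \<in> carrier M.SM"
  using nb assms by auto
 have c2: "stalk_comor f y (rgerm Y (pt f y) V a) \<in> carrier X.St" using c by blast
 have "pb_tens f M y \<one>\<^bsub>X.St\<^esub> (M.mg V (a \<odot>\<^bsub>msec M V\<^esub> m)) = pb_tens f M y \<one>\<^bsub>X.St\<^esub> (rgerm Y (pt f y) V a \<odot>\<^bsub>M.SM\<^esub> M.mg V m)"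
  using nb assms by (simp add: M.mg_smult)
 also have "\<dots> = pb_tens f M y (stalk_comor f y (rgerm Y (pt f y) V a)) (M.mg V m)"
  using c c2 by (subst pt_balanced[symmetric]) simp_all
 also have "\<dots> = rgerm X y (preim f V) (comor f V a) \<odot>\<^bsub>P\<^esub> pb_tens f M y \<one>\<^bsub>X.St\<^esub> (M.mg V m)"
  using c c2 nb assms by (subst pt_smult_one) (simp_all add: stalk_comor_rgerm)
 finally show "pb_tens f M y \<one>\<^bsub>X.St\<^esub> (M.mg V (a \<odot>\<^bsub>msec M V\<^esub> m)) =
   rgerm X y (preim f V) (comor f V a) \<odot>\<^bsub>P\<^esub> (\<lambda>y\<in>preim f V. pb_tens f M y \<one>\<^bsub>stalk_ring X y\<^esub> (mgerm Y M (pt f y) V m)) y"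
  using y by simp
qed

end

section \<open>The stalk of the pullback is the tensor product of the stalks\<close>

context pb_pt
begin

sublocale PBx: mpre_pt "src f" "pullback f M" x ..

definition ug where "ug b = (\<Union>(V, m)\<in>b. mgerm X PB x (preim f V) (usec V m))"

lemma nb_preim: "Y.nb V \<Longrightarrow> X.nb (preim f V)"
 using x_in preim_open by (auto simp: preim_iff)

lemma ug_mgerm:
 assumes V: "Y.opn V" "pt f x \<in> V" "m \<in> Sec M V"
 shows "ug (mgerm Y M (pt f x) V m) = mgerm X PB x (preim f V) (usec V m)"
 unfolding ug_def mgerm_def[of Y]
proof (rule M.m.UN_germ[OF V])
 fix V' t assume V': "Y.opn V'" "pt f x \<in> V'" "t \<in> Sec M V'"
  "germ (rtop Y) (\<lambda>U. Sec M U) (mres M) (pt f x) V' t = germ (rtop Y) (\<lambda>U. Sec M U) (mres M) (pt f x) V m"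
 obtain W where W: "Y.opn W" "pt f x \<in> W" "W \<subseteq> V'" "W \<subseteq> V" "mres M V' W t = mres M V W m"
  using M.m.germ_eqD[OF V'(4) V] .
 show "mgerm X PB x (preim f V') (usec V' t) = mgerm X PB x (preim f V) (usec V m)"
  unfolding mgerm_def
  by (rule PB.m.germ_eqI[of _ _ "preim f W"])
   (use V V' W nb_preim usec_res[OF V'(1) W(1,3) V'(3)] usec_res[OF V(1) W(1,4) V(3)]
    in \<open>simp_all add: usec_closed preim_mono\<close>)
qed

lemma ug_closed: "b \<in> carrier M.SM \<Longrightarrow> ug b \<in> carrier PBx.SM"
 using M.mcarrierE[of b] by (metis PBx.mg_in nb_preim ug_mgerm usec_closed)

lemma ug_add:
 assumes "b \<in> carrier M.SM" "c \<in> carrier M.SM"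
 shows "ug (b \<oplus>\<^bsub>M.SM\<^esub> c) = ug b \<oplus>\<^bsub>PBx.SM\<^esub> ug c"
proof -
 obtain U t u where *: "Y.nb U"
  "t \<in> Sec M U" "u \<in> Sec M U"
  "b = M.mg U t" "c = M.mg U u" using M.mcommon[OF Y.St.zero_closed Y.St.zero_closed, of b c c] assms by metis
 have o: "X.nb (preim f U)" by (rule nb_preim[OF *(1)])
 have "ug (b \<oplus>\<^bsub>M.SM\<^esub> c) = mgerm X PB x (preim f U) (usec U (t \<oplus>\<^bsub>msec M U\<^esub> u))"
  using * M.sec_closed_M by (simp add: M.mg_add ug_mgerm)
 also have "\<dots> = mgerm X PB x (preim f U) (usec U t) \<oplus>\<^bsub>PBx.SM\<^esub> mgerm X PB x (preim f U) (usec U u)"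
  using * o by (subst usec_add) (simp_all only: PBx.mg_add usec_closed)
 also have "\<dots> = ug b \<oplus>\<^bsub>PBx.SM\<^esub> ug c" using * by (simp only: ug_mgerm)
 finally show ?thesis .
qed

lemma ug_smult:
 assumes "a \<in> carrier Y.St" "b \<in> carrier M.SM"
 shows "ug (a \<odot>\<^bsub>M.SM\<^esub> b) = stalk_comor f x a \<odot>\<^bsub>PBx.SM\<^esub> ug b"
proof -
 obtain U r t where *: "Y.nb U" "r \<in> Rsec Y U"
  "t \<in> Sec M U" "a = rgerm Y (pt f x) U r" "b = M.mg U t"
  using M.mcommon[of a a b b b] assms by metis
 have o: "X.nb (preim f U)" by (rule nb_preim[OF *(1)])
 have "ug (a \<odot>\<^bsub>M.SM\<^esub> b) = mgerm X PB x (preim f U) (usec U (r \<odot>\<^bsub>msec M U\<^esub> t))"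
  using * M.sec_closed_M by (simp add: M.mg_smult ug_mgerm)
 also have "\<dots> = rgerm X x (preim f U) (comor f U r) \<odot>\<^bsub>PBx.SM\<^esub> mgerm X PB x (preim f U) (usec U t)"
  using * o by (subst usec_smult) (simp_all only: PBx.mg_smult usec_closed comor_closed)
 also have "\<dots> = stalk_comor f x a \<odot>\<^bsub>PBx.SM\<^esub> ug b" using * by (simp only: ug_mgerm stalk_comor_rgerm)
 finally show ?thesis .
qed

text \<open>\<open>Lg\<close> is inverse to \<open>germ_eval x\<close>, and \<open>ug\<close> is its restriction to the tensors \<open>1 \<otimes> m\<close>.\<close>

definition Lg where "Lg = tensor_lift PBx.SM (\<lambda>(a, b). a \<odot>\<^bsub>PBx.SM\<^esub> ug b)"

lemma Lg: "add_hom P PBx.SM Lg"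
 and Lg_tens: "\<And>r m. r \<in> carrier X.St \<Longrightarrow> m \<in> carrier M.SM \<Longrightarrow> Lg (r \<otimes>\<otimes> m) = r \<odot>\<^bsub>PBx.SM\<^esub> ug m"
proof -
 have ab: "abelian_group PBx.SM" by unfold_locales
 have phi: "stalk_comor f x s \<in> carrier X.St" if "s \<in> carrier Y.St" for s
  using that by (rule E.\<phi>_closed)
 note * = pt_lift[OF ab, where \<beta> = "\<lambda>(a, b). a \<odot>\<^bsub>PBx.SM\<^esub> ug b"]
 show "add_hom P PBx.SM Lg" unfolding Lg_def
  by (rule *(1)) (simp_all add: PBx.SM.smult_closed ug_closed PBx.SM.smult_l_distr ug_add PBx.SM.smult_r_distr
    PBx.SM.smult_assoc phi ug_smult)
 show "\<And>r m. r \<in> carrier X.St \<Longrightarrow> m \<in> carrier M.SM \<Longrightarrow> Lg (r \<otimes>\<otimes> m) = r \<odot>\<^bsub>PBx.SM\<^esub> ug m" unfolding Lg_def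
  by (subst *(2)) (simp_all add: PBx.SM.smult_closed ug_closed PBx.SM.smult_l_distr ug_add PBx.SM.smult_r_distr
    PBx.SM.smult_assoc phi ug_smult)
qed

sublocale Lg: add_group_hom P PBx.SM Lg
 by (intro add_group_hom.intro add_group_hom_axioms.intro Lg) unfold_locales

lemma Lg_smult:
 assumes "r \<in> carrier X.St" "e \<in> carrier P"
 shows "Lg (r \<odot>\<^bsub>P\<^esub> e) = r \<odot>\<^bsub>PBx.SM\<^esub> Lg e"
 using assms(2)
proof (induction rule: pt_induct)
 case zero then show ?case using assms(1) by simp
next
 case (tens r' m) then show ?case using assms(1) by (simp add: pt_smult Lg_tens PBx.SM.smult_assoc ug_closed)
next
 case (add a b) then show ?case using assms(1) by (simp add: P.smult_r_distr P.smult_closed PBx.SM.smult_r_distr)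
qed

text \<open>\<open>Lg\<close> recovers the germ of a section from its value at \<open>x\<close>.
  Both sides are additive along a local representation of \<open>s\<close>, so they need comparing
  only on terms \<open>r \<odot> (1 \<otimes> m)\<close>, where the formula for \<open>Lg\<close> on
  tensors applies.\<close>

lemma Lg_sec:
 assumes W: "X.opn W" "x \<in> W" and s: "s \<in> Sec PB W"
 shows "Lg (s x) = mgerm X PB x W s"
proof -
 obtain W' V n r m where *: "X.opn W'" "x \<in> W'" "W' \<subseteq> W" "Y.opn V" "W' \<subseteq> preim f V"
  and rm': "\<forall>i<n::nat. r i \<in> Rsec X W' \<and> m i \<in> Sec M V"
  and eq: "restrict s W' = (\<Oplus>\<^bsub>msec PB W'\<^esub>i\<in>{..<n}. r i \<odot>\<^bsub>msec PB W'\<^esub> restrict (usec V (m i)) W')"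
  using sec_repr[OF W(1) s W(2)] .
 have rm: "\<And>i. i < n \<Longrightarrow> r i \<in> Rsec X W'" "\<And>i. i < n \<Longrightarrow> m i \<in> Sec M V"
  using rm' by blast+
 have px: "x \<in> preim f V" "pt f x \<in> V" using * by (auto simp: preim_iff)
 have u: "restrict (usec V (m i)) W' \<in> Sec PB W'" if "i < n" for i
  using sec_res[OF usec_closed[OF *(4) rm(2)[OF that]] *(1,5)] .
 have ru: "(\<lambda>i. r i \<odot>\<^bsub>msec PB W'\<^esub> restrict (usec V (m i)) W') \<in> {..<n} \<rightarrow> Sec PB W'"
  by (intro funcsetI PB.sec_closed_M(2) rm u *(1)) simp_all
 interpret mg: add_group_hom "msec PB W'" PBx.SM "mgerm X PB x W'"
 proof (intro add_group_hom.intro add_group_hom_axioms.intro)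
  show "abelian_group (msec PB W')" using left_module.axioms(2)[OF PB.left_module_sec[OF *(1)]] .
  show "abelian_group PBx.SM" by unfold_locales
  show "add_hom (msec PB W') PBx.SM (mgerm X PB x W')"
   unfolding add_hom_def using *(1,2) PBx.mg_in PBx.mg_add by simp
 qed
 interpret ev: add_group_hom "msec PB W'" P "\<lambda>s. s x" by (rule eval_hom[OF *(1,2)])
 have "mgerm X PB x W s = mgerm X PB x W' (restrict s W')"
  using PBx.mg_res[of W W' s] W s * by simp
 also have "\<dots> = (\<Oplus>\<^bsub>PBx.SM\<^esub>i\<in>{..<n}. mgerm X PB x W' (r i \<odot>\<^bsub>msec PB W'\<^esub> restrict (usec V (m i)) W'))"
  unfolding eq by (rule mg.finsum[OF ru])
 also have "\<dots> = (\<Oplus>\<^bsub>PBx.SM\<^esub>i\<in>{..<n}. Lg ((r i \<odot>\<^bsub>msec PB W'\<^esub> restrict (usec V (m i)) W') x))"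
 proof (rule PBx.SM.M.add.finprod_cong'[OF refl])
  show "(\<lambda>i. Lg ((r i \<odot>\<^bsub>msec PB W'\<^esub> restrict (usec V (m i)) W') x)) \<in> {..<n} \<rightarrow> carrier PBx.SM"
   by (rule funcsetI, rule Lg.closed, rule ev.closed, rule funcset_mem[OF ru])
  fix i assume i: "i \<in> {..<n}"
  have c: "rgerm X x W' (r i) \<in> carrier X.St" "mgerm Y M (pt f x) V (m i) \<in> carrier M.SM"
   using rm i * px by auto
  have "mgerm X PB x W' (r i \<odot>\<^bsub>msec PB W'\<^esub> restrict (usec V (m i)) W') =
   rgerm X x W' (r i) \<odot>\<^bsub>PBx.SM\<^esub> mgerm X PB x W' (restrict (usec V (m i)) W')"
   using i * rm u by (intro PBx.mg_smult[symmetric]) simp_all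
  also have "mgerm X PB x W' (restrict (usec V (m i)) W') = mgerm X PB x (preim f V) (usec V (m i))"
   using PBx.mg_res[of "preim f V" W' "usec V (m i)"] i * rm preim_open usec_closed px by simp
  also have "rgerm X x W' (r i) \<odot>\<^bsub>PBx.SM\<^esub> \<dots> = Lg (rgerm X x W' (r i) \<otimes>\<otimes> mgerm Y M (pt f x) V (m i))"
   using i * rm px c by (simp add: Lg_tens ug_mgerm del: set_eq_iff)
  also have "rgerm X x W' (r i) \<otimes>\<otimes> mgerm Y M (pt f x) V (m i) = (r i \<odot>\<^bsub>msec PB W'\<^esub> restrict (usec V (m i)) W') x"
   using c px * by (subst pt_smult_one) (simp_all add: usec_val)
  finally show "mgerm X PB x W' (r i \<odot>\<^bsub>msec PB W'\<^esub> restrict (usec V (m i)) W') =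
    Lg ((r i \<odot>\<^bsub>msec PB W'\<^esub> restrict (usec V (m i)) W') x)" .
 qed
 also have "\<dots> = Lg (\<Oplus>\<^bsub>P\<^esub>i\<in>{..<n}. (r i \<odot>\<^bsub>msec PB W'\<^esub> restrict (usec V (m i)) W') x)"
  by (rule Lg.finsum[symmetric], rule funcsetI, rule ev.closed, rule funcset_mem[OF ru])
 also have "(\<Oplus>\<^bsub>P\<^esub>i\<in>{..<n}. (r i \<odot>\<^bsub>msec PB W'\<^esub> restrict (usec V (m i)) W') x) = restrict s W' x"
  unfolding eq by (rule ev.finsum[OF ru, symmetric])
 finally show ?thesis using * by simp
qed

text \<open>A tensor of two germs extends to the tensor of representing sections over a common
  domain, and sums extend over intersections.\<close>

lemma pt_surj:
 assumes "e \<in> carrier P"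
 obtains W s where "X.opn W" "x \<in> W" "s \<in> Sec PB W" "s x = e"
proof -
 have "\<exists>W s. X.opn W \<and> x \<in> W \<and> s \<in> Sec PB W \<and> s x = e"
  using assms
 proof (induction rule: pt_induct)
  case zero
  show ?case
   by (rule exI[of _ "Pts X"], rule exI[of _ "\<lambda>x\<in>Pts X. \<zero>\<^bsub>pb_stalk f M x\<^esub>"])
    (intro conjI X.opn_top x_in sec_zero[OF X.opn_top] restrict_apply')
 next
  case (tens r m)
  obtain U a where U: "X.nb U" "a \<in> Rsec X U" "r = rgerm X x U a" using X.carrierE[OF tens(1)] .
  obtain V n where V: "Y.nb V" "n \<in> Sec M V" "m = M.mg V n" using M.mcarrierE[OF tens(2)] .
  let ?W = "U \<inter> preim f V"
  have W: "X.nb ?W" "?W \<subseteq> U" "?W \<subseteq> preim f V" using U(1) nb_preim[OF V(1)] by auto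
  have r: "rres X U ?W a \<in> Rsec X ?W" using U W X.r.res_closed by simp
  have s: "restrict (usec V n) ?W \<in> Sec PB ?W" using sec_res[OF usec_closed _ W(3)] V W by simp
  have c: "r \<in> carrier X.St" "m \<in> carrier M.SM" using tens by auto
  have "(rres X U ?W a \<odot>\<^bsub>msec PB ?W\<^esub> restrict (usec V n) ?W) x = r \<odot>\<^bsub>P\<^esub> (\<one>\<^bsub>X.St\<^esub> \<otimes>\<otimes> m)"
   using U V W X.g_res[of U ?W a] by (simp add: usec_val)
  also have "\<dots> = r \<otimes>\<otimes> m" using pt_smult_one[OF c] by simp
  finally show ?case using PB.sec_closed_M(2)[OF _ s r] W(1) by blast
 next
  case (add a b)
  then obtain W s W' s' where *: "X.opn W" "x \<in> W" "s \<in> Sec PB W" "s x = a"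
   "X.opn W'" "x \<in> W'" "s' \<in> Sec PB W'" "s' x = b" by metis
  let ?W = "W \<inter> W'"
  have W: "X.opn ?W" "x \<in> ?W" using * by auto
  have "restrict s ?W \<in> Sec PB ?W" "restrict s' ?W \<in> Sec PB ?W"
   using sec_res[OF *(3) W(1)] sec_res[OF *(7) W(1)] by simp_all
  from PB.sec_closed_M(1)[OF W(1) this]
  have "restrict s ?W \<oplus>\<^bsub>msec PB ?W\<^esub> restrict s' ?W \<in> Sec PB ?W" .
  moreover have "(restrict s ?W \<oplus>\<^bsub>msec PB ?W\<^esub> restrict s' ?W) x = a \<oplus>\<^bsub>P\<^esub> b" using W * by simp
  ultimately show ?case using W by blast
 qed
 then show ?thesis using that by metis
qed

text \<open>Applying \<open>Lg\<close> to the common value yields equal germs. Agreement at the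
  single point \<open>x\<close> thus spreads to a neighbourhood, which is what allows maps between
  pullbacks to be computed on values.\<close>

lemma germ_eqD:
 assumes "X.opn W" "x \<in> W" "s \<in> Sec PB W" "X.opn W'" "x \<in> W'" "t \<in> Sec PB W'"
  and "s x = t x"
 obtains W'' where "X.opn W''" "x \<in> W''" "W'' \<subseteq> W" "W'' \<subseteq> W'" "restrict s W'' = restrict t W''"
proof -
 have "mgerm X PB x W s = mgerm X PB x W' t"
  using Lg_sec[OF assms(1-3)] Lg_sec[OF assms(4-6)] assms(7) by simp
 note l = PB.m.germ_eqD[OF this[unfolded mgerm_def] assms(4-6)]
 show ?thesis by (rule l, rule that) simp_all
qed

lemma germ_eval_mgerm:
 assumes W: "X.opn W" "x \<in> W" "s \<in> Sec PB W"
 shows "germ_eval x (mgerm X PB x W s) = s x"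
proof -
 have eq: "t x = s x" if "(V, t) \<in> mgerm X PB x W s" for V t
 proof -
  note V = PB.m.mem_germ[OF that[unfolded mgerm_def] W(1,3)]
  obtain W' where "x \<in> W'" "restrict t W' = restrict s W'"
   using PB.m.germ_eqD[OF V(4) W] by (metis msec_simps(4))
  then show ?thesis by (metis restrict_apply')
 qed
 have "(W, s) \<in> mgerm X PB x W s" unfolding mgerm_def by (rule PB.m.germ_self[OF W])
 note W_in = this
 show ?thesis
  unfolding germ_eval_def
 proof (rule the_equality, rule ballI)
  fix p assume p: "p \<in> mgerm X PB x W s"
  obtain V t where Vt: "p = (V, t)" by (cases p)
  show "case p of (V, t) \<Rightarrow> s x = t x" unfolding Vt using eq p Vt by simp
 next
  fix v assume "\<forall>(V, t)\<in>mgerm X PB x W s. v = t x"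
  from bspec[OF this W_in] show "v = s x" by simp
 qed
qed

end

text \<open>A map out of \<open>f\<^sup>*M\<close> acts on the modules \<open>pb_stalk f M x\<close>: extend an element to a section and take the
 value at \<open>x\<close> of its image. The value does not depend on the section.\<close>

definition stv ::
 "('x, 'r, 'y, 's) rs_mor \<Rightarrow> ('y, 's, 'm) msheaf \<Rightarrow> ('x set \<Rightarrow> ('x, 'r, 'y, 'm) pb \<Rightarrow> 'x \<Rightarrow> 'c) \<Rightarrow> 'x
  \<Rightarrow> (('x set \<times> 'r) set, ('y set \<times> 'm) set) tensor \<Rightarrow> 'c" where
 "stv f M u x e = (case (SOME (W, s). openin (rtop (src f)) W \<and> x \<in> W \<and> s \<in> Sec (pullback f M) W \<and> s x = e)
   of (W, s) \<Rightarrow> u W s x)"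

section \<open>Sheaf maps between pullbacks and linear maps of their fibres\<close>

locale pb_two = A: pb_pre f M + B: pb_pre f' M'
 for f :: "('x, 'r, 'y, 's) rs_mor" and M :: "('y, 's, 'm) msheaf"
  and f' :: "('x, 'r, 'z, 't) rs_mor" and M' :: "('z, 't, 'n) msheaf" +
 assumes src_eq: "src f' = src f"
begin

text \<open>Two sections with the same value at \<open>x\<close> agree near \<open>x\<close> by
  \<open>germ_eqD\<close>, and by naturality so do their images. Hence the section selected in
  \<open>stv\<close> can be replaced by \<open>s\<close>.\<close>

lemma stv_sec:
 assumes u: "u \<in> mod_hom (src f) (pullback f M) (pullback f' M')"
  and W: "A.X.opn W" "x \<in> W" "s \<in> Sec A.PB W"
 shows "stv f M u x (s x) = u W s x"
proof -
 interpret A: pb_pt f M x by (rule A.pt_locale[OF A.pt_in_open[OF W(1,2)]])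
 note ud = presheaf_homD[OF mod_homD[OF u]]
 let ?P = "\<lambda>(W, t). A.X.opn W \<and> x \<in> W \<and> t \<in> Sec A.PB W \<and> t x = s x"
 obtain W' t where Wt: "(SOME p. ?P p) = (W', t)" by (meson surj_pair)
 have "?P (SOME p. ?P p)" by (rule someI[of ?P "(W, s)"]) (use W in simp)
 then have W': "A.X.opn W'" "x \<in> W'" "t \<in> Sec A.PB W'" "t x = s x" unfolding Wt by auto
 obtain V where V: "A.X.opn V" "x \<in> V" "V \<subseteq> W'" "V \<subseteq> W" "restrict t V = restrict s V"
  using A.germ_eqD[OF W'(1-3) W W'(4)] .
 have "restrict (u W' t) V = restrict (u W s) V"
  using ud(4)[OF W'(1,3) V(1,3)] ud(4)[OF W(1,3) V(1,4)] V(5) by simp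
 from fun_cong[OF this, of x] have "u W' t x = u W s x" using V by simp
 then show ?thesis unfolding stv_def Wt by simp
qed

text \<open>The elements are extended to sections over a common open set; there \<open>u\<close> is
  linear, and evaluation at \<open>x\<close> is linear too.\<close>

lemma stv_lin:
 assumes u: "u \<in> mod_hom (src f) (pullback f M) (pullback f' M')" and x: "x \<in> Pts (src f)"
 shows "lin_map (stalk_ring (src f) x) (pb_stalk f M x) (pb_stalk f' M' x) (stv f M u x)"
 unfolding lin_map_def add_hom_def
proof (intro conjI ballI funcsetI)
 interpret Ax: pb_pt f M x by (rule A.pt_locale[OF x])
 note ud = presheaf_homD[OF mod_homD[OF u]]
 fix a assume a: "a \<in> carrier Ax.P"
 obtain W s where W: "A.X.opn W" "x \<in> W" "s \<in> Sec A.PB W" "s x = a" using Ax.pt_surj[OF a] .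
 show "stv f M u x a \<in> Stk f' M' x"
  unfolding W(4)[symmetric] stv_sec[OF u W(1-3)]
  by (rule B.sec_val[OF ud(1)[OF W(1,3)] W(2)])
 fix b assume b: "b \<in> carrier Ax.P"
 obtain V t where V: "A.X.opn V" "x \<in> V" "t \<in> Sec A.PB V" "t x = b" using Ax.pt_surj[OF b] .
 let ?W = "W \<inter> V"
 have o: "A.X.opn ?W" "x \<in> ?W" "?W \<subseteq> W" "?W \<subseteq> V" using W V by auto
 have s: "restrict s ?W \<in> Sec A.PB ?W" "restrict t ?W \<in> Sec A.PB ?W"
  using A.sec_res[OF W(3) o(1,3)] A.sec_res[OF V(3) o(1,4)] by simp_all
 have e: "a = restrict s ?W x" "b = restrict t ?W x" using W V o by simp_all
 have ab: "a \<oplus>\<^bsub>Ax.P\<^esub> b = (restrict s ?W \<oplus>\<^bsub>msec A.PB ?W\<^esub> restrict t ?W) x" using W V o by simp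
 show "stv f M u x (a \<oplus>\<^bsub>Ax.P\<^esub> b) = stv f M u x a \<oplus>\<^bsub>pb_stalk f' M' x\<^esub> stv f M u x b"
  unfolding ab stv_sec[OF u o(1,2) A.PB.sec_closed_M(1)[OF o(1) s]]
  unfolding e stv_sec[OF u o(1,2) s(1)] stv_sec[OF u o(1,2) s(2)] ud(2)[OF o(1) s]
  using o by simp
next
 interpret Ax: pb_pt f M x by (rule A.pt_locale[OF x])
 note ud = presheaf_homD[OF mod_homD[OF u]]
 fix a e assume a: "a \<in> carrier Ax.X.St" and e: "e \<in> carrier Ax.P"
 obtain W s where W: "A.X.opn W" "x \<in> W" "s \<in> Sec A.PB W" "s x = e" using Ax.pt_surj[OF e] .
 obtain V r where V: "Ax.X.nb V" "r \<in> Rsec A.X V" "a = rgerm A.X x V r" using Ax.X.carrierE[OF a] .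
 let ?W = "W \<inter> V"
 have o: "A.X.opn ?W" "x \<in> ?W" "?W \<subseteq> W" "?W \<subseteq> V" using W V by auto
 have s: "restrict s ?W \<in> Sec A.PB ?W" by (rule A.sec_res[OF W(3) o(1,3)])
 have r: "rres A.X V ?W r \<in> Rsec A.X ?W" using V o by (intro A.X.r.res_closed) auto
 have a: "a = rgerm A.X x ?W (rres A.X V ?W r)" using Ax.X.g_res[of V ?W r] V o by simp
 have e: "e = restrict s ?W x" using W V o by simp
 have ae: "a \<odot>\<^bsub>Ax.P\<^esub> e = (rres A.X V ?W r \<odot>\<^bsub>msec A.PB ?W\<^esub> restrict s ?W) x" using W a o by simp
 show "stv f M u x (a \<odot>\<^bsub>Ax.P\<^esub> e) = a \<odot>\<^bsub>pb_stalk f' M' x\<^esub> stv f M u x e"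
  unfolding ae stv_sec[OF u o(1,2) A.PB.sec_closed_M(2)[OF o(1) s r]] ud(3)[OF o(1) s r]
  unfolding e stv_sec[OF u o(1,2) s]
  using o a src_eq by simp
qed

lemma stv_ext:
 assumes u: "u \<in> mod_hom (src f) (pullback f M) (pullback f' M')" and v: "v \<in> mod_hom (src f) (pullback f M) (pullback f' M')"
  and eq: "\<And>x e. x \<in> Pts (src f) \<Longrightarrow> e \<in> Stk f M x \<Longrightarrow> stv f M u x e = stv f M v x e"
 shows "u = v"
proof (rule mod_hom_ext[OF u v])
 fix W s assume W: "A.X.opn W" "s \<in> Sec A.PB W"
 show "u W s = v W s"
 proof (rule B.sec_eqI)
  show "u W s \<in> Sec B.PB W" "v W s \<in> Sec B.PB W"
   using presheaf_homD(1)[OF mod_homD[OF u] W] presheaf_homD(1)[OF mod_homD[OF v] W] by simp_all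
  fix y assume y: "y \<in> W"
  show "u W s y = v W s y"
   using eq[OF A.pt_in_open[OF W(1) y] A.sec_val[OF W(2) y]]
   by (simp add: stv_sec[OF u W(1) y W(2)] stv_sec[OF v W(1) y W(2)])
 qed
qed

text \<open>The converse of passing to fibres: linear maps of fibres form a sheaf map once they send
  unit sections to sections. Locally a section is a combination of unit sections, and fibrewise
  linearity turns its image into the same combination of their images.\<close>

lemma mk_hom:
 assumes lin: "\<And>x. x \<in> Pts (src f) \<Longrightarrow> lin_map (stalk_ring (src f) x) (pb_stalk f M x) (pb_stalk f' M' x) (L x)"
  and unit: "\<And>V m. A.Y.opn V \<Longrightarrow> m \<in> Sec M V \<Longrightarrow>
    (\<lambda>y\<in>preim f V. L y (pb_tens f M y \<one>\<^bsub>stalk_ring (src f) y\<^esub> (mgerm A.Y M (pt f y) V m))) \<in> Sec B.PB (preim f V)"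
 defines "u \<equiv> on_sections (src f) A.PB (\<lambda>W s. \<lambda>x\<in>W. L x (s x))"
 shows mk_hom_in: "u \<in> mod_hom (src f) A.PB B.PB"
  and stv_mk_hom: "\<And>x e. x \<in> Pts (src f) \<Longrightarrow> e \<in> Stk f M x \<Longrightarrow> stv f M u x e = L x e"
proof -
 have Lc: "L x e \<in> Stk f' M' x" "e' \<in> Stk f M x \<Longrightarrow> L x (e \<oplus>\<^bsub>pb_stalk f M x\<^esub> e') = L x e \<oplus>\<^bsub>pb_stalk f' M' x\<^esub> L x e'"
  "r \<in> carrier (stalk_ring (src f) x) \<Longrightarrow> L x (r \<odot>\<^bsub>pb_stalk f M x\<^esub> e) = r \<odot>\<^bsub>pb_stalk f' M' x\<^esub> L x e"
  if "x \<in> Pts (src f)" "e \<in> Stk f M x" for x e e' r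
  using lin[OF that(1)] that by (auto simp: lin_map_def add_hom_def)
 have oB: "openin (rtop (src f')) W" if "A.X.opn W" for W using that src_eq by simp
 have cl: "(\<lambda>x\<in>W. L x (s x)) \<in> Sec B.PB W" if W: "A.X.opn W" "s \<in> Sec A.PB W" for W s
 proof (rule B.sec_localI)
  fix x assume x: "x \<in> W"
  obtain W' V n r m where *: "A.X.opn W'" "x \<in> W'" "W' \<subseteq> W" "A.Y.opn V" "W' \<subseteq> preim f V"
   and rm': "\<forall>i<n::nat. r i \<in> Rsec A.X W' \<and> m i \<in> Sec M V"
   and eq: "restrict s W' = (\<Oplus>\<^bsub>msec A.PB W'\<^esub>i\<in>{..<n}. r i \<odot>\<^bsub>msec A.PB W'\<^esub> restrict (A.usec V (m i)) W')"
   using A.sec_repr[OF W x] .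
  have rm: "\<And>i. i < n \<Longrightarrow> r i \<in> Rsec A.X W'" "\<And>i. i < n \<Longrightarrow> m i \<in> Sec M V"
   using rm' by blast+
  have u: "restrict (A.usec V (m i)) W' \<in> Sec A.PB W'" if "i < n" for i
   using A.sec_res[OF A.usec_closed[OF *(4) rm(2)[OF that]] *(1,5)] .
  have ru: "(\<lambda>i. r i \<odot>\<^bsub>msec A.PB W'\<^esub> restrict (A.usec V (m i)) W') \<in> {..<n} \<rightarrow> Sec A.PB W'"
   by (intro funcsetI A.PB.sec_closed_M(2) rm u *(1)) simp_all
  define w where "w i = (\<lambda>y\<in>preim f V. L y (pb_tens f M y \<one>\<^bsub>stalk_ring (src f) y\<^esub> (mgerm A.Y M (pt f y) V (m i))))" for i
  have w: "restrict (w i) W' \<in> Sec B.PB W'" if "i < n" for i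
   unfolding w_def using B.sec_res[OF unit[OF *(4) rm(2)[OF that]] oB[OF *(1)] *(5)] .
  have rw: "(\<lambda>i. r i \<odot>\<^bsub>msec B.PB W'\<^esub> restrict (w i) W') \<in> {..<n} \<rightarrow> Sec B.PB W'"
   using rm(1) w oB[OF *(1)] src_eq by (intro funcsetI B.PB.sec_closed_M(2)) simp_all
  define t where "t = (\<Oplus>\<^bsub>msec B.PB W'\<^esub>i\<in>{..<n}. r i \<odot>\<^bsub>msec B.PB W'\<^esub> restrict (w i) W')"
  interpret lb: left_module "rsec (src f') W'" "msec B.PB W'" by (rule B.PB.left_module_sec[OF oB[OF *(1)]])
  have t: "t \<in> Sec B.PB W'" unfolding t_def by (rule lb.M.finsum_closed[OF rw])
  have val: "(\<lambda>x\<in>W. L x (s x)) y = t y" if y: "y \<in> W'" for y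
  proof -
   have yX: "y \<in> Pts (src f)" by (rule A.pt_in_open[OF *(1) y])
   interpret Ay: pb_pt f M y by (rule A.pt_locale[OF yX])
   interpret eA: add_group_hom "msec A.PB W'" "pb_stalk f M y" "\<lambda>s. s y" by (rule A.eval_hom[OF *(1) y])
   interpret eB: add_group_hom "msec B.PB W'" "pb_stalk f' M' y" "\<lambda>s. s y" by (rule B.eval_hom[OF oB[OF *(1)] y])
   interpret L: add_group_hom "pb_stalk f M y" "pb_stalk f' M' y" "L y"
    by (intro add_group_hom.intro add_group_hom_axioms.intro A.abelian_group_P[OF yX] B.abelian_group_P[OF yX[folded src_eq]])
     (use lin[OF yX] in \<open>simp add: lin_map_def\<close>)
   have py: "y \<in> preim f V" using y * by blast
   have "(\<lambda>x\<in>W. L x (s x)) y = L y (restrict s W' y)" using y * by auto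
   also have "restrict s W' y = (\<Oplus>\<^bsub>pb_stalk f M y\<^esub>i\<in>{..<n}. (r i \<odot>\<^bsub>msec A.PB W'\<^esub> restrict (A.usec V (m i)) W') y)"
    unfolding eq by (rule eA.finsum[OF ru])
   also have "L y \<dots> = (\<Oplus>\<^bsub>pb_stalk f' M' y\<^esub>i\<in>{..<n}. L y ((r i \<odot>\<^bsub>msec A.PB W'\<^esub> restrict (A.usec V (m i)) W') y))"
    by (rule L.finsum, rule funcsetI, rule eA.closed, rule funcset_mem[OF ru])
   also have "\<dots> = (\<Oplus>\<^bsub>pb_stalk f' M' y\<^esub>i\<in>{..<n}. (r i \<odot>\<^bsub>msec B.PB W'\<^esub> restrict (w i) W') y)"
   proof (rule eB.B.add.finprod_cong'[OF refl])
    show "(\<lambda>i. (r i \<odot>\<^bsub>msec B.PB W'\<^esub> restrict (w i) W') y) \<in> {..<n} \<rightarrow> Stk f' M' y"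
     by (rule funcsetI, rule eB.closed, rule funcset_mem[OF rw])
    fix i assume i: "i \<in> {..<n}"
    have c: "rgerm (src f) y W' (r i) \<in> carrier (stalk_ring (src f) y)" using rm(1) i * y by (intro Ay.X.g_in) auto
    have c2: "A.usec V (m i) y \<in> Stk f M y"
     using A.sec_val[OF A.usec_closed[OF *(4) rm(2)] py] i by simp
    show "L y ((r i \<odot>\<^bsub>msec A.PB W'\<^esub> restrict (A.usec V (m i)) W') y) = (r i \<odot>\<^bsub>msec B.PB W'\<^esub> restrict (w i) W') y"
     using y py Lc(3)[OF yX c2 c] src_eq by (simp add: w_def A.usec_val)
   qed
   also have "\<dots> = t y" unfolding t_def by (rule eB.finsum[OF rw, symmetric])
   finally show ?thesis .
  qed
  show "\<exists>W' t'. openin (rtop (src f')) W' \<and> x \<in> W' \<and> W' \<subseteq> W \<and> t' \<in> Sec B.PB W' \<and> (\<forall>y\<in>W'. (\<lambda>x\<in>W. L x (s x)) y = t' y)"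
   by (intro exI[of _ W'] exI[of _ t] conjI ballI oB[OF *(1)] *(2,3) t) (rule val)
 qed simp
 have hom: "presheaf_hom (src f) A.PB B.PB (\<lambda>W s. \<lambda>x\<in>W. L x (s x))"
 proof (rule presheaf_homI)
  fix W s t assume W: "A.X.opn W" and s: "s \<in> Sec A.PB W" and t: "t \<in> Sec A.PB W"
  show "(\<lambda>x\<in>W. L x ((s \<oplus>\<^bsub>msec A.PB W\<^esub> t) x)) = (\<lambda>x\<in>W. L x (s x)) \<oplus>\<^bsub>msec B.PB W\<^esub> (\<lambda>x\<in>W. L x (t x))"
   unfolding A.msec_simps B.msec_simps
   by (rule restrict_ext) (simp add: Lc(2)[OF A.pt_in_open[OF W] A.sec_val[OF s] A.sec_val[OF t]])
 next
  fix W s r assume W: "A.X.opn W" and s: "s \<in> Sec A.PB W" and r: "r \<in> Rsec (src f) W"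
  show "(\<lambda>x\<in>W. L x ((r \<odot>\<^bsub>msec A.PB W\<^esub> s) x)) = r \<odot>\<^bsub>msec B.PB W\<^esub> (\<lambda>x\<in>W. L x (s x))"
   unfolding A.msec_simps B.msec_simps src_eq
  proof (rule restrict_ext)
   fix y assume y: "y \<in> W"
   interpret Ay: pb_pt f M y by (rule A.pt_locale[OF A.pt_in_open[OF W y]])
   have "rgerm (src f) y W r \<in> carrier (stalk_ring (src f) y)" using r W y by (intro Ay.X.g_in) auto
   then show "L y ((\<lambda>x\<in>W. rgerm (src f) x W r \<odot>\<^bsub>pb_stalk f M x\<^esub> s x) y) = rgerm (src f) y W r \<odot>\<^bsub>pb_stalk f' M' y\<^esub> (\<lambda>x\<in>W. L x (s x)) y"
    using y Lc(3)[OF A.pt_in_open[OF W y] A.sec_val[OF s y]] by simp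
  qed
 next
  fix W s V assume V: "V \<subseteq> W" "A.X.opn W"
  show "(\<lambda>x\<in>V. L x (mres A.PB W V s x)) = mres B.PB W V (\<lambda>x\<in>W. L x (s x))"
   unfolding A.msec_simps B.msec_simps by (rule ext) (use V in \<open>auto simp: restrict_def\<close>)
 qed (rule cl)
 show u: "u \<in> mod_hom (src f) A.PB B.PB" unfolding u_def by (rule A.PB.on_sections_hom[OF hom])
 fix x e assume x: "x \<in> Pts (src f)" and e: "e \<in> Stk f M x"
 interpret Ax: pb_pt f M x by (rule A.pt_locale[OF x])
 obtain W s where W: "A.X.opn W" "x \<in> W" "s \<in> Sec A.PB W" "s x = e" using Ax.pt_surj[OF e] .
 show "stv f M u x e = L x e"
  unfolding W(4)[symmetric] stv_sec[OF u W(1-3)] unfolding u_def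
  using W by (simp add: on_sections_apply)
qed

text \<open>Injectivity is pointwise. For surjectivity the pointwise preimages of \<open>t\<close>
  must form a section. Near \<open>x\<close>, take a section \<open>v\<close> with the right value
  at \<open>x\<close>; its image agrees with \<open>t\<close> on a neighbourhood, and injectivity at
  the points there identifies \<open>v\<close> with the pointwise preimages.\<close>

lemma stalkwise_iso:
 assumes u: "u \<in> mod_hom (src f) A.PB B.PB"
  and bij: "\<And>x. x \<in> Pts (src f) \<Longrightarrow> bij_betw (stv f M u x) (Stk f M x) (Stk f' M' x)"
 shows "mod_iso (src f) A.PB B.PB u"
 unfolding mod_iso_def
proof (intro conjI u allI impI)
 fix W assume W: "A.X.opn W"
 note ud = presheaf_homD[OF mod_homD[OF u]]
 have oB: "openin (rtop (src f')) W" if "A.X.opn W" for W using that src_eq by simp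
 have inj: "e = e'" if "x \<in> Pts (src f)" "e \<in> Stk f M x" "e' \<in> Stk f M x"
  "stv f M u x e = stv f M u x e'" for x e e'
  using bij[OF that(1)] that by (auto simp: bij_betw_def inj_on_def)
 show "bij_betw (u W) (Sec A.PB W) (Sec B.PB W)"
  unfolding bij_betw_def
 proof (intro conjI inj_onI)
  fix s t assume s: "s \<in> Sec A.PB W" and t: "t \<in> Sec A.PB W" and eq: "u W s = u W t"
  show "s = t"
  proof (rule A.sec_eqI[OF s t])
   fix y assume y: "y \<in> W"
   show "s y = t y"
    by (rule inj[OF A.pt_in_open[OF W y] A.sec_val[OF s y] A.sec_val[OF t y]])
     (simp add: stv_sec[OF u W y s] stv_sec[OF u W y t] eq)
  qed
 next
  show "u W ` Sec A.PB W = Sec B.PB W"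
  proof
   show "u W ` Sec A.PB W \<subseteq> Sec B.PB W" using ud(1)[OF W] by (rule image_subsetI)
   show "Sec B.PB W \<subseteq> u W ` Sec A.PB W"
   proof
    fix t assume t: "t \<in> Sec B.PB W"
    define s where "s = (\<lambda>y\<in>W. inv_into (Stk f M y) (stv f M u y) (t y))"
    have sc: "s y \<in> Stk f M y" "stv f M u y (s y) = t y" if y: "y \<in> W" for y
    proof -
     have "t y \<in> stv f M u y ` Stk f M y"
      using bij[OF A.pt_in_open[OF W y]] B.sec_val[OF t y] by (simp add: bij_betw_def)
     then show "s y \<in> Stk f M y" "stv f M u y (s y) = t y"
      unfolding s_def using y inv_into_into[of "t y"] f_inv_into_f[of "t y"] by simp_all
    qed
    have s: "s \<in> Sec A.PB W"
    proof (rule A.sec_localI)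
     show "s \<in> extensional W" by (simp add: s_def)
     fix x assume x: "x \<in> W"
     interpret Ax: pb_pt f M x by (rule A.pt_locale[OF A.pt_in_open[OF W x]])
     have xB: "x \<in> Pts (src f')" using A.pt_in_open[OF W x] src_eq by simp
     interpret Bx: pb_pt f' M' x by (rule B.pt_locale[OF xB])
     obtain V v where V: "A.X.opn V" "x \<in> V" "v \<in> Sec A.PB V" "v x = s x" using Ax.pt_surj[OF sc(1)[OF x]] .
     have "u V v x = t x" using stv_sec[OF u V(1-3)] V(4) sc(2)[OF x] by simp
     from Bx.germ_eqD[OF oB[OF V(1)] V(2) ud(1)[OF V(1,3)] oB[OF W] x t this]
     obtain W' where W': "openin (rtop (src f')) W'" "x \<in> W'" "W' \<subseteq> V" "W' \<subseteq> W" "restrict (u V v) W' = restrict t W'" .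
     have oW': "A.X.opn W'" using W' src_eq by simp
     show "\<exists>W' t'. A.X.opn W' \<and> x \<in> W' \<and> W' \<subseteq> W \<and> t' \<in> Sec A.PB W' \<and> (\<forall>y\<in>W'. s y = t' y)"
     proof (intro exI conjI ballI)
      show "A.X.opn W'" "x \<in> W'" "W' \<subseteq> W" by fact+
      show "restrict v W' \<in> Sec A.PB W'" by (rule A.sec_res[OF V(3) oW' W'(3)])
      fix y assume y: "y \<in> W'"
      have yV: "y \<in> V" "y \<in> W" using y W' by auto
      have "u V v y = t y" using fun_cong[OF W'(5), of y] y by simp
      then have "s y = v y"
       using inj[OF A.pt_in_open[OF oW' y] sc(1)[OF yV(2)] A.sec_val[OF V(3) yV(1)]]
        stv_sec[OF u V(1) yV(1) V(3)] sc(2)[OF yV(2)] by simp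
      then show "s y = restrict v W' y" using y by simp
     qed
    qed
    have "t = u W s"
    proof (rule B.sec_eqI[OF t ud(1)[OF W s]])
     fix y assume y: "y \<in> W"
     show "t y = u W s y" using stv_sec[OF u W y s] sc(2)[OF y] by simp
    qed
    then show "t \<in> u W ` Sec A.PB W" using s by blast
   qed
  qed
 qed
qed

end

section \<open>Composition of morphisms\<close>

lemma comp_simps [simp]: "src (f oo g) = src g" "tgt (f oo g) = tgt f"
 by (simp_all add: mor_comp_def)

lemma pt_comp: "x \<in> Pts (src g) \<Longrightarrow> pt (f oo g) x = pt f (pt g x)"
 by (simp add: mor_comp_def)

lemma comor_comp: "openin (rtop (tgt f)) V \<Longrightarrow> s \<in> Rsec (tgt f) V \<Longrightarrow>
  comor (f oo g) V s = comor g (preim f V) (comor f V s)"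
 by (simp add: mor_comp_def)

lemma rsmI: "f \<in> mor X Y \<Longrightarrow> rsm f" "f \<in> mor X Y \<Longrightarrow> src f = X" "f \<in> mor X Y \<Longrightarrow> tgt f = Y"
 by (simp_all add: mor_def rsm_def)

locale rsm_comp = F: rsm f + G: rsm g
 for f :: "('y, 's, 'z, 't) rs_mor" and g :: "('x, 'r, 'y, 's) rs_mor" +
 assumes tg: "tgt g = src f"
begin

lemma preim_comp: "preim (f oo g) V = preim g (preim f V)"
 using G.pt_in tg by (auto simp: preim_def pt_comp)

lemma rsm_comp: "rsm (f oo g)"
 unfolding rsm_def rs_morphism_def
proof (intro conjI allI impI ballI)
 show "ringed_space (src (f oo g))" "ringed_space (tgt (f oo g))"
  using F.Y.ringed G.X.ringed by simp_all
 show "continuous_map (rtop (src (f oo g))) (rtop (tgt (f oo g))) (pt (f oo g))"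
 proof -
  have "continuous_map (rtop (src g)) (rtop (tgt f)) (pt f \<circ> pt g)"
   using F.mor G.mor tg by (auto simp: rs_morphism_def intro: continuous_map_compose)
  then show ?thesis
   unfolding comp_simps by (rule continuous_map_eq) (simp_all add: pt_comp)
 qed
 show "pt (f oo g) \<in> extensional (Pts (src (f oo g)))"
  by (simp add: mor_comp_def)
 fix V
 show "\<not> openin (rtop (tgt (f oo g))) V \<Longrightarrow> comor (f oo g) V = (\<lambda>_. undefined)"
  by (simp add: mor_comp_def)
 assume V: "openin (rtop (tgt (f oo g))) V"
 then have V': "F.Y.opn V" "G.Y.opn (preim f V)" using F.preim_open tg by simp_all
 show "comor (f oo g) V \<in> extensional (Rsec (tgt (f oo g)) V)"
  using V by (simp add: mor_comp_def)
 have h: "comor f V \<in> ring_hom (rsec (tgt f) V) (rsec (tgt g) (preim f V))"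
  "comor g (preim f V) \<in> ring_hom (rsec (tgt g) (preim f V)) (rsec (src g) (preim g (preim f V)))"
  using F.comor_hom[OF V'(1)] G.comor_hom[OF V'(2)] tg by simp_all
 interpret S: ring "rsec (tgt f) V" by (rule F.Y.ring_sec[OF V'(1)])
 have c: "\<And>s. s \<in> Rsec (tgt f) V \<Longrightarrow> comor f V s \<in> Rsec (tgt g) (preim f V)"
  using ring_hom_closed[OF h(1)] .
 show "comor (f oo g) V \<in> ring_hom (rsec (tgt (f oo g)) V) (rsec (src (f oo g)) (preim (f oo g) V))"
  unfolding comp_simps preim_comp
  by (rule ring_hom_memI)
   (simp_all add: comor_comp[OF V'(1)] c ring_hom_closed[OF h(2)] ring_hom_add[OF h(1)] ring_hom_add[OF h(2)]
    ring_hom_mult[OF h(1)] ring_hom_mult[OF h(2)] ring_hom_one[OF h(1)] ring_hom_one[OF h(2)])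
next
 fix V W s
 assume VW: "openin (rtop (tgt (f oo g))) V \<and> openin (rtop (tgt (f oo g))) W \<and> W \<subseteq> V"
  and s: "s \<in> Rsec (tgt (f oo g)) V"
 then have o: "F.Y.opn V" "F.Y.opn W" "W \<subseteq> V" and s: "s \<in> Rsec (tgt f) V" by simp_all
 have o': "G.Y.opn (preim f V)" "G.Y.opn (preim f W)" "preim f W \<subseteq> preim f V"
  using F.preim_open[OF o(1)] F.preim_open[OF o(2)] F.preim_mono[OF o(3)] tg by simp_all
 have c: "comor f V s \<in> Rsec (tgt g) (preim f V)" using F.comor_closed[OF o(1) s] tg by simp
 show "comor (f oo g) W (rres (tgt (f oo g)) V W s) =
  rres (src (f oo g)) (preim (f oo g) V) (preim (f oo g) W) (comor (f oo g) V s)"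
  unfolding preim_comp comp_simps comor_comp[OF o(1) s] comor_comp[OF o(2) F.Y.r.res_closed[OF o s]]
  unfolding F.comor_res[OF o s] tg[symmetric]
  by (rule G.comor_res[OF o' c])
qed

lemma stalk_comor_comp:
 assumes x: "x \<in> Pts (src g)" and a: "a \<in> carrier (stalk_ring (tgt f) (pt f (pt g x)))"
 shows "stalk_comor (f oo g) x a = stalk_comor g x (stalk_comor f (pt g x) a)"
proof -
 have y: "pt g x \<in> Pts (src f)" using G.pt_in[OF x] tg by simp
 interpret Fy: rsm_pt f "pt g x" by unfold_locales (rule y)
 interpret Gx: rsm_pt g x by unfold_locales (rule x)
 interpret H: rsm "f oo g" by (rule rsm_comp)
 interpret Hx: rsm_pt "f oo g" x by unfold_locales (simp add: x)
 obtain U s where U: "F.Y.opn U \<and> pt f (pt g x) \<in> U" "s \<in> Rsec (tgt f) U" "a = rgerm (tgt f) (pt f (pt g x)) U s"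
  using Fy.Y.carrierE[OF a] .
 have 1: "stalk_comor f (pt g x) a = rgerm (tgt g) (pt g x) (preim f U) (comor f U s)"
  unfolding U(3) tg using U by (intro Fy.stalk_comor_rgerm) auto
 have 2: "stalk_comor g x (rgerm (tgt g) (pt g x) (preim f U) (comor f U s)) = rgerm (src g) x (preim g (preim f U)) (comor g (preim f U) (comor f U s))"
  using U F.preim_open[of U] y tg F.comor_closed[of U s] by (intro Gx.stalk_comor_rgerm) (simp_all add: F.preim_iff)
 have 3: "stalk_comor (f oo g) x a = rgerm (src g) x (preim (f oo g) U) (comor (f oo g) U s)"
  using Hx.stalk_comor_rgerm[of U s] U(1,2) by (simp add: pt_comp[OF x] U(3) del: set_eq_iff)
 show ?thesis unfolding 1 2 3 preim_comp using U by (simp add: comor_comp)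
qed

end

lemma comp_in_mor: "f \<in> mor Y Z \<Longrightarrow> g \<in> mor X Y \<Longrightarrow> f oo g \<in> mor X Z"
 using rsm_comp.rsm_comp[of f g] by (simp add: mor_def rsm_comp_def rsm_comp_axioms_def rsm_def)

text \<open>An equality of records, so the components are also compared outside their domains, where
  composites are \<open>undefined\<close>. The simplicial identities are used in the same literal
  form, which lets them rewrite inside objects such as
  \<open>pullback (f \<circ> g) A\<close>.\<close>

lemma comp_assoc:
 assumes "rsm f" "rsm g" "rsm h" "tgt h = src g" "tgt g = src f"
 shows "f oo g oo h = f oo (g oo h)"
proof (rule rs_mor.equality)
 interpret f: rsm f by fact
 interpret g: rsm g by fact
 interpret h: rsm h by fact
 interpret fg: rsm_comp f g by unfold_locales fact
 interpret gh: rsm_comp g h by unfold_locales fact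
 interpret ghm: rsm "g oo h" by (rule gh.rsm_comp)
 show "src (f oo g oo h) = src (f oo (g oo h))" "tgt (f oo g oo h) = tgt (f oo (g oo h))" by simp_all
 show "pt (f oo g oo h) = pt (f oo (g oo h))"
 proof -
  have "pt (f oo g oo h) x = pt (f oo (g oo h)) x" if "x \<in> Pts (src h)" for x
   using h.pt_in[OF that] that assms by (simp add: pt_comp)
  moreover have "pt (f oo g oo h) x = pt (f oo (g oo h)) x" if "x \<notin> Pts (src h)" for x
   using that by (simp add: mor_comp_def)
  ultimately show ?thesis by blast
 qed
 show "comor (f oo g oo h) = comor (f oo (g oo h))"
 proof (intro ext)
  fix V s
  show "comor (f oo g oo h) V s = comor (f oo (g oo h)) V s"
  proof (cases "openin (rtop (tgt f)) V \<and> s \<in> Rsec (tgt f) V")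
   case True
   then have "openin (rtop (tgt g)) (preim f V)" "comor f V s \<in> Rsec (tgt g) (preim f V)"
    using f.preim_open f.comor_closed assms(5) by simp_all
   then show ?thesis using True by (simp add: comor_comp fg.preim_comp)
  next
   case False
   then show ?thesis by (auto simp: mor_comp_def)
  qed
 qed
qed simp

lemma id_mor_simps [simp]: "src (id_mor X) = X" "tgt (id_mor X) = X"
 by (simp_all add: id_mor_def)

lemma preim_id: "V \<subseteq> Pts X \<Longrightarrow> preim (id_mor X) V = V"
 by (auto simp: preim_def id_mor_def)

lemma comor_id: "openin (rtop X) V \<Longrightarrow> s \<in> Rsec X V \<Longrightarrow> comor (id_mor X) V s = s"
 by (simp add: id_mor_def)

lemma id_in_mor: "ringed_space X \<Longrightarrow> id_mor X \<in> mor X X"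
proof -
 assume X: "ringed_space X"
 interpret rsp X by unfold_locales (rule X)
 have p: "preim (id_mor X) V = V" if "opn V" for V by (rule preim_id[OF opn_top_sub[OF that]])
 have "rs_morphism (id_mor X)"
  unfolding rs_morphism_def
 proof (intro conjI allI impI ballI)
  show "continuous_map (rtop (src (id_mor X))) (rtop (tgt (id_mor X))) (pt (id_mor X))"
   unfolding id_mor_simps by (rule continuous_map_eq[OF continuous_map_id]) (simp_all add: id_mor_def)
  fix V
  assume V: "openin (rtop (tgt (id_mor X))) V"
  then have V: "opn V" by simp
  interpret S: ring "rsec X V" by (rule ring_sec[OF V])
  show "comor (id_mor X) V \<in> ring_hom (rsec (tgt (id_mor X)) V) (rsec (src (id_mor X)) (preim (id_mor X) V))"
   unfolding p[OF V] id_mor_simps by (rule ring_hom_memI) (simp_all add: comor_id V)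
 next
  fix V W s assume "openin (rtop (tgt (id_mor X))) V \<and> openin (rtop (tgt (id_mor X))) W \<and> W \<subseteq> V"
   "s \<in> Rsec (tgt (id_mor X)) V"
  then show "comor (id_mor X) W (rres (tgt (id_mor X)) V W s) =
    rres (src (id_mor X)) (preim (id_mor X) V) (preim (id_mor X) W) (comor (id_mor X) V s)"
   by (simp add: p comor_id r.res_closed)
 qed (simp_all add: X id_mor_def)
 then show ?thesis by (simp add: mor_def)
qed

text \<open>The extensionality conditions in \<open>rs_morphism\<close> make this an equality:
  outside the domains both sides are \<open>undefined\<close>.\<close>

lemma comp_id:
 assumes "rsm f" shows "f oo id_mor (src f) = f"
proof (rule rs_mor.equality)
 interpret rsm f by fact
 have e: "pt f \<in> extensional (Pts (src f))"
  "\<And>V. Y.opn V \<Longrightarrow> comor f V \<in> extensional (Rsec Y V)" "\<And>V. \<not> Y.opn V \<Longrightarrow> comor f V = (\<lambda>_. undefined)"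
  using mor by (auto simp: rs_morphism_def)
 show "pt (f oo id_mor (src f)) = pt f"
  using e(1) by (auto simp: mor_comp_def id_mor_def fun_eq_iff extensional_def restrict_def)
 show "comor (f oo id_mor (src f)) = comor f"
 proof (intro ext)
  fix V s
  show "comor (f oo id_mor X) V s = comor f V s"
  proof (cases "Y.opn V \<and> s \<in> Rsec Y V")
   case True then show ?thesis by (simp add: comor_comp comor_id preim_open comor_closed)
  next
   case False
   then show ?thesis using e(2)[of V] e(3)[of V] by (auto simp: mor_comp_def extensional_def)
  qed
 qed
qed (simp_all)

lemma id_comp:
 assumes "rsm f" shows "id_mor (tgt f) oo f = f"
proof (rule rs_mor.equality)
 interpret rsm f by fact
 have e: "pt f \<in> extensional (Pts (src f))"
  "\<And>V. Y.opn V \<Longrightarrow> comor f V \<in> extensional (Rsec Y V)" "\<And>V. \<not> Y.opn V \<Longrightarrow> comor f V = (\<lambda>_. undefined)"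
  using mor by (auto simp: rs_morphism_def)
 show "pt (id_mor Y oo f) = pt f"
 proof
  fix x show "pt (id_mor Y oo f) x = pt f x"
   using e(1) pt_in[of x] by (cases "x \<in> Pts (src f)") (auto simp: mor_comp_def id_mor_def extensional_def)
 qed
 show "comor (id_mor Y oo f) = comor f"
 proof (intro ext)
  fix V s
  show "comor (id_mor Y oo f) V s = comor f V s"
  proof (cases "Y.opn V \<and> s \<in> Rsec Y V")
   case True then show ?thesis by (simp add: comor_comp comor_id preim_id[OF Y.opn_top_sub])
  next
   case False
   then show ?thesis using e(2)[of V] e(3)[of V] by (auto simp: mor_comp_def extensional_def)
  qed
 qed
qed (simp_all)

section \<open>Base change along a composition\<close>

text \<open>Extension of scalars is left adjoint to restriction, so a map \<gamma> that is
  semilinear along the comorphism on stalks extends to a linear map. The function under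
  \<open>tensor_lift\<close> is prescribed on the carriers only; thus the different formulas in
  \<open>pullback_map\<close> and \<open>can_comp\<close> can all be inserted.\<close>

lemma (in pb_pt) pt_lift_lin:
 assumes N: "left_module X.St N"
  and \<gamma>: "\<And>m. m \<in> carrier M.SM \<Longrightarrow> \<gamma> m \<in> carrier N"
   "\<And>m m'. m \<in> carrier M.SM \<Longrightarrow> m' \<in> carrier M.SM \<Longrightarrow> \<gamma> (m \<oplus>\<^bsub>M.SM\<^esub> m') = \<gamma> m \<oplus>\<^bsub>N\<^esub> \<gamma> m'"
   "\<And>s m. s \<in> carrier Y.St \<Longrightarrow> m \<in> carrier M.SM \<Longrightarrow> \<gamma> (s \<odot>\<^bsub>M.SM\<^esub> m) = stalk_comor f x s \<odot>\<^bsub>N\<^esub> \<gamma> m"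
  and \<beta>: "\<And>r m. r \<in> carrier X.St \<Longrightarrow> m \<in> carrier M.SM \<Longrightarrow> \<beta> (r, m) = r \<odot>\<^bsub>N\<^esub> \<gamma> m"
 shows "lin_map X.St P N (tensor_lift N \<beta>)"
  and "\<And>r m. r \<in> carrier X.St \<Longrightarrow> m \<in> carrier M.SM \<Longrightarrow> tensor_lift N \<beta> (r \<otimes>\<otimes> m) = r \<odot>\<^bsub>N\<^esub> \<gamma> m"
proof -
 interpret N: left_module X.St N by (rule N)
 have phi: "stalk_comor f x s \<in> carrier X.St" if "s \<in> carrier Y.St" for s
  using that by (rule E.\<phi>_closed)
 have 1: "add_hom P N (tensor_lift N \<beta>)"
  by (rule pt_lift(1)[OF N.M.abelian_group_axioms])
   (simp_all add: \<beta> \<gamma> N.smult_closed N.smult_l_distr N.smult_r_distr N.smult_assoc phi M.SM.smult_closed)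
 show 2: "tensor_lift N \<beta> (r \<otimes>\<otimes> m) = r \<odot>\<^bsub>N\<^esub> \<gamma> m" if "r \<in> carrier X.St" "m \<in> carrier M.SM" for r m
  unfolding \<beta>[OF that, symmetric]
  by (rule pt_lift(2)[OF N.M.abelian_group_axioms])
   (simp_all add: \<beta> \<gamma> N.smult_closed N.smult_l_distr N.smult_r_distr N.smult_assoc phi M.SM.smult_closed that)
 interpret h: add_group_hom P N "tensor_lift N \<beta>"
  by (intro add_group_hom.intro add_group_hom_axioms.intro 1 N.M.abelian_group_axioms) unfold_locales
 have "tensor_lift N \<beta> (r \<odot>\<^bsub>P\<^esub> e) = r \<odot>\<^bsub>N\<^esub> tensor_lift N \<beta> e" if r: "r \<in> carrier X.St" and e: "e \<in> carrier P" for r e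
  using e
 proof (induction rule: pt_induct)
  case zero then show ?case using r by simp
 next
  case (tens r' m) then show ?case using r by (simp add: pt_smult 2 N.smult_assoc \<gamma>)
 next
  case (add a b) then show ?case using r by (simp add: P.smult_r_distr P.smult_closed N.smult_r_distr)
 qed
 then show "lin_map X.St P N (tensor_lift N \<beta>)" using 1 by (simp add: lin_map_def)
qed

context pb_pt
begin

lemma germ_eval_Lg: "e \<in> carrier P \<Longrightarrow> germ_eval x (Lg e) = e"
 using pt_surj[of e] Lg_sec germ_eval_mgerm by metis

lemma SM_rep:
 assumes "c \<in> carrier PBx.SM"
 obtains e where "e \<in> carrier P" "c = Lg e"
proof -
 obtain W s where W: "X.nb W" "s \<in> Sec PB W" "c = mgerm X PB x W s"
  using PBx.mcarrierE[OF assms] .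
 have "c = Lg (s x)" unfolding W(3) by (rule Lg_sec[symmetric]) (use W(1,2) in simp_all)
 moreover have "s x \<in> carrier P" using W(1,2) by (simp add: sec_val)
 ultimately show ?thesis using that by metis
qed

lemma germ_eval_lin: "lin_map X.St PBx.SM P (germ_eval x)"
 unfolding lin_map_def add_hom_def
proof (intro conjI funcsetI ballI)
 fix c assume c: "c \<in> carrier PBx.SM"
 obtain e where e: "e \<in> carrier P" "c = Lg e" using SM_rep[OF c] .
 show "germ_eval x c \<in> carrier P" using e by (simp add: germ_eval_Lg)
 fix c' assume c': "c' \<in> carrier PBx.SM"
 obtain e' where e': "e' \<in> carrier P" "c' = Lg e'" using SM_rep[OF c'] .
 show "germ_eval x (c \<oplus>\<^bsub>PBx.SM\<^esub> c') = germ_eval x c \<oplus>\<^bsub>P\<^esub> germ_eval x c'"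
  using e(1) e'(1) by (simp add: e(2) e'(2) germ_eval_Lg Lg.add[symmetric] del: Lg.add)
next
 fix r c assume r: "r \<in> carrier X.St" and c: "c \<in> carrier PBx.SM"
 obtain e where e: "e \<in> carrier P" "c = Lg e" using SM_rep[OF c] .
 show "germ_eval x (r \<odot>\<^bsub>PBx.SM\<^esub> c) = r \<odot>\<^bsub>P\<^esub> germ_eval x c"
  using e(1) r by (simp add: e(2) germ_eval_Lg Lg_smult[symmetric] P.smult_closed)
qed

end

text \<open>\<open>kap f g M x\<close> is \<open>e \<mapsto> 1 \<otimes> e\<close> from the stalk of \<open>f\<^sup>*M\<close> at \<open>g(x)\<close> to that of \<open>(f \<circ> g)\<^sup>*M\<close> at \<open>x\<close>.\<close>

definition kap where
 "kap f g M x = tensor_lift (pb_stalk (f oo g) M x) (\<lambda>(r', m). pb_tens (f oo g) M x (stalk_comor g x r') m)"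

definition canx where
 "canx f g M x = tensor_lift (pb_stalk (f oo g) M x)
     (\<lambda>(r, c). r \<odot>\<^bsub>pb_stalk (f oo g) M x\<^esub> kap f g M x (germ_eval (pt g x) c))"

lemma can_comp_eq: "can_comp f g M = on_sections (src g) (pullback g (pullback f M)) (\<lambda>W s. \<lambda>x\<in>W. canx f g M x (s x))"
 by (simp only: can_comp_def canx_def kap_def)

section \<open>Fibres of the canonical isomorphism\<close>

locale pb_comp = rsm_comp f g + F: pb_pre f M
 for f :: "('y, 's, 'z, 't) rs_mor" and M :: "('z, 't, 'm) msheaf" and g :: "('x, 'r, 'y, 's) rs_mor"
begin

lemma pb_pre_H: "pb_pre (f oo g) M"
 by (intro pb_pre.intro rsm_comp) (simp add: F.M.mpre_axioms)

lemma pb_pre_G: "pb_pre g (pullback f M)"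
 using F.mpre_PB by (intro pb_pre.intro G.rsm_axioms) (simp add: tg)

sublocale H: pb_pre "f oo g" M by (rule pb_pre_H)
sublocale GP: pb_pre g "pullback f M" by (rule pb_pre_G)

end

locale pb_comp_pt = pb_comp + fixes x assumes x_in: "x \<in> Pts (src g)"
begin

lemma y_in: "pt g x \<in> Pts (src f)"
 using G.pt_in[OF x_in] tg by simp

lemmas cs = comp_simps pt_comp[OF x_in] tg

sublocale Fy: pb_pt f M "pt g x" by (rule F.pt_locale[OF y_in])
sublocale Hx: pb_pt "f oo g" M x by (rule H.pt_locale) (simp add: x_in)
sublocale Gx: pb_pt g "pullback f M" x by (rule GP.pt_locale[OF x_in])

abbreviation "Rx \<equiv> stalk_ring (src g) x"
abbreviation "Ry \<equiv> stalk_ring (src f) (pt g x)"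
abbreviation "Mz \<equiv> stalk_mod (tgt f) M (pt f (pt g x))"
abbreviation "PF \<equiv> pb_stalk f M (pt g x)"
abbreviation "PH \<equiv> pb_stalk (f oo g) M x"
abbreviation "PG \<equiv> pb_stalk g (pullback f M) x"
abbreviation "GM \<equiv> stalk_mod (src f) (pullback f M) (pt g x)"
abbreviation "\<kappa> \<equiv> kap f g M x"

lemma gc: "stalk_comor g x \<in> ring_hom Ry Rx"
 using Gx.stalk_comor_hom by (simp add: tg)

lemma gc_closed [simp]: "a \<in> carrier Ry \<Longrightarrow> stalk_comor g x a \<in> carrier Rx"
 using ring_hom_closed[OF gc] .

lemma gc_one [simp]: "stalk_comor g x \<one>\<^bsub>Ry\<^esub> = \<one>\<^bsub>Rx\<^esub>"
 using ring_hom_one[OF gc] .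

lemmas h_closed = Hx.pt_closed[unfolded cs]
lemmas h_add_left = Hx.pt_add_left[unfolded cs]
lemmas h_add_right = Hx.pt_add_right[unfolded cs]
lemmas h_balanced = Hx.pt_balanced[unfolded cs]
lemmas h_smult = Hx.pt_smult[unfolded cs]
lemmas h_lin_ext = Hx.pt_lin_ext[unfolded cs]
lemmas h_lift_lin = Hx.pt_lift_lin[unfolded cs]
lemmas h_left_module = Hx.P_left_module[unfolded cs]
lemmas g_lift_lin = Gx.pt_lift_lin[unfolded cs]
lemmas g_lin_ext = Gx.pt_lin_ext[unfolded cs]
lemmas g_closed = Gx.pt_closed[unfolded cs]
lemmas g_smult = Gx.pt_smult[unfolded cs]
lemmas g_left_module = Gx.P_left_module
lemmas g_balanced = Gx.pt_balanced[unfolded cs]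
lemmas g_add_right = Gx.pt_add_right[unfolded cs]

lemma kap_hom: "add_hom PF PH \<kappa>"
 and kap_tens: "\<And>r m. r \<in> carrier Ry \<Longrightarrow> m \<in> carrier Mz \<Longrightarrow> \<kappa> (pb_tens f M (pt g x) r m) = pb_tens (f oo g) M x (stalk_comor g x r) m"
proof -
 have ab: "abelian_group PH" by unfold_locales
 have bal: "pb_tens (f oo g) M x (stalk_comor g x (r \<otimes>\<^bsub>Ry\<^esub> stalk_comor f (pt g x) s)) m =
   pb_tens (f oo g) M x (stalk_comor g x r) (s \<odot>\<^bsub>Mz\<^esub> m)"
  if "r \<in> carrier Ry" "s \<in> carrier (stalk_ring (tgt f) (pt f (pt g x)))" "m \<in> carrier Mz" for r s m
  using that h_balanced[of "stalk_comor g x r" s m]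
  by (simp add: ring_hom_mult[OF gc] stalk_comor_comp[OF x_in])
 show "add_hom PF PH \<kappa>"
  unfolding kap_def
  by (rule Fy.pt_lift(1)[OF ab]) (simp_all add: h_closed h_add_left h_add_right ring_hom_add[OF gc] bal)
 show "\<kappa> (pb_tens f M (pt g x) r m) = pb_tens (f oo g) M x (stalk_comor g x r) m"
  if "r \<in> carrier Ry" "m \<in> carrier Mz" for r m
  unfolding kap_def
  by (subst Fy.pt_lift(2)[OF ab]) (simp_all add: that h_closed h_add_left h_add_right ring_hom_add[OF gc] bal)
qed

sublocale kap: add_group_hom PF PH \<kappa>
 by (intro add_group_hom.intro add_group_hom_axioms.intro kap_hom) unfold_locales

lemma kap_smult:
 assumes "r \<in> carrier Ry" "e \<in> carrier PF"
 shows "\<kappa> (r \<odot>\<^bsub>PF\<^esub> e) = stalk_comor g x r \<odot>\<^bsub>PH\<^esub> \<kappa> e"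
proof -
 interpret PH: left_module Rx PH by (rule h_left_module)
 show ?thesis
  using assms(2)
 proof (induction rule: Fy.pt_induct)
  case zero then show ?case using assms(1) by simp
 next
  case (tens r' m) then show ?case
   using assms(1) by (simp add: Fy.pt_smult kap_tens h_smult ring_hom_mult[OF gc])
 next
  case (add a b) then show ?case
   using assms(1) by (simp add: Fy.P.smult_r_distr Fy.P.smult_closed PH.smult_r_distr)
 qed
qed

text \<open>The image of \<kappa> contains every \<open>1 \<otimes> m\<close>, and these generate
  the fibre of \<open>(f \<circ> g)\<^sup>*M\<close> over the stalk of the ring. Testing on
  \<open>\<kappa> e\<close> is what later replaces the inversion of canonical isomorphisms.\<close>

lemma kap_ext:
 assumes "lin_map Rx PH N u" "lin_map Rx PH N v" "left_module Rx N"
  and "\<And>e. e \<in> carrier PF \<Longrightarrow> u (\<kappa> e) = v (\<kappa> e)" and "e \<in> carrier PH"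
 shows "u e = v e"
proof (rule h_lin_ext[OF assms(1-3) _ assms(5)])
 fix m assume m: "m \<in> carrier Mz"
 have "pb_tens (f oo g) M x \<one>\<^bsub>Rx\<^esub> m = \<kappa> (pb_tens f M (pt g x) \<one>\<^bsub>Ry\<^esub> m)"
  using m by (simp add: kap_tens)
 then show "u (pb_tens (f oo g) M x \<one>\<^bsub>Rx\<^esub> m) = v (pb_tens (f oo g) M x \<one>\<^bsub>Rx\<^esub> m)"
  using assms(4)[of "pb_tens f M (pt g x) \<one>\<^bsub>Ry\<^esub> m"] m by simp
qed

lemma ge: "c \<in> carrier GM \<Longrightarrow> germ_eval (pt g x) c \<in> carrier PF"
 using Fy.germ_eval_lin by (auto simp: lin_map_def add_hom_def)

lemma canx_lin: "lin_map Rx PG PH (canx f g M x)"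
 and canx_tens: "\<And>r c. r \<in> carrier Rx \<Longrightarrow> c \<in> carrier GM \<Longrightarrow>
  canx f g M x (pb_tens g (pullback f M) x r c) = r \<odot>\<^bsub>PH\<^esub> \<kappa> (germ_eval (pt g x) c)"
proof -
 have gel: "\<And>c c'. c \<in> carrier GM \<Longrightarrow> c' \<in> carrier GM \<Longrightarrow> germ_eval (pt g x) (c \<oplus>\<^bsub>GM\<^esub> c') = germ_eval (pt g x) c \<oplus>\<^bsub>PF\<^esub> germ_eval (pt g x) c'"
  "\<And>r c. r \<in> carrier Ry \<Longrightarrow> c \<in> carrier GM \<Longrightarrow> germ_eval (pt g x) (r \<odot>\<^bsub>GM\<^esub> c) = r \<odot>\<^bsub>PF\<^esub> germ_eval (pt g x) c"
  using Fy.germ_eval_lin by (simp_all add: lin_map_def add_hom_def)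
 show "lin_map Rx PG PH (canx f g M x)"
  unfolding canx_def
  by (rule g_lift_lin(1)[OF h_left_module, where \<gamma> = "\<lambda>c. \<kappa> (germ_eval (pt g x) c)"]) (simp_all add: ge gel kap_smult)
 show "canx f g M x (pb_tens g (pullback f M) x r c) = r \<odot>\<^bsub>PH\<^esub> \<kappa> (germ_eval (pt g x) c)"
  if "r \<in> carrier Rx" "c \<in> carrier GM" for r c
  unfolding canx_def
  by (rule g_lift_lin(2)[OF h_left_module, where \<gamma> = "\<lambda>c. \<kappa> (germ_eval (pt g x) c)"]) (simp_all add: ge gel kap_smult that)
qed

lemma canx_Lg:
 assumes "e \<in> carrier PF"
 shows "canx f g M x (pb_tens g (pullback f M) x \<one>\<^bsub>Rx\<^esub> (Fy.Lg e)) = \<kappa> e"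
proof -
 interpret PH: left_module Rx PH by (rule h_left_module)
 show ?thesis using assms Fy.Lg.closed[OF assms] by (simp add: canx_tens Fy.germ_eval_Lg PH.smult_one)
qed

text \<open>The inverse \<open>J\<close> is
  \<open>r \<otimes> m \<mapsto> r \<otimes> (1 \<otimes> m)\<close>, where \<open>ug\<close>
  supplies the inner \<open>1 \<otimes> m\<close> as a germ. Both composites are linear; one is
  tested on \<open>\<kappa> e\<close> and the other on \<open>1 \<otimes> c\<close>, where every
  germ \<open>c\<close> is \<open>Lg e\<close> for some \<open>e\<close>.\<close>

lemma canx_bij: "bij_betw (canx f g M x) (carrier PG) (carrier PH)"
proof -
 interpret PH: left_module Rx PH by (rule h_left_module)
 interpret PG: left_module Rx PG by (rule g_left_module)
 have cl: "canx f g M x e \<in> carrier PH" if "e \<in> carrier PG" for e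
  using canx_lin that by (auto simp: lin_map_def add_hom_def)
 have gm: "pb_tens g (pullback f M) x r (Fy.ug m) = r \<odot>\<^bsub>PG\<^esub> pb_tens g (pullback f M) x \<one>\<^bsub>Rx\<^esub> (Fy.ug m)"
  if "r \<in> carrier Rx" "m \<in> carrier Mz" for r m
  using that Fy.ug_closed by (simp add: g_smult)
 have bal: "pb_tens g (pullback f M) x \<one>\<^bsub>Rx\<^esub> (stalk_comor f (pt g x) s \<odot>\<^bsub>GM\<^esub> c) =
   stalk_comor (f oo g) x s \<odot>\<^bsub>PG\<^esub> pb_tens g (pullback f M) x \<one>\<^bsub>Rx\<^esub> c"
  if "s \<in> carrier (stalk_ring (tgt f) (pt f (pt g x)))" "c \<in> carrier GM" for s c
  using that by (simp add: g_balanced[symmetric] g_smult stalk_comor_comp[OF x_in])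
 define J where "J = tensor_lift PG (\<lambda>(r, m). pb_tens g (pullback f M) x r (Fy.ug m))"
 have J_lin: "lin_map Rx PH PG J" and J_tens: "\<And>r m. r \<in> carrier Rx \<Longrightarrow> m \<in> carrier Mz \<Longrightarrow>
   J (pb_tens (f oo g) M x r m) = r \<odot>\<^bsub>PG\<^esub> pb_tens g (pullback f M) x \<one>\<^bsub>Rx\<^esub> (Fy.ug m)"
  unfolding J_def
  by (rule h_lift_lin[OF g_left_module, where \<gamma> = "\<lambda>m. pb_tens g (pullback f M) x \<one>\<^bsub>Rx\<^esub> (Fy.ug m)"];
    simp add: gm[symmetric] Fy.ug_closed g_closed Fy.ug_add g_add_right Fy.ug_smult bal)+
 have J_cl: "J e \<in> carrier PG" if "e \<in> carrier PH" for e
  using J_lin that by (auto simp: lin_map_def add_hom_def)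
 have J_add: "J (a \<oplus>\<^bsub>PH\<^esub> b) = J a \<oplus>\<^bsub>PG\<^esub> J b" if "a \<in> carrier PH" "b \<in> carrier PH" for a b
  using J_lin that by (auto simp: lin_map_def add_hom_def)
 have J_smult: "J (r \<odot>\<^bsub>PH\<^esub> e) = r \<odot>\<^bsub>PG\<^esub> J e" if "r \<in> carrier Rx" "e \<in> carrier PH" for r e
  using J_lin that by (auto simp: lin_map_def)
 have idlin: "lin_map Rx N N (\<lambda>e. e)" for N by (simp add: lin_map_def add_hom_def)
 have complin: "lin_map Rx A C (\<lambda>e. v (u e))" if "lin_map Rx A B u" "lin_map Rx B C v" for A B C u v
  using that by (auto simp: lin_map_def add_hom_def Pi_iff)
 interpret Jh: add_group_hom PH PG J
  by (intro add_group_hom.intro add_group_hom_axioms.intro) (unfold_locales, use J_lin in \<open>simp add: lin_map_def\<close>)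
 have J\<kappa>: "J (\<kappa> e) = pb_tens g (pullback f M) x \<one>\<^bsub>Rx\<^esub> (Fy.Lg e)" if "e \<in> carrier PF" for e
  using that
 proof (induction rule: Fy.pt_induct)
  case zero
  have "pb_tens g (pullback f M) x \<one>\<^bsub>Rx\<^esub> \<zero>\<^bsub>GM\<^esub> = \<zero>\<^bsub>PG\<^esub>"
   using g_add_right[of "\<one>\<^bsub>Rx\<^esub>" "\<zero>\<^bsub>GM\<^esub>" "\<zero>\<^bsub>GM\<^esub>"] g_closed[of "\<one>\<^bsub>Rx\<^esub>" "\<zero>\<^bsub>GM\<^esub>"] Gx.P.M.add.l_cancel_one' by fastforce
  then show ?case by simp
 next
  case (tens r m)
  have c: "Fy.ug m \<in> carrier GM" using tens by (simp add: Fy.ug_closed)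
  have "J (\<kappa> (pb_tens f M (pt g x) r m)) = stalk_comor g x r \<odot>\<^bsub>PG\<^esub> pb_tens g (pullback f M) x \<one>\<^bsub>Rx\<^esub> (Fy.ug m)"
   using tens by (simp add: kap_tens J_tens)
  also have "\<dots> = pb_tens g (pullback f M) x \<one>\<^bsub>Rx\<^esub> (r \<odot>\<^bsub>GM\<^esub> Fy.ug m)"
   using tens c by (simp add: g_smult g_balanced[symmetric])
  also have "r \<odot>\<^bsub>GM\<^esub> Fy.ug m = Fy.Lg (pb_tens f M (pt g x) r m)" using tens by (simp add: Fy.Lg_tens)
  finally show ?case .
 next
  case (add a b) then show ?case by (simp add: g_add_right)
 qed
 have 1: "canx f g M x (J e) = e" if "e \<in> carrier PH" for e
 proof (rule kap_ext[OF complin[OF J_lin canx_lin] idlin h_left_module _ that])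
  fix e assume "e \<in> carrier PF"
  then show "canx f g M x (J (\<kappa> e)) = \<kappa> e" by (simp add: J\<kappa> canx_Lg)
 qed
 have 2: "J (canx f g M x e) = e" if "e \<in> carrier PG" for e
 proof (rule g_lin_ext[OF complin[OF canx_lin J_lin] idlin g_left_module _ that])
  fix c assume "c \<in> carrier GM"
  then obtain e where e: "e \<in> carrier PF" "c = Fy.Lg e" using Fy.SM_rep by metis
  show "J (canx f g M x (pb_tens g (pullback f M) x \<one>\<^bsub>Rx\<^esub> c)) = pb_tens g (pullback f M) x \<one>\<^bsub>Rx\<^esub> c"
   unfolding e(2) canx_Lg[OF e(1)] by (rule J\<kappa>[OF e(1)])
 qed
 show ?thesis
  by (rule bij_betwI[where g = J]) (use cl J_cl 1 2 in auto)
qed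

end

context pb_comp
begin

lemma comp_pt_locale: "x \<in> Pts (src g) \<Longrightarrow> pb_comp_pt f M g x"
 by (intro pb_comp_pt.intro pb_comp_pt_axioms.intro pb_comp_axioms)

lemma pb_two_can: "pb_two g (pullback f M) (f oo g) M"
 by (intro pb_two.intro pb_two_axioms.intro pb_pre_G pb_pre_H) simp

text \<open>A local sum of tensors \<open>r i \<otimes> m i\<close> near \<open>g(x)\<close> becomes
  a local sum near \<open>x\<close> with the same \<open>m i\<close>, whose coefficients are the
  images of the \<open>r i\<close> under the comorphism of \<open>g\<close>.\<close>

lemma kap_section:
 assumes V: "F.X.opn V" and s: "s \<in> Sec (pullback f M) V"
 shows "(\<lambda>x\<in>preim g V. kap f g M x (s (pt g x))) \<in> Sec (pullback (f oo g) M) (preim g V)"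
proof (rule H.sec_localI)
 fix x assume x: "x \<in> preim g V"
 have x': "x \<in> Pts (src g)" "pt g x \<in> V" using x by (simp_all add: G.preim_iff)
 obtain W' U n r m where *: "F.X.opn W'" "pt g x \<in> W'" "W' \<subseteq> V" "F.Y.opn U" "W' \<subseteq> preim f U"
  and rm': "\<forall>i<n::nat. r i \<in> Rsec F.X W' \<and> m i \<in> Sec M U"
  and eq: "restrict s W' = (\<Oplus>\<^bsub>msec (pullback f M) W'\<^esub>i\<in>{..<n}. r i \<odot>\<^bsub>msec (pullback f M) W'\<^esub> restrict (F.usec U (m i)) W')"
  using F.sec_repr[OF V s x'(2)] .
 have rm: "\<And>i. i < n \<Longrightarrow> r i \<in> Rsec F.X W'" "\<And>i. i < n \<Longrightarrow> m i \<in> Sec M U"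
  using rm' by blast+
 have u: "restrict (F.usec U (m i)) W' \<in> Sec (pullback f M) W'" if "i < n" for i
  using F.sec_res[OF F.usec_closed[OF *(4) rm(2)[OF that]] *(1,5)] .
 have ru: "(\<lambda>i. r i \<odot>\<^bsub>msec (pullback f M) W'\<^esub> restrict (F.usec U (m i)) W') \<in> {..<n} \<rightarrow> Sec (pullback f M) W'"
  by (intro funcsetI F.PB.sec_closed_M(2) rm u *(1)) simp_all
 let ?W = "preim g W'"
 have oG: "G.Y.opn W'" using *(1) tg by simp
 have oW: "G.X.opn ?W" by (rule G.preim_open[OF oG])
 then have oH: "H.X.opn ?W" by simp
 have W_sub: "?W \<subseteq> preim (f oo g) U" unfolding preim_comp by (rule G.preim_mono[OF *(5)])
 have oU: "H.Y.opn U" using *(4) by simp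
 have rc: "comor g W' (r i) \<in> Rsec H.X ?W" if "i < n" for i
  using G.comor_closed[OF oG, of "r i"] rm(1)[OF that] tg by simp
 have uH: "restrict (H.usec U (m i)) ?W \<in> Sec H.PB ?W" if "i < n" for i
  using H.sec_res[OF H.usec_closed[OF oU rm(2)[OF that]] oH W_sub] .
 have rH: "(\<lambda>i. comor g W' (r i) \<odot>\<^bsub>msec H.PB ?W\<^esub> restrict (H.usec U (m i)) ?W) \<in> {..<n} \<rightarrow> Sec H.PB ?W"
  by (intro funcsetI H.PB.sec_closed_M(2) rc uH oH) simp_all
 define t where "t = (\<Oplus>\<^bsub>msec H.PB ?W\<^esub>i\<in>{..<n}. comor g W' (r i) \<odot>\<^bsub>msec H.PB ?W\<^esub> restrict (H.usec U (m i)) ?W)"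
 interpret lb: left_module "rsec H.X ?W" "msec H.PB ?W" by (rule H.PB.left_module_sec[OF oH])
 have t: "t \<in> Sec H.PB ?W" unfolding t_def by (rule lb.M.finsum_closed[OF rH])
 have val: "(\<lambda>x\<in>preim g V. kap f g M x (s (pt g x))) y = t y" if y: "y \<in> ?W" for y
 proof -
  have yX: "y \<in> Pts (src g)" "pt g y \<in> W'" using y by (simp_all add: G.preim_iff)
  interpret C: pb_comp_pt f M g y by (rule comp_pt_locale[OF yX(1)])
  interpret eF: add_group_hom "msec (pullback f M) W'" "pb_stalk f M (pt g y)" "\<lambda>s. s (pt g y)" by (rule F.eval_hom[OF *(1) yX(2)])
  interpret eH: add_group_hom "msec H.PB ?W" "pb_stalk (f oo g) M y" "\<lambda>s. s y" by (rule H.eval_hom[OF oH y])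
  have fy: "pt g y \<in> preim f U" "y \<in> preim (f oo g) U" "pt f (pt g y) \<in> U" using yX *(5) y W_sub by (auto simp: F.preim_iff)
  have yV: "y \<in> preim g V" using y G.preim_mono[OF *(3)] by blast
  have "(\<lambda>x\<in>preim g V. kap f g M x (s (pt g x))) y = C.\<kappa> (restrict s W' (pt g y))" using yV yX by simp
  also have "restrict s W' (pt g y) = (\<Oplus>\<^bsub>C.PF\<^esub>i\<in>{..<n}. (r i \<odot>\<^bsub>msec (pullback f M) W'\<^esub> restrict (F.usec U (m i)) W') (pt g y))"
   unfolding eq by (rule eF.finsum[OF ru])
  also have "C.\<kappa> \<dots> = (\<Oplus>\<^bsub>C.PH\<^esub>i\<in>{..<n}. C.\<kappa> ((r i \<odot>\<^bsub>msec (pullback f M) W'\<^esub> restrict (F.usec U (m i)) W') (pt g y)))"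
   by (rule C.kap.finsum, rule funcsetI, rule eF.closed, rule funcset_mem[OF ru])
  also have "\<dots> = (\<Oplus>\<^bsub>C.PH\<^esub>i\<in>{..<n}. (comor g W' (r i) \<odot>\<^bsub>msec H.PB ?W\<^esub> restrict (H.usec U (m i)) ?W) y)"
  proof (rule C.Hx.P.M.add.finprod_cong'[OF refl])
   show "(\<lambda>i. (comor g W' (r i) \<odot>\<^bsub>msec H.PB ?W\<^esub> restrict (H.usec U (m i)) ?W) y) \<in> {..<n} \<rightarrow> carrier C.PH"
    by (rule funcsetI, rule eH.closed, rule funcset_mem[OF rH])
   fix i assume "i \<in> {..<n}"
   then have i: "i < n" by simp
   have c: "rgerm (src f) (pt g y) W' (r i) \<in> carrier C.Ry" using rm(1)[OF i] *(1) yX by (intro C.Fy.X.g_in) auto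
   have cm: "mgerm (tgt f) M (pt f (pt g y)) U (m i) \<in> carrier C.Mz" using rm(2)[OF i] *(4) fy by (intro C.Fy.M.mg_in) auto
   have sc: "stalk_comor g y (rgerm (src f) (pt g y) W' (r i)) = rgerm (src g) y ?W (comor g W' (r i))"
    using C.Gx.stalk_comor_rgerm[of W' "r i"] oG yX rm(1)[OF i] by (simp add: tg del: set_eq_iff)
   have "C.\<kappa> ((r i \<odot>\<^bsub>msec (pullback f M) W'\<^esub> restrict (F.usec U (m i)) W') (pt g y)) =
     C.\<kappa> (rgerm (src f) (pt g y) W' (r i) \<odot>\<^bsub>C.PF\<^esub> pb_tens f M (pt g y) \<one>\<^bsub>C.Ry\<^esub> (mgerm (tgt f) M (pt f (pt g y)) U (m i)))"
    using yX fy by (simp add: F.usec_val)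
   also have "\<dots> = rgerm (src g) y ?W (comor g W' (r i)) \<odot>\<^bsub>C.PH\<^esub> pb_tens (f oo g) M y \<one>\<^bsub>C.Rx\<^esub> (mgerm (tgt f) M (pt f (pt g y)) U (m i))"
    using c cm by (simp add: C.kap_smult C.kap_tens sc del: set_eq_iff)
   also have "\<dots> = (comor g W' (r i) \<odot>\<^bsub>msec H.PB ?W\<^esub> restrict (H.usec U (m i)) ?W) y"
    using y fy by (simp add: H.usec_val pt_comp[OF yX(1)] del: set_eq_iff)
   finally show "C.\<kappa> ((r i \<odot>\<^bsub>msec (pullback f M) W'\<^esub> restrict (F.usec U (m i)) W') (pt g y)) =
    (comor g W' (r i) \<odot>\<^bsub>msec H.PB ?W\<^esub> restrict (H.usec U (m i)) ?W) y" .
  qed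
  also have "\<dots> = t y" unfolding t_def by (rule eH.finsum[OF rH, symmetric])
  finally show ?thesis .
 qed
 show "\<exists>W' t'. H.X.opn W' \<and> x \<in> W' \<and> W' \<subseteq> preim g V \<and> t' \<in> Sec H.PB W' \<and>
   (\<forall>y\<in>W'. (\<lambda>x\<in>preim g V. kap f g M x (s (pt g x))) y = t' y)"
 proof (intro exI conjI ballI)
  show "H.X.opn ?W" "?W \<subseteq> preim g V" "t \<in> Sec H.PB ?W" using oH G.preim_mono[OF *(3)] t by simp_all
  show "x \<in> ?W" using x' *(2) by (simp add: G.preim_iff)
 qed (rule val)
qed simp

lemma can_comp:
 shows can_comp_hom: "can_comp f g M \<in> mod_hom (src g) (pullback g (pullback f M)) (pullback (f oo g) M)"
  and stv_can_comp: "\<And>x e. x \<in> Pts (src g) \<Longrightarrow> e \<in> Stk g (pullback f M) x \<Longrightarrow>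
   stv g (pullback f M) (can_comp f g M) x e = canx f g M x e"
  and can_comp_iso: "mod_iso (src g) (pullback g (pullback f M)) (pullback (f oo g) M) (can_comp f g M)"
proof -
 interpret T: pb_two g "pullback f M" "f oo g" M by (rule pb_two_can)
 have lin: "lin_map (stalk_ring (src g) x) (pb_stalk g (pullback f M) x) (pb_stalk (f oo g) M x) (canx f g M x)"
  if "x \<in> Pts (src g)" for x
  using pb_comp_pt.canx_lin[OF comp_pt_locale[OF that]] .
 \<comment> \<open>The germ of \<open>m\<close> at \<open>g(y)\<close> is \<open>Lg\<close> of its
   value, on which \<open>canx\<close> reduces to \<kappa>; so the required sections are those of
   \<open>kap_section\<close>.\<close>
 have unit: "(\<lambda>y\<in>preim g V. canx f g M y (pb_tens g (pullback f M) y \<one>\<^bsub>stalk_ring (src g) y\<^esub> (mgerm (tgt g) (pullback f M) (pt g y) V m)))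
   \<in> Sec (pullback (f oo g) M) (preim g V)"
  if V: "G.Y.opn V" and m: "m \<in> Sec (pullback f M) V" for V m
 proof -
  have V': "F.X.opn V" using V tg by simp
  have "(\<lambda>y\<in>preim g V. canx f g M y (pb_tens g (pullback f M) y \<one>\<^bsub>stalk_ring (src g) y\<^esub> (mgerm (tgt g) (pullback f M) (pt g y) V m))) =
   (\<lambda>x\<in>preim g V. kap f g M x (m (pt g x)))"
  proof (rule restrict_ext)
   fix y assume "y \<in> preim g V"
   then have y: "y \<in> Pts (src g)" "pt g y \<in> V" by (simp_all add: G.preim_iff)
   interpret C: pb_comp_pt f M g y by (rule comp_pt_locale[OF y(1)])
   have "mgerm (tgt g) (pullback f M) (pt g y) V m = C.Fy.Lg (m (pt g y))"
    unfolding tg by (rule C.Fy.Lg_sec[OF V' y(2) m, symmetric])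
   then show "canx f g M y (pb_tens g (pullback f M) y \<one>\<^bsub>stalk_ring (src g) y\<^esub> (mgerm (tgt g) (pullback f M) (pt g y) V m)) = kap f g M y (m (pt g y))"
    using C.canx_Lg[OF F.sec_val[OF m y(2)]] by (simp del: set_eq_iff)
  qed
  then show ?thesis using kap_section[OF V' m] by simp
 qed
 show 1: "can_comp f g M \<in> mod_hom (src g) (pullback g (pullback f M)) (pullback (f oo g) M)"
  unfolding can_comp_eq by (rule T.mk_hom_in[OF lin unit])
 show 2: "stv g (pullback f M) (can_comp f g M) x e = canx f g M x e"
  if "x \<in> Pts (src g)" "e \<in> Stk g (pullback f M) x" for x e
  unfolding can_comp_eq by (rule T.stv_mk_hom[OF lin unit that])
 show "mod_iso (src g) (pullback g (pullback f M)) (pullback (f oo g) M) (can_comp f g M)"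
 proof (rule T.stalkwise_iso[OF 1])
  fix x assume x: "x \<in> Pts (src g)"
  show "bij_betw (stv g (pullback f M) (can_comp f g M) x) (Stk g (pullback f M) x) (Stk (f oo g) M x)"
   using pb_comp_pt.canx_bij[OF comp_pt_locale[OF x]] by (rule bij_betw_cong[THEN iffD1, rotated]) (simp add: 2[OF x])
 qed
qed

end

section \<open>Pullback of maps between pullbacks\<close>

lemma stv_comp:
 assumes "pb_pre f M" "pb_pre f' M'" "pb_pre f'' M''" "src f' = src f" "src f'' = src f"
  and u: "u \<in> mod_hom (src f) (pullback f M) (pullback f' M')"
  and v: "v \<in> mod_hom (src f) (pullback f' M') (pullback f'' M'')"
  and x: "x \<in> Pts (src f)" and e: "e \<in> Stk f M x"
 shows "stv f M (mod_comp (src f) (pullback f M) v u) x e = stv f' M' v x (stv f M u x e)"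
proof -
 interpret A: pb_pre f M by fact
 interpret B: pb_pre f' M' by fact
 interpret C: pb_pre f'' M'' by fact
 interpret AB: pb_two f M f' M' by unfold_locales fact
 interpret AC: pb_two f M f'' M'' by unfold_locales fact
 interpret BC: pb_two f' M' f'' M'' by unfold_locales (simp add: assms)
 interpret Ax: pb_pt f M x by (rule A.pt_locale[OF x])
 obtain W s where W: "A.X.opn W" "x \<in> W" "s \<in> Sec A.PB W" "s x = e" using Ax.pt_surj[OF e] .
 have vu: "mod_comp (src f) (pullback f M) v u \<in> mod_hom (src f) (pullback f M) (pullback f'' M'')"
  by (rule A.PB.mod_comp_hom[OF u v])
 have v': "v \<in> mod_hom (src f') (pullback f' M') (pullback f'' M'')" using v assms by simp
 have us: "u W s \<in> Sec B.PB W" using presheaf_homD(1)[OF mod_homD[OF u] W(1,3)] .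
 have oB: "B.X.opn W" using W assms by simp
 show ?thesis
  unfolding W(4)[symmetric] AC.stv_sec[OF vu W(1-3)] AB.stv_sec[OF u W(1-3)] BC.stv_sec[OF v' oB W(2) us]
  by (simp add: mod_comp_apply W)
qed

lemma stv_inv:
 assumes "pb_pre f M" "pb_pre f' M'" "src f' = src f"
  and u: "mod_iso (src f) (pullback f M) (pullback f' M') u"
  and x: "x \<in> Pts (src f)" and e: "e \<in> Stk f M x"
 shows "stv f' M' (mod_inv (src f) (pullback f M) (pullback f' M') u) x (stv f M u x e) = e"
proof -
 interpret A: pb_pre f M by fact
 interpret B: pb_pre f' M' by fact
 interpret AB: pb_two f M f' M' by unfold_locales fact
 interpret BA: pb_two f' M' f M by unfold_locales (simp add: assms)
 interpret Ax: pb_pt f M x by (rule A.pt_locale[OF x])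
 obtain W s where W: "A.X.opn W" "x \<in> W" "s \<in> Sec A.PB W" "s x = e" using Ax.pt_surj[OF e] .
 have B_mpre: "mpre (src f) (pullback f' M')" using B.mpre_PB assms by simp
 have u': "u \<in> mod_hom (src f) (pullback f M) (pullback f' M')" using u by (simp add: mod_iso_def)
 have v: "mod_inv (src f) (pullback f M) (pullback f' M') u \<in> mod_hom (src f') (pullback f' M') (pullback f M)"
  using A.PB.mod_inv_hom[OF u B_mpre] assms by simp
 have us: "u W s \<in> Sec B.PB W" using presheaf_homD(1)[OF mod_homD[OF u'] W(1,3)] .
 have oB: "B.X.opn W" using W assms by simp
 show ?thesis
  unfolding W(4)[symmetric] AB.stv_sec[OF u' W(1-3)] BA.stv_sec[OF v oB W(2) us]
  by (simp add: A.PB.mod_inv_left[OF u B_mpre W(1,3)])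
qed

text \<open>The unit section of \<open>m\<close> goes to the unit section of \<open>u m\<close>,
  which is the condition under which \<open>mk_hom\<close> makes a sheaf map out of the linear maps
  on fibres.\<close>

lemma pullback_map:
 assumes "pb_pre f M" "pb_pre f N" and u: "u \<in> mod_hom (tgt f) M N"
 shows pullback_map_hom: "pullback_map f M N u \<in> mod_hom (src f) (pullback f M) (pullback f N)"
  and stv_pullback_map: "\<And>x r c. x \<in> Pts (src f) \<Longrightarrow> r \<in> carrier (stalk_ring (src f) x) \<Longrightarrow>
   c \<in> carrier (stalk_mod (tgt f) M (pt f x)) \<Longrightarrow>
   stv f M (pullback_map f M N u) x (pb_tens f M x r c) = pb_tens f N x r (stalk_map (tgt f) N u (pt f x) c)"
proof -
 interpret A: pb_pre f M by fact
 interpret B: pb_pre f N by fact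
 interpret AB: pb_two f M f N by unfold_locales simp
 define L where "L = (\<lambda>x. tensor_lift (pb_stalk f N x) (\<lambda>(r, m). pb_tens f N x r (stalk_map (tgt f) N u (pt f x) m)))"
 have L: "lin_map (stalk_ring (src f) x) (pb_stalk f M x) (pb_stalk f N x) (L x)"
  "\<And>r c. r \<in> carrier (stalk_ring (src f) x) \<Longrightarrow> c \<in> carrier (stalk_mod (tgt f) M (pt f x)) \<Longrightarrow>
   L x (pb_tens f M x r c) = pb_tens f N x r (stalk_map (tgt f) N u (pt f x) c)"
  if x: "x \<in> Pts (src f)" for x
 proof -
  interpret Ax: pb_pt f M x by (rule A.pt_locale[OF x])
  interpret Bx: pb_pt f N x by (rule B.pt_locale[OF x])
  note sl = lin_map_stalk_map[OF A.M.mpre_axioms B.M.mpre_axioms mod_homD[OF u] A.pt_in[OF x]]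
  have sm: "stalk_map A.Y N u (pt f x) c \<in> carrier (stalk_mod A.Y N (pt f x))" if "c \<in> carrier (stalk_mod A.Y M (pt f x))" for c
   using sl that by (auto simp: lin_map_def add_hom_def)
  have sa: "stalk_map A.Y N u (pt f x) (c \<oplus>\<^bsub>stalk_mod A.Y M (pt f x)\<^esub> c') =
    stalk_map A.Y N u (pt f x) c \<oplus>\<^bsub>stalk_mod A.Y N (pt f x)\<^esub> stalk_map A.Y N u (pt f x) c'"
   if "c \<in> carrier (stalk_mod A.Y M (pt f x))" "c' \<in> carrier (stalk_mod A.Y M (pt f x))" for c c'
   using sl that by (auto simp: lin_map_def add_hom_def)
  have ss: "stalk_map A.Y N u (pt f x) (s \<odot>\<^bsub>stalk_mod A.Y M (pt f x)\<^esub> c) = s \<odot>\<^bsub>stalk_mod A.Y N (pt f x)\<^esub> stalk_map A.Y N u (pt f x) c"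
   if "s \<in> carrier (stalk_ring A.Y (pt f x))" "c \<in> carrier (stalk_mod A.Y M (pt f x))" for c s
   using sl that by (auto simp: lin_map_def)
  have phi: "stalk_comor f x s \<in> carrier (stalk_ring A.X x)" if "s \<in> carrier (stalk_ring A.Y (pt f x))" for s
   using ring_hom_closed[OF Ax.stalk_comor_hom that] .
  have bal: "pb_tens f N x \<one>\<^bsub>stalk_ring A.X x\<^esub> (s \<odot>\<^bsub>stalk_mod A.Y N (pt f x)\<^esub> d) =
    stalk_comor f x s \<odot>\<^bsub>pb_stalk f N x\<^esub> pb_tens f N x \<one>\<^bsub>stalk_ring A.X x\<^esub> d"
   if "s \<in> carrier (stalk_ring A.Y (pt f x))" "d \<in> carrier (stalk_mod A.Y N (pt f x))" for s d
   using that phi[OF that(1)] by (simp add: Bx.pt_balanced[symmetric] Bx.pt_smult)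
  show "lin_map (stalk_ring (src f) x) (pb_stalk f M x) (pb_stalk f N x) (L x)"
   unfolding L_def
   by (rule Ax.pt_lift_lin(1)[OF Bx.P_left_module, where \<gamma> = "\<lambda>m. pb_tens f N x \<one>\<^bsub>stalk_ring A.X x\<^esub> (stalk_map (tgt f) N u (pt f x) m)"])
    (simp_all add: sm sa ss Bx.pt_add_right Bx.pt_smult bal)
  show "L x (pb_tens f M x r c) = pb_tens f N x r (stalk_map (tgt f) N u (pt f x) c)"
   if "r \<in> carrier (stalk_ring (src f) x)" "c \<in> carrier (stalk_mod (tgt f) M (pt f x))" for r c
  proof -
   have "L x (pb_tens f M x r c) = r \<odot>\<^bsub>pb_stalk f N x\<^esub> pb_tens f N x \<one>\<^bsub>stalk_ring A.X x\<^esub> (stalk_map (tgt f) N u (pt f x) c)"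
    unfolding L_def
    by (rule Ax.pt_lift_lin(2)[OF Bx.P_left_module, where \<gamma> = "\<lambda>m. pb_tens f N x \<one>\<^bsub>stalk_ring A.X x\<^esub> (stalk_map (tgt f) N u (pt f x) m)"])
     (simp_all add: sm sa ss Bx.pt_add_right Bx.pt_smult bal that)
   then show ?thesis using that sm by (simp add: Bx.pt_smult)
  qed
 qed
 have unit: "(\<lambda>y\<in>preim f V. L y (pb_tens f M y \<one>\<^bsub>stalk_ring (src f) y\<^esub> (mgerm A.Y M (pt f y) V m))) \<in> Sec B.PB (preim f V)"
  if V: "A.Y.opn V" and m: "m \<in> Sec M V" for V m
 proof -
  have "(\<lambda>y\<in>preim f V. L y (pb_tens f M y \<one>\<^bsub>stalk_ring (src f) y\<^esub> (mgerm A.Y M (pt f y) V m))) = B.usec V (u V m)"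
   unfolding B.usec_def
  proof (rule restrict_ext)
   fix y assume "y \<in> preim f V"
   then have y: "y \<in> Pts A.X" "pt f y \<in> V" by (simp_all add: A.preim_iff)
   interpret Ay: pb_pt f M y by (rule A.pt_locale[OF y(1)])
   have c: "mgerm A.Y M (pt f y) V m \<in> carrier (stalk_mod A.Y M (pt f y))" using V m y by (intro Ay.M.mg_in) auto
   show "L y (pb_tens f M y \<one>\<^bsub>stalk_ring (src f) y\<^esub> (mgerm A.Y M (pt f y) V m)) =
     pb_tens f N y \<one>\<^bsub>stalk_ring A.X y\<^esub> (mgerm A.Y N (pt f y) V (u V m))"
    unfolding L(2)[OF y(1) Ay.X.St.one_closed c]
    by (simp only: stalk_map_mgerm[OF A.M.mpre_axioms B.M.mpre_axioms mod_homD[OF u] A.pt_in[OF y(1)] V y(2) m])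
  qed
  then show ?thesis using B.usec_closed[OF V presheaf_homD(1)[OF mod_homD[OF u] V m]] by simp
 qed
 have eq: "pullback_map f M N u = on_sections (src f) A.PB (\<lambda>W s. \<lambda>x\<in>W. L x (s x))"
  unfolding pullback_map_def L_def by simp
 show "pullback_map f M N u \<in> mod_hom (src f) (pullback f M) (pullback f N)"
  unfolding eq by (rule AB.mk_hom_in[OF L(1) unit])
 show "stv f M (pullback_map f M N u) x (pb_tens f M x r c) = pb_tens f N x r (stalk_map (tgt f) N u (pt f x) c)"
  if x: "x \<in> Pts (src f)" "r \<in> carrier (stalk_ring (src f) x)"
   "c \<in> carrier (stalk_mod (tgt f) M (pt f x))" for x r c
 proof -
  interpret Ax: pb_pt f M x by (rule A.pt_locale[OF x(1)])
  have "pb_tens f M x r c \<in> Stk f M x" using x by simp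
  from AB.stv_mk_hom[OF L(1) unit x(1) this] show ?thesis
   unfolding eq using L(2)[OF x] by simp
 qed
qed

text \<open>One degree of \<open>gpull\<close>. The graded operators are families of such maps, so
  the identities are proved for a single map first; \<open>gunfold1\<close> has the same relation to
  \<open>gunfold\<close>.\<close>

definition gpull1 where
 "gpull1 h f g A B u =
   mod_comp (src h) (pullback (f oo h) A) (can_comp g h B)
    (mod_comp (src h) (pullback (f oo h) A)
     (pullback_map h (pullback f A) (pullback g B) u)
     (mod_inv (src h) (pullback h (pullback f A)) (pullback (f oo h) A) (can_comp f h A)))"

definition gunfold1 where
 "gunfold1 k k' f g A B u =
   mod_comp (src f) (pullback f (pullback k A))
    (mod_inv (src f) (pullback g (pullback k' B)) (pullback (k' oo g) B) (can_comp k' g B))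
    (mod_comp (src f) (pullback f (pullback k A)) u (can_comp k f A))"

section \<open>Transport of a single map, characterised on fibres\<close>

locale pull2 = CA: pb_comp f A h + CB: pb_comp g B h
 for h :: "('x, 'r, 'y, 's) rs_mor" and f g :: "('y, 's, 'z, 't) rs_mor"
  and A :: "('z, 't, 'm) msheaf" and B :: "('z, 't, 'n) msheaf"
begin

lemma src_eq: "src g = src f" using CA.tg CB.tg by simp

context
 fixes u assumes u: "u \<in> mod_hom (src f) (pullback f A) (pullback g B)"
begin

lemma u': "u \<in> mod_hom (tgt h) (pullback f A) (pullback g B)"
 using u CA.tg by simp

lemma inv_hom: "mod_inv (src h) (pullback h (pullback f A)) (pullback (f oo h) A) (can_comp f h A)
  \<in> mod_hom (src h) (pullback (f oo h) A) (pullback h (pullback f A))"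
 using CA.H.mpre_PB by (intro CA.GP.PB.mod_inv_hom[OF CA.can_comp_iso]) simp

lemma pinv_hom: "mod_comp (src h) (pullback (f oo h) A)
     (pullback_map h (pullback f A) (pullback g B) u)
     (mod_inv (src h) (pullback h (pullback f A)) (pullback (f oo h) A) (can_comp f h A))
  \<in> mod_hom (src h) (pullback (f oo h) A) (pullback h (pullback g B))"
 using CA.H.PB.mod_comp_hom[unfolded comp_simps, OF inv_hom pullback_map_hom[OF CA.pb_pre_G CB.pb_pre_G u']] .

lemma gpull1_hom: "gpull1 h f g A B u \<in> mod_hom (src h) (pullback (f oo h) A) (pullback (g oo h) B)"
 unfolding gpull1_def
 using CA.H.PB.mod_comp_hom[unfolded comp_simps, OF pinv_hom CB.can_comp_hom] .

text \<open>The element \<open>kap e\<close> is followed through the three factors: the inverse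
  canonical isomorphism turns it into \<open>1 \<otimes> Lg e\<close>, the pulled back map turns
  this into \<open>1 \<otimes> Lg (u e)\<close>, and the canonical isomorphism of the target gives
  \<open>kap (u e)\<close>.\<close>

lemma gpull1_stv:
 assumes x: "x \<in> Pts (src h)" and e: "e \<in> Stk f A (pt h x)"
 shows "stv (f oo h) A (gpull1 h f g A B u) x (kap f h A x e) = kap g h B x (stv f A u (pt h x) e)"
proof -
 interpret a: pb_comp_pt f A h x by (rule CA.comp_pt_locale[OF x])
 interpret b: pb_comp_pt g B h x by (rule CB.comp_pt_locale[OF x])
 interpret ab: pb_two f A g B by unfold_locales (rule src_eq)
 let ?inv = "mod_inv (src h) (pullback h (pullback f A)) (pullback (f oo h) A) (can_comp f h A)"
 let ?p = "pullback_map h (pullback f A) (pullback g B) u"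
 have \<kappa>e: "kap f h A x e \<in> Stk (f oo h) A x" by (rule a.kap.closed[OF e])
 have le: "a.Fy.Lg e \<in> carrier a.GM" by (rule a.Fy.Lg.closed[OF e])
 let ?t = "pb_tens h (pullback f A) x \<one>\<^bsub>a.Rx\<^esub> (a.Fy.Lg e)"
 have t: "?t \<in> Stk h (pullback f A) x" using le by (intro a.g_closed) simp_all
 have 0: "stv h (pullback f A) (can_comp f h A) x ?t = kap f h A x e"
  unfolding CA.stv_can_comp[OF x t] by (rule a.canx_Lg[OF e])
 have 1: "stv (f oo h) A ?inv x (kap f h A x e) = ?t"
  using stv_inv[OF CA.pb_pre_G CA.pb_pre_H _ CA.can_comp_iso x t] unfolding 0 by simp
 obtain W s where W: "CA.F.X.opn W" "pt h x \<in> W" "s \<in> Sec (pullback f A) W" "s (pt h x) = e"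
  using a.Fy.pt_surj[OF e] .
 have us: "u W s \<in> Sec (pullback g B) W" using presheaf_homD(1)[OF mod_homD[OF u] W(1,3)] .
 have oB: "CB.F.X.opn W" using W src_eq by simp
 have e': "stv f A u (pt h x) e \<in> Stk g B (pt h x)"
  using ab.stv_lin[OF u a.y_in] e by (auto simp: lin_map_def add_hom_def)
 have "stalk_map (tgt h) (pullback g B) u (pt h x) (a.Fy.Lg e) = mgerm (tgt h) (pullback g B) (pt h x) W (u W s)"
  unfolding W(4)[symmetric] a.Fy.Lg_sec[OF W(1-3)] CA.tg[symmetric]
  by (rule stalk_map_mgerm[OF CA.GP.M.mpre_axioms CB.GP.M.mpre_axioms mod_homD[OF u']])
   (use W CA.tg CA.G.pt_in[OF x] in simp_all)
 also have "\<dots> = b.Fy.Lg (u W s (pt h x))"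
  unfolding CB.tg by (rule b.Fy.Lg_sec[OF oB W(2) us, symmetric])
 also have "u W s (pt h x) = stv f A u (pt h x) e"
  unfolding W(4)[symmetric] by (rule ab.stv_sec[OF u W(1-3), symmetric])
 finally have sm: "stalk_map (tgt h) (pullback g B) u (pt h x) (a.Fy.Lg e) = b.Fy.Lg (stv f A u (pt h x) e)" .
 have le': "a.Fy.Lg e \<in> carrier (stalk_mod (tgt h) (pullback f A) (pt h x))" using le CA.tg by simp
 have 2: "stv h (pullback f A) ?p x ?t = pb_tens h (pullback g B) x \<one>\<^bsub>a.Rx\<^esub> (b.Fy.Lg (stv f A u (pt h x) e))"
  using stv_pullback_map[OF CA.pb_pre_G CB.pb_pre_G u' x _ le'] unfolding sm by simp
 have t': "pb_tens h (pullback g B) x \<one>\<^bsub>a.Rx\<^esub> (b.Fy.Lg (stv f A u (pt h x) e)) \<in> Stk h (pullback g B) x"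
  using b.Fy.Lg.closed[OF e'] by (intro b.g_closed) simp_all
 have 3: "stv h (pullback g B) (can_comp g h B) x (pb_tens h (pullback g B) x \<one>\<^bsub>a.Rx\<^esub> (b.Fy.Lg (stv f A u (pt h x) e)))
   = kap g h B x (stv f A u (pt h x) e)"
  unfolding CB.stv_can_comp[OF x t'] by (rule b.canx_Lg[OF e'])
 have "stv (f oo h) A (gpull1 h f g A B u) x (kap f h A x e) =
   stv h (pullback g B) (can_comp g h B) x (stv (f oo h) A (mod_comp (src h) (pullback (f oo h) A) ?p ?inv) x (kap f h A x e))"
  unfolding gpull1_def
  using stv_comp[OF CA.pb_pre_H CB.pb_pre_G CB.pb_pre_H, unfolded comp_simps, OF refl refl pinv_hom CB.can_comp_hom x \<kappa>e] .
 also have "stv (f oo h) A (mod_comp (src h) (pullback (f oo h) A) ?p ?inv) x (kap f h A x e) =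
   stv h (pullback f A) ?p x (stv (f oo h) A ?inv x (kap f h A x e))"
  using stv_comp[OF CA.pb_pre_H CA.pb_pre_G CB.pb_pre_G, unfolded comp_simps, OF refl refl inv_hom
    pullback_map_hom[OF CA.pb_pre_G CB.pb_pre_G u'] x \<kappa>e] .
 finally show ?thesis unfolding 1 2 3 .
qed

text \<open>Since the elements \<open>kap e\<close> generate (\<open>kap_ext\<close>), the square of
  \<open>gpull1_stv\<close> determines the map. From here on, identities for \<open>gpull1\<close>
  are proved by verifying this square.\<close>

lemma gpull1_unique:
 assumes w: "w \<in> mod_hom (src h) (pullback (f oo h) A) (pullback (g oo h) B)"
  and eq: "\<And>x e. x \<in> Pts (src h) \<Longrightarrow> e \<in> Stk f A (pt h x) \<Longrightarrow>
   stv (f oo h) A w x (kap f h A x e) = kap g h B x (stv f A u (pt h x) e)"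
 shows "gpull1 h f g A B u = w"
proof -
 interpret T: pb_two "f oo h" A "g oo h" B by unfold_locales simp
 show ?thesis
 proof (rule T.stv_ext[unfolded comp_simps, OF gpull1_hom w])
  fix x e assume x: "x \<in> Pts (src h)" and e: "e \<in> Stk (f oo h) A x"
  interpret a: pb_comp_pt f A h x by (rule CA.comp_pt_locale[OF x])
  interpret b: pb_comp_pt g B h x by (rule CB.comp_pt_locale[OF x])
  note l = T.stv_lin[unfolded comp_simps]
  show "stv (f oo h) A (gpull1 h f g A B u) x e = stv (f oo h) A w x e"
   by (rule a.kap_ext[OF l[OF gpull1_hom x] l[OF w x] b.h_left_module _ e]) (simp only: gpull1_stv[OF x] eq[OF x])
 qed
qed

end

end

locale unf2 = CA: pb_comp k A f + CB: pb_comp k' B g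
 for f :: "('x, 'r, 'y, 's) rs_mor" and g :: "('x, 'r, 'y, 's) rs_mor" and k k' :: "('y, 's, 'z, 't) rs_mor"
  and A :: "('z, 't, 'm) msheaf" and B :: "('z, 't, 'n) msheaf" +
 assumes src_eq: "src g = src f"
begin

context
 fixes u assumes u: "u \<in> mod_hom (src f) (pullback (k oo f) A) (pullback (k' oo g) B)"
begin

lemma inv_hom': "mod_inv (src f) (pullback g (pullback k' B)) (pullback (k' oo g) B) (can_comp k' g B)
  \<in> mod_hom (src f) (pullback (k' oo g) B) (pullback g (pullback k' B))"
 using CB.H.mpre_PB CB.GP.PB.mod_inv_hom[OF CB.can_comp_iso] src_eq by simp

lemma uc_hom: "mod_comp (src f) (pullback f (pullback k A)) u (can_comp k f A)
  \<in> mod_hom (src f) (pullback f (pullback k A)) (pullback (k' oo g) B)"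
 by (rule CA.GP.PB.mod_comp_hom[OF CA.can_comp_hom u])

lemma gunfold1_hom: "gunfold1 k k' f g A B u \<in> mod_hom (src f) (pullback f (pullback k A)) (pullback g (pullback k' B))"
 unfolding gunfold1_def by (rule CA.GP.PB.mod_comp_hom[OF uc_hom inv_hom'])

lemma canx_B_bij: "x \<in> Pts (src f) \<Longrightarrow> bij_betw (canx k' g B x) (Stk g (pullback k' B) x) (Stk (k' oo g) B x)"
 using pb_comp_pt.canx_bij[OF CB.comp_pt_locale] src_eq by simp

text \<open>The inverse isomorphism on the target side is removed by applying \<open>canx\<close>
  there. As \<open>canx\<close> is injective, the equation still determines the map.\<close>

lemma gunfold1_stv:
 assumes x: "x \<in> Pts (src f)" and c: "c \<in> Stk f (pullback k A) x"
 shows "canx k' g B x (stv f (pullback k A) (gunfold1 k k' f g A B u) x c) = stv (k oo f) A u x (canx k f A x c)"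
proof -
 have x': "x \<in> Pts (src g)" using x src_eq by simp
 interpret a: pb_comp_pt k A f x by (rule CA.comp_pt_locale[OF x])
 interpret b: pb_comp_pt k' B g x by (rule CB.comp_pt_locale[OF x'])
 interpret T: pb_two "k oo f" A "k' oo g" B by unfold_locales (simp add: src_eq)
 let ?inv = "mod_inv (src f) (pullback g (pullback k' B)) (pullback (k' oo g) B) (can_comp k' g B)"
 have cc: "canx k f A x c \<in> Stk (k oo f) A x"
  using a.canx_lin c by (auto simp: lin_map_def add_hom_def)
 let ?d = "stv (k oo f) A u x (canx k f A x c)"
 have d: "?d \<in> Stk (k' oo g) B x"
  using T.stv_lin[unfolded comp_simps, OF u x] cc by (auto simp: lin_map_def add_hom_def)
 have "?d \<in> canx k' g B x ` Stk g (pullback k' B) x"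
  unfolding bij_betw_imp_surj_on[OF canx_B_bij[OF x]] by (rule d)
 from imageE[OF this] obtain c' where "?d = canx k' g B x c'" "c' \<in> Stk g (pullback k' B) x" .
 then have c': "c' \<in> Stk g (pullback k' B) x" "canx k' g B x c' = ?d" by (simp_all only:)
 have "stv f (pullback k A) (gunfold1 k k' f g A B u) x c =
   stv (k' oo g) B ?inv x (stv f (pullback k A) (mod_comp (src f) (pullback f (pullback k A)) u (can_comp k f A)) x c)"
  unfolding gunfold1_def
  using stv_comp[OF CA.pb_pre_G CB.pb_pre_H CB.pb_pre_G, unfolded comp_simps, OF src_eq src_eq uc_hom inv_hom' x c] .
 also have "stv f (pullback k A) (mod_comp (src f) (pullback f (pullback k A)) u (can_comp k f A)) x c = ?d"
  using stv_comp[OF CA.pb_pre_G CA.pb_pre_H CB.pb_pre_H, unfolded comp_simps, OF refl src_eq CA.can_comp_hom u x c]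
  unfolding CA.stv_can_comp[OF x c] .
 also have "?d = stv g (pullback k' B) (can_comp k' g B) x c'"
  unfolding CB.stv_can_comp[OF x' c'(1)] c'(2) ..
 also have "stv (k' oo g) B ?inv x \<dots> = c'"
  using stv_inv[OF CB.pb_pre_G CB.pb_pre_H _ CB.can_comp_iso x' c'(1)] src_eq by simp
 finally show ?thesis using c'(2) by simp
qed

lemma gunfold1_unique:
 assumes w: "w \<in> mod_hom (src f) (pullback f (pullback k A)) (pullback g (pullback k' B))"
  and eq: "\<And>x c. x \<in> Pts (src f) \<Longrightarrow> c \<in> Stk f (pullback k A) x \<Longrightarrow>
   canx k' g B x (stv f (pullback k A) w x c) = stv (k oo f) A u x (canx k f A x c)"
 shows "gunfold1 k k' f g A B u = w"
proof -
 interpret T: pb_two f "pullback k A" g "pullback k' B" by unfold_locales (rule src_eq)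
 show ?thesis
 proof (rule T.stv_ext[OF gunfold1_hom w])
  fix x c assume x: "x \<in> Pts (src f)" and c: "c \<in> Stk f (pullback k A) x"
  have cl: "stv f (pullback k A) v x c \<in> Stk g (pullback k' B) x"
   if "v \<in> mod_hom (src f) (pullback f (pullback k A)) (pullback g (pullback k' B))" for v
   using T.stv_lin[OF that x] c by (auto simp: lin_map_def add_hom_def)
  show "stv f (pullback k A) (gunfold1 k k' f g A B u) x c = stv f (pullback k A) w x c"
   by (rule inj_onD[OF bij_betw_imp_inj_on[OF canx_B_bij[OF x]] _ cl[OF gunfold1_hom] cl[OF w]])
    (simp only: gunfold1_stv[OF x c] eq[OF x c])
 qed
qed

end

end

lemma pb_preI: "f \<in> mor Y Z \<Longrightarrow> sheaf_of_modules Z A \<Longrightarrow> pb_pre f A"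
 using sheaf_of_modules_mpre[of Z A] rsmI[of f Y Z] by (simp add: pb_pre_def)

lemma pb_compI: "h \<in> mor X Y \<Longrightarrow> f \<in> mor Y Z \<Longrightarrow> sheaf_of_modules Z A \<Longrightarrow> pb_comp f A h"
 using pb_preI[of f Y Z A] rsmI[of f Y Z] rsmI[of h X Y]
 by (simp add: pb_comp_def rsm_comp_def rsm_comp_axioms_def)

lemma pull2I: "h \<in> mor X Y \<Longrightarrow> f \<in> mor Y Z \<Longrightarrow> g \<in> mor Y Z \<Longrightarrow> sheaf_of_modules Z A \<Longrightarrow> sheaf_of_modules Z B \<Longrightarrow>
 pull2 h f g A B"
 using pb_compI[of h X Y f Z A] pb_compI[of h X Y g Z B] by (simp add: pull2_def)

lemma unf2I: "f \<in> mor X Y \<Longrightarrow> g \<in> mor X Y \<Longrightarrow> k \<in> mor Y Z \<Longrightarrow> k' \<in> mor Y Z \<Longrightarrow>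
  sheaf_of_modules Z A \<Longrightarrow> sheaf_of_modules Z B \<Longrightarrow> unf2 f g k k' A B"
 using pb_compI[of f X Y k Z A] pb_compI[of g X Y k' Z B] rsmI[of f X Y] rsmI[of g X Y]
 by (simp add: unf2_def unf2_axioms_def)

lemma pullback_sheaf: "f \<in> mor Y Z \<Longrightarrow> sheaf_of_modules Z A \<Longrightarrow> sheaf_of_modules Y (pullback f A)"
 using pb_pre.sheaf_PB[OF pb_preI, of f Y Z A] rsmI[of f Y Z] by simp

text \<open>The cocycle condition for base change of fibres. Both sides are additive in
  \<open>e\<close>, and on pure tensors it is the composition law for comorphisms on stalks.\<close>

lemma kap_kap:
 assumes m: "l \<in> mor W X" "h \<in> mor X Y" "f \<in> mor Y Z" and A: "sheaf_of_modules Z A"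
  and x: "x \<in> Pts W" and e: "e \<in> Stk f A (pt h (pt l x))"
 shows "kap f (h oo l) A x e = kap (f oo h) l A x (kap f h A (pt l x) e)"
proof -
 note src = rsmI(2)[OF m(1)] rsmI(2)[OF m(2)] rsmI(2)[OF m(3)] rsmI(3)[OF m(1)] rsmI(3)[OF m(2)] rsmI(3)[OF m(3)]
 interpret a: pb_comp f A "h oo l" by (rule pb_compI[OF comp_in_mor[OF m(2,1)] m(3) A])
 interpret b: pb_comp "f oo h" A l by (rule pb_compI[OF m(1) comp_in_mor[OF m(3,2)] A])
 interpret c: pb_comp f A h by (rule pb_compI[OF m(2,3) A])
 interpret mm: rsm_comp h l using rsmI(1)[OF m(1)] rsmI(1)[OF m(2)] src by (simp add: rsm_comp_def rsm_comp_axioms_def)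
 have x1: "x \<in> Pts (src (h oo l))" "x \<in> Pts (src l)" using x src by simp_all
 have x2: "pt l x \<in> Pts (src h)" using rsm.pt_in[OF rsmI(1)[OF m(1)] x1(2)] src by simp
 interpret a: pb_comp_pt f A "h oo l" x by (rule a.comp_pt_locale[OF x1(1)])
 interpret b: pb_comp_pt "f oo h" A l x by (rule b.comp_pt_locale[OF x1(2)])
 interpret c: pb_comp_pt f A h "pt l x" by (rule c.comp_pt_locale[OF x2])
 \<comment> \<open>The two sides live in fibres of differently bracketed pullbacks; as associativity
   is a literal equality, these fibres coincide.\<close>
 have as: "f oo (h oo l) = f oo h oo l"
  using comp_assoc[OF rsmI(1)[OF m(3)] rsmI(1)[OF m(2)] rsmI(1)[OF m(1)]] src by simp
 have p: "pt (h oo l) x = pt h (pt l x)" by (rule pt_comp[OF x1(2)])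
 note akz = a.kap.zero[unfolded p as] and aka = a.kap.add[unfolded p as] and akt = a.kap_tens[unfolded p as]
 show ?thesis
  using e
 proof (induction rule: c.Fy.pt_induct)
  case zero
  show ?case using akz c.kap.zero b.kap.zero by simp
 next
  case (tens r m)
  have "stalk_comor h (pt l x) r \<in> carrier (stalk_ring (src h) (pt l x))" by (rule c.gc_closed[OF tens(1)])
  moreover have "m \<in> carrier (stalk_mod (tgt (f oo h)) A (pt (f oo h) (pt l x)))" using tens x2 by (simp add: pt_comp)
  ultimately show ?case
   using tens akt[OF tens(1,2)] mm.stalk_comor_comp[OF x1(2), of r] src
   by (simp add: c.kap_tens b.kap_tens)
 next
  case (add u v)
  then show ?case using aka[of u v] by simp
 qed
qed

text \<open>Naturality of the canonical isomorphism under base change. On a tensor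
  \<open>r \<otimes> c\<close> both routes give the image of \<open>r\<close> times a base change of
  the value of \<open>c\<close>, so the claim comes down to \<open>kap_kap\<close>.\<close>

lemma can_kap:
 assumes m: "h \<in> mor W X" "f \<in> mor X Y" "k \<in> mor Y Z" and A: "sheaf_of_modules Z A"
  and x: "x \<in> Pts W" and d: "d \<in> Stk f (pullback k A) (pt h x)"
 shows "canx k (f oo h) A x (kap f h (pullback k A) x d) = kap (k oo f) h A x (canx k f A (pt h x) d)"
proof -
 note src = rsmI(2)[OF m(1)] rsmI(2)[OF m(2)] rsmI(2)[OF m(3)] rsmI(3)[OF m(1)] rsmI(3)[OF m(2)] rsmI(3)[OF m(3)]
 interpret a: pb_comp k A "f oo h" by (rule pb_compI[OF comp_in_mor[OF m(2,1)] m(3) A])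
 interpret b: pb_comp "k oo f" A h by (rule pb_compI[OF m(1) comp_in_mor[OF m(3,2)] A])
 interpret c: pb_comp k A f by (rule pb_compI[OF m(2,3) A])
 interpret k: pb_comp f "pullback k A" h by (rule pb_compI[OF m(1,2) pullback_sheaf[OF m(3) A]])
 have x1: "x \<in> Pts (src (f oo h))" "x \<in> Pts (src h)" using x src by simp_all
 have x2: "pt h x \<in> Pts (src f)" using rsm.pt_in[OF rsmI(1)[OF m(1)] x1(2)] src by simp
 interpret a: pb_comp_pt k A "f oo h" x by (rule a.comp_pt_locale[OF x1(1)])
 interpret b: pb_comp_pt "k oo f" A h x by (rule b.comp_pt_locale[OF x1(2)])
 interpret c: pb_comp_pt k A f "pt h x" by (rule c.comp_pt_locale[OF x2])
 interpret k: pb_comp_pt f "pullback k A" h x by (rule k.comp_pt_locale[OF x1(2)])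
 have as: "k oo (f oo h) = k oo f oo h"
  using comp_assoc[OF rsmI(1)[OF m(3)] rsmI(1)[OF m(2)] rsmI(1)[OF m(1)]] src by simp
 have p: "pt (f oo h) x = pt f (pt h x)" by (rule pt_comp[OF x1(2)])
 have ca: "add_hom (pb_stalk (f oo h) (pullback k A) x) (pb_stalk (k oo f oo h) A x) (canx k (f oo h) A x)"
  using a.canx_lin unfolding lin_map_def as by simp
 have cc: "add_hom (pb_stalk f (pullback k A) (pt h x)) (pb_stalk (k oo f) A (pt h x)) (canx k f A (pt h x))"
  using c.canx_lin unfolding lin_map_def by simp
 show ?thesis
 proof (rule c.Gx.pt_ext[OF _ _ _ _ d])
  show "add_hom (pb_stalk f (pullback k A) (pt h x)) (pb_stalk (k oo f oo h) A x) (\<lambda>d. canx k (f oo h) A x (kap f h (pullback k A) x d))"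
   using ca k.kap_hom unfolding add_hom_def by (simp add: Pi_iff)
  show "add_hom (pb_stalk f (pullback k A) (pt h x)) (pb_stalk (k oo f oo h) A x) (\<lambda>d. kap (k oo f) h A x (canx k f A (pt h x) d))"
   using cc b.kap_hom unfolding add_hom_def by (simp add: Pi_iff)
  show "abelian_group (pb_stalk (k oo f oo h) A x)"
   using left_module.axioms(2)[OF b.h_left_module] .
  fix r c assume r: "r \<in> carrier (stalk_ring (src f) (pt h x))"
   and c: "c \<in> carrier (stalk_mod (tgt f) (pullback k A) (pt f (pt h x)))"
  have c': "c \<in> carrier (stalk_mod (src k) (pullback k A) (pt f (pt h x)))" using c src by simp
  have r': "stalk_comor h x r \<in> carrier (stalk_ring (src h) x)" by (rule k.gc_closed[OF r])
  note at = a.canx_tens[unfolded comp_simps p as]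
  have ge: "germ_eval (pt f (pt h x)) c \<in> Stk k A (pt f (pt h x))" by (rule c.ge[OF c'])
  have "canx k (f oo h) A x (kap f h (pullback k A) x (pb_tens f (pullback k A) (pt h x) r c)) =
    stalk_comor h x r \<odot>\<^bsub>pb_stalk (k oo f oo h) A x\<^esub> kap k (f oo h) A x (germ_eval (pt f (pt h x)) c)"
   unfolding k.kap_tens[OF r c] by (rule at[OF r' c'])
  also have "kap k (f oo h) A x (germ_eval (pt f (pt h x)) c) =
    kap (k oo f) h A x (kap k f A (pt h x) (germ_eval (pt f (pt h x)) c))"
   by (rule kap_kap[OF m A x ge])
  also have "stalk_comor h x r \<odot>\<^bsub>pb_stalk (k oo f oo h) A x\<^esub> \<dots> =
    kap (k oo f) h A x (r \<odot>\<^bsub>pb_stalk (k oo f) A (pt h x)\<^esub> kap k f A (pt h x) (germ_eval (pt f (pt h x)) c))"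
   using b.kap_smult[unfolded comp_simps, OF r c.kap.closed[OF ge]] by (rule sym)
  also have "r \<odot>\<^bsub>pb_stalk (k oo f) A (pt h x)\<^esub> kap k f A (pt h x) (germ_eval (pt f (pt h x)) c) =
    canx k f A (pt h x) (pb_tens f (pullback k A) (pt h x) r c)"
   by (rule c.canx_tens[OF r c', symmetric])
  finally show "canx k (f oo h) A x (kap f h (pullback k A) x (pb_tens f (pullback k A) (pt h x) r c)) =
   kap (k oo f) h A x (canx k f A (pt h x) (pb_tens f (pullback k A) (pt h x) r c))" .
 qed
qed

definition hadd where
 "hadd X M N u v = on_sections X M (\<lambda>W s. u W s \<oplus>\<^bsub>msec N W\<^esub> v W s)"

lemma hadd_hom:
 assumes "mpre X M" "mpre X N" and u: "u \<in> mod_hom X M N" and v: "v \<in> mod_hom X M N"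
 shows "hadd X M N u v \<in> mod_hom X M N"
proof -
 interpret M: mpre X M by fact
 interpret N: mpre X N by fact
 note ud = presheaf_homD[OF mod_homD[OF u]] and vd = presheaf_homD[OF mod_homD[OF v]]
 show ?thesis
  unfolding hadd_def
 proof (rule M.on_sections_hom, rule presheaf_homI)
  fix W s assume W: "M.opn W" and s: "s \<in> Sec M W"
  interpret NW: left_module "rsec X W" "msec N W" by (rule N.left_module_sec[OF W])
  show "u W s \<oplus>\<^bsub>msec N W\<^esub> v W s \<in> Sec N W" using ud(1)[OF W s] vd(1)[OF W s] by simp
  show "u W (s \<oplus>\<^bsub>msec M W\<^esub> t) \<oplus>\<^bsub>msec N W\<^esub> v W (s \<oplus>\<^bsub>msec M W\<^esub> t) = u W s \<oplus>\<^bsub>msec N W\<^esub> v W s \<oplus>\<^bsub>msec N W\<^esub> (u W t \<oplus>\<^bsub>msec N W\<^esub> v W t)"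
   if t: "t \<in> Sec M W" for t
   using ud(1)[OF W s] vd(1)[OF W s] ud(1)[OF W t] vd(1)[OF W t]
   by (simp add: ud(2)[OF W s t] vd(2)[OF W s t] NW.M.a_ac)
  show "u W (r \<odot>\<^bsub>msec M W\<^esub> s) \<oplus>\<^bsub>msec N W\<^esub> v W (r \<odot>\<^bsub>msec M W\<^esub> s) = r \<odot>\<^bsub>msec N W\<^esub> (u W s \<oplus>\<^bsub>msec N W\<^esub> v W s)"
   if r: "r \<in> Rsec X W" for r
   using ud(1)[OF W s] vd(1)[OF W s] r by (simp add: ud(3)[OF W s r] vd(3)[OF W s r] NW.smult_r_distr)
  show "u V (mres M W V s) \<oplus>\<^bsub>msec N V\<^esub> v V (mres M W V s) = mres N W V (u W s \<oplus>\<^bsub>msec N W\<^esub> v W s)"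
   if V: "M.opn V" "V \<subseteq> W" for V
   using ud(1)[OF W s] vd(1)[OF W s] by (simp add: ud(4)[OF W s V] vd(4)[OF W s V] N.mres_add W V)
 qed
qed

lemma hadd_apply: "openin (rtop X) W \<Longrightarrow> s \<in> Sec M W \<Longrightarrow> hadd X M N u v W s = u W s \<oplus>\<^bsub>msec N W\<^esub> v W s"
 by (simp add: hadd_def on_sections_apply)

lemma stv_hadd:
 assumes "pb_pre f M" "pb_pre f' M'" "src f' = src f"
  and u: "u \<in> mod_hom (src f) (pullback f M) (pullback f' M')" and v: "v \<in> mod_hom (src f) (pullback f M) (pullback f' M')"
  and x: "x \<in> Pts (src f)" and e: "e \<in> Stk f M x"
 shows "stv f M (hadd (src f) (pullback f M) (pullback f' M') u v) x e = stv f M u x e \<oplus>\<^bsub>pb_stalk f' M' x\<^esub> stv f M v x e"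
proof -
 interpret A: pb_pre f M by fact
 interpret B: pb_pre f' M' by fact
 interpret AB: pb_two f M f' M' by unfold_locales fact
 interpret Ax: pb_pt f M x by (rule A.pt_locale[OF x])
 obtain W s where W: "A.X.opn W" "x \<in> W" "s \<in> Sec A.PB W" "s x = e" using Ax.pt_surj[OF e] .
 have h: "hadd (src f) (pullback f M) (pullback f' M') u v \<in> mod_hom (src f) (pullback f M) (pullback f' M')"
  using A.mpre_PB B.mpre_PB assms(3) by (intro hadd_hom u v) simp_all
 show ?thesis
  unfolding W(4)[symmetric] AB.stv_sec[OF h W(1-3)] AB.stv_sec[OF u W(1-3)] AB.stv_sec[OF v W(1-3)] hadd_apply[OF W(1,3)]
  using W(2) by simp
qed

lemma mod_id_hom: "mpre X M \<Longrightarrow> mod_id X M \<in> mod_hom X M M"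
proof -
 assume "mpre X M"
 then interpret mpre X M .
 show ?thesis unfolding mod_id_def by (rule on_sections_hom, rule presheaf_homI) simp_all
qed

lemma stv_id:
 assumes "pb_pre f M" and x: "x \<in> Pts (src f)" and e: "e \<in> Stk f M x"
 shows "stv f M (mod_id (src f) (pullback f M)) x e = e"
proof -
 interpret A: pb_pre f M by fact
 interpret AB: pb_two f M f M by unfold_locales simp
 interpret Ax: pb_pt f M x by (rule A.pt_locale[OF x])
 obtain W s where W: "A.X.opn W" "x \<in> W" "s \<in> Sec A.PB W" "s x = e" using Ax.pt_surj[OF e] .
 show ?thesis
  unfolding W(4)[symmetric] AB.stv_sec[OF mod_id_hom[OF A.mpre_PB] W(1-3)]
  by (simp add: mod_id_def on_sections_apply W)
qed

context
 fixes h :: "('x, 'r, 'y, 's) rs_mor" and X Y and Z :: "('z, 't) rspace"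
 assumes h: "h \<in> mor X Y"
begin

lemma src_phi: "src h = X" "tgt h = Y" using rsmI(2,3)[OF h] by simp_all

lemma gpull1_in:
 assumes f: "f \<in> mor Y Z" and g: "g \<in> mor Y Z" and A: "sheaf_of_modules Z A" and B: "sheaf_of_modules Z B"
  and u: "u \<in> mod_hom Y (pullback f A) (pullback g B)"
 shows "gpull1 h f g A B u \<in> mod_hom X (pullback (f oo h) A) (pullback (g oo h) B)"
 using pull2.gpull1_hom[OF pull2I[OF h f g A B], of u] u src_phi rsmI(2)[OF f] by simp

lemma gpull1_val:
 assumes f: "f \<in> mor Y Z" and g: "g \<in> mor Y Z" and A: "sheaf_of_modules Z A" and B: "sheaf_of_modules Z B"
  and u: "u \<in> mod_hom Y (pullback f A) (pullback g B)"
  and x: "x \<in> Pts X" and e: "e \<in> Stk f A (pt h x)"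
 shows "stv (f oo h) A (gpull1 h f g A B u) x (kap f h A x e) = kap g h B x (stv f A u (pt h x) e)"
 using pull2.gpull1_stv[OF pull2I[OF h f g A B], of u x e] u x e src_phi rsmI(2)[OF f] by simp

lemma gpull1_eqI:
 assumes f: "f \<in> mor Y Z" and g: "g \<in> mor Y Z" and A: "sheaf_of_modules Z A" and B: "sheaf_of_modules Z B"
  and u: "u \<in> mod_hom Y (pullback f A) (pullback g B)"
  and w: "w \<in> mod_hom X (pullback (f oo h) A) (pullback (g oo h) B)"
  and eq: "\<And>x e. x \<in> Pts X \<Longrightarrow> e \<in> Stk f A (pt h x) \<Longrightarrow>
   stv (f oo h) A w x (kap f h A x e) = kap g h B x (stv f A u (pt h x) e)"
 shows "gpull1 h f g A B u = w"
 using pull2.gpull1_unique[OF pull2I[OF h f g A B], of u w] u w eq src_phi rsmI(2)[OF f] by simp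

lemma kap_closed:
 assumes f: "f \<in> mor Y Z" and A: "sheaf_of_modules Z A" and x: "x \<in> Pts X"
 shows "e \<in> Stk f A (pt h x) \<Longrightarrow> kap f h A x e \<in> Stk (f oo h) A x"
  and "e \<in> Stk f A (pt h x) \<Longrightarrow> e' \<in> Stk f A (pt h x) \<Longrightarrow>
   kap f h A x (e \<oplus>\<^bsub>pb_stalk f A (pt h x)\<^esub> e') = kap f h A x e \<oplus>\<^bsub>pb_stalk (f oo h) A x\<^esub> kap f h A x e'"
proof -
 interpret pb_comp f A h by (rule pb_compI[OF h f A])
 interpret pb_comp_pt f A h x by (rule comp_pt_locale) (simp add: x src_phi)
 show "e \<in> Stk f A (pt h x) \<Longrightarrow> kap f h A x e \<in> Stk (f oo h) A x"
  by (rule kap.closed)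
 show "e \<in> Stk f A (pt h x) \<Longrightarrow> e' \<in> Stk f A (pt h x) \<Longrightarrow>
   kap f h A x (e \<oplus>\<^bsub>pb_stalk f A (pt h x)\<^esub> e') = kap f h A x e \<oplus>\<^bsub>pb_stalk (f oo h) A x\<^esub> kap f h A x e'"
  by (rule kap.add)
qed

lemma phi_pt: "x \<in> Pts X \<Longrightarrow> pt h x \<in> Pts Y"
 using rsm.pt_in[OF rsmI(1)[OF h]] src_phi by simp

end

lemma stv_closed:
 assumes f: "f \<in> mor Y Z" and g: "g \<in> mor Y Z'" and A: "sheaf_of_modules Z A" and B: "sheaf_of_modules Z' B"
  and u: "u \<in> mod_hom Y (pullback f A) (pullback g B)"
  and y: "y \<in> Pts Y" and e: "e \<in> Stk f A y"
 shows "stv f A u y e \<in> Stk g B y"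
proof -
 interpret T: pb_two f A g B
  using pb_preI[OF f A] pb_preI[OF g B] rsmI(2)[OF f] rsmI(2)[OF g] by (simp add: pb_two_def pb_two_axioms_def)
 show ?thesis using T.stv_lin[of u y] u y e rsmI(2)[OF f] by (auto simp: lin_map_def add_hom_def)
qed

lemma stv_hadd':
 assumes f: "f \<in> mor Y Z" and g: "g \<in> mor Y Z'" and A: "sheaf_of_modules Z A" and B: "sheaf_of_modules Z' B"
  and u: "u \<in> mod_hom Y (pullback f A) (pullback g B)" and v: "v \<in> mod_hom Y (pullback f A) (pullback g B)"
  and y: "y \<in> Pts Y" and e: "e \<in> Stk f A y"
 shows "stv f A (hadd Y (pullback f A) (pullback g B) u v) y e = stv f A u y e \<oplus>\<^bsub>pb_stalk g B y\<^esub> stv f A v y e"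
 using stv_hadd[OF pb_preI[OF f A] pb_preI[OF g B], of u v y e] u v y e rsmI(2)[OF f] rsmI(2)[OF g] by simp

lemma stv_comp':
 assumes f: "f \<in> mor Y Z" and g: "g \<in> mor Y Z'" and k: "k \<in> mor Y Z''"
  and A: "sheaf_of_modules Z A" and B: "sheaf_of_modules Z' B" and C: "sheaf_of_modules Z'' C"
  and u: "u \<in> mod_hom Y (pullback f A) (pullback g B)" and v: "v \<in> mod_hom Y (pullback g B) (pullback k C)"
  and y: "y \<in> Pts Y" and e: "e \<in> Stk f A y"
 shows "stv f A (mod_comp Y (pullback f A) v u) y e = stv g B v y (stv f A u y e)"
 using stv_comp[OF pb_preI[OF f A] pb_preI[OF g B] pb_preI[OF k C], of u v y e] u v y e
  rsmI(2)[OF f] rsmI(2)[OF g] rsmI(2)[OF k] by simp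

lemma mod_comp_hom':
 assumes A: "sheaf_of_modules Y A" and u: "u \<in> mod_hom Y A B" and v: "v \<in> mod_hom Y B C"
 shows "mod_comp Y A v u \<in> mod_hom Y A C"
 using mpre.mod_comp_hom[OF sheaf_of_modules_mpre[OF A] u v] .

lemma hadd_hom':
 assumes A: "sheaf_of_modules Y A" and B: "sheaf_of_modules Y B" and u: "u \<in> mod_hom Y A B" and v: "v \<in> mod_hom Y A B"
 shows "hadd Y A B u v \<in> mod_hom Y A B"
 using hadd_hom[OF sheaf_of_modules_mpre[OF A] sheaf_of_modules_mpre[OF B] u v] .

text \<open>Here and in \<open>gpull1_comp\<close> and \<open>gpull1_id\<close>, the right-hand side
  is shown to satisfy the square with \<open>kap\<close> that characterises the left-hand side. For
  sums this works because \<open>kap\<close> is additive.\<close>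

lemma gpull1_add:
 assumes h: "h \<in> mor X Y" and f: "f \<in> mor Y Z" and g: "g \<in> mor Y Z" and A: "sheaf_of_modules Z A" and B: "sheaf_of_modules Z B"
  and u: "u \<in> mod_hom Y (pullback f A) (pullback g B)" and v: "v \<in> mod_hom Y (pullback f A) (pullback g B)"
 shows "gpull1 h f g A B (hadd Y (pullback f A) (pullback g B) u v) =
  hadd X (pullback (f oo h) A) (pullback (g oo h) B) (gpull1 h f g A B u) (gpull1 h f g A B v)"
proof (rule gpull1_eqI[OF h f g A B])
 note fh = comp_in_mor[OF f h] and gh = comp_in_mor[OF g h]
 show "hadd Y (pullback f A) (pullback g B) u v \<in> mod_hom Y (pullback f A) (pullback g B)"
  by (rule hadd_hom'[OF pullback_sheaf[OF f A] pullback_sheaf[OF g B] u v])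
 show "hadd X (pullback (f oo h) A) (pullback (g oo h) B) (gpull1 h f g A B u) (gpull1 h f g A B v) \<in>
  mod_hom X (pullback (f oo h) A) (pullback (g oo h) B)"
  by (rule hadd_hom'[OF pullback_sheaf[OF fh A] pullback_sheaf[OF gh B] gpull1_in[OF h f g A B u] gpull1_in[OF h f g A B v]])
 fix x e assume x: "x \<in> Pts X" and e: "e \<in> Stk f A (pt h x)"
 note y = phi_pt[OF h x]
 show "stv (f oo h) A (hadd X (pullback (f oo h) A) (pullback (g oo h) B) (gpull1 h f g A B u) (gpull1 h f g A B v)) x (kap f h A x e) =
  kap g h B x (stv f A (hadd Y (pullback f A) (pullback g B) u v) (pt h x) e)"
  unfolding stv_hadd'[OF fh gh A B gpull1_in[OF h f g A B u] gpull1_in[OF h f g A B v] x kap_closed(1)[OF h f A x e]]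
   stv_hadd'[OF f g A B u v y e] gpull1_val[OF h f g A B u x e] gpull1_val[OF h f g A B v x e]
  by (rule kap_closed(2)[OF h g B x stv_closed[OF f g A B u y e] stv_closed[OF f g A B v y e], symmetric])
qed

lemma gpull1_comp:
 assumes h: "h \<in> mor X Y" and f: "f \<in> mor Y Z" and g: "g \<in> mor Y Z" and k: "k \<in> mor Y Z"
  and A: "sheaf_of_modules Z A" and B: "sheaf_of_modules Z B" and C: "sheaf_of_modules Z C"
  and u: "u \<in> mod_hom Y (pullback f A) (pullback g B)" and v: "v \<in> mod_hom Y (pullback g B) (pullback k C)"
 shows "gpull1 h f k A C (mod_comp Y (pullback f A) v u) =
  mod_comp X (pullback (f oo h) A) (gpull1 h g k B C v) (gpull1 h f g A B u)"
proof (rule gpull1_eqI[OF h f k A C])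
 note fh = comp_in_mor[OF f h] and gh = comp_in_mor[OF g h] and kh = comp_in_mor[OF k h]
 show "mod_comp Y (pullback f A) v u \<in> mod_hom Y (pullback f A) (pullback k C)"
  by (rule mod_comp_hom'[OF pullback_sheaf[OF f A] u v])
 show "mod_comp X (pullback (f oo h) A) (gpull1 h g k B C v) (gpull1 h f g A B u) \<in> mod_hom X (pullback (f oo h) A) (pullback (k oo h) C)"
  by (rule mod_comp_hom'[OF pullback_sheaf[OF fh A] gpull1_in[OF h f g A B u] gpull1_in[OF h g k B C v]])
 fix x e assume x: "x \<in> Pts X" and e: "e \<in> Stk f A (pt h x)"
 note y = phi_pt[OF h x]
 show "stv (f oo h) A (mod_comp X (pullback (f oo h) A) (gpull1 h g k B C v) (gpull1 h f g A B u)) x (kap f h A x e) =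
  kap k h C x (stv f A (mod_comp Y (pullback f A) v u) (pt h x) e)"
  unfolding stv_comp'[OF fh gh kh A B C gpull1_in[OF h f g A B u] gpull1_in[OF h g k B C v] x kap_closed(1)[OF h f A x e]]
   stv_comp'[OF f g k A B C u v y e] gpull1_val[OF h f g A B u x e]
  by (rule gpull1_val[OF h g k B C v x stv_closed[OF f g A B u y e]])
qed

lemma gpull1_id:
 assumes h: "h \<in> mor X Y" and f: "f \<in> mor Y Z" and A: "sheaf_of_modules Z A"
 shows "gpull1 h f f A A (mod_id Y (pullback f A)) = mod_id X (pullback (f oo h) A)"
proof (rule gpull1_eqI[OF h f f A A])
 note fh = comp_in_mor[OF f h]
 show "mod_id Y (pullback f A) \<in> mod_hom Y (pullback f A) (pullback f A)"
  by (rule mod_id_hom[OF sheaf_of_modules_mpre[OF pullback_sheaf[OF f A]]])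
 show "mod_id X (pullback (f oo h) A) \<in> mod_hom X (pullback (f oo h) A) (pullback (f oo h) A)"
  by (rule mod_id_hom[OF sheaf_of_modules_mpre[OF pullback_sheaf[OF fh A]]])
 fix x e assume x: "x \<in> Pts X" and e: "e \<in> Stk f A (pt h x)"
 show "stv (f oo h) A (mod_id X (pullback (f oo h) A)) x (kap f h A x e) = kap f h A x (stv f A (mod_id Y (pullback f A)) (pt h x) e)"
  using stv_id[OF pb_preI[OF fh A], of x "kap f h A x e"] stv_id[OF pb_preI[OF f A], of "pt h x" e]
   x e kap_closed(1)[OF h f A x e] phi_pt[OF h x] rsmI(2)[OF f] rsmI(2)[OF fh] rsmI(2)[OF h] by simp
qed

lemma comp_assoc': "f \<in> mor Y Z \<Longrightarrow> g \<in> mor X Y \<Longrightarrow> h \<in> mor W X \<Longrightarrow> f oo (g oo h) = f oo g oo h"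
 using comp_assoc[of f g h] rsmI[of f Y Z] rsmI[of g X Y] rsmI[of h W X] by simp

text \<open>The square for \<open>h \<circ> l\<close> is obtained by stacking the squares for
  \<open>h\<close> and \<open>l\<close>, because \<open>kap\<close> along a composite is the
  composite of the base changes.\<close>

lemma gpull1_gpull1:
 assumes l: "l \<in> mor W X" and h: "h \<in> mor X Y" and f: "f \<in> mor Y Z" and g: "g \<in> mor Y Z"
  and A: "sheaf_of_modules Z A" and B: "sheaf_of_modules Z B"
  and u: "u \<in> mod_hom Y (pullback f A) (pullback g B)"
 shows "gpull1 l (f oo h) (g oo h) A B (gpull1 h f g A B u) = gpull1 (h oo l) f g A B u"
proof (rule gpull1_eqI[OF comp_in_mor[OF h l] f g A B u, symmetric])
 note fh = comp_in_mor[OF f h] and gh = comp_in_mor[OF g h]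
 note in1 = gpull1_in[OF h f g A B u]
 show "gpull1 l (f oo h) (g oo h) A B (gpull1 h f g A B u) \<in> mod_hom W (pullback (f oo (h oo l)) A) (pullback (g oo (h oo l)) B)"
  using gpull1_in[OF l fh gh A B in1] by (simp add: comp_assoc'[OF f h l] comp_assoc'[OF g h l])
 fix x e assume x: "x \<in> Pts W" and e: "e \<in> Stk f A (pt (h oo l) x)"
 have p: "pt (h oo l) x = pt h (pt l x)" using x rsmI(2)[OF l] by (simp add: pt_comp)
 note e' = e[unfolded p]
 note y = phi_pt[OF l x] and z = phi_pt[OF h phi_pt[OF l x]]
 show "stv (f oo (h oo l)) A (gpull1 l (f oo h) (g oo h) A B (gpull1 h f g A B u)) x (kap f (h oo l) A x e) =
  kap g (h oo l) B x (stv f A u (pt (h oo l) x) e)"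
  unfolding p kap_kap[OF l h f A x e'] kap_kap[OF l h g B x stv_closed[OF f g A B u z e']]
   comp_assoc'[OF f h l] gpull1_val[OF l fh gh A B in1 x kap_closed(1)[OF h f A y e']] gpull1_val[OF h f g A B u y e'] ..
qed

lemma gunfold1_in:
 assumes f: "f \<in> mor X Y" and g: "g \<in> mor X Y" and k: "k \<in> mor Y Z" and k': "k' \<in> mor Y Z"
  and A: "sheaf_of_modules Z A" and B: "sheaf_of_modules Z B"
  and u: "u \<in> mod_hom X (pullback (k oo f) A) (pullback (k' oo g) B)"
 shows "gunfold1 k k' f g A B u \<in> mod_hom X (pullback f (pullback k A)) (pullback g (pullback k' B))"
 using unf2.gunfold1_hom[OF unf2I[OF f g k k' A B], of u] u rsmI(2)[OF f] by simp

lemma gunfold1_val: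
 assumes f: "f \<in> mor X Y" and g: "g \<in> mor X Y" and k: "k \<in> mor Y Z" and k': "k' \<in> mor Y Z"
  and A: "sheaf_of_modules Z A" and B: "sheaf_of_modules Z B"
  and u: "u \<in> mod_hom X (pullback (k oo f) A) (pullback (k' oo g) B)"
  and x: "x \<in> Pts X" and c: "c \<in> Stk f (pullback k A) x"
 shows "canx k' g B x (stv f (pullback k A) (gunfold1 k k' f g A B u) x c) = stv (k oo f) A u x (canx k f A x c)"
 using unf2.gunfold1_stv[OF unf2I[OF f g k k' A B], of u x c] u x c rsmI(2)[OF f] by simp

lemma gunfold1_eqI:
 assumes f: "f \<in> mor X Y" and g: "g \<in> mor X Y" and k: "k \<in> mor Y Z" and k': "k' \<in> mor Y Z"
  and A: "sheaf_of_modules Z A" and B: "sheaf_of_modules Z B"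
  and u: "u \<in> mod_hom X (pullback (k oo f) A) (pullback (k' oo g) B)"
  and w: "w \<in> mod_hom X (pullback f (pullback k A)) (pullback g (pullback k' B))"
  and eq: "\<And>x c. x \<in> Pts X \<Longrightarrow> c \<in> Stk f (pullback k A) x \<Longrightarrow>
   canx k' g B x (stv f (pullback k A) w x c) = stv (k oo f) A u x (canx k f A x c)"
 shows "gunfold1 k k' f g A B u = w"
 using unf2.gunfold1_unique[OF unf2I[OF f g k k' A B], of u w] u w eq rsmI(2)[OF f] by simp

lemma canx_props:
 assumes f: "f \<in> mor X Y" and k: "k \<in> mor Y Z" and A: "sheaf_of_modules Z A" and x: "x \<in> Pts X"
 shows canx_closed: "c \<in> Stk f (pullback k A) x \<Longrightarrow> canx k f A x c \<in> Stk (k oo f) A x"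
  and canx_add: "c \<in> Stk f (pullback k A) x \<Longrightarrow> d \<in> Stk f (pullback k A) x \<Longrightarrow>
   canx k f A x (c \<oplus>\<^bsub>pb_stalk f (pullback k A) x\<^esub> d) = canx k f A x c \<oplus>\<^bsub>pb_stalk (k oo f) A x\<^esub> canx k f A x d"
  and canx_linear: "lin_map (stalk_ring X x) (pb_stalk f (pullback k A) x) (pb_stalk (k oo f) A x) (canx k f A x)"
proof -
 interpret pb_comp k A f by (rule pb_compI[OF f k A])
 interpret pb_comp_pt k A f x by (rule comp_pt_locale) (simp add: x rsmI(2)[OF f])
 show *: "lin_map (stalk_ring X x) (pb_stalk f (pullback k A) x) (pb_stalk (k oo f) A x) (canx k f A x)"
  using canx_lin rsmI(2)[OF f] by simp
 show "c \<in> Stk f (pullback k A) x \<Longrightarrow> canx k f A x c \<in> Stk (k oo f) A x"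
  "c \<in> Stk f (pullback k A) x \<Longrightarrow> d \<in> Stk f (pullback k A) x \<Longrightarrow>
   canx k f A x (c \<oplus>\<^bsub>pb_stalk f (pullback k A) x\<^esub> d) = canx k f A x c \<oplus>\<^bsub>pb_stalk (k oo f) A x\<^esub> canx k f A x d"
  using * by (auto simp: lin_map_def add_hom_def)
qed

lemma gunfold1_add:
 assumes f: "f \<in> mor X Y" and g: "g \<in> mor X Y" and k: "k \<in> mor Y Z" and k': "k' \<in> mor Y Z"
  and A: "sheaf_of_modules Z A" and B: "sheaf_of_modules Z B"
  and u: "u \<in> mod_hom X (pullback (k oo f) A) (pullback (k' oo g) B)"
  and v: "v \<in> mod_hom X (pullback (k oo f) A) (pullback (k' oo g) B)"
 shows "gunfold1 k k' f g A B (hadd X (pullback (k oo f) A) (pullback (k' oo g) B) u v) =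
  hadd X (pullback f (pullback k A)) (pullback g (pullback k' B)) (gunfold1 k k' f g A B u) (gunfold1 k k' f g A B v)"
proof (rule gunfold1_eqI[OF f g k k' A B])
 note ga = comp_in_mor[OF k f] and gb = comp_in_mor[OF k' g] and pA = pullback_sheaf[OF k A] and pB = pullback_sheaf[OF k' B]
 note iu = gunfold1_in[OF f g k k' A B u] and iv = gunfold1_in[OF f g k k' A B v]
 show "hadd X (pullback (k oo f) A) (pullback (k' oo g) B) u v \<in> mod_hom X (pullback (k oo f) A) (pullback (k' oo g) B)"
  by (rule hadd_hom'[OF pullback_sheaf[OF ga A] pullback_sheaf[OF gb B] u v])
 show "hadd X (pullback f (pullback k A)) (pullback g (pullback k' B)) (gunfold1 k k' f g A B u) (gunfold1 k k' f g A B v)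
   \<in> mod_hom X (pullback f (pullback k A)) (pullback g (pullback k' B))"
  by (rule hadd_hom'[OF pullback_sheaf[OF f pA] pullback_sheaf[OF g pB] iu iv])
 fix x c assume x: "x \<in> Pts X" and c: "c \<in> Stk f (pullback k A) x"
 show "canx k' g B x (stv f (pullback k A) (hadd X (pullback f (pullback k A)) (pullback g (pullback k' B)) (gunfold1 k k' f g A B u) (gunfold1 k k' f g A B v)) x c) =
  stv (k oo f) A (hadd X (pullback (k oo f) A) (pullback (k' oo g) B) u v) x (canx k f A x c)"
  unfolding stv_hadd'[OF f g pA pB iu iv x c] stv_hadd'[OF ga gb A B u v x canx_closed[OF f k A x c]]
   canx_add[OF g k' B x stv_closed[OF f g pA pB iu x c] stv_closed[OF f g pA pB iv x c]]
   gunfold1_val[OF f g k k' A B u x c] gunfold1_val[OF f g k k' A B v x c] ..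
qed

lemma gunfold1_comp:
 assumes f: "f \<in> mor X Y" and g: "g \<in> mor X Y" and \<delta>: "\<delta> \<in> mor X Y"
  and k: "k \<in> mor Y Z" and k': "k' \<in> mor Y Z" and k'': "k'' \<in> mor Y Z"
  and A: "sheaf_of_modules Z A" and B: "sheaf_of_modules Z B" and C: "sheaf_of_modules Z C"
  and u: "u \<in> mod_hom X (pullback (k oo f) A) (pullback (k' oo g) B)"
  and v: "v \<in> mod_hom X (pullback (k' oo g) B) (pullback (k'' oo \<delta>) C)"
 shows "gunfold1 k k'' f \<delta> A C (mod_comp X (pullback (k oo f) A) v u) =
  mod_comp X (pullback f (pullback k A)) (gunfold1 k' k'' g \<delta> B C v) (gunfold1 k k' f g A B u)"
proof (rule gunfold1_eqI[OF f \<delta> k k'' A C])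
 note ga = comp_in_mor[OF k f] and gb = comp_in_mor[OF k' g] and gd = comp_in_mor[OF k'' \<delta>]
  and pA = pullback_sheaf[OF k A] and pB = pullback_sheaf[OF k' B] and pC = pullback_sheaf[OF k'' C]
 note iu = gunfold1_in[OF f g k k' A B u] and iv = gunfold1_in[OF g \<delta> k' k'' B C v]
 show "mod_comp X (pullback (k oo f) A) v u \<in> mod_hom X (pullback (k oo f) A) (pullback (k'' oo \<delta>) C)"
  by (rule mod_comp_hom'[OF pullback_sheaf[OF ga A] u v])
 show "mod_comp X (pullback f (pullback k A)) (gunfold1 k' k'' g \<delta> B C v) (gunfold1 k k' f g A B u)
  \<in> mod_hom X (pullback f (pullback k A)) (pullback \<delta> (pullback k'' C))"
  by (rule mod_comp_hom'[OF pullback_sheaf[OF f pA] iu iv])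
 fix x c assume x: "x \<in> Pts X" and c: "c \<in> Stk f (pullback k A) x"
 show "canx k'' \<delta> C x (stv f (pullback k A) (mod_comp X (pullback f (pullback k A)) (gunfold1 k' k'' g \<delta> B C v) (gunfold1 k k' f g A B u)) x c) =
  stv (k oo f) A (mod_comp X (pullback (k oo f) A) v u) x (canx k f A x c)"
  unfolding stv_comp'[OF f g \<delta> pA pB pC iu iv x c] stv_comp'[OF ga gb gd A B C u v x canx_closed[OF f k A x c]]
   gunfold1_val[OF g \<delta> k' k'' B C v x stv_closed[OF f g pA pB iu x c]] gunfold1_val[OF f g k k' A B u x c] ..
qed

lemma gunfold1_id:
 assumes f: "f \<in> mor X Y" and k: "k \<in> mor Y Z" and A: "sheaf_of_modules Z A"
 shows "gunfold1 k k f f A A (mod_id X (pullback (k oo f) A)) = mod_id X (pullback f (pullback k A))"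
proof (rule gunfold1_eqI[OF f f k k A A])
 note ga = comp_in_mor[OF k f] and pA = pullback_sheaf[OF k A]
 show "mod_id X (pullback (k oo f) A) \<in> mod_hom X (pullback (k oo f) A) (pullback (k oo f) A)"
  by (rule mod_id_hom[OF sheaf_of_modules_mpre[OF pullback_sheaf[OF ga A]]])
 show "mod_id X (pullback f (pullback k A)) \<in> mod_hom X (pullback f (pullback k A)) (pullback f (pullback k A))"
  by (rule mod_id_hom[OF sheaf_of_modules_mpre[OF pullback_sheaf[OF f pA]]])
 fix x c assume x: "x \<in> Pts X" and c: "c \<in> Stk f (pullback k A) x"
 show "canx k f A x (stv f (pullback k A) (mod_id X (pullback f (pullback k A))) x c) =
  stv (k oo f) A (mod_id X (pullback (k oo f) A)) x (canx k f A x c)"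
  using stv_id[OF pb_preI[OF f pA], of x c] stv_id[OF pb_preI[OF ga A], of x "canx k f A x c"]
   x c canx_closed[OF f k A x c] rsmI(2)[OF f] by simp
qed

text \<open>Transport commutes with unfolding because base change is natural for the canonical
  isomorphisms (\<open>can_kap\<close>). The fibrewise linear maps are again compared on elements
  \<open>kap d\<close> only.\<close>

lemma gpull1_gunfold1:
 assumes h: "h \<in> mor W X" and f: "f \<in> mor X Y" and g: "g \<in> mor X Y" and k: "k \<in> mor Y Z" and k': "k' \<in> mor Y Z"
  and A: "sheaf_of_modules Z A" and B: "sheaf_of_modules Z B"
  and u: "u \<in> mod_hom X (pullback (k oo f) A) (pullback (k' oo g) B)"
 shows "gpull1 h f g (pullback k A) (pullback k' B) (gunfold1 k k' f g A B u) =
  gunfold1 k k' (f oo h) (g oo h) A B (gpull1 h (k oo f) (k' oo g) A B u)"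
proof (rule gunfold1_eqI[OF _ _ k k' A B, symmetric])
 note ga = comp_in_mor[OF k f] and gb = comp_in_mor[OF k' g]
  and pA = pullback_sheaf[OF k A] and pB = pullback_sheaf[OF k' B]
  and fh = comp_in_mor[OF f h] and gh = comp_in_mor[OF g h]
 show "f oo h \<in> mor W Y" "g oo h \<in> mor W Y" by (fact fh, fact gh)
 note iu = gunfold1_in[OF f g k k' A B u]
 note as = comp_assoc'[OF k f h] comp_assoc'[OF k' g h]
 show "gpull1 h (k oo f) (k' oo g) A B u \<in> mod_hom W (pullback (k oo (f oo h)) A) (pullback (k' oo (g oo h)) B)"
  unfolding as by (rule gpull1_in[OF h ga gb A B u])
 show "gpull1 h f g (pullback k A) (pullback k' B) (gunfold1 k k' f g A B u)
  \<in> mod_hom W (pullback (f oo h) (pullback k A)) (pullback (g oo h) (pullback k' B))"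
  by (rule gpull1_in[OF h f g pA pB iu])
 note giu = this
 fix x c assume x: "x \<in> Pts W" and c: "c \<in> Stk (f oo h) (pullback k A) x"
 interpret k: pb_comp f "pullback k A" h by (rule pb_compI[OF h f pA])
 interpret k: pb_comp_pt f "pullback k A" h x by (rule k.comp_pt_locale) (simp add: x rsmI(2)[OF h])
 interpret h: pb_comp "k' oo g" B h by (rule pb_compI[OF h gb B])
 interpret h: pb_comp_pt "k' oo g" B h x by (rule h.comp_pt_locale) (simp add: x rsmI(2)[OF h])
 interpret T1: pb_two "f oo h" "pullback k A" "g oo h" "pullback k' B"
  using pb_preI[OF fh pA] pb_preI[OF gh pB] by (simp add: pb_two_def pb_two_axioms_def)
 interpret T2: pb_two "k oo f oo h" A "k' oo g oo h" B
  using pb_preI[OF comp_in_mor[OF ga h] A] pb_preI[OF comp_in_mor[OF gb h] B] by (simp add: pb_two_def pb_two_axioms_def)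
 have sp: "src h = W" by (rule rsmI(2)[OF h])
 have complin: "lin_map R A' C' (\<lambda>e. v (u e))" if "lin_map R A' B' u" "lin_map R B' C' v" for R A' B' C' u v
  using that by (auto simp: lin_map_def add_hom_def Pi_iff)
 note l1 = T1.stv_lin[unfolded comp_simps sp, OF giu x] and l2 = T2.stv_lin[unfolded comp_simps sp, OF gpull1_in[OF h ga gb A B u] x]
 show "canx k' (g oo h) B x (stv (f oo h) (pullback k A) (gpull1 h f g (pullback k A) (pullback k' B) (gunfold1 k k' f g A B u)) x c) =
  stv (k oo (f oo h)) A (gpull1 h (k oo f) (k' oo g) A B u) x (canx k (f oo h) A x c)"
  unfolding as(1)
 proof (rule k.kap_ext[unfolded sp, OF complin[OF l1 canx_linear[OF gh k' B x, unfolded as]]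
    complin[OF canx_linear[OF fh k A x, unfolded as] l2] h.h_left_module[unfolded sp] _ c])
  fix d assume d: "d \<in> Stk f (pullback k A) (pt h x)"
  note y = phi_pt[OF h x]
  show "canx k' (g oo h) B x (stv (f oo h) (pullback k A) (gpull1 h f g (pullback k A) (pullback k' B) (gunfold1 k k' f g A B u)) x (kap f h (pullback k A) x d)) =
   stv (k oo f oo h) A (gpull1 h (k oo f) (k' oo g) A B u) x (canx k (f oo h) A x (kap f h (pullback k A) x d))"
   unfolding gpull1_val[OF h f g pA pB iu x d] can_kap[OF h g k' B x stv_closed[OF f g pA pB iu y d]]
    gunfold1_val[OF f g k k' A B u y d] can_kap[OF h f k A x d]
    gpull1_val[OF h ga gb A B u x canx_closed[OF f k A y d]] ..
 qed
qed

section \<open>Pullback along the identity\<close>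

lemma stalk_comor_id:
 assumes X: "ringed_space X" and x: "x \<in> Pts X" and a: "a \<in> carrier (stalk_ring X x)"
 shows "stalk_comor (id_mor X) x a = a"
proof -
 interpret rsm "id_mor X" by (rule rsmI(1)[OF id_in_mor[OF X]])
 interpret rsm_pt "id_mor X" x by unfold_locales (simp add: x)
 interpret r: rsp_pt X x using X x by (simp add: rsp_pt_def rsp_pt_axioms_def rsp_def)
 obtain U s where U: "r.nb U" "s \<in> Rsec X U" "a = rgerm X x U s" using r.carrierE[OF a] .
 have p: "pt (id_mor X) x = x" using x by (simp add: id_mor_def)
 have "stalk_comor (id_mor X) x (rgerm X x U s) = rgerm X x (preim (id_mor X) U) (comor (id_mor X) U s)"
  using stalk_comor_rgerm[of U s, unfolded id_mor_simps p] U(1,2) by blast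
 then show ?thesis using U(1,2) unfolding U(3) by (simp only: preim_id[OF r.opn_top_sub] comor_id)
qed

lemma kap_id:
 assumes f: "f \<in> mor X Y" and A: "sheaf_of_modules Y A" and x: "x \<in> Pts X" and e: "e \<in> Stk f A x"
 shows "kap f (id_mor X) A x e = e"
proof -
 have X: "ringed_space X" using rsm.mor[OF rsmI(1)[OF f]] rsmI(2)[OF f] by (simp add: rs_morphism_def)
 note i = id_in_mor[OF X]
 interpret pb_comp f A "id_mor X" by (rule pb_compI[OF i f A])
 interpret pb_comp_pt f A "id_mor X" x by (rule comp_pt_locale) (simp add: x)
 have p: "pt (id_mor X) x = x" using x by (simp add: id_mor_def)
 have fi: "f oo id_mor X = f" using comp_id[OF rsmI(1)[OF f]] rsmI(2)[OF f] by simp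
 have s: "src f = X" by (rule rsmI(2)[OF f])
 show ?thesis
 proof (rule Fy.pt_ext[unfolded p, OF kap_hom[unfolded p fi] _ _ _ e])
  show "add_hom (pb_stalk f A x) (pb_stalk f A x) (\<lambda>e. e)" by (simp add: add_hom_def)
  show "abelian_group (pb_stalk f A x)" using Fy.P.M.abelian_group_axioms unfolding p .
  fix r m assume "r \<in> carrier (stalk_ring (src f) x)" "m \<in> carrier (stalk_mod (tgt f) A (pt f x))"
  then show "kap f (id_mor X) A x (pb_tens f A x r m) = pb_tens f A x r m"
   using kap_tens[unfolded p fi, of r m] stalk_comor_id[OF X x, of r] s by simp
 qed
qed

definition gid1 where
 "gid1 X A B u = mod_comp X A (mod_inv X B (pullback (id_mor X) B) (can_id X B)) (mod_comp X A u (can_id X A))"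

text \<open>\<open>can_id\<close> takes a section to its unit section, and \<open>can_comp\<close>
  with the identity as second morphism evaluates this by \<open>kap f id\<close>, which changes
  nothing. So \<open>can_id\<close> on a pullback is an inverse canonical isomorphism of the kind
  already treated.\<close>

lemma can_comp_can_id:
 assumes f: "f \<in> mor X Y" and A: "sheaf_of_modules Y A"
  and W: "openin (rtop X) W" and s: "s \<in> Sec (pullback f A) W"
 shows "can_id X (pullback f A) W s \<in> Sec (pullback (id_mor X) (pullback f A)) W"
  and "can_comp f (id_mor X) A W (can_id X (pullback f A) W s) = s"
proof -
 have X: "ringed_space X" using rsm.mor[OF rsmI(1)[OF f]] rsmI(2)[OF f] by (simp add: rs_morphism_def)
 note i = id_in_mor[OF X]
 have fi: "f oo id_mor X = f" using comp_id[OF rsmI(1)[OF f]] rsmI(2)[OF f] by simp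
 have sf: "src f = X" by (rule rsmI(2)[OF f])
 interpret c: pb_comp f A "id_mor X" by (rule pb_compI[OF i f A])
 interpret T: pb_two "id_mor X" "pullback f A" f A
  using c.pb_pre_G pb_preI[OF f A] sf by (simp add: pb_two_def pb_two_axioms_def)
 have pW: "preim (id_mor X) W = W" by (rule preim_id[OF openin_subset[OF W]])
 have pt: "pt (id_mor X) y = y" if "y \<in> W" for y using that openin_subset[OF W] by (auto simp: id_mor_def)
 let ?s = "can_id X (pullback f A) W s"
 have eq: "?s = c.GP.usec W s"
  unfolding can_id_def on_sections_apply[OF W s] c.GP.usec_def pW id_mor_simps
  by (rule restrict_ext) (simp add: pt del: set_eq_iff)
 have c1: "?s \<in> Sec (pullback (id_mor X) (pullback f A)) W"
  using c.GP.usec_closed[of W s] W s unfolding eq pW id_mor_simps by simp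
 then show "?s \<in> Sec (pullback (id_mor X) (pullback f A)) W" .
 have ch: "can_comp f (id_mor X) A \<in> mod_hom X (pullback (id_mor X) (pullback f A)) (pullback f A)"
  using c.can_comp_hom unfolding fi id_mor_simps .
 show "can_comp f (id_mor X) A W ?s = s"
 proof (rule c.F.sec_eqI[OF presheaf_homD(1)[OF mod_homD[OF ch] W c1] s])
  fix y assume y: "y \<in> W"
  have yX: "y \<in> Pts X" using y openin_subset[OF W] by blast
  interpret q: pb_comp_pt f A "id_mor X" y by (rule c.comp_pt_locale) (simp add: yX)
  have sy: "s y \<in> Stk f A y" by (rule c.F.sec_val[OF s y])
  have val: "?s y = pb_tens (id_mor X) (pullback f A) y \<one>\<^bsub>stalk_ring X y\<^esub> (pb_pt.Lg f A y (s y))"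
   unfolding eq using y pW c.GP.usec_val[of y W s] q.Fy.Lg_sec[of W s, unfolded pt[OF y]] W s sf by (simp add: pt[OF y] del: set_eq_iff)
  have "can_comp f (id_mor X) A W ?s y = stv (id_mor X) (pullback f A) (can_comp f (id_mor X) A) y (?s y)"
   using T.stv_sec[unfolded id_mor_simps, OF ch W y c1] by simp
  also have "\<dots> = canx f (id_mor X) A y (?s y)"
   using c.stv_can_comp[of y "?s y"] yX c.GP.sec_val[OF c1 y] by simp
  also have "\<dots> = kap f (id_mor X) A y (s y)"
   unfolding val using q.canx_Lg[unfolded pt[OF y] id_mor_simps, OF sy] by simp
  also have "\<dots> = s y" by (rule kap_id[OF f A yX sy])
  finally show "can_comp f (id_mor X) A W ?s y = s y" .
 qed
qed

lemma can_id_iso: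
 assumes f: "f \<in> mor X Y" and A: "sheaf_of_modules Y A"
 shows "mod_iso X (pullback f A) (pullback (id_mor X) (pullback f A)) (can_id X (pullback f A))"
  and "can_id X (pullback f A) = mod_inv X (pullback (id_mor X) (pullback f A)) (pullback f A) (can_comp f (id_mor X) A)"
proof -
 have X: "ringed_space X" using rsm.mor[OF rsmI(1)[OF f]] rsmI(2)[OF f] by (simp add: rs_morphism_def)
 note i = id_in_mor[OF X]
 have fi: "f oo id_mor X = f" using comp_id[OF rsmI(1)[OF f]] rsmI(2)[OF f] by simp
 have pA: "sheaf_of_modules X (pullback f A)" by (rule pullback_sheaf[OF f A])
 interpret c: pb_comp f A "id_mor X" by (rule pb_compI[OF i f A])
 have iso: "mod_iso X (pullback (id_mor X) (pullback f A)) (pullback f A) (can_comp f (id_mor X) A)"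
  using c.can_comp_iso unfolding fi id_mor_simps .
 interpret I: mpre X "pullback (id_mor X) (pullback f A)" by (rule sheaf_of_modules_mpre[OF pullback_sheaf[OF i pA]])
 interpret P: mpre X "pullback f A" by (rule sheaf_of_modules_mpre[OF pA])
 note inv = I.mod_inv[OF iso P.mpre_axioms]
 let ?j = "mod_inv X (pullback (id_mor X) (pullback f A)) (pullback f A) (can_comp f (id_mor X) A)"
 show eq: "can_id X (pullback f A) = ?j"
 proof -
  have "can_id X (pullback f A) = on_sections X (pullback f A) (can_id X (pullback f A))"
   unfolding can_id_def on_sections_idem ..
  also have "\<dots> = on_sections X (pullback f A) ?j"
  proof (rule on_sections_cong)
   fix W s assume W: "openin (rtop X) W" and s: "s \<in> Sec (pullback f A) W"
   note cc = can_comp_can_id[OF f A W s]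
   show "can_id X (pullback f A) W s = ?j W s" using inv(3)[OF W cc(1)] cc(2) by simp
  qed
  also have "\<dots> = ?j" using inv(1) by (simp add: mod_hom_iff)
  finally show ?thesis .
 qed
 show "mod_iso X (pullback f A) (pullback (id_mor X) (pullback f A)) (can_id X (pullback f A))"
  unfolding eq mod_iso_def
 proof (intro conjI allI impI inv(1))
  fix W assume W: "openin (rtop X) W"
  have ch: "can_comp f (id_mor X) A \<in> mod_hom X (pullback (id_mor X) (pullback f A)) (pullback f A)"
   using iso by (simp add: mod_iso_def)
  show "bij_betw (?j W) (Sec (pullback f A) W) (Sec (pullback (id_mor X) (pullback f A)) W)"
   by (rule bij_betwI[where g = "can_comp f (id_mor X) A W"])
    (use inv(2,3)[OF W] presheaf_homD(1)[OF mod_homD[OF inv(1)] W] presheaf_homD(1)[OF mod_homD[OF ch] W] in \<open>simp_all add: Pi_iff\<close>)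
 qed
qed

text \<open>In level 0 both \<open>tau\<close> and \<open>rho\<close> are the identity. A
  transported component is unfolded over the identity and then, in \<open>gunfold_id\<close>,
  stripped of it; as \<open>can_id\<close> inverts \<open>can_comp\<close>, the two operations
  cancel.\<close>

lemma gid1_gunfold1:
 assumes f: "f \<in> mor X Y" and g: "g \<in> mor X Y" and A: "sheaf_of_modules Y A" and B: "sheaf_of_modules Y B"
  and w: "w \<in> mod_hom X (pullback f A) (pullback g B)"
 shows "gid1 X (pullback f A) (pullback g B) (gunfold1 f g (id_mor X) (id_mor X) A B w) = w"
proof -
 have X: "ringed_space X" using rsm.mor[OF rsmI(1)[OF f]] rsmI(2)[OF f] by (simp add: rs_morphism_def)
 note i = id_in_mor[OF X]
 have fi: "f oo id_mor X = f" "g oo id_mor X = g"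
  using comp_id[OF rsmI(1)[OF f]] comp_id[OF rsmI(1)[OF g]] rsmI(2)[OF f] rsmI(2)[OF g] by simp_all
 have pA: "sheaf_of_modules X (pullback f A)" and pB: "sheaf_of_modules X (pullback g B)"
  by (rule pullback_sheaf[OF f A], rule pullback_sheaf[OF g B])
 have w': "w \<in> mod_hom X (pullback (f oo id_mor X) A) (pullback (g oo id_mor X) B)" using w fi by simp
 note gw = gunfold1_in[OF i i f g A B w']
 note iA = can_id_iso[OF f A] and iB = can_id_iso[OF g B]
 interpret PA: mpre X "pullback f A" by (rule sheaf_of_modules_mpre[OF pA])
 interpret PB: mpre X "pullback g B" by (rule sheaf_of_modules_mpre[OF pB])
 have IB: "mpre X (pullback (id_mor X) (pullback g B))" by (rule sheaf_of_modules_mpre[OF pullback_sheaf[OF i pB]])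
 note invB = PB.mod_inv[OF iB(1) IB]
 have iA': "can_id X (pullback f A) \<in> mod_hom X (pullback f A) (pullback (id_mor X) (pullback f A))" using iA(1) by (simp add: mod_iso_def)
 have m1: "mod_comp X (pullback f A) (gunfold1 f g (id_mor X) (id_mor X) A B w) (can_id X (pullback f A))
  \<in> mod_hom X (pullback f A) (pullback (id_mor X) (pullback g B))"
  by (rule PA.mod_comp_hom[OF iA' gw])
 have m2: "gid1 X (pullback f A) (pullback g B) (gunfold1 f g (id_mor X) (id_mor X) A B w) \<in> mod_hom X (pullback f A) (pullback g B)"
  unfolding gid1_def by (rule PA.mod_comp_hom[OF m1 invB(1)])
 show ?thesis
 proof (rule mod_hom_ext[OF m2 w])
  fix W s assume W: "openin (rtop X) W" and s: "s \<in> Sec (pullback f A) W"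
  note cA = can_comp_can_id[OF f A W s]
  have ws: "w W s \<in> Sec (pullback g B) W" by (rule presheaf_homD(1)[OF mod_homD[OF w] W s])
  have "gunfold1 f g (id_mor X) (id_mor X) A B w W (can_id X (pullback f A) W s) = can_id X (pullback g B) W (w W s)"
   unfolding gunfold1_def id_mor_simps mod_comp_apply[OF W cA(1)] cA(2) fi iB(2) ..
  then show "gid1 X (pullback f A) (pullback g B) (gunfold1 f g (id_mor X) (id_mor X) A B w) W s = w W s"
   unfolding gid1_def mod_comp_apply[OF W s] using invB(3)[OF W ws] by simp
 qed
qed

section \<open>Graded maps\<close>

definition sheaves :: "('x, 'r) rspace \<Rightarrow> ('x, 'r, 'm) gmod \<Rightarrow> bool" where
 "sheaves X E \<longleftrightarrow> (\<forall>n. sheaf_of_modules X (E n))"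

lemma sheavesD: "sheaves X E \<Longrightarrow> sheaf_of_modules X (E n)" "sheaves X E \<Longrightarrow> mpre X (E n)"
 by (auto simp: sheaves_def intro: sheaf_of_modules_mpre)

lemma sheaves_gpullback: "f \<in> mor Y Z \<Longrightarrow> sheaves Z E \<Longrightarrow> sheaves Y (gpullback f E)"
 by (auto simp: sheaves_def gpullback_def intro: pullback_sheaf)

lemma gHom_carrier: "u \<in> carrier (gHom X E F q) \<longleftrightarrow> (\<forall>n. u n \<in> mod_hom X (E n) (F (n + q)))"
 by (simp add: gHom_def)

lemma gHom_add: "u \<oplus>\<^bsub>gHom X E F q\<^esub> v = (\<lambda>n. hadd X (E n) (F (n + q)) (u n) (v n))"
 by (simp add: gHom_def hadd_def)

lemma gHom_zero: "\<zero>\<^bsub>gHom X E F q\<^esub> = (\<lambda>n. on_sections X (E n) (\<lambda>W s. \<zero>\<^bsub>msec (F (n + q)) W\<^esub>))"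
 by (simp add: gHom_def)

lemma hadd_ext:
 assumes "mpre X M" "mpre X N" "u \<in> mod_hom X M N" "v \<in> mod_hom X M N"
  and "w \<in> mod_hom X M N"
  and "\<And>W s. openin (rtop X) W \<Longrightarrow> s \<in> Sec M W \<Longrightarrow> u W s \<oplus>\<^bsub>msec N W\<^esub> v W s = w W s"
 shows "hadd X M N u v = w"
 by (rule mod_hom_ext[OF hadd_hom[OF assms(1-4)] assms(5)]) (simp add: hadd_apply assms(6))

lemma (in left_module) smult_uminus: "a \<in> carrier R \<Longrightarrow> x \<in> carrier M \<Longrightarrow> a \<odot>\<^bsub>M\<^esub> (\<ominus>\<^bsub>M\<^esub> x) = \<ominus>\<^bsub>M\<^esub> (a \<odot>\<^bsub>M\<^esub> x)"
proof -
 assume a: "a \<in> carrier R" and x: "x \<in> carrier M"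
 interpret h: add_group_hom M M "smult M a"
  by (intro add_group_hom.intro add_group_hom_axioms.intro M.abelian_group_axioms add_hom_smult a)
 show ?thesis using x by simp
qed

lemma mod_hom_add_group_hom:
 assumes "mpre X M" "mpre X N" "u \<in> mod_hom X M N" "openin (rtop X) W"
 shows "add_group_hom (msec M W) (msec N W) (u W)"
proof (intro add_group_hom.intro add_group_hom_axioms.intro)
 show "abelian_group (msec M W)" "abelian_group (msec N W)"
  using left_module.axioms(2)[OF mpre.left_module_sec[OF assms(1,4)]] left_module.axioms(2)[OF mpre.left_module_sec[OF assms(2,4)]] .
 show "add_hom (msec M W) (msec N W) (u W)"
  using presheaf_homD(1,2)[OF mod_homD[OF assms(3)] assms(4)] by (simp add: add_hom_def Pi_iff)
qed

lemma mres_add_group_hom: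
 assumes "mpre X M" "openin (rtop X) W" "openin (rtop X) V" "V \<subseteq> W"
 shows "add_group_hom (msec M W) (msec M V) (mres M W V)"
proof (intro add_group_hom.intro add_group_hom_axioms.intro)
 interpret mpre X M by fact
 show "abelian_group (msec M W)" "abelian_group (msec M V)"
  using left_module.axioms(2)[OF left_module_sec[OF assms(2)]] left_module.axioms(2)[OF left_module_sec[OF assms(3)]] .
 show "add_hom (msec M W) (msec M V) (mres M W V)"
  using m.res_closed mres_add assms by (simp add: add_hom_def Pi_iff)
qed

lemma hneg_hom:
 assumes "mpre X M" "mpre X N" and u: "u \<in> mod_hom X M N"
 shows "on_sections X M (\<lambda>W s. \<ominus>\<^bsub>msec N W\<^esub> u W s) \<in> mod_hom X M N"
proof -
 interpret M: mpre X M by fact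
 interpret N: mpre X N by fact
 note ud = presheaf_homD[OF mod_homD[OF u]]
 show ?thesis
 proof (rule M.on_sections_hom, rule presheaf_homI)
  fix W s assume W: "M.opn W" and s: "s \<in> Sec M W"
  interpret NW: left_module "rsec X W" "msec N W" by (rule N.left_module_sec[OF W])
  show "\<ominus>\<^bsub>msec N W\<^esub> u W s \<in> Sec N W" using ud(1)[OF W s] by simp
  show "\<ominus>\<^bsub>msec N W\<^esub> u W (s \<oplus>\<^bsub>msec M W\<^esub> t) = \<ominus>\<^bsub>msec N W\<^esub> u W s \<oplus>\<^bsub>msec N W\<^esub> \<ominus>\<^bsub>msec N W\<^esub> u W t"
   if t: "t \<in> Sec M W" for t
   using ud(1)[OF W s] ud(1)[OF W t] by (simp add: ud(2)[OF W s t] NW.M.minus_add)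
  show "\<ominus>\<^bsub>msec N W\<^esub> u W (r \<odot>\<^bsub>msec M W\<^esub> s) = r \<odot>\<^bsub>msec N W\<^esub> (\<ominus>\<^bsub>msec N W\<^esub> u W s)"
   if r: "r \<in> Rsec X W" for r
   using ud(1)[OF W s] r by (simp add: ud(3)[OF W s r] NW.smult_uminus)
  show "\<ominus>\<^bsub>msec N V\<^esub> u V (mres M W V s) = mres N W V (\<ominus>\<^bsub>msec N W\<^esub> u W s)"
   if V: "M.opn V" "V \<subseteq> W" for V
   using ud(1)[OF W s] add_group_hom.uminus[OF mres_add_group_hom[OF N.mpre_axioms W V]] by (simp add: ud(4)[OF W s V])
 qed
qed

lemma hzero_hom:
 assumes "mpre X M" "mpre X N"
 shows "on_sections X M (\<lambda>W s. \<zero>\<^bsub>msec N W\<^esub>) \<in> mod_hom X M N"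
proof -
 interpret M: mpre X M by fact
 interpret N: mpre X N by fact
 show ?thesis
 proof (rule M.on_sections_hom, rule presheaf_homI)
  fix W assume W: "M.opn W"
  interpret NW: left_module "rsec X W" "msec N W" by (rule N.left_module_sec[OF W])
  show "\<zero>\<^bsub>msec N W\<^esub> \<in> Sec N W" "\<zero>\<^bsub>msec N W\<^esub> = \<zero>\<^bsub>msec N W\<^esub> \<oplus>\<^bsub>msec N W\<^esub> \<zero>\<^bsub>msec N W\<^esub>" by simp_all
  show "\<zero>\<^bsub>msec N W\<^esub> = r \<odot>\<^bsub>msec N W\<^esub> \<zero>\<^bsub>msec N W\<^esub>" if "r \<in> Rsec X W" for r using that by simp
  show "\<zero>\<^bsub>msec N V\<^esub> = mres N W V \<zero>\<^bsub>msec N W\<^esub>" if "M.opn V" "V \<subseteq> W" for V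
   using N.mres_zero[OF W that] by simp
 qed
qed

lemma abelian_group_gHom:
 assumes E: "sheaves X E" and F: "sheaves X F"
 shows "abelian_group (gHom X E F q)"
proof (rule abelian_groupI)
 note sE = sheavesD(2)[OF E] and sF = sheavesD(2)[OF F]
 have ab: "abelian_group (msec (F n) W)" if "openin (rtop X) W" for n W
  using left_module.axioms(2)[OF mpre.left_module_sec[OF sF that]] .
 have z: "\<zero>\<^bsub>gHom X E F q\<^esub> \<in> carrier (gHom X E F q)"
  unfolding gHom_carrier gHom_zero using hzero_hom[OF sE sF] by simp
 then show "\<zero>\<^bsub>gHom X E F q\<^esub> \<in> carrier (gHom X E F q)" .
 fix u v w assume u: "u \<in> carrier (gHom X E F q)" and v: "v \<in> carrier (gHom X E F q)" and w: "w \<in> carrier (gHom X E F q)"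
 note u' = u[unfolded gHom_carrier, rule_format] and v' = v[unfolded gHom_carrier, rule_format] and w' = w[unfolded gHom_carrier, rule_format]
 have cl: "hadd X (E n) (F (n + q)) a b \<in> mod_hom X (E n) (F (n + q))"
  if "a \<in> mod_hom X (E n) (F (n + q))" "b \<in> mod_hom X (E n) (F (n + q))" for a b n
  using hadd_hom[OF sE sF that] .
 show "u \<oplus>\<^bsub>gHom X E F q\<^esub> v \<oplus>\<^bsub>gHom X E F q\<^esub> w = u \<oplus>\<^bsub>gHom X E F q\<^esub> (v \<oplus>\<^bsub>gHom X E F q\<^esub> w)"
  unfolding gHom_add
 proof (rule ext, rule hadd_ext[OF sE sF cl[OF u' v'] w' cl[OF u' cl[OF v' w']]])
  fix n W s assume W: "openin (rtop X) W" and s: "s \<in> Sec (E n) W"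
  interpret abelian_group "msec (F (n + q)) W" by (rule ab[OF W])
  show "hadd X (E n) (F (n + q)) (u n) (v n) W s \<oplus>\<^bsub>msec (F (n + q)) W\<^esub> w n W s =
    hadd X (E n) (F (n + q)) (u n) (hadd X (E n) (F (n + q)) (v n) (w n)) W s"
   using presheaf_homD(1)[OF mod_homD[OF u'] W s] presheaf_homD(1)[OF mod_homD[OF v'] W s] presheaf_homD(1)[OF mod_homD[OF w'] W s]
   by (simp add: hadd_apply[OF W s] a_assoc)
 qed
next
 note sE = sheavesD(2)[OF E] and sF = sheavesD(2)[OF F]
 have ab: "abelian_group (msec (F n) W)" if "openin (rtop X) W" for n W
  using left_module.axioms(2)[OF mpre.left_module_sec[OF sF that]] .
 fix u v assume u: "u \<in> carrier (gHom X E F q)" and v: "v \<in> carrier (gHom X E F q)"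
 note u' = u[unfolded gHom_carrier, rule_format] and v' = v[unfolded gHom_carrier, rule_format]
 have cl: "hadd X (E n) (F (n + q)) a b \<in> mod_hom X (E n) (F (n + q))"
  if "a \<in> mod_hom X (E n) (F (n + q))" "b \<in> mod_hom X (E n) (F (n + q))" for a b n
  using hadd_hom[OF sE sF that] .
 show "u \<oplus>\<^bsub>gHom X E F q\<^esub> v \<in> carrier (gHom X E F q)"
  unfolding gHom_carrier gHom_add using cl[OF u' v'] by simp
 show "u \<oplus>\<^bsub>gHom X E F q\<^esub> v = v \<oplus>\<^bsub>gHom X E F q\<^esub> u"
  unfolding gHom_add
 proof (rule ext, rule hadd_ext[OF sE sF u' v' cl[OF v' u']])
  fix n W s assume W: "openin (rtop X) W" and s: "s \<in> Sec (E n) W"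
  interpret abelian_group "msec (F (n + q)) W" by (rule ab[OF W])
  show "u n W s \<oplus>\<^bsub>msec (F (n + q)) W\<^esub> v n W s = hadd X (E n) (F (n + q)) (v n) (u n) W s"
   using presheaf_homD(1)[OF mod_homD[OF u'] W s] presheaf_homD(1)[OF mod_homD[OF v'] W s]
   by (simp add: hadd_apply[OF W s] a_comm)
 qed
 show "\<zero>\<^bsub>gHom X E F q\<^esub> \<oplus>\<^bsub>gHom X E F q\<^esub> u = u"
  unfolding gHom_add gHom_zero
 proof (rule ext, rule hadd_ext[OF sE sF hzero_hom[OF sE sF] u' u'])
  fix n W s assume W: "openin (rtop X) W" and s: "s \<in> Sec (E n) W"
  interpret abelian_group "msec (F (n + q)) W" by (rule ab[OF W])
  show "on_sections X (E n) (\<lambda>W s. \<zero>\<^bsub>msec (F (n + q)) W\<^esub>) W s \<oplus>\<^bsub>msec (F (n + q)) W\<^esub> u n W s = u n W s"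
   using presheaf_homD(1)[OF mod_homD[OF u'] W s] by (simp add: on_sections_apply[OF W s])
 qed
 show "\<exists>y\<in>carrier (gHom X E F q). y \<oplus>\<^bsub>gHom X E F q\<^esub> u = \<zero>\<^bsub>gHom X E F q\<^esub>"
 proof (rule bexI)
  let ?y = "\<lambda>n. on_sections X (E n) (\<lambda>W s. \<ominus>\<^bsub>msec (F (n + q)) W\<^esub> u n W s)"
  show "?y \<in> carrier (gHom X E F q)" unfolding gHom_carrier using hneg_hom[OF sE sF u'] by simp
  show "?y \<oplus>\<^bsub>gHom X E F q\<^esub> u = \<zero>\<^bsub>gHom X E F q\<^esub>"
   unfolding gHom_add gHom_zero
  proof (rule ext, rule hadd_ext[OF sE sF hneg_hom[OF sE sF u'] u' hzero_hom[OF sE sF]])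
   fix n W s assume W: "openin (rtop X) W" and s: "s \<in> Sec (E n) W"
   interpret abelian_group "msec (F (n + q)) W" by (rule ab[OF W])
   show "on_sections X (E n) (\<lambda>W s. \<ominus>\<^bsub>msec (F (n + q)) W\<^esub> u n W s) W s \<oplus>\<^bsub>msec (F (n + q)) W\<^esub> u n W s =
     on_sections X (E n) (\<lambda>W s. \<zero>\<^bsub>msec (F (n + q)) W\<^esub>) W s"
    using presheaf_homD(1)[OF mod_homD[OF u'] W s] by (simp add: on_sections_apply[OF W s] l_neg)
  qed
 qed
qed

section \<open>Transport and composition of graded maps\<close>

lemma gpull_eq: "gpull h f g E F q u = (\<lambda>n. gpull1 h f g (E n) (F (n + q)) (u n))"
 by (simp add: gpull_def gpull1_def)

lemma gunfold_eq: "gunfold k k' f g E F q u = (\<lambda>n. gunfold1 k k' f g (E n) (F (n + q)) (u n))"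
 by (simp add: gunfold_def gunfold1_def)

lemma gunfold_id_eq: "gunfold_id X E F q u = (\<lambda>n. gid1 X (E n) (F (n + q)) (u n))"
 by (simp add: gunfold_id_def gid1_def)

lemma gpull_hom:
 assumes h: "h \<in> mor X Y" and f: "f \<in> mor Y Z" and g: "g \<in> mor Y Z" and E: "sheaves Z E" and F: "sheaves Z F"
 shows "add_group_hom (gHom Y (gpullback f E) (gpullback g F) q)
  (gHom X (gpullback (f oo h) E) (gpullback (g oo h) F) q) (gpull h f g E F q)"
proof (intro add_group_hom.intro add_group_hom_axioms.intro)
 show "abelian_group (gHom Y (gpullback f E) (gpullback g F) q)"
  by (rule abelian_group_gHom[OF sheaves_gpullback[OF f E] sheaves_gpullback[OF g F]])
 show "abelian_group (gHom X (gpullback (f oo h) E) (gpullback (g oo h) F) q)"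
  by (rule abelian_group_gHom[OF sheaves_gpullback[OF comp_in_mor[OF f h] E] sheaves_gpullback[OF comp_in_mor[OF g h] F]])
 note sE = sheavesD(1)[OF E] and sF = sheavesD(1)[OF F]
 show "add_hom (gHom Y (gpullback f E) (gpullback g F) q)
  (gHom X (gpullback (f oo h) E) (gpullback (g oo h) F) q) (gpull h f g E F q)"
  unfolding add_hom_def
 proof (intro conjI funcsetI ballI)
  fix u assume u: "u \<in> carrier (gHom Y (gpullback f E) (gpullback g F) q)"
  note u' = u[unfolded gHom_carrier gpullback_def, rule_format]
  show "gpull h f g E F q u \<in> carrier (gHom X (gpullback (f oo h) E) (gpullback (g oo h) F) q)"
   unfolding gpull_eq gHom_carrier gpullback_def using gpull1_in[OF h f g sE sF u'] by simp
  fix v assume v: "v \<in> carrier (gHom Y (gpullback f E) (gpullback g F) q)"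
  note v' = v[unfolded gHom_carrier gpullback_def, rule_format]
  show "gpull h f g E F q (u \<oplus>\<^bsub>gHom Y (gpullback f E) (gpullback g F) q\<^esub> v) =
   gpull h f g E F q u \<oplus>\<^bsub>gHom X (gpullback (f oo h) E) (gpullback (g oo h) F) q\<^esub> gpull h f g E F q v"
   unfolding gpull_eq gHom_add gpullback_def using gpull1_add[OF h f g sE sF u' v'] by simp
 qed
qed

lemma gunfold_hom:
 assumes f: "f \<in> mor X Y" and g: "g \<in> mor X Y" and k: "k \<in> mor Y Z" and k': "k' \<in> mor Y Z"
  and E: "sheaves Z E" and F: "sheaves Z F"
 shows "add_group_hom (gHom X (gpullback (k oo f) E) (gpullback (k' oo g) F) q)
  (gHom X (gpullback f (gpullback k E)) (gpullback g (gpullback k' F)) q) (gunfold k k' f g E F q)"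
proof (intro add_group_hom.intro add_group_hom_axioms.intro)
 show "abelian_group (gHom X (gpullback (k oo f) E) (gpullback (k' oo g) F) q)"
  by (rule abelian_group_gHom[OF sheaves_gpullback[OF comp_in_mor[OF k f] E] sheaves_gpullback[OF comp_in_mor[OF k' g] F]])
 show "abelian_group (gHom X (gpullback f (gpullback k E)) (gpullback g (gpullback k' F)) q)"
  by (rule abelian_group_gHom[OF sheaves_gpullback[OF f sheaves_gpullback[OF k E]] sheaves_gpullback[OF g sheaves_gpullback[OF k' F]]])
 note sE = sheavesD(1)[OF E] and sF = sheavesD(1)[OF F]
 show "add_hom (gHom X (gpullback (k oo f) E) (gpullback (k' oo g) F) q)
  (gHom X (gpullback f (gpullback k E)) (gpullback g (gpullback k' F)) q) (gunfold k k' f g E F q)"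
  unfolding add_hom_def
 proof (intro conjI funcsetI ballI)
  fix u assume u: "u \<in> carrier (gHom X (gpullback (k oo f) E) (gpullback (k' oo g) F) q)"
  note u' = u[unfolded gHom_carrier gpullback_def, rule_format]
  show "gunfold k k' f g E F q u \<in> carrier (gHom X (gpullback f (gpullback k E)) (gpullback g (gpullback k' F)) q)"
   unfolding gunfold_eq gHom_carrier gpullback_def using gunfold1_in[OF f g k k' sE sF u'] by simp
  fix v assume v: "v \<in> carrier (gHom X (gpullback (k oo f) E) (gpullback (k' oo g) F) q)"
  note v' = v[unfolded gHom_carrier gpullback_def, rule_format]
  show "gunfold k k' f g E F q (u \<oplus>\<^bsub>gHom X (gpullback (k oo f) E) (gpullback (k' oo g) F) q\<^esub> v) =
   gunfold k k' f g E F q u \<oplus>\<^bsub>gHom X (gpullback f (gpullback k E)) (gpullback g (gpullback k' F)) q\<^esub> gunfold k k' f g E F q v"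
   unfolding gunfold_eq gHom_add gpullback_def using gunfold1_add[OF f g k k' sE sF u' v'] by simp
 qed
qed

text \<open>Target degrees of composites arise as \<open>(n + s) + q\<close>, whereas the group of
  maps asks for \<open>n + t\<close>. Reassociating is a rewriting of the index of the sheaf, not a
  map.\<close>

lemma gHom_shift: "u \<in> carrier (gHom X F G q) \<Longrightarrow> t = s + q \<Longrightarrow> u (n + s) \<in> mod_hom X (F (n + s)) (G (n + t))"
 unfolding gHom_carrier by (metis add.assoc)

lemma gcomp_closed:
 assumes "sheaves X E" and u: "u \<in> carrier (gHom X F G q)" and v: "v \<in> carrier (gHom X E F s)" and t: "t = s + q"
 shows "gcomp X E s u v \<in> carrier (gHom X E G t)"
 using mod_comp_hom'[OF sheavesD(1)[OF assms(1)] v[unfolded gHom_carrier, rule_format] gHom_shift[OF u t]]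
 by (simp add: gHom_carrier gcomp_def)

lemma gcomp_hom_left:
 assumes E: "sheaves X E" and F: "sheaves X F" and G: "sheaves X G" and v: "v \<in> carrier (gHom X E F s)" and t: "t = s + q"
 shows "add_group_hom (gHom X F G q) (gHom X E G t) (\<lambda>u. gcomp X E s u v)"
proof (intro add_group_hom.intro add_group_hom_axioms.intro abelian_group_gHom E F G)
 show "add_hom (gHom X F G q) (gHom X E G t) (\<lambda>u. gcomp X E s u v)"
  unfolding add_hom_def
 proof (intro conjI funcsetI ballI)
  fix u assume u: "u \<in> carrier (gHom X F G q)"
  show "gcomp X E s u v \<in> carrier (gHom X E G t)" by (rule gcomp_closed[OF E u v t])
  note uv = this[unfolded gHom_carrier, rule_format]
  fix u' assume u': "u' \<in> carrier (gHom X F G q)"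
  note uv' = gcomp_closed[OF E u' v t, unfolded gHom_carrier, rule_format]
  interpret a: abelian_group "gHom X F G q" by (rule abelian_group_gHom[OF F G])
  note uuv = gcomp_closed[OF E a.a_closed[OF u u'] v t, unfolded gHom_carrier, rule_format]
  show "gcomp X E s (u \<oplus>\<^bsub>gHom X F G q\<^esub> u') v = gcomp X E s u v \<oplus>\<^bsub>gHom X E G t\<^esub> gcomp X E s u' v"
   unfolding gHom_add[of X E G t]
  proof (rule ext, rule hadd_ext[OF sheavesD(2)[OF E] sheavesD(2)[OF G] uv uv' uuv, symmetric])
   fix n W x assume W: "openin (rtop X) W" and x: "x \<in> Sec (E n) W"
   have vx: "v n W x \<in> Sec (F (n + s)) W" using presheaf_homD(1)[OF mod_homD[OF v[unfolded gHom_carrier, rule_format]] W x] .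
   show "gcomp X E s u v n W x \<oplus>\<^bsub>msec (G (n + t)) W\<^esub> gcomp X E s u' v n W x = gcomp X E s (u \<oplus>\<^bsub>gHom X F G q\<^esub> u') v n W x"
    using t by (simp add: gcomp_def mod_comp_apply[OF W x] gHom_add hadd_apply[OF W vx] add.assoc)
  qed
 qed
qed

lemma gcomp_hom_right:
 assumes E: "sheaves X E" and F: "sheaves X F" and G: "sheaves X G" and u: "u \<in> carrier (gHom X F G q)" and t: "t = s + q"
 shows "add_group_hom (gHom X E F s) (gHom X E G t) (\<lambda>v. gcomp X E s u v)"
proof (intro add_group_hom.intro add_group_hom_axioms.intro abelian_group_gHom E F G)
 show "add_hom (gHom X E F s) (gHom X E G t) (\<lambda>v. gcomp X E s u v)"
  unfolding add_hom_def
 proof (intro conjI funcsetI ballI)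
  fix v assume v: "v \<in> carrier (gHom X E F s)"
  show "gcomp X E s u v \<in> carrier (gHom X E G t)" by (rule gcomp_closed[OF E u v t])
  note uv = this[unfolded gHom_carrier, rule_format]
  fix v' assume v': "v' \<in> carrier (gHom X E F s)"
  note uv' = gcomp_closed[OF E u v' t, unfolded gHom_carrier, rule_format]
  interpret a: abelian_group "gHom X E F s" by (rule abelian_group_gHom[OF E F])
  note uvv = gcomp_closed[OF E u a.a_closed[OF v v'] t, unfolded gHom_carrier, rule_format]
  show "gcomp X E s u (v \<oplus>\<^bsub>gHom X E F s\<^esub> v') = gcomp X E s u v \<oplus>\<^bsub>gHom X E G t\<^esub> gcomp X E s u v'"
   unfolding gHom_add[of X E G t]
  proof (rule ext, rule hadd_ext[OF sheavesD(2)[OF E] sheavesD(2)[OF G] uv uv' uvv, symmetric])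
   fix n W x assume W: "openin (rtop X) W" and x: "x \<in> Sec (E n) W"
   note vx = presheaf_homD(1)[OF mod_homD[OF v[unfolded gHom_carrier, rule_format]] W x]
    presheaf_homD(1)[OF mod_homD[OF v'[unfolded gHom_carrier, rule_format]] W x]
   show "gcomp X E s u v n W x \<oplus>\<^bsub>msec (G (n + t)) W\<^esub> gcomp X E s u v' n W x = gcomp X E s u (v \<oplus>\<^bsub>gHom X E F s\<^esub> v') n W x"
    using presheaf_homD(2)[OF mod_homD[OF gHom_shift[OF u t]] W vx]
    by (simp add: gcomp_def mod_comp_apply[OF W x] gHom_add hadd_apply[OF W x])
  qed
 qed
qed

lemma gpull_gcomp:
 assumes h: "h \<in> mor X Y" and f: "f \<in> mor Y Z" and g: "g \<in> mor Y Z" and k: "k \<in> mor Y Z"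
  and E: "sheaves Z E" and F: "sheaves Z F" and G: "sheaves Z G" and t: "t = s + q"
  and u: "u \<in> carrier (gHom Y (gpullback g F) (gpullback k G) q)" and v: "v \<in> carrier (gHom Y (gpullback f E) (gpullback g F) s)"
 shows "gpull h f k E G t (gcomp Y (gpullback f E) s u v) =
  gcomp X (gpullback (f oo h) E) s (gpull h g k F G q u) (gpull h f g E F s v)"
proof
 fix n
 have nt: "n + s + q = n + t" using t by simp
 note v' = v[unfolded gHom_carrier gpullback_def, rule_format, of n] and u' = gHom_shift[OF u t, unfolded gpullback_def, of n]
 show "gpull h f k E G t (gcomp Y (gpullback f E) s u v) n =
  gcomp X (gpullback (f oo h) E) s (gpull h g k F G q u) (gpull h f g E F s v) n"
  unfolding gpull_eq gcomp_def gpullback_def nt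
  by (rule gpull1_comp[OF h f g k sheavesD(1)[OF E] sheavesD(1)[OF F] sheavesD(1)[OF G] v' u'])
qed

lemma gunfold_gcomp:
 assumes f: "f \<in> mor X Y" and g: "g \<in> mor X Y" and \<delta>: "\<delta> \<in> mor X Y"
  and k: "k \<in> mor Y Z" and k': "k' \<in> mor Y Z" and k'': "k'' \<in> mor Y Z"
  and E: "sheaves Z E" and F: "sheaves Z F" and G: "sheaves Z G" and t: "t = s + q"
  and u: "u \<in> carrier (gHom X (gpullback (k' oo g) F) (gpullback (k'' oo \<delta>) G) q)"
  and v: "v \<in> carrier (gHom X (gpullback (k oo f) E) (gpullback (k' oo g) F) s)"
 shows "gunfold k k'' f \<delta> E G t (gcomp X (gpullback (k oo f) E) s u v) =
  gcomp X (gpullback f (gpullback k E)) s (gunfold k' k'' g \<delta> F G q u) (gunfold k k' f g E F s v)"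
proof
 fix n
 have nt: "n + s + q = n + t" using t by simp
 note v' = v[unfolded gHom_carrier gpullback_def, rule_format, of n] and u' = gHom_shift[OF u t, unfolded gpullback_def, of n]
 show "gunfold k k'' f \<delta> E G t (gcomp X (gpullback (k oo f) E) s u v) n =
  gcomp X (gpullback f (gpullback k E)) s (gunfold k' k'' g \<delta> F G q u) (gunfold k k' f g E F s v) n"
  unfolding gunfold_eq gcomp_def gpullback_def nt
  by (rule gunfold1_comp[OF f g \<delta> k k' k'' sheavesD(1)[OF E] sheavesD(1)[OF F] sheavesD(1)[OF G] v' u'])
qed

lemma gpull_gid:
 assumes "h \<in> mor X Y" "f \<in> mor Y Z" "sheaves Z E"
 shows "gpull h f f E E 0 (gid Y (gpullback f E)) = gid X (gpullback (f oo h) E)"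
 using gpull1_id[OF assms(1,2) sheavesD(1)[OF assms(3)]] by (simp add: gpull_eq gid_def gpullback_def)

lemma gunfold_gid:
 assumes "f \<in> mor X Y" "k \<in> mor Y Z" "sheaves Z E"
 shows "gunfold k k f f E E 0 (gid X (gpullback (k oo f) E)) = gid X (gpullback f (gpullback k E))"
 using gunfold1_id[OF assms(1,2) sheavesD(1)[OF assms(3)]] by (simp add: gunfold_eq gid_def gpullback_def)

lemma gpull_gpull:
 assumes l: "l \<in> mor W X" and h: "h \<in> mor X Y" and f: "f \<in> mor Y Z" and g: "g \<in> mor Y Z"
  and E: "sheaves Z E" and F: "sheaves Z F"
  and u: "u \<in> carrier (gHom Y (gpullback f E) (gpullback g F) q)"
 shows "gpull l (f oo h) (g oo h) E F q (gpull h f g E F q u) = gpull (h oo l) f g E F q u"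
 unfolding gpull_eq
 using gpull1_gpull1[OF l h f g sheavesD(1)[OF E] sheavesD(1)[OF F] u[unfolded gHom_carrier gpullback_def, rule_format]] by simp

lemma gpull_gunfold:
 assumes h: "h \<in> mor W X" and f: "f \<in> mor X Y" and g: "g \<in> mor X Y" and k: "k \<in> mor Y Z" and k': "k' \<in> mor Y Z"
  and E: "sheaves Z E" and F: "sheaves Z F"
  and u: "u \<in> carrier (gHom X (gpullback (k oo f) E) (gpullback (k' oo g) F) q)"
 shows "gpull h f g (gpullback k E) (gpullback k' F) q (gunfold k k' f g E F q u) =
  gunfold k k' (f oo h) (g oo h) E F q (gpull h (k oo f) (k' oo g) E F q u)"
 unfolding gpull_eq gunfold_eq gpullback_def
 using gpull1_gunfold1[OF h f g k k' sheavesD(1)[OF E] sheavesD(1)[OF F] u[unfolded gHom_carrier gpullback_def, rule_format]] by simp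

lemma gunfold_id_gunfold:
 assumes "f \<in> mor X Y" "g \<in> mor X Y" "sheaves Y E" "sheaves Y F"
  and u: "u \<in> carrier (gHom X (gpullback f E) (gpullback g F) q)"
 shows "gunfold_id X (gpullback f E) (gpullback g F) q (gunfold f g (id_mor X) (id_mor X) E F q u) = u"
 unfolding gunfold_id_eq gunfold_eq gpullback_def
 using gid1_gunfold1[OF assms(1,2) sheavesD(1)[OF assms(3)] sheavesD(1)[OF assms(4)] u[unfolded gHom_carrier gpullback_def, rule_format]] by simp

text \<open>Chain maps and homotopies are expressed by composition, sums, zero and identities, so an
  operation \<open>P\<close> that respects these carries a homotopy equivalence over. The objects
  are indexed by \<open>bool\<close> because an equivalence involves two of them, and maps in both
  directions as well as endomorphisms of each are transported.\<close>

lemma homotopy_invertible_functor: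
 fixes Ob :: "bool \<Rightarrow> ('y, 's, 'm) gmod" and Ob' :: "bool \<Rightarrow> ('x, 'r, 'n) gmod"
 assumes sh: "\<And>i. sheaves Y (Ob i)" and sh': "\<And>i. sheaves X (Ob' i)"
  and hom: "\<And>i j q. add_group_hom (gHom Y (Ob i) (Ob j) q) (gHom X (Ob' i) (Ob' j) q) (P i j q)"
  and comp: "\<And>i j k q s t u v. t = s + q \<Longrightarrow> u \<in> carrier (gHom Y (Ob j) (Ob k) q) \<Longrightarrow> v \<in> carrier (gHom Y (Ob i) (Ob j) s) \<Longrightarrow>
   P i k t (gcomp Y (Ob i) s u v) = gcomp X (Ob' i) s (P j k q u) (P i j s v)"
  and id: "\<And>i. P i i 0 (gid Y (Ob i)) = gid X (Ob' i)"
  and inv: "homotopy_invertible Y (Ob False) dA (Ob True) dB h"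
 shows "homotopy_invertible X (Ob' False) (P False False 1 dA) (Ob' True) (P True True 1 dB) (P False True 0 h)"
proof -
 have cl: "P i j q u \<in> carrier (gHom X (Ob' i) (Ob' j) q)" if "u \<in> carrier (gHom Y (Ob i) (Ob j) q)" for i j q u
  using add_group_hom.closed[OF hom that] .
 have cc: "cochain_complex X (Ob' i) (P i i 1 d)" if c: "cochain_complex Y (Ob i) d" for i d
 proof -
  have d: "d \<in> carrier (gHom Y (Ob i) (Ob i) 1)" and dd: "gcomp Y (Ob i) 1 d d = \<zero>\<^bsub>gHom Y (Ob i) (Ob i) 2\<^esub>"
   using c by (simp_all add: cochain_complex_def)
  have "gcomp X (Ob' i) 1 (P i i 1 d) (P i i 1 d) = P i i 2 (gcomp Y (Ob i) 1 d d)"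
   by (rule comp[symmetric]) (simp_all add: d)
  then show ?thesis
   unfolding cochain_complex_def dd using cl[OF d] sh' add_group_hom.zero[OF hom] by (simp add: sheaves_def)
 qed
 have cm: "chain_map X (Ob' i) (P i i 1 d) (Ob' j) (P j j 1 e) (P i j 0 l)" if c: "chain_map Y (Ob i) d (Ob j) e l" for i j d e l
 proof -
  have d: "d \<in> carrier (gHom Y (Ob i) (Ob i) 1)" "e \<in> carrier (gHom Y (Ob j) (Ob j) 1)" "l \<in> carrier (gHom Y (Ob i) (Ob j) 0)"
   and eq: "gcomp Y (Ob i) 0 e l = gcomp Y (Ob i) 1 l d"
   using c by (simp_all add: chain_map_def cochain_complex_def)
  have "gcomp X (Ob' i) 0 (P j j 1 e) (P i j 0 l) = P i j 1 (gcomp Y (Ob i) 0 e l)"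
   by (rule comp[symmetric]) (simp_all add: d)
  also have "\<dots> = gcomp X (Ob' i) 1 (P i j 0 l) (P i i 1 d)"
   unfolding eq by (rule comp) (simp_all add: d)
  finally show ?thesis using c cc cl[OF d(3)] by (simp add: chain_map_def)
 qed
 have ch: "chain_homotopic X (Ob' i) (P i i 1 d) (Ob' i) (P i i 1 d) (P i i 0 l) (P i i 0 \<chi>)"
  if c: "chain_homotopic Y (Ob i) d (Ob i) d l \<chi>" and d: "d \<in> carrier (gHom Y (Ob i) (Ob i) 1)"
   and p: "l \<in> carrier (gHom Y (Ob i) (Ob i) 0)" "\<chi> \<in> carrier (gHom Y (Ob i) (Ob i) 0)" for i d l \<chi>
 proof -
  obtain \<eta> where e: "\<eta> \<in> carrier (gHom Y (Ob i) (Ob i) (- 1))" and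
   eq: "l \<ominus>\<^bsub>gHom Y (Ob i) (Ob i) 0\<^esub> \<chi> = gcomp Y (Ob i) (- 1) d \<eta> \<oplus>\<^bsub>gHom Y (Ob i) (Ob i) 0\<^esub> gcomp Y (Ob i) 1 \<eta> d"
   using c by (auto simp: chain_homotopic_def)
  have g: "gcomp Y (Ob i) (- 1) d \<eta> \<in> carrier (gHom Y (Ob i) (Ob i) 0)" "gcomp Y (Ob i) 1 \<eta> d \<in> carrier (gHom Y (Ob i) (Ob i) 0)"
   using gcomp_closed[OF sh d e, of 0] gcomp_closed[OF sh e d, of 0] by simp_all
  have "P i i 0 l \<ominus>\<^bsub>gHom X (Ob' i) (Ob' i) 0\<^esub> P i i 0 \<chi> =
    P i i 0 (gcomp Y (Ob i) (- 1) d \<eta>) \<oplus>\<^bsub>gHom X (Ob' i) (Ob' i) 0\<^esub> P i i 0 (gcomp Y (Ob i) 1 \<eta> d)"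
   using arg_cong[OF eq, of "P i i 0"] add_group_hom.minus[OF hom p] add_group_hom.add[OF hom g] by simp
  also have "P i i 0 (gcomp Y (Ob i) (- 1) d \<eta>) = gcomp X (Ob' i) (- 1) (P i i 1 d) (P i i (- 1) \<eta>)"
   by (rule comp) (simp_all add: d e)
  also have "P i i 0 (gcomp Y (Ob i) 1 \<eta> d) = gcomp X (Ob' i) 1 (P i i (- 1) \<eta>) (P i i 1 d)"
   by (rule comp) (simp_all add: d e)
  finally show ?thesis unfolding chain_homotopic_def using cl[OF e] by blast
 qed
 obtain l where h: "chain_map Y (Ob False) dA (Ob True) dB h" and l: "chain_map Y (Ob True) dB (Ob False) dA l"
  and h1: "chain_homotopic Y (Ob False) dA (Ob False) dA (gcomp Y (Ob False) 0 l h) (gid Y (Ob False))"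
  and h2: "chain_homotopic Y (Ob True) dB (Ob True) dB (gcomp Y (Ob True) 0 h l) (gid Y (Ob True))"
  using inv by (auto simp: homotopy_invertible_def)
 have m: "h \<in> carrier (gHom Y (Ob False) (Ob True) 0)" "l \<in> carrier (gHom Y (Ob True) (Ob False) 0)"
  "dA \<in> carrier (gHom Y (Ob False) (Ob False) 1)" "dB \<in> carrier (gHom Y (Ob True) (Ob True) 1)"
  using h l by (simp_all add: chain_map_def cochain_complex_def)
 have gi: "gid Y (Ob i) \<in> carrier (gHom Y (Ob i) (Ob i) 0)" for i
  unfolding gHom_carrier gid_def using mod_id_hom[OF sheavesD(2)[OF sh]] by simp
 have c: "gcomp Y (Ob False) 0 l h \<in> carrier (gHom Y (Ob False) (Ob False) 0)" "gcomp Y (Ob True) 0 h l \<in> carrier (gHom Y (Ob True) (Ob True) 0)"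
  using gcomp_closed[OF sh m(2) m(1), of 0] gcomp_closed[OF sh m(1) m(2), of 0] by simp_all
 have p: "P False False 0 (gcomp Y (Ob False) 0 l h) = gcomp X (Ob' False) 0 (P True False 0 l) (P False True 0 h)"
  "P True True 0 (gcomp Y (Ob True) 0 h l) = gcomp X (Ob' True) 0 (P False True 0 h) (P True False 0 l)"
  by (rule comp; simp add: m)+
 show ?thesis
  unfolding homotopy_invertible_def
  using cm[OF h] cm[OF l] ch[OF h1 m(3) c(1) gi] ch[OF h2 m(4) c(2) gi] unfolding p id by blast
qed

lemma homotopy_invertible_gpull:
 assumes h: "h \<in> mor X Y" and f: "f \<in> mor Y Z" and g: "g \<in> mor Y Z" and E: "sheaves Z E"
  and inv: "homotopy_invertible Y (gpullback f E) dA (gpullback g E) dB u"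
 shows "homotopy_invertible X (gpullback (f oo h) E) (gpull h f f E E 1 dA)
   (gpullback (g oo h) E) (gpull h g g E E 1 dB) (gpull h f g E E 0 u)"
proof -
 \<comment> \<open>\<open>False\<close> stands for the source of the equivalence and
   \<open>True\<close> for its target.\<close>
 let ?m = "\<lambda>i. if i then g else f"
 have m: "?m i \<in> mor Y Z" for i using f g by simp
 show ?thesis
  using homotopy_invertible_functor[where Ob = "\<lambda>i. gpullback (?m i) E" and Ob' = "\<lambda>i. gpullback (?m i oo h) E"
    and P = "\<lambda>i j q. gpull h (?m i) (?m j) E E q" and Y = Y and X = X and dA = dA and dB = dB and h = u,
    OF sheaves_gpullback[OF m E] sheaves_gpullback[OF comp_in_mor[OF m h] E] gpull_hom[OF h m m E E]
    gpull_gcomp[OF h m m m E E E] gpull_gid[OF h m E]] inv by simp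
qed

lemma homotopy_invertible_gunfold:
 assumes f: "f \<in> mor X Y" and g: "g \<in> mor X Y" and k: "k \<in> mor Y Z" and E: "sheaves Z E"
  and inv: "homotopy_invertible X (gpullback (k oo f) E) dA (gpullback (k oo g) E) dB u"
 shows "homotopy_invertible X (gpullback f (gpullback k E)) (gunfold k k f f E E 1 dA)
   (gpullback g (gpullback k E)) (gunfold k k g g E E 1 dB) (gunfold k k f g E E 0 u)"
proof -
 let ?m = "\<lambda>i. if i then g else f"
 have m: "?m i \<in> mor X Y" for i using f g by simp
 show ?thesis
  using homotopy_invertible_functor[where Ob = "\<lambda>i. gpullback (k oo ?m i) E" and Ob' = "\<lambda>i. gpullback (?m i) (gpullback k E)"
    and P = "\<lambda>i j q. gunfold k k (?m i) (?m j) E E q" and Y = X and X = X and dA = dA and dB = dB and h = u,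
    OF sheaves_gpullback[OF comp_in_mor[OF k m] E] sheaves_gpullback[OF m sheaves_gpullback[OF k E]] gunfold_hom[OF m m k k E E]
    gunfold_gcomp[OF m m m k k k E E E] gunfold_gid[OF m k E]] inv by simp
qed

section \<open>Homotopy equivalences are quasi-isomorphisms\<close>

locale complex_at = rsp X for X :: "('x, 'r) rspace" +
 fixes A :: "('x, 'r, 'm) gmod" and d :: "('x, 'm, 'm) gmap" and n :: int
 assumes cc: "cochain_complex X A d"
begin

abbreviation "Mn \<equiv> msec (A n)"
abbreviation "Mp \<equiv> msec (A (n - 1))"
abbreviation "Ms \<equiv> msec (A (n + 1))"
abbreviation "Bd W \<equiv> d (n - 1) W ` carrier (Mp W)"
abbreviation "cl W s \<equiv> Bd W +>\<^bsub>Mn W\<^esub> s"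
abbreviation "cocyc W s \<equiv> s \<in> carrier (Mn W) \<and> d n W s = \<zero>\<^bsub>Ms W\<^esub>"
abbreviation "H \<equiv> cohom_presheaf X A d n"

lemma sh: "sheaves X A"
 using cc by (simp add: cochain_complex_def sheaves_def)

lemma d_hom: "d k \<in> mod_hom X (A k) (A (k + 1))"
 using cc by (simp add: cochain_complex_def gHom_carrier)

lemma d0_hom: "d (n - 1) \<in> mod_hom X (A (n - 1)) (A n)"
 using d_hom[of "n - 1"] by simp

sublocale An: mpre X "A n" by (rule sheavesD(2)[OF sh])
sublocale A0: mpre X "A (n - 1)" by (rule sheavesD(2)[OF sh])
sublocale A1: mpre X "A (n + 1)" by (rule sheavesD(2)[OF sh])

lemmas d0 = presheaf_homD[OF mod_homD[OF d0_hom]]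
lemmas d1 = presheaf_homD[OF mod_homD[OF d_hom[of n]]]

lemma dd:
 assumes W: "opn W" and s: "s \<in> carrier (Mp W)"
 shows "d n W (d (n - 1) W s) = \<zero>\<^bsub>Ms W\<^esub>"
proof -
 have "gcomp X A 1 d d (n - 1) W s = \<zero>\<^bsub>gHom X A A 2\<^esub> (n - 1) W s"
  using cc by (simp add: cochain_complex_def)
 then show ?thesis
  by (simp add: gcomp_def mod_comp_apply[OF W s] gHom_zero on_sections_apply[OF W s] add.commute[of 1 n])
qed

lemma d_add_hom:
 assumes "opn W"
 shows "add_group_hom (Mp W) (Mn W) (d (n - 1) W)"
  and "add_group_hom (Mn W) (Ms W) (d n W)"
 using mod_hom_add_group_hom[OF A0.mpre_axioms An.mpre_axioms d0_hom assms]
  mod_hom_add_group_hom[OF An.mpre_axioms A1.mpre_axioms d_hom assms] .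

lemma Bd_closed:
 assumes W: "opn W"
 shows Bd_carrier: "b \<in> Bd W \<Longrightarrow> b \<in> carrier (Mn W)"
  and Bd_cocyc: "b \<in> Bd W \<Longrightarrow> d n W b = \<zero>\<^bsub>Ms W\<^esub>"
  and Bd_zero: "\<zero>\<^bsub>Mn W\<^esub> \<in> Bd W"
  and Bd_add: "b \<in> Bd W \<Longrightarrow> b' \<in> Bd W \<Longrightarrow> b \<oplus>\<^bsub>Mn W\<^esub> b' \<in> Bd W"
  and Bd_minus: "b \<in> Bd W \<Longrightarrow> \<ominus>\<^bsub>Mn W\<^esub> b \<in> Bd W"
  and Bd_smult: "b \<in> Bd W \<Longrightarrow> a \<in> Rsec X W \<Longrightarrow> a \<odot>\<^bsub>Mn W\<^esub> b \<in> Bd W"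
  and Bd_res: "b \<in> Bd W \<Longrightarrow> opn V \<Longrightarrow> V \<subseteq> W \<Longrightarrow> mres (A n) W V b \<in> Bd V"
proof -
 interpret h: add_group_hom "Mp W" "Mn W" "d (n - 1) W" by (rule d_add_hom(1)[OF W])
 show "b \<in> Bd W \<Longrightarrow> b \<in> carrier (Mn W)" by blast
 show "b \<in> Bd W \<Longrightarrow> d n W b = \<zero>\<^bsub>Ms W\<^esub>" using dd[OF W] by blast
 show "\<zero>\<^bsub>Mn W\<^esub> \<in> Bd W" using h.zero[symmetric] h.A.zero_closed by (rule image_eqI)
 show "b \<oplus>\<^bsub>Mn W\<^esub> b' \<in> Bd W" if bb: "b \<in> Bd W" "b' \<in> Bd W"
 proof -
  obtain x x' where "x \<in> carrier (Mp W)" "x' \<in> carrier (Mp W)" "b = d (n - 1) W x" "b' = d (n - 1) W x'"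
   using imageE[OF bb(1)] imageE[OF bb(2)] by metis
  then show ?thesis by (intro image_eqI[of _ _ "x \<oplus>\<^bsub>Mp W\<^esub> x'"]) simp_all
 qed
 show "\<ominus>\<^bsub>Mn W\<^esub> b \<in> Bd W" if bb: "b \<in> Bd W"
 proof -
  obtain x where "x \<in> carrier (Mp W)" "b = d (n - 1) W x" using imageE[OF bb] by metis
  then show ?thesis by (intro image_eqI[of _ _ "\<ominus>\<^bsub>Mp W\<^esub> x"]) simp_all
 qed
 show "a \<odot>\<^bsub>Mn W\<^esub> b \<in> Bd W" if bb: "b \<in> Bd W" and a: "a \<in> Rsec X W"
 proof -
  obtain x where x: "x \<in> carrier (Mp W)" "b = d (n - 1) W x" using imageE[OF bb] by metis
  show ?thesis
   by (rule image_eqI[of _ _ "a \<odot>\<^bsub>Mp W\<^esub> x"]) (simp_all add: x d0(3)[OF W x(1) a] A0.sec_closed_M(2)[OF W x(1) a])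
 qed
 show "mres (A n) W V b \<in> Bd V" if bb: "b \<in> Bd W" and V: "opn V" "V \<subseteq> W"
 proof -
  obtain x where x: "x \<in> carrier (Mp W)" "b = d (n - 1) W x" using imageE[OF bb] by metis
  show ?thesis
   by (rule image_eqI[of _ _ "mres (A (n - 1)) W V x"]) (simp_all add: x d0(4)[OF W x(1) V] A0.m.res_closed[OF W V x(1)])
 qed
qed

lemma mem_cl: "t \<in> cl W s \<longleftrightarrow> (\<exists>b\<in>Bd W. t = b \<oplus>\<^bsub>Mn W\<^esub> s)"
 unfolding a_r_coset_def' by blast

lemma ab: "opn W \<Longrightarrow> abelian_group (Mn W)"
 using left_module.axioms(2)[OF An.left_module_sec] .

lemma cl_shift:
 assumes W: "opn W" and b: "b \<in> Bd W" and s: "s \<in> carrier (Mn W)"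
 shows "cl W (b \<oplus>\<^bsub>Mn W\<^esub> s) = cl W s"
proof -
 interpret abelian_group "Mn W" by (rule ab[OF W])
 note bc = Bd_carrier[OF W b]
 show ?thesis
 proof (rule Set.set_eqI)
  fix t
  show "t \<in> cl W (b \<oplus>\<^bsub>Mn W\<^esub> s) \<longleftrightarrow> t \<in> cl W s"
  proof
   assume "t \<in> cl W (b \<oplus>\<^bsub>Mn W\<^esub> s)"
   then obtain h where h: "h \<in> Bd W" "t = h \<oplus>\<^bsub>Mn W\<^esub> (b \<oplus>\<^bsub>Mn W\<^esub> s)" unfolding mem_cl by blast
   have "t = (h \<oplus>\<^bsub>Mn W\<^esub> b) \<oplus>\<^bsub>Mn W\<^esub> s"
    using h(2) Bd_carrier[OF W h(1)] bc s by (simp add: a_assoc)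
   then show "t \<in> cl W s" unfolding mem_cl using Bd_add[OF W h(1) b] by blast
  next
   assume "t \<in> cl W s"
   then obtain h where h: "h \<in> Bd W" "t = h \<oplus>\<^bsub>Mn W\<^esub> s" unfolding mem_cl by blast
   have hc: "h \<in> carrier (Mn W)" by (rule Bd_carrier[OF W h(1)])
   have "t = (h \<oplus>\<^bsub>Mn W\<^esub> \<ominus>\<^bsub>Mn W\<^esub> b) \<oplus>\<^bsub>Mn W\<^esub> (b \<oplus>\<^bsub>Mn W\<^esub> s)"
    using h(2) hc bc s by (simp add: a_assoc r_neg1 r_neg2)
   then show "t \<in> cl W (b \<oplus>\<^bsub>Mn W\<^esub> s)" unfolding mem_cl using Bd_add[OF W h(1) Bd_minus[OF W b]] by blast
  qed
 qed
qed

lemma cl_self: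
 assumes W: "opn W" and s: "s \<in> carrier (Mn W)"
 shows "s \<in> cl W s"
proof -
 interpret abelian_group "Mn W" by (rule ab[OF W])
 have "s = \<zero>\<^bsub>Mn W\<^esub> \<oplus>\<^bsub>Mn W\<^esub> s" using s by simp
 then show ?thesis unfolding mem_cl using Bd_zero[OF W] by blast
qed

text \<open>As for germs, the operations on cohomology classes are unions over representatives, and
  such a union collapses when \<open>F\<close> ignores boundaries.\<close>

lemma UN_cl:
 assumes W: "opn W" and s: "s \<in> carrier (Mn W)"
  and F: "\<And>b. b \<in> Bd W \<Longrightarrow> F (b \<oplus>\<^bsub>Mn W\<^esub> s) = F s"
 shows "(\<Union>t\<in>cl W s. F t) = F s"
proof -
 have "F t = F s" if "t \<in> cl W s" for t using that F unfolding mem_cl by blast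
 then show ?thesis using cl_self[OF W s] by blast
qed

lemma H_simps:
 "Sec H W = {cl W s |s. cocyc W s}"
 "\<zero>\<^bsub>msec H W\<^esub> = cl W \<zero>\<^bsub>Mn W\<^esub>"
 "K \<oplus>\<^bsub>msec H W\<^esub> L = K <+>\<^bsub>Mn W\<^esub> L"
 "r \<odot>\<^bsub>msec H W\<^esub> K = (\<Union>s\<in>K. cl W (r \<odot>\<^bsub>Mn W\<^esub> s))"
 "mres H W W' K = (\<Union>s\<in>K. cl W' (mres (A n) W W' s))"
 by (simp_all add: cohom_presheaf_def)

lemma H_rep:
 assumes "K \<in> Sec H W" obtains s where "cocyc W s" "K = cl W s"
 using assms unfolding H_simps by blast

lemma cl_in: "cocyc W s \<Longrightarrow> cl W s \<in> Sec H W"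
 unfolding H_simps by blast

lemma cl_add:
 assumes W: "opn W" and s: "s \<in> carrier (Mn W)" and t: "t \<in> carrier (Mn W)"
 shows "cl W s \<oplus>\<^bsub>msec H W\<^esub> cl W t = cl W (s \<oplus>\<^bsub>Mn W\<^esub> t)"
proof -
 interpret abelian_group "Mn W" by (rule ab[OF W])
 show ?thesis
  unfolding H_simps
 proof (rule Set.set_eqI)
  fix u
  show "u \<in> cl W s <+>\<^bsub>Mn W\<^esub> cl W t \<longleftrightarrow> u \<in> cl W (s \<oplus>\<^bsub>Mn W\<^esub> t)"
  proof
   assume "u \<in> cl W s <+>\<^bsub>Mn W\<^esub> cl W t"
   then obtain p q where "p \<in> cl W s" "q \<in> cl W t" "u = p \<oplus>\<^bsub>Mn W\<^esub> q" unfolding set_add_def' by blast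
   then obtain b c where bc: "b \<in> Bd W" "c \<in> Bd W" "u = (b \<oplus>\<^bsub>Mn W\<^esub> s) \<oplus>\<^bsub>Mn W\<^esub> (c \<oplus>\<^bsub>Mn W\<^esub> t)"
    unfolding mem_cl by blast
   have "u = (b \<oplus>\<^bsub>Mn W\<^esub> c) \<oplus>\<^bsub>Mn W\<^esub> (s \<oplus>\<^bsub>Mn W\<^esub> t)"
    using bc(3) Bd_carrier[OF W bc(1)] Bd_carrier[OF W bc(2)] s t by (simp add: a_ac)
   then show "u \<in> cl W (s \<oplus>\<^bsub>Mn W\<^esub> t)" unfolding mem_cl using Bd_add[OF W bc(1,2)] by blast
  next
   assume "u \<in> cl W (s \<oplus>\<^bsub>Mn W\<^esub> t)"
   then obtain b where b: "b \<in> Bd W" "u = b \<oplus>\<^bsub>Mn W\<^esub> (s \<oplus>\<^bsub>Mn W\<^esub> t)" unfolding mem_cl by blast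
   have "u = (b \<oplus>\<^bsub>Mn W\<^esub> s) \<oplus>\<^bsub>Mn W\<^esub> t"
    using b(2) Bd_carrier[OF W b(1)] s t by (simp add: a_assoc)
   moreover have "b \<oplus>\<^bsub>Mn W\<^esub> s \<in> cl W s" unfolding mem_cl using b by blast
   ultimately show "u \<in> cl W s <+>\<^bsub>Mn W\<^esub> cl W t" unfolding set_add_def' using cl_self[OF W t] by blast
  qed
 qed
qed

lemma cl_smult:
 assumes W: "opn W" and s: "s \<in> carrier (Mn W)" and r: "r \<in> Rsec X W"
 shows "r \<odot>\<^bsub>msec H W\<^esub> cl W s = cl W (r \<odot>\<^bsub>Mn W\<^esub> s)"
 unfolding H_simps
proof (rule UN_cl[OF W s])
 interpret left_module "rsec X W" "Mn W" by (rule An.left_module_sec[OF W])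
 fix b assume b: "b \<in> Bd W"
 show "cl W (r \<odot>\<^bsub>Mn W\<^esub> (b \<oplus>\<^bsub>Mn W\<^esub> s)) = cl W (r \<odot>\<^bsub>Mn W\<^esub> s)"
  unfolding smult_r_distr[OF r Bd_carrier[OF W b] s]
  by (rule cl_shift[OF W Bd_smult[OF W b r] smult_closed[OF r s]])
qed

lemma cl_res:
 assumes W: "opn W" and s: "s \<in> carrier (Mn W)" and V: "opn V" "V \<subseteq> W"
 shows "mres H W V (cl W s) = cl V (mres (A n) W V s)"
 unfolding H_simps
proof (rule UN_cl[OF W s])
 fix b assume b: "b \<in> Bd W"
 show "cl V (mres (A n) W V (b \<oplus>\<^bsub>Mn W\<^esub> s)) = cl V (mres (A n) W V s)"
  unfolding An.mres_add[OF W V Bd_carrier[OF W b] s]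
  by (rule cl_shift[OF V(1) Bd_res[OF W b V] An.m.res_closed[OF W V s]])
qed

lemma cocyc_closed:
 assumes W: "opn W"
 shows cocyc_add: "cocyc W s \<Longrightarrow> cocyc W t \<Longrightarrow> cocyc W (s \<oplus>\<^bsub>Mn W\<^esub> t)"
  and cocyc_zero: "cocyc W \<zero>\<^bsub>Mn W\<^esub>"
  and cocyc_minus: "cocyc W s \<Longrightarrow> cocyc W (\<ominus>\<^bsub>Mn W\<^esub> s)"
  and cocyc_smult: "cocyc W s \<Longrightarrow> r \<in> Rsec X W \<Longrightarrow> cocyc W (r \<odot>\<^bsub>Mn W\<^esub> s)"
  and cocyc_res: "cocyc W s \<Longrightarrow> opn V \<Longrightarrow> V \<subseteq> W \<Longrightarrow> cocyc V (mres (A n) W V s)"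
proof -
 interpret h: add_group_hom "Mn W" "Ms W" "d n W" by (rule d_add_hom(2)[OF W])
 interpret L: left_module "rsec X W" "Ms W" by (rule A1.left_module_sec[OF W])
 show "cocyc W s \<Longrightarrow> cocyc W t \<Longrightarrow> cocyc W (s \<oplus>\<^bsub>Mn W\<^esub> t)" "cocyc W \<zero>\<^bsub>Mn W\<^esub>"
  "cocyc W s \<Longrightarrow> cocyc W (\<ominus>\<^bsub>Mn W\<^esub> s)"
  by simp_all
 show "cocyc W s \<Longrightarrow> r \<in> Rsec X W \<Longrightarrow> cocyc W (r \<odot>\<^bsub>Mn W\<^esub> s)"
  using d1(3)[OF W, of s r] An.sec_closed_M(2)[OF W, of s r] by simp
 show "cocyc W s \<Longrightarrow> opn V \<Longrightarrow> V \<subseteq> W \<Longrightarrow> cocyc V (mres (A n) W V s)"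
  using d1(4)[OF W, of s V] An.m.res_closed[OF W, of V s] A1.mres_zero[OF W, of V] by simp
qed

lemma mpre_H: "mpre X H"
proof (intro mpre.intro mpre_axioms.intro rsp_axioms)
 show "presheaf (rtop X) (\<lambda>U. Sec H U) (mres H)"
 proof
  fix U V K assume UV: "opn U" "opn V" "V \<subseteq> U" and K: "K \<in> Sec H U"
  obtain s where s: "cocyc U s" "K = cl U s" using H_rep[OF K] .
  show "mres H U V K \<in> Sec H V"
   unfolding s(2) cl_res[OF UV(1) conjunct1[OF s(1)] UV(2,3)] by (rule cl_in[OF cocyc_res[OF UV(1) s(1) UV(2,3)]])
 next
  fix U K assume U: "opn U" and K: "K \<in> Sec H U"
  obtain s where s: "cocyc U s" "K = cl U s" using H_rep[OF K] .
  show "mres H U U K = K"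
   unfolding s(2) cl_res[OF U conjunct1[OF s(1)] U subset_refl] An.m.res_id[OF U conjunct1[OF s(1)]] ..
 next
  fix U V W K assume o: "opn U" "opn V" "opn W" "W \<subseteq> V" "V \<subseteq> U" and K: "K \<in> Sec H U"
  obtain s where s: "cocyc U s" "K = cl U s" using H_rep[OF K] .
  note sc = conjunct1[OF s(1)]
  have o': "W \<subseteq> U" using o by blast
  show "mres H V W (mres H U V K) = mres H U W K"
   unfolding s(2) cl_res[OF o(1) sc o(2,5)] cl_res[OF o(1) sc o(3) o'] cl_res[OF o(2) An.m.res_closed[OF o(1,2,5) sc] o(3,4)]
    An.m.res_res[OF o sc] ..
 qed
next
 fix W assume W: "opn W"
 interpret L: left_module "rsec X W" "Mn W" by (rule An.left_module_sec[OF W])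
 note cs = cl_add[OF W] cl_smult[OF W] H_simps(2) L.smult_closed
 show "left_module (rsec X W) (msec H W)"
 proof (intro left_module.intro left_module_axioms.intro ring_sec[OF W] abelian_groupI)
  show "\<zero>\<^bsub>msec H W\<^esub> \<in> Sec H W" unfolding H_simps(2) by (rule cl_in[OF cocyc_zero[OF W]])
  fix K assume K: "K \<in> Sec H W"
  obtain s where s: "cocyc W s" "K = cl W s" using H_rep[OF K] .
  note sc = conjunct1[OF s(1)]
  show "\<zero>\<^bsub>msec H W\<^esub> \<oplus>\<^bsub>msec H W\<^esub> K = K" unfolding s(2) using sc by (simp only: cs L.M.zero_closed L.M.l_zero)
  show "\<exists>L\<in>Sec H W. L \<oplus>\<^bsub>msec H W\<^esub> K = \<zero>\<^bsub>msec H W\<^esub>"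
   by (rule bexI[OF _ cl_in[OF cocyc_minus[OF W s(1)]]]) (use sc in \<open>simp only: s(2) cs L.M.a_inv_closed L.M.l_neg\<close>)
  show "\<one>\<^bsub>rsec X W\<^esub> \<odot>\<^bsub>msec H W\<^esub> K = K" unfolding s(2) using sc by (simp only: cs L.R.one_closed L.smult_one)
  show "a \<odot>\<^bsub>msec H W\<^esub> K \<in> Sec H W" if "a \<in> Rsec X W" for a
   unfolding s(2) cl_smult[OF W sc that] by (rule cl_in[OF cocyc_smult[OF W s(1) that]])
  show "(a \<otimes>\<^bsub>rsec X W\<^esub> b) \<odot>\<^bsub>msec H W\<^esub> K = a \<odot>\<^bsub>msec H W\<^esub> (b \<odot>\<^bsub>msec H W\<^esub> K)"
   "(a \<oplus>\<^bsub>rsec X W\<^esub> b) \<odot>\<^bsub>msec H W\<^esub> K = a \<odot>\<^bsub>msec H W\<^esub> K \<oplus>\<^bsub>msec H W\<^esub> b \<odot>\<^bsub>msec H W\<^esub> K"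
   if "a \<in> Rsec X W" "b \<in> Rsec X W" for a b
   unfolding s(2) using sc that by (simp_all only: cs L.R.m_closed L.R.a_closed L.smult_assoc L.smult_l_distr)
  fix K' assume K': "K' \<in> Sec H W"
  obtain t where t: "cocyc W t" "K' = cl W t" using H_rep[OF K'] .
  note tc = conjunct1[OF t(1)]
  show "K \<oplus>\<^bsub>msec H W\<^esub> K' \<in> Sec H W"
   unfolding s(2) t(2) cl_add[OF W sc tc] by (rule cl_in[OF cocyc_add[OF W s(1) t(1)]])
  show "K \<oplus>\<^bsub>msec H W\<^esub> K' = K' \<oplus>\<^bsub>msec H W\<^esub> K"
   unfolding s(2) t(2) cl_add[OF W sc tc] cl_add[OF W tc sc] L.M.a_comm[OF sc tc] ..
  show "a \<odot>\<^bsub>msec H W\<^esub> (K \<oplus>\<^bsub>msec H W\<^esub> K') = a \<odot>\<^bsub>msec H W\<^esub> K \<oplus>\<^bsub>msec H W\<^esub> a \<odot>\<^bsub>msec H W\<^esub> K'"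
   if "a \<in> Rsec X W" for a
   unfolding s(2) t(2) using sc tc that by (simp only: cs L.M.a_closed L.smult_r_distr)
  fix K'' assume K'': "K'' \<in> Sec H W"
  obtain u where u: "cocyc W u" "K'' = cl W u" using H_rep[OF K''] .
  note uc = conjunct1[OF u(1)]
  show "K \<oplus>\<^bsub>msec H W\<^esub> K' \<oplus>\<^bsub>msec H W\<^esub> K'' = K \<oplus>\<^bsub>msec H W\<^esub> (K' \<oplus>\<^bsub>msec H W\<^esub> K'')"
   unfolding s(2) t(2) u(2) using sc tc uc by (simp only: cs L.M.a_closed L.M.a_assoc)
 qed
next
 fix U V K K' a assume UV: "opn U" "opn V" "V \<subseteq> U"
 assume K': "K' \<in> Sec H U"
 obtain t where t: "cocyc U t" "K' = cl U t" using H_rep[OF K'] .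
 note tc = conjunct1[OF t(1)]
 note rc = An.m.res_closed[OF UV]
 show "mres H U V (K \<oplus>\<^bsub>msec H U\<^esub> K') = mres H U V K \<oplus>\<^bsub>msec H V\<^esub> mres H U V K'" if K: "K \<in> Sec H U"
 proof -
  obtain s where s: "cocyc U s" "K = cl U s" using H_rep[OF K] .
  note sc = conjunct1[OF s(1)]
  show ?thesis
   unfolding s(2) t(2) cl_add[OF UV(1) sc tc] cl_res[OF UV(1) sc UV(2,3)] cl_res[OF UV(1) tc UV(2,3)]
    cl_res[OF UV(1) An.sec_closed_M(1)[OF UV(1) sc tc] UV(2,3)] cl_add[OF UV(2) rc[OF sc] rc[OF tc]] An.mres_add[OF UV sc tc] ..
 qed
 show "mres H U V (a \<odot>\<^bsub>msec H U\<^esub> K') = rres X U V a \<odot>\<^bsub>msec H V\<^esub> mres H U V K'" if a: "a \<in> Rsec X U"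
  unfolding t(2) cl_smult[OF UV(1) tc a] cl_res[OF UV(1) tc UV(2,3)] cl_res[OF UV(1) An.sec_closed_M(2)[OF UV(1) tc a] UV(2,3)]
   cl_smult[OF UV(2) rc[OF tc] r.res_closed[OF UV a]] An.mres_smult[OF UV a tc] ..
qed

end

text \<open>The map of cohomology presheaves inside \<open>cohom_map\<close>, before passing to
  stalks.\<close>

definition ind_map where
 "ind_map B dB \<phi> n = (\<lambda>V K. \<Union>c\<in>K. dB (n - 1) V ` Sec (B (n - 1)) V +>\<^bsub>msec (B n) V\<^esub> \<phi> n V c)"

locale chain_map_at = A: complex_at X A dA n + B: complex_at X B dB n
 for X :: "('x, 'r) rspace" and A :: "('x, 'r, 'm) gmod" and dA and B :: "('x, 'r, 'n) gmod" and dB and n +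
 fixes \<phi> assumes cm: "chain_map X A dA B dB \<phi>"
begin

lemma \<phi>_hom: "\<phi> k \<in> mod_hom X (A k) (B k)"
 using cm by (auto simp: chain_map_def gHom_carrier dest: spec[of _ k])

lemmas \<phi>D = presheaf_homD[OF mod_homD[OF \<phi>_hom]]

lemma \<phi>_d:
 assumes W: "A.opn W" and s: "s \<in> Sec (A k) W"
 shows "dB k W (\<phi> k W s) = \<phi> (k + 1) W (dA k W s)"
proof -
 have "gcomp X A 0 dB \<phi> k W s = gcomp X A 1 \<phi> dA k W s" using cm by (simp add: chain_map_def)
 then show ?thesis by (simp add: gcomp_def mod_comp_apply[OF W s])
qed

lemma \<phi>_Bd: "A.opn W \<Longrightarrow> b \<in> A.Bd W \<Longrightarrow> \<phi> n W b \<in> B.Bd W"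
proof -
 assume W: "A.opn W" and "b \<in> A.Bd W"
 then obtain x where x: "x \<in> Sec (A (n - 1)) W" "b = dA (n - 1) W x" by blast
 show ?thesis
  by (rule image_eqI[OF _ \<phi>D(1)[OF W x(1)]]) (use \<phi>_d[OF W x(1)] x(2) in simp)
qed

lemma \<phi>_cocyc: "A.opn W \<Longrightarrow> A.cocyc W s \<Longrightarrow> B.cocyc W (\<phi> n W s)"
proof -
 assume W: "A.opn W" and s: "A.cocyc W s"
 interpret h: add_group_hom "msec (A (n + 1)) W" "msec (B (n + 1)) W" "\<phi> (n + 1) W"
  by (rule mod_hom_add_group_hom[OF A.A1.mpre_axioms B.A1.mpre_axioms \<phi>_hom W])
 show ?thesis using \<phi>_d[OF W conjunct1[OF s]] s \<phi>D(1)[OF W conjunct1[OF s]] by simp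
qed

lemma ind_cl:
 assumes W: "A.opn W" and s: "s \<in> Sec (A n) W"
 shows "ind_map B dB \<phi> n W (A.cl W s) = B.cl W (\<phi> n W s)"
 unfolding ind_map_def
proof (rule A.UN_cl[OF W s])
 fix b assume b: "b \<in> A.Bd W"
 show "B.cl W (\<phi> n W (b \<oplus>\<^bsub>msec (A n) W\<^esub> s)) = B.cl W (\<phi> n W s)"
  unfolding \<phi>D(2)[OF W A.Bd_carrier[OF W b] s] by (rule B.cl_shift[OF W \<phi>_Bd[OF W b] \<phi>D(1)[OF W s]])
qed

lemma ind_map_hom: "presheaf_hom X A.H B.H (ind_map B dB \<phi> n)"
proof (rule presheaf_homI)
 fix W K assume W: "A.opn W" and K: "K \<in> Sec A.H W"
 obtain s where s: "A.cocyc W s" "K = A.cl W s" using A.H_rep[OF K] .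
 note sc = conjunct1[OF s(1)]
 show "ind_map B dB \<phi> n W K \<in> Sec B.H W"
  unfolding s(2) ind_cl[OF W sc] by (rule B.cl_in[OF \<phi>_cocyc[OF W s(1)]])
 show "ind_map B dB \<phi> n W (r \<odot>\<^bsub>msec A.H W\<^esub> K) = r \<odot>\<^bsub>msec B.H W\<^esub> ind_map B dB \<phi> n W K" if r: "r \<in> Rsec X W" for r
  unfolding s(2) A.cl_smult[OF W sc r] ind_cl[OF W sc] ind_cl[OF W A.An.sec_closed_M(2)[OF W sc r]]
   B.cl_smult[OF W \<phi>D(1)[OF W sc] r] \<phi>D(3)[OF W sc r] ..
 show "ind_map B dB \<phi> n V (mres A.H W V K) = mres B.H W V (ind_map B dB \<phi> n W K)" if V: "A.opn V" "V \<subseteq> W" for V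
  unfolding s(2) A.cl_res[OF W sc V] ind_cl[OF W sc] ind_cl[OF V(1) A.An.m.res_closed[OF W V sc]]
   B.cl_res[OF W \<phi>D(1)[OF W sc] V] \<phi>D(4)[OF W sc V] ..
 fix K' assume K': "K' \<in> Sec A.H W"
 obtain t where t: "A.cocyc W t" "K' = A.cl W t" using A.H_rep[OF K'] .
 note tc = conjunct1[OF t(1)]
 show "ind_map B dB \<phi> n W (K \<oplus>\<^bsub>msec A.H W\<^esub> K') = ind_map B dB \<phi> n W K \<oplus>\<^bsub>msec B.H W\<^esub> ind_map B dB \<phi> n W K'"
  unfolding s(2) t(2) A.cl_add[OF W sc tc] ind_cl[OF W sc] ind_cl[OF W tc] ind_cl[OF W A.An.sec_closed_M(1)[OF W sc tc]]
   B.cl_add[OF W \<phi>D(1)[OF W sc] \<phi>D(1)[OF W tc]] \<phi>D(2)[OF W sc tc] ..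
qed

end

text \<open>On a cocycle \<open>s\<close> the homotopy gives
  \<open>\<psi> (\<phi> s) = d (\<eta> s) + \<eta> (d s) + s\<close>, and the middle term vanishes,
  so the class of \<open>s\<close> does not change. The argument takes place over one open set,
  hence before sheafification.\<close>

lemma ind_map_inverse:
 assumes \<phi>: "chain_map X A dA B dB \<phi>" and \<psi>: "chain_map X B dB A dA \<psi>"
  and h: "chain_homotopic X A dA A dA (gcomp X A 0 \<psi> \<phi>) (gid X A)"
  and W: "openin (rtop X) W" and K: "K \<in> Sec (cohom_presheaf X A dA n) W"
 shows "ind_map A dA \<psi> n W (ind_map B dB \<phi> n W K) = K"
proof -
 have cA: "cochain_complex X A dA" and cB: "cochain_complex X B dB" using \<phi> by (simp_all add: chain_map_def)
 have X: "rsp X" using cA sheaf_of_modules_mpre[of X "A 0"] by (simp add: cochain_complex_def mpre_def)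
 interpret p: chain_map_at X A dA B dB n \<phi>
  using cA cB \<phi> X by (simp add: chain_map_at_def chain_map_at_axioms_def complex_at_def complex_at_axioms_def)
 interpret q: chain_map_at X B dB A dA n \<psi>
  using cA cB \<psi> X by (simp add: chain_map_at_def chain_map_at_axioms_def complex_at_def complex_at_axioms_def)
 obtain s where s: "p.A.cocyc W s" "K = p.A.cl W s" using p.A.H_rep[OF K] .
 note sc = conjunct1[OF s(1)]
 obtain \<eta> where e: "\<eta> \<in> carrier (gHom X A A (- 1))" and
  eq: "gcomp X A 0 \<psi> \<phi> \<ominus>\<^bsub>gHom X A A 0\<^esub> gid X A = gcomp X A (- 1) dA \<eta> \<oplus>\<^bsub>gHom X A A 0\<^esub> gcomp X A 1 \<eta> dA"
  using h by (auto simp: chain_homotopic_def)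
 note shA = p.A.sh
 have d: "dA \<in> carrier (gHom X A A 1)" using cA by (simp add: cochain_complex_def)
 interpret G: abelian_group "gHom X A A 0" by (rule abelian_group_gHom[OF shA shA])
 have g1: "gcomp X A 0 \<psi> \<phi> \<in> carrier (gHom X A A 0)"
  using gcomp_closed[OF shA, of \<psi> B A 0 \<phi> 0 0] \<phi> \<psi> by (simp add: chain_map_def)
 have g2: "gid X A \<in> carrier (gHom X A A 0)"
  unfolding gHom_carrier gid_def using mod_id_hom[OF sheavesD(2)[OF shA]] by simp
 have g3: "gcomp X A (- 1) dA \<eta> \<in> carrier (gHom X A A 0)" "gcomp X A 1 \<eta> dA \<in> carrier (gHom X A A 0)"
  using gcomp_closed[OF shA d e, of 0] gcomp_closed[OF shA e d, of 0] by simp_all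
 have "gcomp X A 0 \<psi> \<phi> = (gcomp X A 0 \<psi> \<phi> \<ominus>\<^bsub>gHom X A A 0\<^esub> gid X A) \<oplus>\<^bsub>gHom X A A 0\<^esub> gid X A"
  using g1 g2 by (simp add: a_minus_def G.a_assoc G.l_neg)
 also have "\<dots> = (gcomp X A (- 1) dA \<eta> \<oplus>\<^bsub>gHom X A A 0\<^esub> gcomp X A 1 \<eta> dA) \<oplus>\<^bsub>gHom X A A 0\<^esub> gid X A"
  unfolding eq ..
 finally have "gcomp X A 0 \<psi> \<phi> n W s = ((gcomp X A (- 1) dA \<eta> \<oplus>\<^bsub>gHom X A A 0\<^esub> gcomp X A 1 \<eta> dA) \<oplus>\<^bsub>gHom X A A 0\<^esub> gid X A) n W s"
  by (rule arg_cong[of _ _ "\<lambda>f. f n W s"])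
 then have val: "\<psi> n W (\<phi> n W s) = (dA (n - 1) W (\<eta> n W s) \<oplus>\<^bsub>msec (A n) W\<^esub> \<eta> (n + 1) W (dA n W s)) \<oplus>\<^bsub>msec (A n) W\<^esub> s"
  by (simp add: gcomp_def gHom_add hadd_apply[OF W sc] mod_comp_apply[OF W sc] gid_def mod_id_def on_sections_apply[OF W sc])
 have en: "\<eta> (n + 1) \<in> mod_hom X (A (n + 1)) (A n)"
  using e[unfolded gHom_carrier, rule_format, of "n + 1"] by simp
 have en0: "\<eta> n \<in> mod_hom X (A n) (A (n - 1))"
  using e[unfolded gHom_carrier, rule_format, of n] by simp
 interpret hh: add_group_hom "msec (A (n + 1)) W" "msec (A n) W" "\<eta> (n + 1) W"
  by (rule mod_hom_add_group_hom[OF p.A.A1.mpre_axioms p.A.An.mpre_axioms en W])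
 have es: "\<eta> n W s \<in> Sec (A (n - 1)) W" by (rule presheaf_homD(1)[OF mod_homD[OF en0] W sc])
 have bd: "dA (n - 1) W (\<eta> n W s) \<in> p.A.Bd W" using es by (rule imageI)
 have val': "\<psi> n W (\<phi> n W s) = dA (n - 1) W (\<eta> n W s) \<oplus>\<^bsub>msec (A n) W\<^esub> s"
  unfolding val conjunct2[OF s(1)] using p.A.Bd_carrier[OF W bd] by simp
 show ?thesis
  unfolding s(2) p.ind_cl[OF W sc] q.ind_cl[OF W p.\<phi>D(1)[OF W sc]] val' by (rule p.A.cl_shift[OF W bd sc])
qed

section \<open>Sheafification of presheaf maps\<close>

context mpre
begin

lemma sheafify_simps [simp]:
 "zero (msec (sheafify X M) W) = (\<lambda>x\<in>W. \<zero>\<^bsub>stalk_mod X M x\<^esub>)"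
 "add (msec (sheafify X M) W) = (\<lambda>s t. \<lambda>x\<in>W. s x \<oplus>\<^bsub>stalk_mod X M x\<^esub> t x)"
 "smult (msec (sheafify X M) W) = (\<lambda>r s. \<lambda>x\<in>W. rgerm X x W r \<odot>\<^bsub>stalk_mod X M x\<^esub> s x)"
 "mres (sheafify X M) W W' s = restrict s W'"
 by (simp_all add: sheafify_def)

definition gsec where "gsec W s x \<longleftrightarrow> (\<exists>W' m. opn W' \<and> x \<in> W' \<and> W' \<subseteq> W \<and> m \<in> Sec M W' \<and> (\<forall>y\<in>W'. s y = mgerm X M y W' m))"

lemma sheafify_carrier: "s \<in> Sec (sheafify X M) W \<longleftrightarrow> s \<in> (\<Pi>\<^sub>E x\<in>W. carrier (stalk_mod X M x)) \<and> (\<forall>x\<in>W. gsec W s x)"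
 unfolding sheafify_def msheaf.select_convs partial_object.select_convs gsec_def by blast

lemma at_pt: "opn W \<Longrightarrow> x \<in> W \<Longrightarrow> mpre_pt X M x"
 using opn_top_sub by (intro mpre_pt.intro rsp_pt.intro rsp_pt_axioms.intro mpre_axioms rsp_axioms) blast

lemma sheafify_val: "s \<in> Sec (sheafify X M) W \<Longrightarrow> x \<in> W \<Longrightarrow> s x \<in> carrier (stalk_mod X M x)"
 unfolding sheafify_carrier by blast

lemma gsecE:
 assumes "gsec W s x"
 obtains W' m where "opn W'" "x \<in> W'" "W' \<subseteq> W" "m \<in> Sec M W'" "\<And>y. y \<in> W' \<Longrightarrow> s y = mgerm X M y W' m"
 using assms unfolding gsec_def by blast

lemma gsecI:
 assumes "opn W'" "x \<in> W'" "W' \<subseteq> W" "m \<in> Sec M W'" "\<And>y. y \<in> W' \<Longrightarrow> s y = mgerm X M y W' m"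
 shows "gsec W s x"
 unfolding gsec_def using assms by blast

lemma sheafify_add:
 assumes W: "opn W" and s: "s \<in> Sec (sheafify X M) W" and t: "t \<in> Sec (sheafify X M) W"
 shows "s \<oplus>\<^bsub>msec (sheafify X M) W\<^esub> t \<in> Sec (sheafify X M) W"
 unfolding sheafify_carrier
proof (intro conjI ballI)
 show "s \<oplus>\<^bsub>msec (sheafify X M) W\<^esub> t \<in> (\<Pi>\<^sub>E x\<in>W. carrier (stalk_mod X M x))"
  unfolding sheafify_simps
 proof (rule restrict_PiE_iff[THEN iffD2], rule ballI)
  fix x assume x: "x \<in> W"
  interpret mpre_pt X M x by (rule at_pt[OF W x])
  show "s x \<oplus>\<^bsub>SM\<^esub> t x \<in> carrier SM" using sheafify_val[OF s x] sheafify_val[OF t x] by simp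
 qed
 fix x assume x: "x \<in> W"
 have "gsec W s x" "gsec W t x" using s t x unfolding sheafify_carrier by blast+
 then obtain W1 m1 W2 m2 where 1: "opn W1" "x \<in> W1" "W1 \<subseteq> W" "m1 \<in> Sec M W1" "\<And>y. y \<in> W1 \<Longrightarrow> s y = mgerm X M y W1 m1"
  and 2: "opn W2" "x \<in> W2" "W2 \<subseteq> W" "m2 \<in> Sec M W2" "\<And>y. y \<in> W2 \<Longrightarrow> t y = mgerm X M y W2 m2"
  by (elim gsecE) (rule that)
 let ?V = "W1 \<inter> W2"
 have V: "opn ?V" "x \<in> ?V" "?V \<subseteq> W" "?V \<subseteq> W1" "?V \<subseteq> W2" using 1 2 by auto
 have m: "mres M W1 ?V m1 \<in> Sec M ?V" "mres M W2 ?V m2 \<in> Sec M ?V"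
  using m.res_closed[OF 1(1) V(1,4) 1(4)] m.res_closed[OF 2(1) V(1,5) 2(4)] .
 show "gsec W (s \<oplus>\<^bsub>msec (sheafify X M) W\<^esub> t) x"
 proof (rule gsecI[OF V(1-3) sec_closed_M(1)[OF V(1) m]])
  fix y assume y: "y \<in> ?V"
  interpret mpre_pt X M y by (rule at_pt[OF V(1) y])
  have y': "y \<in> W" "y \<in> W1" "y \<in> W2" using y V by auto
  have nb: "nb ?V" "nb W1" "nb W2" using y 1 2 V by auto
  have "mg ?V (mres M W1 ?V m1 \<oplus>\<^bsub>msec M ?V\<^esub> mres M W2 ?V m2) = mg ?V (mres M W1 ?V m1) \<oplus>\<^bsub>SM\<^esub> mg ?V (mres M W2 ?V m2)"
   by (rule mg_add[OF nb(1) m, symmetric])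
  also have "\<dots> = s y \<oplus>\<^bsub>SM\<^esub> t y"
   unfolding mg_res[OF nb(2,1) V(4) 1(4)] mg_res[OF nb(3,1) V(5) 2(4)] 1(5)[OF y'(2)] 2(5)[OF y'(3)] ..
  finally show "(s \<oplus>\<^bsub>msec (sheafify X M) W\<^esub> t) y = mg ?V (mres M W1 ?V m1 \<oplus>\<^bsub>msec M ?V\<^esub> mres M W2 ?V m2)"
   using y'(1) by simp
 qed
qed

lemma sheafify_smult:
 assumes W: "opn W" and s: "s \<in> Sec (sheafify X M) W" and a: "a \<in> Rsec X W"
 shows "a \<odot>\<^bsub>msec (sheafify X M) W\<^esub> s \<in> Sec (sheafify X M) W"
 unfolding sheafify_carrier
proof (intro conjI ballI)
 show "a \<odot>\<^bsub>msec (sheafify X M) W\<^esub> s \<in> (\<Pi>\<^sub>E x\<in>W. carrier (stalk_mod X M x))"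
  unfolding sheafify_simps
 proof (rule restrict_PiE_iff[THEN iffD2], rule ballI)
  fix x assume x: "x \<in> W"
  interpret mpre_pt X M x by (rule at_pt[OF W x])
  show "rgerm X x W a \<odot>\<^bsub>SM\<^esub> s x \<in> carrier SM" using sheafify_val[OF s x] a W x by (intro SM.smult_closed) simp_all
 qed
 fix x assume x: "x \<in> W"
 have "gsec W s x" using s x unfolding sheafify_carrier by blast
 then obtain V m1 where V: "opn V" "x \<in> V" "V \<subseteq> W" "m1 \<in> Sec M V" "\<And>y. y \<in> V \<Longrightarrow> s y = mgerm X M y V m1"
  by (elim gsecE) (rule that)
 have a': "rres X W V a \<in> Rsec X V" by (rule r.res_closed[OF W V(1,3) a])
 show "gsec W (a \<odot>\<^bsub>msec (sheafify X M) W\<^esub> s) x"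
 proof (rule gsecI[OF V(1-3) sec_closed_M(2)[OF V(1,4) a']])
  fix y assume y: "y \<in> V"
  interpret mpre_pt X M y by (rule at_pt[OF V(1) y])
  have nb: "nb V" "nb W" and yW: "y \<in> W" using y V W by auto
  have "mg V (rres X W V a \<odot>\<^bsub>msec M V\<^esub> m1) = g V (rres X W V a) \<odot>\<^bsub>SM\<^esub> mg V m1"
   by (rule mg_smult[OF nb(1) a' V(4), symmetric])
  also have "\<dots> = g W a \<odot>\<^bsub>SM\<^esub> s y" unfolding g_res[OF nb(2,1) V(3) a] V(5)[OF y] ..
  finally show "(a \<odot>\<^bsub>msec (sheafify X M) W\<^esub> s) y = mg V (rres X W V a \<odot>\<^bsub>msec M V\<^esub> m1)" using yW by simp
 qed
qed

lemma sheafify_res: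
 assumes V: "opn V" "V \<subseteq> W" and s: "s \<in> Sec (sheafify X M) W"
 shows "restrict s V \<in> Sec (sheafify X M) V"
 unfolding sheafify_carrier
proof (intro conjI ballI)
 show "restrict s V \<in> (\<Pi>\<^sub>E x\<in>V. carrier (stalk_mod X M x))"
  using sheafify_val[OF s] V by (intro restrict_PiE_iff[THEN iffD2]) blast
 fix x assume x: "x \<in> V"
 have "gsec W s x" using s x V unfolding sheafify_carrier by blast
 then obtain U m1 where U: "opn U" "x \<in> U" "U \<subseteq> W" "m1 \<in> Sec M U" "\<And>y. y \<in> U \<Longrightarrow> s y = mgerm X M y U m1"
  by (elim gsecE) (rule that)
 let ?V = "U \<inter> V"
 have o: "opn ?V" "x \<in> ?V" "?V \<subseteq> V" "?V \<subseteq> U" using U V x by auto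
 show "gsec V (restrict s V) x"
 proof (rule gsecI[OF o(1-3) m.res_closed[OF U(1) o(1,4) U(4)]])
  fix y assume y: "y \<in> ?V"
  interpret mpre_pt X M y by (rule at_pt[OF o(1) y])
  have nb: "nb U" "nb ?V" and yV: "y \<in> V" "y \<in> U" using y U o by auto
  show "restrict s V y = mg ?V (mres M U ?V m1)"
   unfolding mg_res[OF nb o(4) U(4)] using yV U(5) by simp
 qed
qed

end

text \<open>A family of germs that is locally given by a section \<open>m1\<close> is sent to the
  family locally given by \<open>u m1\<close>, so the pointwise stalk maps preserve
  sections.\<close>

lemma sheafify_hom:
 assumes "mpre X M" "mpre X N" and u: "presheaf_hom X M N u"
 shows "presheaf_hom X (sheafify X M) (sheafify X N) (\<lambda>W s. \<lambda>x\<in>W. stalk_map X N u x (s x))"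
proof (rule presheaf_homI)
 interpret M: mpre X M by fact
 interpret N: mpre X N by fact
 fix W s assume W: "M.opn W" and s: "s \<in> Sec (sheafify X M) W"
 note sm = stalk_map[OF assms]
 have xX: "x \<in> Pts X" if "x \<in> W" for x using W that M.opn_top_sub by blast
 have lin: "stalk_map X N u x c \<in> carrier (stalk_mod X N x)"
  "c' \<in> carrier (stalk_mod X M x) \<Longrightarrow> stalk_map X N u x (c \<oplus>\<^bsub>stalk_mod X M x\<^esub> c') = stalk_map X N u x c \<oplus>\<^bsub>stalk_mod X N x\<^esub> stalk_map X N u x c'"
  "a \<in> carrier (stalk_ring X x) \<Longrightarrow> stalk_map X N u x (a \<odot>\<^bsub>stalk_mod X M x\<^esub> c) = a \<odot>\<^bsub>stalk_mod X N x\<^esub> stalk_map X N u x c"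
  if "x \<in> W" "c \<in> carrier (stalk_mod X M x)" for x c c' a
  using sm(2)[OF xX[OF that(1)]] that by (auto simp: lin_map_def add_hom_def)
 show "(\<lambda>x\<in>W. stalk_map X N u x (s x)) \<in> Sec (sheafify X N) W"
  unfolding N.sheafify_carrier
 proof (intro conjI ballI)
  show "(\<lambda>x\<in>W. stalk_map X N u x (s x)) \<in> (\<Pi>\<^sub>E x\<in>W. carrier (stalk_mod X N x))"
   by (rule restrict_PiE_iff[THEN iffD2]) (simp add: lin(1) M.sheafify_val[OF s])
  fix x assume x: "x \<in> W"
  have "M.gsec W s x" using s x unfolding M.sheafify_carrier by blast
  then obtain V m1 where V: "M.opn V" "x \<in> V" "V \<subseteq> W" "m1 \<in> Sec M V" "\<And>y. y \<in> V \<Longrightarrow> s y = mgerm X M y V m1"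
   by (elim M.gsecE) (rule that)
  show "N.gsec W (\<lambda>x\<in>W. stalk_map X N u x (s x)) x"
  proof (rule N.gsecI[OF V(1-3) presheaf_homD(1)[OF u V(1,4)]])
   fix y assume y: "y \<in> V"
   have yW: "y \<in> W" using y V by blast
   have "stalk_map X N u y (s y) = mgerm X N y V (u V m1)"
    unfolding V(5)[OF y] by (rule sm(1)[OF xX[OF yW] V(1) y V(4)])
   then show "(\<lambda>x\<in>W. stalk_map X N u x (s x)) y = mgerm X N y V (u V m1)" using yW by simp
  qed
 qed
 show "(\<lambda>x\<in>W. stalk_map X N u x ((s \<oplus>\<^bsub>msec (sheafify X M) W\<^esub> t) x)) =
   (\<lambda>x\<in>W. stalk_map X N u x (s x)) \<oplus>\<^bsub>msec (sheafify X N) W\<^esub> (\<lambda>x\<in>W. stalk_map X N u x (t x))"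
  if t: "t \<in> Sec (sheafify X M) W" for t
  unfolding M.sheafify_simps N.sheafify_simps
  by (rule restrict_ext) (simp add: lin(2)[OF _ M.sheafify_val[OF s] M.sheafify_val[OF t]])
 show "(\<lambda>x\<in>W. stalk_map X N u x ((r \<odot>\<^bsub>msec (sheafify X M) W\<^esub> s) x)) =
   r \<odot>\<^bsub>msec (sheafify X N) W\<^esub> (\<lambda>x\<in>W. stalk_map X N u x (s x))"
  if r: "r \<in> Rsec X W" for r
  unfolding M.sheafify_simps N.sheafify_simps
 proof (rule restrict_ext)
  fix y assume y: "y \<in> W"
  interpret mpre_pt X M y by (rule M.at_pt[OF W y])
  have "g W r \<in> carrier St" using W y r by simp
  from lin(3)[OF y M.sheafify_val[OF s y] this]
  show "stalk_map X N u y ((\<lambda>x\<in>W. rgerm X x W r \<odot>\<^bsub>stalk_mod X M x\<^esub> s x) y) =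
   rgerm X y W r \<odot>\<^bsub>stalk_mod X N y\<^esub> (\<lambda>x\<in>W. stalk_map X N u x (s x)) y" using y by simp
 qed
 show "(\<lambda>x\<in>V. stalk_map X N u x (mres (sheafify X M) W V s x)) = mres (sheafify X N) W V (\<lambda>x\<in>W. stalk_map X N u x (s x))"
  if V: "M.opn V" "V \<subseteq> W" for V
  unfolding M.sheafify_simps N.sheafify_simps by (rule ext) (use V in \<open>auto simp: restrict_def\<close>)
qed

text \<open>Mutually inverse maps of presheaves induce mutually inverse maps of stalks, and sections
  of the sheafification are families of germs, so the two maps on sections are inverse to each other
  pointwise.\<close>

lemma sheafify_iso:
 assumes M: "mpre X M" and N: "mpre X N" and u: "presheaf_hom X M N u" and v: "presheaf_hom X N M v"
  and vu: "\<And>W s. openin (rtop X) W \<Longrightarrow> s \<in> Sec M W \<Longrightarrow> v W (u W s) = s"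
  and uv: "\<And>W s. openin (rtop X) W \<Longrightarrow> s \<in> Sec N W \<Longrightarrow> u W (v W s) = s"
 shows "mod_iso X (sheafify X M) (sheafify X N)
   (on_sections X (sheafify X M) (\<lambda>W s. \<lambda>x\<in>W. stalk_map X N u x (s x)))"
proof -
 interpret M: mpre X M by fact
 interpret N: mpre X N by fact
 note hu = sheafify_hom[OF M N u] and hv = sheafify_hom[OF N M v]
 let ?U = "\<lambda>W s. \<lambda>x\<in>W. stalk_map X N u x (s x)"
 let ?V = "\<lambda>W s. \<lambda>x\<in>W. stalk_map X M v x (s x)"
 \<comment> \<open>Stated for arbitrary presheaves and section types, since it is used for both
   orders of \<open>M\<close> and \<open>N\<close>.\<close>
 have stalk: "stalk_map X L' v x (stalk_map X L u x c) = c"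
  if a: "mpre X L" "mpre X L'" "presheaf_hom X L' L u" "presheaf_hom X L L' v"
   "\<And>W s. openin (rtop X) W \<Longrightarrow> s \<in> Sec L' W \<Longrightarrow> v W (u W s) = s"
   "openin (rtop X) W" "x \<in> W" "c \<in> carrier (stalk_mod X L' x)"
  for L :: "('x, 'r, 'k) msheaf" and L' :: "('x, 'r, 'l) msheaf" and X :: "('x, 'r) rspace" and u v x c W
 proof -
  interpret L': mpre X L' by fact
  interpret L': mpre_pt X L' x by (rule L'.at_pt) (rule a)+
  obtain V m where V: "openin (rtop X) V \<and> x \<in> V" "m \<in> Sec L' V" "c = mgerm X L' x V m" using L'.mcarrierE[OF a(8)] .
  have V1: "openin (rtop X) V" "x \<in> V" using V(1) by auto
  show ?thesis
   unfolding V(3) stalk_map_mgerm[OF a(2,1,3) L'.x_in V1 V(2)]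
    stalk_map_mgerm[OF a(1,2,4) L'.x_in V1 presheaf_homD(1)[OF a(3) V1(1) V(2)]] a(5)[OF V1(1) V(2)] ..
 qed
 have hom: "on_sections X (sheafify X M) ?U \<in> mod_hom X (sheafify X M) (sheafify X N)"
 proof -
  have "presheaf_hom X (sheafify X M) (sheafify X N) (on_sections X (sheafify X M) ?U)"
  proof (rule presheaf_homI)
   fix W s assume W: "openin (rtop X) W" and s: "s \<in> Sec (sheafify X M) W"
   note o = on_sections_apply[OF W, of _ "sheafify X M" ?U]
   show "on_sections X (sheafify X M) ?U W s \<in> Sec (sheafify X N) W"
    unfolding o[OF s] by (rule presheaf_homD(1)[OF hu W s])
   show "on_sections X (sheafify X M) ?U W (s \<oplus>\<^bsub>msec (sheafify X M) W\<^esub> t) =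
    on_sections X (sheafify X M) ?U W s \<oplus>\<^bsub>msec (sheafify X N) W\<^esub> on_sections X (sheafify X M) ?U W t"
    if t: "t \<in> Sec (sheafify X M) W" for t
    unfolding o[OF s] o[OF t] o[OF M.sheafify_add[OF W s t]] by (rule presheaf_homD(2)[OF hu W s t])
   show "on_sections X (sheafify X M) ?U W (r \<odot>\<^bsub>msec (sheafify X M) W\<^esub> s) =
    r \<odot>\<^bsub>msec (sheafify X N) W\<^esub> on_sections X (sheafify X M) ?U W s"
    if r: "r \<in> Rsec X W" for r
    unfolding o[OF s] o[OF M.sheafify_smult[OF W s r]] by (rule presheaf_homD(3)[OF hu W s r])
   show "on_sections X (sheafify X M) ?U V (mres (sheafify X M) W V s) = mres (sheafify X N) W V (on_sections X (sheafify X M) ?U W s)"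
    if V: "openin (rtop X) V" "V \<subseteq> W" for V
   proof -
    have r: "mres (sheafify X M) W V s \<in> Sec (sheafify X M) V"
     unfolding M.sheafify_simps by (rule M.sheafify_res[OF V s])
    show ?thesis
     unfolding o[OF s] on_sections_apply[OF V(1) r, of ?U] by (rule presheaf_homD(4)[OF hu W s V])
   qed
  qed
  then show ?thesis by (simp add: mod_hom_iff on_sections_idem)
 qed
 show ?thesis
  unfolding mod_iso_def
 proof (intro conjI hom allI impI)
  fix W assume W: "openin (rtop X) W"
  have VU: "?V W (?U W s) = s" if s: "s \<in> Sec (sheafify X M) W" for s
  proof -
   have "?V W (?U W s) x = s x" for x
   proof (cases "x \<in> W")
    case True
    then show ?thesis using stalk[OF N M u v vu W True M.sheafify_val[OF s True]] by simp
   next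
    case False
    then show ?thesis using s unfolding M.sheafify_carrier by auto
   qed
   then show ?thesis by blast
  qed
  have UV: "?U W (?V W s) = s" if s: "s \<in> Sec (sheafify X N) W" for s
  proof -
   have "?U W (?V W s) x = s x" for x
   proof (cases "x \<in> W")
    case True
    then show ?thesis using stalk[OF M N v u uv W True N.sheafify_val[OF s True]] by simp
   next
    case False
    then show ?thesis using s unfolding N.sheafify_carrier by auto
   qed
   then show ?thesis by blast
  qed
  show "bij_betw (on_sections X (sheafify X M) ?U W) (Sec (sheafify X M) W) (Sec (sheafify X N) W)"
  proof (rule bij_betwI[where g = "?V W"])
   show "on_sections X (sheafify X M) ?U W \<in> Sec (sheafify X M) W \<rightarrow> Sec (sheafify X N) W"
    by (rule funcsetI, rule presheaf_homD(1)[OF mod_homD[OF hom] W])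
   show "?V W \<in> Sec (sheafify X N) W \<rightarrow> Sec (sheafify X M) W"
    by (rule funcsetI, rule presheaf_homD(1)[OF hv W])
   show "?V W (on_sections X (sheafify X M) ?U W s) = s" if s: "s \<in> Sec (sheafify X M) W" for s
    unfolding on_sections_apply[OF W s, of ?U] by (rule VU[OF s])
   show "on_sections X (sheafify X M) ?U W (?V W s) = s" if s: "s \<in> Sec (sheafify X N) W" for s
    unfolding on_sections_apply[OF W presheaf_homD(1)[OF hv W s], of ?U] by (rule UV[OF s])
  qed
 qed
qed

lemma homotopy_invertible_quasi_isomorphism:
 assumes "homotopy_invertible X A dA B dB \<phi>"
 shows "quasi_isomorphism X A dA B dB \<phi>"
proof -
 obtain \<psi> where \<phi>: "chain_map X A dA B dB \<phi>" and \<psi>: "chain_map X B dB A dA \<psi>"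
  and h1: "chain_homotopic X A dA A dA (gcomp X A 0 \<psi> \<phi>) (gid X A)"
  and h2: "chain_homotopic X B dB B dB (gcomp X B 0 \<phi> \<psi>) (gid X B)"
  using assms by (auto simp: homotopy_invertible_def)
 have cA: "cochain_complex X A dA" and cB: "cochain_complex X B dB" using \<phi> by (simp_all add: chain_map_def)
 have X: "rsp X" using cA sheaf_of_modules_mpre[of X "A 0"] by (simp add: cochain_complex_def mpre_def)
 have "mod_iso X (cohom_sheaf X A dA n) (cohom_sheaf X B dB n) (cohom_map X A dA B dB \<phi> n)" for n
 proof -
  interpret p: chain_map_at X A dA B dB n \<phi>
   using cA cB \<phi> X by (simp add: chain_map_at_def chain_map_at_axioms_def complex_at_def complex_at_axioms_def)
  interpret q: chain_map_at X B dB A dA n \<psi>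
   using cA cB \<psi> X by (simp add: chain_map_at_def chain_map_at_axioms_def complex_at_def complex_at_axioms_def)
  show ?thesis
   unfolding cohom_sheaf_def cohom_map_def ind_map_def[symmetric]
   by (rule sheafify_iso[OF p.A.mpre_H p.B.mpre_H p.ind_map_hom q.ind_map_hom
      ind_map_inverse[OF \<phi> \<psi> h1] ind_map_inverse[OF \<psi> \<phi> h2]])
 qed
 then show ?thesis using \<phi> by (simp add: quasi_isomorphism_def)
qed

section \<open>Simplicial ringed spaces\<close>

locale simplicial =
 fixes U :: "('x, 'r) simplicial_rs"
 assumes simplicial: "simplicial_ringed_space U"
begin

lemma obj_ringed: "ringed_space (obj U n)"
 using simplicial by (simp add: simplicial_ringed_space_def)

lemma face_mor: "i \<le> Suc n \<Longrightarrow> face U n i \<in> mor (obj U (Suc n)) (obj U n)"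
 using simplicial by (simp add: simplicial_ringed_space_def)

lemma face_face: "i < j \<Longrightarrow> j \<le> n + 2 \<Longrightarrow>
  face U n i oo face U (Suc n) j = face U n (j - 1) oo face U (Suc n) i"
 using simplicial by (simp add: simplicial_ringed_space_def)

lemma id_obj: "f \<in> mor (obj U n) Y \<Longrightarrow> f oo id_mor (obj U n) = f"
  "g \<in> mor X (obj U n) \<Longrightarrow> id_mor (obj U n) oo g = g"
 using comp_id[OF rsmI(1)] rsmI(2) id_comp[OF rsmI(1)] rsmI(3) by metis+

end

text \<open>\<open>tau U\<close> and \<open>rho U\<close> are the iterated face maps for \<open>e = (\<lambda>_. 0)\<close> and \<open>e = Suc\<close>.\<close>

locale face_chain = simplicial U for U :: "('x, 'r) simplicial_rs" +
 fixes e :: "nat \<Rightarrow> nat" and T :: "nat \<Rightarrow> nat \<Rightarrow> ('x, 'r, 'x, 'r) rs_mor"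
 assumes e: "e n \<le> Suc n"
  and self: "T k k = id_mor (obj U k)"
  and step: "p \<le> k \<Longrightarrow> T (Suc k) p = T k p oo face U k (e k)"
begin

lemma T_mor: "p \<le> k \<Longrightarrow> T k p \<in> mor (obj U k) (obj U p)"
proof (induction k)
 case 0
 then show ?case using id_in_mor[OF obj_ringed, of 0] by (simp add: self)
next
 case (Suc k)
 then show ?case
  using id_in_mor[OF obj_ringed, of "Suc k"] comp_in_mor[OF _ face_mor[OF e]] self[of "Suc k"]
  by (cases "p = Suc k") (simp_all add: step)
qed

lemma T_T: "p \<le> q \<Longrightarrow> q \<le> k \<Longrightarrow> T q p oo T k q = T k p"
proof (induction k)
 case 0
 then show ?case using id_obj(1)[OF T_mor[of 0 0]] by (simp add: self)
next
 case (Suc k)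
 show ?case
 proof (cases "q = Suc k")
  case True
  then show ?thesis using id_obj(1)[OF T_mor[OF Suc.prems(1)]] by (simp add: self)
 next
  case False
  with Suc.prems have q: "p \<le> q" "q \<le> k" by auto
  show ?thesis
   using comp_assoc'[OF T_mor[OF q(1)] T_mor[OF q(2)] face_mor[OF e]] Suc.IH[OF q] q by (simp add: step)
 qed
qed

end

lemma face_chain_tau: "simplicial_ringed_space U \<Longrightarrow> face_chain U (\<lambda>_. 0) (tau U)"
 by unfold_locales (simp, simp, rename_tac k, case_tac k, simp_all)

lemma face_chain_rho: "simplicial_ringed_space U \<Longrightarrow> face_chain U Suc (rho U)"
 by unfold_locales (simp, simp, rename_tac k, case_tac k, simp_all)

context simplicial
begin

sublocale tau: face_chain U "\<lambda>_. 0" "tau U" by (rule face_chain_tau[OF simplicial])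
sublocale rho: face_chain U Suc "rho U" by (rule face_chain_rho[OF simplicial])

lemmas tau_mor = tau.T_mor and rho_mor = rho.T_mor
lemmas tau0_mor = tau.T_mor[OF le0] and rho0_mor = rho.T_mor[OF le0]

text \<open>\<open>tau\<close> keeps the last vertex of a simplex and \<open>rho\<close> the first
  one, so the inner faces, which are those occurring in \<open>tw_delta\<close>, change neither. In
  the induction, moving a zero face past the face of index \<open>j\<close> lowers \<open>j\<close>
  by one until it is 0.\<close>

lemma tau_face: "j \<le> p \<Longrightarrow> tau U p 0 oo face U p j = tau U (Suc p) 0"
proof (induction p arbitrary: j)
 case (Suc p)
 note m = face_mor[of 0 p] face_mor[of j "Suc p"]
 show ?case
 proof (cases j)
  case (Suc i)
  have i: "i \<le> p" using Suc Suc.prems by simp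
  have "tau U (Suc p) 0 oo face U (Suc p) j = tau U p 0 oo (face U p 0 oo face U (Suc p) j)"
   using comp_assoc'[OF tau0_mor face_mor[of 0 p] face_mor[of j "Suc p"]] Suc.prems by simp
  also have "\<dots> = tau U p 0 oo (face U p i oo face U (Suc p) 0)"
   using face_face[of 0 j p] Suc Suc.prems by simp
  also have "\<dots> = tau U (Suc p) 0 oo face U (Suc p) 0"
   using comp_assoc'[OF tau0_mor face_mor[of i p] face_mor[of 0 "Suc p"]] Suc.IH[OF i] i by simp
  finally show ?thesis by (simp add: tau.step[of 0 "Suc p"])
 qed (simp add: tau.step[of 0 "Suc p"])
qed (simp add: tau.step[of 0 0])

lemma rho_face: "1 \<le> j \<Longrightarrow> j \<le> Suc p \<Longrightarrow> rho U p 0 oo face U p j = rho U (Suc p) 0"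
proof (induction p)
 case (Suc p)
 show ?case
 proof (cases "j = Suc (Suc p)")
  case False
  then have j: "j \<le> Suc p" using Suc.prems by simp
  have "rho U (Suc p) 0 oo face U (Suc p) j = rho U p 0 oo (face U p (Suc p) oo face U (Suc p) j)"
   using comp_assoc'[OF rho0_mor face_mor[of "Suc p" p] face_mor[of j "Suc p"]] Suc.prems by simp
  also have "\<dots> = rho U p 0 oo (face U p j oo face U (Suc p) (Suc (Suc p)))"
   using face_face[of j "Suc (Suc p)" p] j by simp
  also have "\<dots> = rho U (Suc p) 0 oo face U (Suc p) (Suc (Suc p))"
   using comp_assoc'[OF rho0_mor face_mor[of j p] face_mor[of "Suc (Suc p)" "Suc p"]] Suc.IH[OF Suc.prems(1) j] j by simp
  finally show ?thesis by (simp add: rho.step[of 0 "Suc p"])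
 qed (simp add: rho.step[of 0 "Suc p"])
next
 case 0
 then have "j = Suc 0" by simp
 then show ?case by (simp add: rho.step[of 0 0])
qed

text \<open>A last face stays a last face, one level lower, when a zero face is moved past
  it.\<close>

lemma tau_last_face: "q \<le> k \<Longrightarrow> tau U k q oo face U k (Suc k) = face U q (Suc q) oo tau U (Suc k) (Suc q)"
proof (induction k)
 case 0
 then show ?case using id_obj[OF face_mor[of 1 0]] by simp
next
 case (Suc k)
 show ?case
 proof (cases "q = Suc k")
  case True
  then show ?thesis using id_obj[OF face_mor[of "Suc (Suc k)" "Suc k"]] by (simp add: tau.self[of "Suc (Suc k)"] del: tau.simps) (simp add: tau.self)
 next
  case False
  with Suc.prems have q: "q \<le> k" by simp
  have "tau U (Suc k) q oo face U (Suc k) (Suc (Suc k)) = tau U k q oo (face U k 0 oo face U (Suc k) (Suc (Suc k)))"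
   using comp_assoc'[OF tau_mor[OF q] face_mor[of 0 k] face_mor[of "Suc (Suc k)" "Suc k"]] q by simp
  also have "\<dots> = tau U k q oo (face U k (Suc k) oo face U (Suc k) 0)"
   using face_face[of 0 "Suc (Suc k)" k] by simp
  also have "\<dots> = face U q (Suc q) oo tau U (Suc k) (Suc q) oo face U (Suc k) 0"
   using comp_assoc'[OF tau_mor[OF q] face_mor[of "Suc k" k] face_mor[of 0 "Suc k"]] Suc.IH[OF q] by simp
  also have "\<dots> = face U q (Suc q) oo tau U (Suc (Suc k)) (Suc q)"
   using comp_assoc'[OF face_mor[of "Suc q" q] tau_mor[of "Suc q" "Suc k"] face_mor[of 0 "Suc k"]] q
   by (simp add: tau.step[of "Suc q" "Suc k"])
  finally show ?thesis .
 qed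
qed

text \<open>Both composites extract vertex \<open>p\<close> of a simplex with vertices
  \<open>0, ..., p + r\<close>. This is where the two factors of a product meet: the target of the
  pulled back right factor is the source of the pulled back left one.\<close>

lemma tau_rho: "tau U p 0 oo rho U (p + r) p = rho U r 0 oo tau U (p + r) r"
proof (induction r)
 case 0
 then show ?case using id_obj[OF tau0_mor[of p]] by (simp add: rho.self)
next
 case (Suc r)
 have "tau U p 0 oo rho U (p + Suc r) p = tau U p 0 oo rho U (p + r) p oo face U (p + r) (Suc (p + r))"
  using comp_assoc'[OF tau0_mor rho_mor[of p "p + r"] face_mor[of "Suc (p + r)" "p + r"]] by simp
 also have "\<dots> = rho U r 0 oo (tau U (p + r) r oo face U (p + r) (Suc (p + r)))"
  using comp_assoc'[OF rho0_mor tau_mor[of r "p + r"] face_mor[of "Suc (p + r)" "p + r"]] Suc.IH by simp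
 also have "\<dots> = rho U r 0 oo (face U r (Suc r) oo tau U (Suc (p + r)) (Suc r))"
  using tau_last_face[of r "p + r"] by simp
 also have "\<dots> = rho U (Suc r) 0 oo tau U (p + Suc r) (Suc r)"
  using comp_assoc'[OF rho0_mor face_mor[of "Suc r" r] tau_mor[of "Suc r" "Suc (p + r)"]] by simp
 finally show ?case .
qed

end

section \<open>Simplicial maps and homotopies against iterated faces\<close>

lemma face_chain_natural:
 assumes U: "face_chain U e T" and V: "face_chain V e T'" and f: "simplicial_map U V f" and "q \<le> k"
 shows "T' k q oo f k = f q oo T k q"
 using \<open>q \<le> k\<close>
proof (induction k)
 interpret U: face_chain U e T by fact
 interpret V: face_chain V e T' by fact
 have fm: "f n \<in> mor (obj U n) (obj V n)" for n using f by (simp add: simplicial_map_def)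
 {
  case 0
  then show ?case using U.id_obj(1)[OF fm] V.id_obj(2)[OF fm] by (simp add: U.self V.self)
 next
  case (Suc k)
  show ?case
  proof (cases "q = Suc k")
   case True
   then show ?thesis using U.id_obj(1)[OF fm] V.id_obj(2)[OF fm] by (simp add: U.self V.self)
  next
   case False
   with Suc.prems have q: "q \<le> k" by simp
   have "T' (Suc k) q oo f (Suc k) = T' k q oo (face V k (e k) oo f (Suc k))"
    using comp_assoc'[OF V.T_mor[OF q] V.face_mor[OF V.e] fm] q by (simp add: V.step)
   also have "\<dots> = T' k q oo f k oo face U k (e k)"
    using comp_assoc'[OF V.T_mor[OF q] fm U.face_mor[OF U.e]] f U.e[of k] by (simp add: simplicial_map_def)
   also have "\<dots> = f q oo T (Suc k) q"
    using comp_assoc'[OF fm U.T_mor[OF q] U.face_mor[OF U.e]] Suc.IH[OF q] q by (simp add: U.step)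
   finally show ?thesis .
  qed
 }
qed

locale simplicial_morphism = U: simplicial U + V: simplicial V
 for U :: "('u, 'r) simplicial_rs" and V :: "('v, 's) simplicial_rs" +
 fixes f :: "nat \<Rightarrow> ('u, 'r, 'v, 's) rs_mor"
 assumes simplicial_map: "simplicial_map U V f"
begin

lemma map_mor: "f n \<in> mor (obj U n) (obj V n)"
 using simplicial_map by (simp add: simplicial_map_def)

lemma map_face: "i \<le> Suc n \<Longrightarrow> face V n i oo f (Suc n) = f n oo face U n i"
 using simplicial_map by (simp add: simplicial_map_def)

lemma map_tau: "q \<le> k \<Longrightarrow> tau V k q oo f k = f q oo tau U k q"
 by (rule face_chain_natural[OF U.tau.face_chain_axioms V.tau.face_chain_axioms simplicial_map])

lemma map_rho: "q \<le> k \<Longrightarrow> rho V k q oo f k = f q oo rho U k q"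
 by (rule face_chain_natural[OF U.rho.face_chain_axioms V.rho.face_chain_axioms simplicial_map])

end

locale homotopy = f: simplicial_morphism U V f + g: simplicial_morphism U V g
 for U :: "('u, 'r) simplicial_rs" and V :: "('v, 's) simplicial_rs"
  and f g :: "nat \<Rightarrow> ('u, 'r, 'v, 's) rs_mor" +
 fixes h :: "nat \<Rightarrow> nat \<Rightarrow> ('u, 'r, 'v, 's) rs_mor"
 assumes homotopy: "simplicial_homotopy U V f g h"
begin

lemma h_mor: "i \<le> p \<Longrightarrow> h p i \<in> mor (obj U p) (obj V (Suc p))"
 and h_first: "face V p 0 oo h p 0 = f p"
 and h_last: "face V p (Suc p) oo h p p = g p"
 and h_lt: "i < j \<Longrightarrow> j \<le> Suc p \<Longrightarrow> face V (Suc p) i oo h (Suc p) j = h p (j - 1) oo face U p i"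
 and h_eq: "i \<noteq> 0 \<Longrightarrow> i \<le> p \<Longrightarrow> face V p i oo h p i = face V p i oo h p (i - 1)"
 and h_gt: "Suc j < i \<Longrightarrow> i \<le> p + 2 \<Longrightarrow> face V (Suc p) i oo h (Suc p) j = h p j oo face U p (i - 1)"
proof -
 note H = homotopy[unfolded simplicial_homotopy_def]
 note H2 = H[THEN conjunct2] note H3 = H2[THEN conjunct2] note H4 = H3[THEN conjunct2]
 note H5 = H4[THEN conjunct2] note H6 = H5[THEN conjunct2]
 show "i \<le> p \<Longrightarrow> h p i \<in> mor (obj U p) (obj V (Suc p))" using H[THEN conjunct1] by blast
 show "face V p 0 oo h p 0 = f p" using H2[THEN conjunct1] by blast
 show "face V p (Suc p) oo h p p = g p" using H3[THEN conjunct1] by blast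
 show "i < j \<Longrightarrow> j \<le> Suc p \<Longrightarrow> face V (Suc p) i oo h (Suc p) j = h p (j - 1) oo face U p i"
  using H4[THEN conjunct1] by blast
 show "i \<noteq> 0 \<Longrightarrow> i \<le> p \<Longrightarrow> face V p i oo h p i = face V p i oo h p (i - 1)"
  using H5[THEN conjunct1] by blast
 show "Suc j < i \<Longrightarrow> i \<le> p + 2 \<Longrightarrow> face V (Suc p) i oo h (Suc p) j = h p j oo face U p (i - 1)"
  using H6[THEN conjunct1] by blast
qed

text \<open>In the prism, the simplex \<open>h k i\<close> has its first \<open>i + 1\<close>
  vertices on the side of \<open>g\<close> and the others on the side of \<open>f\<close>. Here
  \<open>tau\<close> keeps the last \<open>q + 1\<close> vertices, all on the side of
  \<open>f\<close> as \<open>i + q \<le> k\<close>. If more vertices are kept, the jump between the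
  sides stays inside and a smaller prism simplex results, as in \<open>tau_h_high\<close>.
  \<open>rho\<close> keeps the first vertices, which gives the same dichotomy with \<open>g\<close>.
  In the inductions a zero face lowers \<open>i\<close> by one and a last face leaves it alone; in
  the two \<open>low\<close> lemmas this ends with \<open>h_first\<close> or
  \<open>h_last\<close>.\<close>

lemma tau_h_low: "i + q \<le> k \<Longrightarrow> tau V (Suc k) q oo h k i = f q oo tau U k q"
proof (induction k arbitrary: i)
 case 0
 then have "i = 0" "q = 0" by simp_all
 then show ?case
  using f.V.id_obj(2)[OF f.map_mor[of 0]] f.U.id_obj(1)[OF f.map_mor[of 0]] f.V.id_obj(2)[OF f.V.face_mor[of 0 0]] h_first[of 0] by simp
next
 case (Suc k)
 have q: "q \<le> Suc k" using Suc.prems by simp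
 have 1: "tau V (Suc (Suc k)) q oo h (Suc k) i = tau V (Suc k) q oo (face V (Suc k) 0 oo h (Suc k) i)"
  using comp_assoc'[OF f.V.tau_mor[OF q] f.V.face_mor[of 0 "Suc k"] h_mor[of i "Suc k"]] Suc.prems q
  by (simp add: f.V.tau.step[of q "Suc k"])
 show ?case
 proof (cases i)
  case 0
  then show ?thesis using 1 h_first[of "Suc k"] f.map_tau[OF q] by simp
 next
  case (Suc j)
  then have q': "q \<le> k" and j: "j + q \<le> k" using Suc.prems by simp_all
  have "tau V (Suc (Suc k)) q oo h (Suc k) i = tau V (Suc k) q oo (h k j oo face U k 0)"
   using 1 h_lt[of 0 i k] Suc j by simp
  also have "\<dots> = f q oo tau U k q oo face U k 0"
   using comp_assoc'[OF f.V.tau_mor[OF q] h_mor[of j k] f.U.face_mor[of 0 k]] Suc.IH[OF j] j by simp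
  also have "\<dots> = f q oo tau U (Suc k) q"
   using comp_assoc'[OF f.map_mor f.U.tau_mor[OF q'] f.U.face_mor[of 0 k]] q' by simp
  finally show ?thesis .
 qed
qed

lemma tau_h_high: "p + q = k \<Longrightarrow> p \<le> i \<Longrightarrow> i \<le> k \<Longrightarrow> tau V (Suc k) (Suc q) oo h k i = h q (i - p) oo tau U k q"
proof (induction k arbitrary: i p)
 case 0
 then show ?case using f.V.id_obj(2)[OF h_mor[of 0 0]] f.U.id_obj(1)[OF h_mor[of 0 0]] by simp
next
 case (Suc k)
 show ?case
 proof (cases p)
  case 0
  then show ?thesis
   using Suc.prems f.V.id_obj(2)[OF h_mor[of i "Suc k"]] f.U.id_obj(1)[OF h_mor[of i "Suc k"]]
    f.V.tau.self[of "Suc (Suc k)"] f.U.tau.self[of "Suc k"] by (simp del: tau.simps)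
 next
  case (Suc p')
  then obtain j where j: "i = Suc j" "p' \<le> j" "j \<le> k" "p' + q = k" using Suc.prems by (cases i) auto
  have q: "Suc q \<le> Suc k" "q \<le> k" using j by simp_all
  have "tau V (Suc (Suc k)) (Suc q) oo h (Suc k) i = tau V (Suc k) (Suc q) oo (face V (Suc k) 0 oo h (Suc k) i)"
   using comp_assoc'[OF f.V.tau_mor[OF q(1)] f.V.face_mor[of 0 "Suc k"] h_mor[of i "Suc k"]] Suc.prems q
   by (simp add: f.V.tau.step[of "Suc q" "Suc k"])
  also have "\<dots> = tau V (Suc k) (Suc q) oo (h k j oo face U k 0)"
   using h_lt[of 0 i k] j by simp
  also have "\<dots> = h q (j - p') oo tau U k q oo face U k 0"
   using comp_assoc'[OF f.V.tau_mor[OF q(1)] h_mor[of j k] f.U.face_mor[of 0 k]] Suc.IH[OF j(4,2,3)] j by simp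
  also have "\<dots> = h q (j - p') oo tau U (Suc k) q"
   using comp_assoc'[OF h_mor[of "j - p'" q] f.U.tau_mor[OF q(2)] f.U.face_mor[of 0 k]] q j by simp
  finally show ?thesis using Suc j by simp
 qed
qed

lemma rho_h_high: "i \<le> p \<Longrightarrow> p \<le> k \<Longrightarrow> rho V (Suc k) (Suc p) oo h k i = h p i oo rho U k p"
proof (induction k)
 case 0
 then show ?case using f.V.id_obj(2)[OF h_mor[of 0 0]] f.U.id_obj(1)[OF h_mor[of 0 0]] by simp
next
 case (Suc k)
 show ?case
 proof (cases "p = Suc k")
  case True
  then show ?thesis
   using Suc.prems f.V.id_obj(2)[OF h_mor[of i "Suc k"]] f.U.id_obj(1)[OF h_mor[of i "Suc k"]]
    f.V.rho.self[of "Suc (Suc k)"] f.U.rho.self[of "Suc k"] by (simp del: rho.simps)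
 next
  case False
  with Suc.prems have p: "p \<le> k" "Suc p \<le> Suc k" and i: "i \<le> k" by simp_all
  have "rho V (Suc (Suc k)) (Suc p) oo h (Suc k) i = rho V (Suc k) (Suc p) oo (face V (Suc k) (Suc (Suc k)) oo h (Suc k) i)"
   using comp_assoc'[OF f.V.rho_mor[OF p(2)] f.V.face_mor[of "Suc (Suc k)" "Suc k"] h_mor[of i "Suc k"]] i p
   by (simp add: f.V.rho.step[of "Suc p" "Suc k"])
  also have "\<dots> = rho V (Suc k) (Suc p) oo (h k i oo face U k (Suc k))"
   using h_gt[of i "Suc (Suc k)" k] i by simp
  also have "\<dots> = h p i oo rho U k p oo face U k (Suc k)"
   using comp_assoc'[OF f.V.rho_mor[OF p(2)] h_mor[OF i] f.U.face_mor[of "Suc k" k]] Suc.IH[OF Suc.prems(1) p(1)] by simp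
  also have "\<dots> = h p i oo rho U (Suc k) p"
   using comp_assoc'[OF h_mor[OF Suc.prems(1)] f.U.rho_mor[OF p(1)] f.U.face_mor[of "Suc k" k]] p by simp
  finally show ?thesis .
 qed
qed

lemma rho_h_low: "p \<le> i \<Longrightarrow> i \<le> k \<Longrightarrow> rho V (Suc k) p oo h k i = g p oo rho U k p"
proof (induction k)
 case 0
 then have "i = 0" "p = 0" by simp_all
 then show ?case
  using f.V.id_obj(2)[OF g.map_mor[of 0]] f.U.id_obj(1)[OF g.map_mor[of 0]] f.V.id_obj(2)[OF f.V.face_mor[of 1 0]] h_last[of 0] by simp
next
 case (Suc k)
 have p: "p \<le> Suc k" using Suc.prems by simp
 have 1: "rho V (Suc (Suc k)) p oo h (Suc k) i = rho V (Suc k) p oo (face V (Suc k) (Suc (Suc k)) oo h (Suc k) i)"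
  using comp_assoc'[OF f.V.rho_mor[OF p] f.V.face_mor[of "Suc (Suc k)" "Suc k"] h_mor[of i "Suc k"]] Suc.prems p
  by (simp add: f.V.rho.step[of p "Suc k"])
 show ?case
 proof (cases "i = Suc k")
  case True
  then show ?thesis using 1 h_last[of "Suc k"] g.map_rho[OF p] by simp
 next
  case False
  then have p': "p \<le> k" and i: "i \<le> k" using Suc.prems by simp_all
  have "rho V (Suc (Suc k)) p oo h (Suc k) i = rho V (Suc k) p oo (h k i oo face U k (Suc k))"
   using 1 h_gt[of i "Suc (Suc k)" k] i by simp
  also have "\<dots> = g p oo rho U k p oo face U k (Suc k)"
   using comp_assoc'[OF f.V.rho_mor[OF p] h_mor[OF i] f.U.face_mor[of "Suc k" k]] Suc.IH[OF Suc.prems(1) i] by simp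
  also have "\<dots> = g p oo rho U (Suc k) p"
   using comp_assoc'[OF g.map_mor f.U.rho_mor[OF p'] f.U.face_mor[of "Suc k" k]] p' by simp
  finally show ?thesis .
 qed
qed

lemma tau0_h: "i \<le> k \<Longrightarrow> tau V (Suc k) 0 oo h k i = f 0 oo tau U k 0"
 using tau_h_low[of i 0 k] by simp

lemma rho0_h: "i \<le> k \<Longrightarrow> rho V (Suc k) 0 oo h k i = g 0 oo rho U k 0"
 using rho_h_low[of 0 i k] by simp

end

section \<open>Signed sums\<close>

text \<open>Formal signed sums. In a free abelian group ordinary sums with their rules for splitting
  and reindexing apply; \<open>altsum\<close> is the corresponding sum in the group
  \<open>G\<close>, and \<open>finsum_frag\<close> passes from one to the other.\<close>

abbreviation altfrag :: "nat set \<Rightarrow> (nat \<Rightarrow> int) \<Rightarrow> (nat \<Rightarrow> 'a \<Rightarrow>\<^sub>0 int) \<Rightarrow> 'a \<Rightarrow>\<^sub>0 int" where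
 "altfrag I w x \<equiv> \<Sum>i\<in>I. frag_cmul (sgn_pow (w i)) (x i)"

abbreviation altsum :: "('a, 'b) ring_scheme \<Rightarrow> nat set \<Rightarrow> (nat \<Rightarrow> int) \<Rightarrow> (nat \<Rightarrow> 'a) \<Rightarrow> 'a" where
 "altsum G I w x \<equiv> \<Oplus>\<^bsub>G\<^esub>i\<in>I. [sgn_pow (w i)] \<cdot>\<^bsub>G\<^esub> x i"


lemma sgn_pow_add: "sgn_pow (a + b) = sgn_pow a * sgn_pow b"
 by (simp add: sgn_pow_def)

lemma sgn_pow_parity: "even (a - b) \<Longrightarrow> sgn_pow a = sgn_pow b" "odd (a - b) \<Longrightarrow> sgn_pow a = - sgn_pow b"
 by (auto simp: sgn_pow_def)

lemma frag_cmul_sum2: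
 "(\<Sum>i\<in>I. frag_cmul (z i) (\<Sum>j\<in>J i. frag_cmul (w i j) (x i j))) =
  (\<Sum>(i, j)\<in>Sigma I J. frag_cmul (z i * w i j) (x i j))" if "finite I" "\<And>i. i \<in> I \<Longrightarrow> finite (J i)"
proof -
 have "(\<Sum>i\<in>I. frag_cmul (z i) (\<Sum>j\<in>J i. frag_cmul (w i j) (x i j))) =
   (\<Sum>i\<in>I. \<Sum>j\<in>J i. frag_cmul (z i * w i j) (x i j))"
  by (simp add: frag_cmul_sum)
 then show ?thesis using that by (simp add: sum.Sigma)
qed

text \<open>The prism cancellation. The pairs with \<open>j = i\<close> and those with
  \<open>j = i + 1\<close> carry the same terms by \<open>diag\<close>, with opposite signs. The
  triangles \<open>j < i\<close> and \<open>i + 1 < j\<close> become, after lowering one index, the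
  parts \<open>j \<le> i\<close> and \<open>i < j\<close> of the index set on the right; the lowered
  index accounts for the minus sign.\<close>

lemma homotopy_delta_sum:
 fixes D B :: "nat \<Rightarrow> nat \<Rightarrow> ('a \<Rightarrow>\<^sub>0 int)"
 assumes diag: "\<And>i. 1 \<le> i \<Longrightarrow> i \<le> Suc n \<Longrightarrow> D i i = D (i - 1) i"
  and low: "\<And>i j. 1 \<le> j \<Longrightarrow> j < i \<Longrightarrow> i \<le> Suc n \<Longrightarrow> D i j = B j (i - 1)"
  and high: "\<And>i j. Suc i < j \<Longrightarrow> j \<le> Suc n \<Longrightarrow> D i j = B (j - 1) i"
 shows "(altfrag {0..Suc n} int (\<lambda>i. altfrag {1..Suc n} int (D i))) =
  - (altfrag {1..n} int (\<lambda>j. altfrag {0..n} int (B j)))"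
proof -
 define t where "t = (\<lambda>(i, j). frag_cmul (sgn_pow (int i) * sgn_pow (int j)) (D i j))"
 define b where "b = (\<lambda>(j, i). frag_cmul (sgn_pow (int j) * sgn_pow (int i)) (B j i))"
 let ?L = "{(i, j). 1 \<le> j \<and> j < i \<and> i \<le> Suc n}"
 let ?E = "{(i, j). 1 \<le> j \<and> j = i \<and> i \<le> Suc n}"
 let ?E' = "{(i, j). j = Suc i \<and> j \<le> Suc n}"
 let ?H = "{(i, j). Suc i < j \<and> j \<le> Suc n}"
 have fin: "finite ?L" "finite ?E" "finite ?E'" "finite ?H"
  by (rule finite_subset[of _ "{0..Suc n} \<times> {0..Suc n}"]; auto)+
 have sets: "{0..Suc n} \<times> {1..Suc n} = ((?L \<union> ?H) \<union> (?E \<union> ?E'))" by auto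
 have dis: "(?L \<union> ?H) \<inter> (?E \<union> ?E') = {}" "?L \<inter> ?H = {}" "?E \<inter> ?E' = {}" by auto
 have "sum t ({0..Suc n} \<times> {1..Suc n}) = (sum t ?L + sum t ?H) + (sum t ?E + sum t ?E')"
  unfolding sets sum.union_disjoint[OF finite_UnI[OF fin(1,4)] finite_UnI[OF fin(2,3)] dis(1)]
   sum.union_disjoint[OF fin(1,4) dis(2)] sum.union_disjoint[OF fin(2,3) dis(3)] ..
 also have "sum t ?E' = (\<Sum>x\<in>?E. - t x)"
 proof (rule sum.reindex_bij_witness[of _ "\<lambda>(i, j). (i - 1, j)" "\<lambda>(i, j). (Suc i, j)"])
  fix x assume x: "x \<in> ?E'"
  obtain i where i: "x = (i, Suc i)" using x by (cases x) simp
  show "- t (case x of (i, j) \<Rightarrow> (Suc i, j)) = t x"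
   using x diag[of "Suc i"] by (simp add: i t_def sgn_pow_def)
 qed auto
 also have "sum t ?L = (\<Sum>x\<in>{(j, i). 1 \<le> j \<and> j \<le> i \<and> i \<le> n}. - b x)"
 proof (rule sum.reindex_bij_witness[of _ "\<lambda>(j, i). (Suc i, j)" "\<lambda>(i, j). (j, i - 1)"])
  fix x assume x: "x \<in> ?L"
  obtain i j where ij: "x = (Suc i, j)" using x by (cases x, case_tac a) auto
  show "- b (case x of (i, j) \<Rightarrow> (j, i - 1)) = t x"
   using x low[of j "Suc i"] by (simp add: ij t_def b_def sgn_pow_def)
 qed auto
 also have "sum t ?H = (\<Sum>x\<in>{(j, i). i < j \<and> j \<le> n}. - b x)"
 proof (rule sum.reindex_bij_witness[of _ "\<lambda>(j, i). (i, Suc j)" "\<lambda>(i, j). (j - 1, i)"])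
  fix x assume x: "x \<in> ?H"
  obtain i j where ij: "x = (i, Suc j)" using x by (cases x, case_tac b) auto
  show "- b (case x of (i, j) \<Rightarrow> (j - 1, i)) = t x"
   using x high[of i "Suc j"] by (simp add: ij t_def b_def sgn_pow_def)
 qed auto
 finally have 1: "sum t ({0..Suc n} \<times> {1..Suc n}) =
   (\<Sum>x\<in>{(j, i). 1 \<le> j \<and> j \<le> i \<and> i \<le> n}. - b x) + (\<Sum>x\<in>{(j, i). i < j \<and> j \<le> n}. - b x)"
  by (simp add: sum_negf)
 have fin': "finite {(j, i). 1 \<le> j \<and> j \<le> i \<and> i \<le> n}" "finite {(j, i). i < j \<and> j \<le> n}"
  by (rule finite_subset[of _ "{0..n} \<times> {0..n}"]; auto)+
 have sets': "{1..n} \<times> {0..n} = {(j, i). 1 \<le> j \<and> j \<le> i \<and> i \<le> n} \<union> {(j, i). i < j \<and> j \<le> n}" by auto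
 have 2: "sum b ({1..n} \<times> {0..n}) = sum b {(j, i). 1 \<le> j \<and> j \<le> i \<and> i \<le> n} + sum b {(j, i). i < j \<and> j \<le> n}"
  unfolding sets' by (rule sum.union_disjoint[OF fin']) auto
 show ?thesis
  unfolding frag_cmul_sum2[OF finite_atLeastAtMost finite_atLeastAtMost] t_def[symmetric] b_def[symmetric] 1 2
  by (simp add: sum_negf)
qed

text \<open>A product with left factor in level \<open>p\<close> cuts a prism simplex at vertex
  \<open>p\<close>. For \<open>i < p\<close> the jump between the two sides lies in the left factor;
  otherwise it lies in the right one, where its index is counted from the cut and becomes
  \<open>i - p\<close>.\<close>

lemma homotopy_product_sum:
 fixes C X Y :: "nat \<Rightarrow> nat \<Rightarrow> ('a \<Rightarrow>\<^sub>0 int)"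
 assumes CX: "\<And>i p. i \<le> p \<Longrightarrow> p \<le> l \<Longrightarrow> C i (Suc p) = X p i"
  and CY: "\<And>i p. p \<le> i \<Longrightarrow> i \<le> l \<Longrightarrow> C i p = Y p (i - p)"
 shows "(altfrag {0..l} int (\<lambda>i. altfrag {0..Suc l} (\<lambda>p. (1 - int p) * int (Suc l - p)) (C i))) =
  (altfrag {0..l} (\<lambda>p. (0 - int p) * int (l - p)) (\<lambda>p. altfrag {0..p} int (X p)))
  - (altfrag {0..l} (\<lambda>p. (1 - int p) * int (l - p)) (\<lambda>p. altfrag {0..l - p} int (Y p)))"
proof -
 define t where "t = (\<lambda>(i, p). frag_cmul (sgn_pow (int i) * sgn_pow ((1 - int p) * int (Suc l - p))) (C i p))"
 define x where "x = (\<lambda>(p, i). frag_cmul (sgn_pow ((0 - int p) * int (l - p)) * sgn_pow (int i)) (X p i))"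
 define y where "y = (\<lambda>(p, i). frag_cmul (sgn_pow ((1 - int p) * int (l - p)) * sgn_pow (int i)) (Y p i))"
 let ?X = "{(i, p). i < p \<and> p \<le> Suc l}" and ?Y = "{(i, p). p \<le> i \<and> i \<le> l}"
 have fin: "finite ?X" "finite ?Y"
  by (rule finite_subset[of _ "{0..Suc l} \<times> {0..Suc l}"]; auto)+
 have sets: "{0..l} \<times> {0..Suc l} = ?X \<union> ?Y" by auto
 have "sum t ({0..l} \<times> {0..Suc l}) = sum t ?X + sum t ?Y"
  unfolding sets by (rule sum.union_disjoint[OF fin]) auto
 also have "sum t ?X = sum x (Sigma {0..l} (\<lambda>p. {0..p}))"
 proof (rule sum.reindex_bij_witness[of _ "\<lambda>(p, i). (i, Suc p)" "\<lambda>(i, p). (p - 1, i)"])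
  fix z assume z: "z \<in> ?X"
  obtain i p where ip: "z = (i, Suc p)" using z by (cases z, case_tac b) auto
  \<comment> \<open>With \<open>Suc p\<close> in place of \<open>p\<close> the exponent of
    \<open>t\<close> is literally that of \<open>x\<close>, so this half keeps its sign.\<close>
  show "x (case z of (i, p) \<Rightarrow> (p - 1, i)) = t z"
   using z CX[of i p] by (simp add: ip t_def x_def mult.commute)
 qed auto
 also have "sum t ?Y = (\<Sum>z\<in>Sigma {0..l} (\<lambda>p. {0..l - p}). - y z)"
 proof (rule sum.reindex_bij_witness[of _ "\<lambda>(p, i). (i + p, p)" "\<lambda>(i, p). (p, i - p)"])
  fix z assume z: "z \<in> ?Y"
  then obtain i p where ip: "z = (i, p)" "p \<le> i" "i \<le> l" by auto
  have d: "int (Suc l - p) = int (l - p) + 1" "int (i - p) = int i - int p" using ip by auto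
  \<comment> \<open>The exponents differ by \<open>(1 - p) + p = 1\<close>: the first part comes
    from the larger simplex, the second from the shifted index. This is the minus sign before the
    second sum.\<close>
  have "sgn_pow (int i) * sgn_pow ((1 - int p) * int (Suc l - p)) =
    - (sgn_pow ((1 - int p) * int (l - p)) * sgn_pow (int (i - p)))"
   unfolding sgn_pow_add[symmetric] d by (rule sgn_pow_parity(2)) (simp add: algebra_simps)
  then show "- y (case z of (i, p) \<Rightarrow> (p, i - p)) = t z"
   using CY[OF ip(2,3)] by (simp add: ip t_def y_def)
 qed auto
 finally have 1: "sum t ({0..l} \<times> {0..Suc l}) =
   sum x (Sigma {0..l} (\<lambda>p. {0..p})) + (\<Sum>z\<in>Sigma {0..l} (\<lambda>p. {0..l - p}). - y z)" .
 show ?thesis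
  unfolding frag_cmul_sum2[OF finite_atLeastAtMost finite_atLeastAtMost] t_def[symmetric] x_def[symmetric] y_def[symmetric] 1
  by (simp add: sum_negf)
qed

text \<open>Elements of \<open>G\<close> are made generators of a free abelian group, and
  \<open>lin_ext\<close> of the identity evaluates them back. An equality of formal sums then yields
  an equality in \<open>G\<close>.\<close>

lemma (in abelian_group) finsum_frag:
 assumes fin: "finite I" and x: "\<And>i. i \<in> I \<Longrightarrow> x i \<in> carrier G"
 shows "(\<Oplus>i\<in>I. [(z i :: int)] \<cdot> x i) = lin_ext G (\<lambda>v. v) (\<Sum>i\<in>I. frag_cmul (z i) (frag_of (x i)))"
  and "Poly_Mapping.keys (\<Sum>i\<in>I. frag_cmul (z i) (frag_of (x i))) \<subseteq> carrier G"
proof -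
 have k: "Poly_Mapping.keys (frag_cmul (z i) (frag_of (x i))) \<subseteq> carrier G" if "i \<in> I" for i
  using keys_cmul[of "z i" "frag_of (x i)"] x[OF that] by auto
 show "Poly_Mapping.keys (\<Sum>i\<in>I. frag_cmul (z i) (frag_of (x i))) \<subseteq> carrier G"
  using keys_sum[of "\<lambda>i. frag_cmul (z i) (frag_of (x i))" I] k by blast
 have "lin_ext G (\<lambda>v. v) (\<Sum>i\<in>I. frag_cmul (z i) (frag_of (x i))) = (\<Oplus>i\<in>I. lin_ext G (\<lambda>v. v) (frag_cmul (z i) (frag_of (x i))))"
  by (rule lin_ext_sum) (use k fin in auto)
 also have "\<dots> = (\<Oplus>i\<in>I. [z i] \<cdot> x i)"
  by (rule finsum_cong') (simp_all add: x lin_ext_cmul Pi_iff)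
 finally show "(\<Oplus>i\<in>I. [(z i :: int)] \<cdot> x i) = lin_ext G (\<lambda>v. v) (\<Sum>i\<in>I. frag_cmul (z i) (frag_of (x i)))" ..
qed

lemma (in abelian_group) finsum2_frag:
 assumes fin: "finite I" "\<And>i. i \<in> I \<Longrightarrow> finite (J i)" and x: "\<And>i j. i \<in> I \<Longrightarrow> j \<in> J i \<Longrightarrow> x i j \<in> carrier G"
 shows "(\<Oplus>i\<in>I. [(z i :: int)] \<cdot> (\<Oplus>j\<in>J i. [(w i j :: int)] \<cdot> x i j)) =
   lin_ext G (\<lambda>v. v) (\<Sum>i\<in>I. frag_cmul (z i) (\<Sum>j\<in>J i. frag_cmul (w i j) (frag_of (x i j))))"
  and "Poly_Mapping.keys (\<Sum>i\<in>I. frag_cmul (z i) (\<Sum>j\<in>J i. frag_cmul (w i j) (frag_of (x i j)))) \<subseteq> carrier G"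
proof -
 let ?c = "\<lambda>i. \<Sum>j\<in>J i. frag_cmul (w i j) (frag_of (x i j))"
 have k: "Poly_Mapping.keys (?c i) \<subseteq> carrier G" if "i \<in> I" for i
  by (rule finsum_frag(2)[OF fin(2)[OF that] x[OF that]])
 have k': "Poly_Mapping.keys (frag_cmul (z i) (?c i)) \<subseteq> carrier G" if "i \<in> I" for i
  using keys_cmul[of "z i" "?c i"] k[OF that] by blast
 show "Poly_Mapping.keys (\<Sum>i\<in>I. frag_cmul (z i) (?c i)) \<subseteq> carrier G"
  using keys_sum[of "\<lambda>i. frag_cmul (z i) (?c i)" I] k' by blast
 have "lin_ext G (\<lambda>v. v) (\<Sum>i\<in>I. frag_cmul (z i) (?c i)) = (\<Oplus>i\<in>I. lin_ext G (\<lambda>v. v) (frag_cmul (z i) (?c i)))"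
  by (rule lin_ext_sum) (use k' fin in auto)
 also have "\<dots> = (\<Oplus>i\<in>I. [z i] \<cdot> (\<Oplus>j\<in>J i. [w i j] \<cdot> x i j))"
 proof (rule finsum_cong')
  fix i assume i: "i \<in> I"
  have "lin_ext G (\<lambda>v. v) (frag_cmul (z i) (?c i)) = [z i] \<cdot> lin_ext G (\<lambda>v. v) (?c i)"
   by (rule lin_ext_cmul) (use k[OF i] in auto)
  also have "\<dots> = [z i] \<cdot> (\<Oplus>j\<in>J i. [w i j] \<cdot> x i j)"
   by (simp only: finsum_frag(1)[OF fin(2)[OF i] x[OF i]])
  finally show "lin_ext G (\<lambda>v. v) (frag_cmul (z i) (?c i)) = [z i] \<cdot> (\<Oplus>j\<in>J i. [w i j] \<cdot> x i j)" .
 qed (auto intro!: finsum_closed int_mult_closed simp: x)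
 finally show "(\<Oplus>i\<in>I. [(z i :: int)] \<cdot> (\<Oplus>j\<in>J i. [(w i j :: int)] \<cdot> x i j)) =
   lin_ext G (\<lambda>v. v) (\<Sum>i\<in>I. frag_cmul (z i) (?c i))" ..
qed

lemma (in add_group_hom) lin:
 assumes "\<And>i. i \<in> I \<Longrightarrow> x i \<in> carrier A"
 shows "h (\<Oplus>\<^bsub>A\<^esub>i\<in>I. [(z i :: int)] \<cdot>\<^bsub>A\<^esub> x i) = (\<Oplus>\<^bsub>B\<^esub>i\<in>I. [z i] \<cdot>\<^bsub>B\<^esub> h (x i))"
proof -
 have "h (\<Oplus>\<^bsub>A\<^esub>i\<in>I. [z i] \<cdot>\<^bsub>A\<^esub> x i) = (\<Oplus>\<^bsub>B\<^esub>i\<in>I. h ([z i] \<cdot>\<^bsub>A\<^esub> x i))"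
  by (rule finsum) (simp add: assms Pi_iff)
 also have "\<dots> = (\<Oplus>\<^bsub>B\<^esub>i\<in>I. [z i] \<cdot>\<^bsub>B\<^esub> h (x i))"
  by (rule B.finsum_cong') (simp_all add: assms int_mult Pi_iff)
 finally show ?thesis .
qed

lemma add_group_hom_comp:
 assumes "add_group_hom A B u" "add_group_hom B C v"
 shows "add_group_hom A C (\<lambda>x. v (u x))"
proof -
 interpret u: add_group_hom A B u by fact
 interpret v: add_group_hom B C v by fact
 show ?thesis
  by (intro add_group_hom.intro add_group_hom_axioms.intro u.A.abelian_group_axioms v.B.abelian_group_axioms)
   (simp add: add_hom_def)
qed

section \<open>Transport of twisted data along maps between levels\<close>

text \<open>\<open>carry\<close> turns a map \<open>\<tau>\<^bsub>k,0\<^esub>\<^sup>*E \<rightarrow> \<rho>\<^bsub>k,0\<^esub>\<^sup>*E\<close> into its pullback along \<open>\<phi> : U\<^sub>l \<rightarrow> V\<^sub>k\<close>, read as a map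
 \<open>\<tau>\<^bsub>l,0\<^esub>\<^sup>*\<gamma>\<^sup>*E \<rightarrow> \<rho>\<^bsub>l,0\<^esub>\<^sup>*\<gamma>'\<^sup>*E\<close>; \<open>over\<close> is the compatibility that this needs.\<close>

definition carry ::
 "('u, 'r) simplicial_rs \<Rightarrow> ('v, 's) simplicial_rs \<Rightarrow> ('v, 's, 'm) gmod
  \<Rightarrow> ('u, 'r, 'v, 's) rs_mor \<Rightarrow> ('u, 'r, 'v, 's) rs_mor \<Rightarrow> nat \<Rightarrow> nat \<Rightarrow> ('u, 'r, 'v, 's) rs_mor \<Rightarrow> int
  \<Rightarrow> ('v, ('v, 's, 'v, 'm) pb, ('v, 's, 'v, 'm) pb) gmap
  \<Rightarrow> ('u, ('u, 'r, 'u, ('u, 'r, 'v, 'm) pb) pb, ('u, 'r, 'u, ('u, 'r, 'v, 'm) pb) pb) gmap" where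
 "carry U V E \<gamma> \<gamma>' k l \<phi> q u =
   gunfold \<gamma> \<gamma>' (tau U l 0) (rho U l 0) E E q (gpull \<phi> (tau V k 0) (rho V k 0) E E q u)"

definition over ::
 "('u, 'r) simplicial_rs \<Rightarrow> ('v, 's) simplicial_rs \<Rightarrow> ('u, 'r, 'v, 's) rs_mor \<Rightarrow> ('u, 'r, 'v, 's) rs_mor
  \<Rightarrow> nat \<Rightarrow> nat \<Rightarrow> ('u, 'r, 'v, 's) rs_mor \<Rightarrow> bool" where
 "over U V \<gamma> \<gamma>' k l \<phi> \<longleftrightarrow>
   \<gamma> \<in> mor (obj U 0) (obj V 0) \<and> \<gamma>' \<in> mor (obj U 0) (obj V 0) \<and> \<phi> \<in> mor (obj U l) (obj V k) \<and>
   tau V k 0 oo \<phi> = \<gamma> oo tau U l 0 \<and> rho V k 0 oo \<phi> = \<gamma>' oo rho U l 0"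

locale transport = U: simplicial U + V: simplicial V
 for U :: "('u, 'r) simplicial_rs" and V :: "('v, 's) simplicial_rs" +
 fixes E :: "('v, 's, 'm) gmod"
 assumes E: "sheaves (obj V 0) E"
begin

lemma overD:
 assumes "over U V \<gamma> \<gamma>' k l \<phi>"
 shows "\<gamma> \<in> mor (obj U 0) (obj V 0)" "\<gamma>' \<in> mor (obj U 0) (obj V 0)" "\<phi> \<in> mor (obj U l) (obj V k)"
  "tau V k 0 oo \<phi> = \<gamma> oo tau U l 0" "rho V k 0 oo \<phi> = \<gamma>' oo rho U l 0"
 using assms by (simp_all add: over_def)

lemma gpull_tw_hom:
 assumes "\<chi> \<in> mor X (obj V k)"
 shows "add_group_hom (tw_Hom V E E k q)
  (gHom X (gpullback (tau V k 0 oo \<chi>) E) (gpullback (rho V k 0 oo \<chi>) E) q) (gpull \<chi> (tau V k 0) (rho V k 0) E E q)"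
 unfolding tw_Hom_def by (rule gpull_hom[OF assms V.tau0_mor V.rho0_mor E E])

lemma carry_hom:
 assumes o: "over U V \<gamma> \<gamma>' k l \<phi>"
 shows "add_group_hom (tw_Hom V E E k q) (tw_Hom U (gpullback \<gamma> E) (gpullback \<gamma>' E) l q) (carry U V E \<gamma> \<gamma>' k l \<phi> q)"
proof -
 note m = overD[OF o]
 show ?thesis
  unfolding carry_def
  by (rule add_group_hom_comp[OF gpull_tw_hom[OF m(3)]])
   (unfold m(4,5) tw_Hom_def, rule gunfold_hom[OF U.tau0_mor U.rho0_mor m(1,2) E E])
qed

lemma carry_gpull:
 assumes o: "over U V \<gamma> \<gamma>' k l \<phi>" and \<chi>: "\<chi> \<in> mor (obj V k) (obj V r)"
  and c: "tau V r 0 oo \<chi> = tau V k 0" "rho V r 0 oo \<chi> = rho V k 0"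
  and u: "u \<in> carrier (tw_Hom V E E r q)"
 shows "carry U V E \<gamma> \<gamma>' k l \<phi> q (gpull \<chi> (tau V r 0) (rho V r 0) E E q u) =
  gunfold \<gamma> \<gamma>' (tau U l 0) (rho U l 0) E E q (gpull (\<chi> oo \<phi>) (tau V r 0) (rho V r 0) E E q u)"
 using gpull_gpull[OF overD(3)[OF o] \<chi> V.tau0_mor V.rho0_mor E E u[unfolded tw_Hom_def]]
 unfolding c carry_def by simp

text \<open>By \<open>gpull_gunfold\<close> the unfolding moves outside, and the two pullbacks merge
  into one along \<open>\<xi> \<circ> \<psi>\<close>. Together with \<open>carry_gpull\<close> this
  brings both sides of a compatibility to a common form, an unfolding after a single
  pullback.\<close>

lemma gpull_carry:
 assumes o: "over U V \<gamma> \<gamma>' k l \<xi>" and \<psi>: "\<psi> \<in> mor W (obj U l)" and u: "u \<in> carrier (tw_Hom V E E k q)"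
 shows "gpull \<psi> (tau U l 0) (rho U l 0) (gpullback \<gamma> E) (gpullback \<gamma>' E) q (carry U V E \<gamma> \<gamma>' k l \<xi> q u) =
  gunfold \<gamma> \<gamma>' (tau U l 0 oo \<psi>) (rho U l 0 oo \<psi>) E E q (gpull (\<xi> oo \<psi>) (tau V k 0) (rho V k 0) E E q u)"
proof -
 note m = overD[OF o]
 have 1: "gpull \<xi> (tau V k 0) (rho V k 0) E E q u \<in>
   carrier (gHom (obj U l) (gpullback (\<gamma> oo tau U l 0) E) (gpullback (\<gamma>' oo rho U l 0) E) q)"
  using add_group_hom.closed[OF gpull_tw_hom[OF m(3)] u] unfolding m(4,5) .
 show ?thesis
  unfolding carry_def gpull_gunfold[OF \<psi> U.tau0_mor U.rho0_mor m(1,2) E E 1]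
  unfolding m(4,5)[symmetric] gpull_gpull[OF \<psi> m(3) V.tau0_mor V.rho0_mor E E u[unfolded tw_Hom_def]] ..
qed

text \<open>In that common form the two sides differ only by the two paths around the square
  \<open>c\<close>. That \<open>j\<close> and \<open>j'\<close> are inner faces ensures that the
  ends of the maps are the same.\<close>

lemma carry_face:
 assumes o: "over U V \<gamma> \<gamma>' (Suc k) (Suc l) \<phi>" and o': "over U V \<gamma> \<gamma>' k l \<xi>"
  and j: "1 \<le> j" "j \<le> k" and j': "1 \<le> j'" "j' \<le> l"
  and c: "face V k j oo \<phi> = \<xi> oo face U l j'" and u: "u \<in> carrier (tw_Hom V E E k q)"
 shows "carry U V E \<gamma> \<gamma>' (Suc k) (Suc l) \<phi> q (gpull (face V k j) (tau V k 0) (rho V k 0) E E q u) =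
  gpull (face U l j') (tau U l 0) (rho U l 0) (gpullback \<gamma> E) (gpullback \<gamma>' E) q (carry U V E \<gamma> \<gamma>' k l \<xi> q u)"
proof -
 have f: "face V k j \<in> mor (obj V (Suc k)) (obj V k)" "face U l j' \<in> mor (obj U (Suc l)) (obj U l)"
  using j j' by (simp_all add: V.face_mor U.face_mor)
 have e: "tau V k 0 oo face V k j = tau V (Suc k) 0" "rho V k 0 oo face V k j = rho V (Suc k) 0"
  "tau U l 0 oo face U l j' = tau U (Suc l) 0" "rho U l 0 oo face U l j' = rho U (Suc l) 0"
  using V.tau_face[of j k] V.rho_face[of j k] U.tau_face[of j' l] U.rho_face[of j' l] j j' by (simp_all del: tau.simps rho.simps)
 show ?thesis
  unfolding carry_gpull[OF o f(1) e(1,2) u] gpull_carry[OF o' f(2) u] e(3,4) c ..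
qed

text \<open>The two factors meet over the middle vertex, extracted by \<open>?\<mu>\<close> in
  \<open>V\<close> and by \<open>?\<delta>\<close> in \<open>U\<close>; \<open>tau_rho\<close>
  provides the two descriptions of each. The map \<open>\<gamma>'\<close> says to which side of the
  homotopy this vertex belongs, and so it is the target side of the right factor and the source side
  of the left one.\<close>

lemma carry_product:
 assumes o: "over U V \<gamma> \<gamma>'' (p + r) (P + Q) \<phi>" and o1: "over U V \<gamma>' \<gamma>'' p P \<xi>" and o2: "over U V \<gamma> \<gamma>' r Q \<zeta>"
  and c1: "rho V (p + r) p oo \<phi> = \<xi> oo rho U (P + Q) P" and c2: "tau V (p + r) r oo \<phi> = \<zeta> oo tau U (P + Q) Q"
  and u: "u \<in> carrier (tw_Hom V E E p q)" and v: "v \<in> carrier (tw_Hom V E E r s)" and t: "t = s + q"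
 shows "carry U V E \<gamma> \<gamma>'' (p + r) (P + Q) \<phi> t
   (gcomp (obj V (p + r)) (gpullback (tau V (p + r) 0) E) s
    (gpull (rho V (p + r) p) (tau V p 0) (rho V p 0) E E q u)
    (gpull (tau V (p + r) r) (tau V r 0) (rho V r 0) E E s v)) =
  gcomp (obj U (P + Q)) (gpullback (tau U (P + Q) 0) (gpullback \<gamma> E)) s
   (gpull (rho U (P + Q) P) (tau U P 0) (rho U P 0) (gpullback \<gamma>' E) (gpullback \<gamma>'' E) q (carry U V E \<gamma>' \<gamma>'' p P \<xi> q u))
   (gpull (tau U (P + Q) Q) (tau U Q 0) (rho U Q 0) (gpullback \<gamma> E) (gpullback \<gamma>' E) s (carry U V E \<gamma> \<gamma>' r Q \<zeta> s v))"
proof -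
 let ?k = "p + r" and ?l = "P + Q"
 let ?\<mu> = "rho V r 0 oo tau V ?k r" and ?\<delta> = "rho U Q 0 oo tau U ?l Q"
 note m = overD[OF o] and m1 = overD[OF o1] and m2 = overD[OF o2]
 have mr: "rho V ?k p \<in> mor (obj V ?k) (obj V p)" "tau V ?k r \<in> mor (obj V ?k) (obj V r)"
  "rho U ?l P \<in> mor (obj U ?l) (obj U P)" "tau U ?l Q \<in> mor (obj U ?l) (obj U Q)"
  by (simp_all add: V.rho_mor V.tau_mor U.rho_mor U.tau_mor)
 have e: "tau V p 0 oo rho V ?k p = ?\<mu>" "rho V p 0 oo rho V ?k p = rho V ?k 0" "tau V r 0 oo tau V ?k r = tau V ?k 0"
  "tau U P 0 oo rho U ?l P = ?\<delta>" "rho U P 0 oo rho U ?l P = rho U ?l 0" "tau U Q 0 oo tau U ?l Q = tau U ?l 0"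
  using V.tau_rho[of p r] U.tau_rho[of P Q] V.rho.T_T[of 0 p ?k] V.tau.T_T[of 0 r ?k] U.rho.T_T[of 0 P ?l] U.tau.T_T[of 0 Q ?l]
  by simp_all
 have \<mu>: "?\<mu> \<in> mor (obj V ?k) (obj V 0)" by (rule comp_in_mor[OF V.rho0_mor mr(2)])
 have \<delta>: "?\<delta> \<in> mor (obj U ?l) (obj U 0)" by (rule comp_in_mor[OF U.rho0_mor mr(4)])
 have \<mu>\<phi>: "?\<mu> oo \<phi> = \<gamma>' oo ?\<delta>"
  using comp_assoc'[OF V.rho0_mor mr(2) m(3)] comp_assoc'[OF V.rho0_mor m2(3) mr(4)] comp_assoc'[OF m2(2) U.rho0_mor mr(4)] c2 m2(5)
  by simp
 note gu = add_group_hom.closed[OF gpull_tw_hom[OF mr(1)] u, unfolded e] and gv = add_group_hom.closed[OF gpull_tw_hom[OF mr(2)] v, unfolded e]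
 have pu: "gpull \<phi> ?\<mu> (rho V ?k 0) E E q (gpull (rho V ?k p) (tau V p 0) (rho V p 0) E E q u) =
   gpull (\<xi> oo rho U ?l P) (tau V p 0) (rho V p 0) E E q u"
  using gpull_gpull[OF m(3) mr(1) V.tau0_mor V.rho0_mor E E u[unfolded tw_Hom_def]] unfolding e c1 .
 have pv: "gpull \<phi> (tau V ?k 0) ?\<mu> E E s (gpull (tau V ?k r) (tau V r 0) (rho V r 0) E E s v) =
   gpull (\<zeta> oo tau U ?l Q) (tau V r 0) (rho V r 0) E E s v"
  using gpull_gpull[OF m(3) mr(2) V.tau0_mor V.rho0_mor E E v[unfolded tw_Hom_def]] unfolding e c2 .
 have cu: "gpull (\<xi> oo rho U ?l P) (tau V p 0) (rho V p 0) E E q u \<in>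
   carrier (gHom (obj U ?l) (gpullback (\<gamma>' oo ?\<delta>) E) (gpullback (\<gamma>'' oo rho U ?l 0) E) q)"
  using add_group_hom.closed[OF gpull_hom[OF m(3) \<mu> V.rho0_mor E E] gu] unfolding pu \<mu>\<phi> m(5) .
 have cv: "gpull (\<zeta> oo tau U ?l Q) (tau V r 0) (rho V r 0) E E s v \<in>
   carrier (gHom (obj U ?l) (gpullback (\<gamma> oo tau U ?l 0) E) (gpullback (\<gamma>' oo ?\<delta>) E) s)"
  using add_group_hom.closed[OF gpull_hom[OF m(3) V.tau0_mor \<mu> E E] gv] unfolding pv \<mu>\<phi> m(4) .
 show ?thesis
  unfolding carry_def[of U V E \<gamma> \<gamma>'' ?k ?l] gpull_gcomp[OF m(3) V.tau0_mor \<mu> V.rho0_mor E E E t gu gv] pu pv m(4)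
   gunfold_gcomp[OF U.tau0_mor \<delta> U.rho0_mor m(1) m1(1) m(2) E E E t cu cv]
   gpull_carry[OF o1 mr(3) u] gpull_carry[OF o2 mr(4) v] e ..
qed

end

text \<open>A summand of \<open>tw_comp\<close> without its sign. The degrees are free arguments, so
  that bilinearity and transport can be stated for single maps.\<close>

definition cup ::
 "('x, 'r) simplicial_rs \<Rightarrow> ('x, 'r, 'm) gmod \<Rightarrow> ('x, 'r, 'n) gmod \<Rightarrow> ('x, 'r, 'o) gmod \<Rightarrow> nat \<Rightarrow> nat \<Rightarrow> int \<Rightarrow> int
  \<Rightarrow> ('x, ('x, 'r, 'x, 'n) pb, ('x, 'r, 'x, 'o) pb) gmap \<Rightarrow> ('x, ('x, 'r, 'x, 'm) pb, ('x, 'r, 'x, 'n) pb) gmap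
  \<Rightarrow> ('x, ('x, 'r, 'x, 'm) pb, ('x, 'r, 'x, 'o) pb) gmap" where
 "cup U E F G k p q s u v =
   gcomp (obj U k) (gpullback (tau U k 0) E) s
    (gpull (rho U k p) (tau U p 0) (rho U p 0) F G q u)
    (gpull (tau U k (k - p)) (tau U (k - p) 0) (rho U (k - p) 0) E F s v)"

context simplicial
begin

lemma abelian_group_tw_Hom:
 "sheaves (obj U 0) F \<Longrightarrow> sheaves (obj U 0) G \<Longrightarrow> abelian_group (tw_Hom U F G k q)"
 unfolding tw_Hom_def by (intro abelian_group_gHom sheaves_gpullback[OF tau0_mor] sheaves_gpullback[OF rho0_mor])

lemma face_hom:
 assumes F: "sheaves (obj U 0) F" and G: "sheaves (obj U 0) G" and j: "1 \<le> j" "j \<le> k"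
 shows "add_group_hom (tw_Hom U F G k q) (tw_Hom U F G (Suc k) q) (gpull (face U k j) (tau U k 0) (rho U k 0) F G q)"
 using gpull_hom[OF face_mor tau0_mor rho0_mor F G, of j k q] j tau_face[of j k] rho_face[of j k]
 by (simp add: tw_Hom_def del: tau.simps rho.simps)

text \<open>The pulled back factors are composable over the middle vertex, reached by
  \<open>?\<mu>\<close>. Additivity in one factor is that of its pullback followed by that of
  composition.\<close>

lemma cup_homs:
 assumes F: "sheaves (obj U 0) F" and G: "sheaves (obj U 0) G" and H: "sheaves (obj U 0) H" and p: "p \<le> k" and t: "t = s + q"
 shows cup_hom_left: "v \<in> carrier (tw_Hom U F G (k - p) s) \<Longrightarrow>
   add_group_hom (tw_Hom U G H p q) (tw_Hom U F H k t) (\<lambda>u. cup U F G H k p q s u v)"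
  and cup_hom_right: "u \<in> carrier (tw_Hom U G H p q) \<Longrightarrow>
   add_group_hom (tw_Hom U F G (k - p) s) (tw_Hom U F H k t) (\<lambda>v. cup U F G H k p q s u v)"
proof -
 let ?\<mu> = "tau U p 0 oo rho U k p"
 have k: "k - p \<le> k" by simp
 have e: "rho U p 0 oo rho U k p = rho U k 0" "rho U (k - p) 0 oo tau U k (k - p) = ?\<mu>" "tau U (k - p) 0 oo tau U k (k - p) = tau U k 0"
  using tau_rho[of p "k - p"] rho.T_T[OF le0 p] tau.T_T[OF le0 k] p by simp_all
 have \<mu>: "?\<mu> \<in> mor (obj U k) (obj U 0)" by (rule comp_in_mor[OF tau0_mor rho_mor[OF p]])
 note hu = gpull_hom[OF rho_mor[OF p] tau0_mor rho0_mor G H, unfolded e(1)]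
 note hv = gpull_hom[OF tau_mor[OF k] tau0_mor rho0_mor F G, unfolded e(2,3)]
 note s = sheaves_gpullback[OF tau0_mor[of k] F] sheaves_gpullback[OF \<mu> G] sheaves_gpullback[OF rho0_mor[of k] H]
 show "add_group_hom (tw_Hom U G H p q) (tw_Hom U F H k t) (\<lambda>u. cup U F G H k p q s u v)"
  if v: "v \<in> carrier (tw_Hom U F G (k - p) s)"
  unfolding cup_def tw_Hom_def
  by (rule add_group_hom_comp[OF hu gcomp_hom_left[OF s add_group_hom.closed[OF hv v[unfolded tw_Hom_def]] t]])
 show "add_group_hom (tw_Hom U F G (k - p) s) (tw_Hom U F H k t) (\<lambda>v. cup U F G H k p q s u v)"
  if u: "u \<in> carrier (tw_Hom U G H p q)"
  unfolding cup_def tw_Hom_def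
  by (rule add_group_hom_comp[OF hv gcomp_hom_right[OF s add_group_hom.closed[OF hu u[unfolded tw_Hom_def]] t]])
qed

end

lemma tw_delta_simps:
 "tw_delta U E F m \<theta> 0 = \<zero>\<^bsub>tw_Hom U E F 0 (m + 1)\<^esub>"
 "tw_delta U E F m \<theta> (Suc p) = (altsum (tw_Hom U E F (Suc p) (m - int p)) {1..p} int (\<lambda>j. gpull (face U p j) (tau U p 0) (rho U p 0) E F (m - int p) (\<theta> p)))"
 by (simp_all add: tw_delta_def)

lemma tw_comp_cup:
 "tw_comp U E F G m l u v k = (altsum (tw_Hom U E G k (m + l - int k)) {0..k} (\<lambda>p. (m - int p) * int (k - p)) (\<lambda>p. cup U E F G k p (m - int p) (l - int (k - p)) (u p) (v (k - p))))"
 by (simp add: tw_comp_def cup_def)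

lemma (in transport) carry_cup:
 assumes o: "over U V \<gamma> \<gamma>'' k l \<phi>" and o1: "over U V \<gamma>' \<gamma>'' p P \<xi>" and o2: "over U V \<gamma> \<gamma>' (k - p) (l - P) \<zeta>"
  and le: "p \<le> k" "P \<le> l"
  and c: "rho V k p oo \<phi> = \<xi> oo rho U l P" "tau V k (k - p) oo \<phi> = \<zeta> oo tau U l (l - P)"
  and u: "u \<in> carrier (tw_Hom V E E p q)" and v: "v \<in> carrier (tw_Hom V E E (k - p) s)" and t: "t = s + q"
 shows "carry U V E \<gamma> \<gamma>'' k l \<phi> t (cup V E E E k p q s u v) =
  cup U (gpullback \<gamma> E) (gpullback \<gamma>' E) (gpullback \<gamma>'' E) l P q s (carry U V E \<gamma>' \<gamma>'' p P \<xi> q u) (carry U V E \<gamma> \<gamma>' (k - p) (l - P) \<zeta> s v)"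
proof -
 have kl: "p + (k - p) = k" "P + (l - P) = l" using le by simp_all
 show ?thesis
  unfolding cup_def
  by (rule carry_product[where p = p and r = "k - p" and P = P and Q = "l - P", unfolded kl, OF o o1 o2 c u v t])
qed

locale twisted = transport U V E
 for U :: "('u, 'r) simplicial_rs" and V :: "('v, 's) simplicial_rs" and E :: "('v, 's, 'm) gmod" +
 fixes a :: "('v, 's, 'm, 'm) tw_family"
 assumes twisted: "twisted_complex V (E, a)"
begin

lemma a_closed: "a k \<in> carrier (tw_Hom V E E k (1 - int k))"
 using twisted by (simp add: twisted_complex_def tw_families_def)

lemma a_Suc_closed: "a (Suc k) \<in> carrier (tw_Hom V E E (Suc k) (- int k))"
 using a_closed[of "Suc k"] by simp

lemma maurer_cartan: "tw_delta V E E 1 a k \<oplus>\<^bsub>tw_Hom V E E k (2 - int k)\<^esub> tw_comp V E E E 1 1 a a k = \<zero>\<^bsub>tw_Hom V E E k (2 - int k)\<^esub>"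
 using twisted by (simp add: twisted_complex_def)

lemma face_closed: "1 \<le> j \<Longrightarrow> j \<le> k \<Longrightarrow>
  gpull (face V k j) (tau V k 0) (rho V k 0) E E (1 - int k) (a k) \<in> carrier (tw_Hom V E E (Suc k) (1 - int k))"
 by (rule add_group_hom.closed[OF V.face_hom[OF E E] a_closed])

lemma cup_closed: "p \<le> k \<Longrightarrow>
  cup V E E E k p (1 - int p) (1 - int (k - p)) (a p) (a (k - p)) \<in> carrier (tw_Hom V E E k (2 - int k))"
 by (rule add_group_hom.closed[OF V.cup_hom_left[OF E E E _ _ a_closed] a_closed]) simp_all

lemma carry_comp:
 assumes o: "over U V \<gamma> \<gamma>' k l \<phi>"
 shows "carry U V E \<gamma> \<gamma>' k l \<phi> (2 - int k) (tw_comp V E E E 1 1 a a k) =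
  (altsum (tw_Hom U (gpullback \<gamma> E) (gpullback \<gamma>' E) l (2 - int k)) {0..k} (\<lambda>p. (1 - int p) * int (k - p)) (\<lambda>p. carry U V E \<gamma> \<gamma>' k l \<phi> (2 - int k) (cup V E E E k p (1 - int p) (1 - int (k - p)) (a p) (a (k - p)))))"
 unfolding tw_comp_cup one_add_one by (rule add_group_hom.lin[OF carry_hom[OF o] cup_closed]) simp

lemma carry_delta:
 assumes o: "over U V \<gamma> \<gamma>' (Suc k) l \<phi>"
 shows "carry U V E \<gamma> \<gamma>' (Suc k) l \<phi> (1 - int k) (tw_delta V E E 1 a (Suc k)) =
  (altsum (tw_Hom U (gpullback \<gamma> E) (gpullback \<gamma>' E) l (1 - int k)) {1..k} int (\<lambda>j. carry U V E \<gamma> \<gamma>' (Suc k) l \<phi> (1 - int k) (gpull (face V k j) (tau V k 0) (rho V k 0) E E (1 - int k) (a k))))"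
 unfolding tw_delta_simps by (rule add_group_hom.lin[OF carry_hom[OF o] face_closed]) simp_all

lemma delta_comp_closed:
 "tw_delta V E E 1 a k \<in> carrier (tw_Hom V E E k (2 - int k))" "tw_comp V E E E 1 1 a a k \<in> carrier (tw_Hom V E E k (2 - int k))"
proof -
 interpret G: abelian_group "tw_Hom V E E k (2 - int k)" by (rule V.abelian_group_tw_Hom[OF E E])
 show "tw_comp V E E E 1 1 a a k \<in> carrier (tw_Hom V E E k (2 - int k))"
  unfolding tw_comp_cup one_add_one by (rule G.finsum_closed) (simp add: Pi_iff cup_closed del: of_nat_diff)
 show "tw_delta V E E 1 a k \<in> carrier (tw_Hom V E E k (2 - int k))"
 proof (cases k)
  case 0
  then show ?thesis using G.zero_closed by (simp add: tw_delta_simps)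
 next
  case (Suc p)
  have q: "2 - int (Suc p) = 1 - int p" by simp
  interpret G: abelian_group "tw_Hom V E E (Suc p) (1 - int p)" by (rule V.abelian_group_tw_Hom[OF E E])
  show ?thesis
   unfolding Suc q tw_delta_simps by (rule G.finsum_closed) (use face_closed in \<open>simp add: Pi_iff\<close>)
 qed
qed

lemma carry_maurer_cartan:
 assumes o: "over U V \<gamma> \<gamma>' k l \<phi>"
 shows "carry U V E \<gamma> \<gamma>' k l \<phi> (2 - int k) (tw_delta V E E 1 a k)
   \<oplus>\<^bsub>tw_Hom U (gpullback \<gamma> E) (gpullback \<gamma>' E) l (2 - int k)\<^esub>
   carry U V E \<gamma> \<gamma>' k l \<phi> (2 - int k) (tw_comp V E E E 1 1 a a k) =
  \<zero>\<^bsub>tw_Hom U (gpullback \<gamma> E) (gpullback \<gamma>' E) l (2 - int k)\<^esub>"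
proof -
 interpret c: add_group_hom "tw_Hom V E E k (2 - int k)" "tw_Hom U (gpullback \<gamma> E) (gpullback \<gamma>' E) l (2 - int k)"
  "carry U V E \<gamma> \<gamma>' k l \<phi> (2 - int k)" by (rule carry_hom[OF o])
 show ?thesis using c.add[OF delta_comp_closed] c.zero unfolding maurer_cartan by simp
qed

end

section \<open>Pullback of twisted complexes\<close>

locale twisted_map = simplicial_morphism U V f + twisted U V E a
 for U :: "('u, 'r) simplicial_rs" and V :: "('v, 's) simplicial_rs" and f :: "nat \<Rightarrow> ('u, 'r, 'v, 's) rs_mor"
  and E :: "('v, 's, 'm) gmod" and a :: "('v, 's, 'm, 'm) tw_family"
begin

abbreviation "fE \<equiv> gpullback (f 0) E"
abbreviation "fa k \<equiv> carry U V E (f 0) (f 0) k k (f k) (1 - int k) (a k)"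

lemma pullback_eq: "tw_pullback U V f (E, a) = (fE, \<lambda>k. fa k)"
 by (simp add: tw_pullback_def carry_def)

lemma over_map: "over U V (f 0) (f 0) k k (f k)"
 by (simp add: over_def map_mor map_tau map_rho)

lemma fE: "sheaves (obj U 0) fE"
 by (rule sheaves_gpullback[OF map_mor E])

lemma fa_closed: "fa k \<in> carrier (tw_Hom U fE fE k (1 - int k))"
 by (rule add_group_hom.closed[OF carry_hom[OF over_map] a_closed])

text \<open>A simplicial map commutes with faces of every index, so \<open>carry_face\<close>
  applies to each summand with the same \<open>j\<close> on both sides.\<close>

lemma delta_map: "tw_delta U fE fE 1 (\<lambda>k. fa k) k = carry U V E (f 0) (f 0) k k (f k) (2 - int k) (tw_delta V E E 1 a k)"
proof (cases k)
 case 0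
 then show ?thesis using add_group_hom.zero[OF carry_hom[OF over_map[of 0], of 2]] by (simp add: tw_delta_simps)
next
 case (Suc p)
 have q: "2 - int (Suc p) = 1 - int p" by simp
 interpret G: abelian_group "tw_Hom U fE fE (Suc p) (1 - int p)" by (rule U.abelian_group_tw_Hom[OF fE fE])
 have e: "carry U V E (f 0) (f 0) (Suc p) (Suc p) (f (Suc p)) (1 - int p) (gpull (face V p j) (tau V p 0) (rho V p 0) E E (1 - int p) (a p)) =
   gpull (face U p j) (tau U p 0) (rho U p 0) fE fE (1 - int p) (fa p)" if j: "1 \<le> j" "j \<le> p" for j
  by (rule carry_face[OF over_map over_map j j map_face a_closed]) (use j in simp)
 have c: "gpull (face U p j) (tau U p 0) (rho U p 0) fE fE (1 - int p) (fa p) \<in> carrier (tw_Hom U fE fE (Suc p) (1 - int p))"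
  if j: "1 \<le> j" "j \<le> p" for j
  by (rule add_group_hom.closed[OF U.face_hom[OF fE fE j] fa_closed])
 show ?thesis
  unfolding Suc q carry_delta[OF over_map] unfolding tw_delta_simps
  by (rule G.finsum_cong') (simp_all add: e c Pi_iff)
qed

lemma comp_map: "tw_comp U fE fE fE 1 1 (\<lambda>k. fa k) (\<lambda>k. fa k) k = carry U V E (f 0) (f 0) k k (f k) (2 - int k) (tw_comp V E E E 1 1 a a k)"
proof -
 interpret G: abelian_group "tw_Hom U fE fE k (2 - int k)" by (rule U.abelian_group_tw_Hom[OF fE fE])
 have e: "carry U V E (f 0) (f 0) k k (f k) (2 - int k) (cup V E E E k p (1 - int p) (1 - int (k - p)) (a p) (a (k - p))) =
   cup U fE fE fE k p (1 - int p) (1 - int (k - p)) (fa p) (fa (k - p))" if "p \<le> k" for p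
  by (rule carry_cup[OF over_map over_map over_map that that map_rho[OF that] map_tau a_closed a_closed]) (use that in simp_all)
 have c: "cup U fE fE fE k p (1 - int p) (1 - int (k - p)) (fa p) (fa (k - p)) \<in> carrier (tw_Hom U fE fE k (2 - int k))" if "p \<le> k" for p
  by (rule add_group_hom.closed[OF U.cup_hom_left[OF fE fE fE that _ fa_closed] fa_closed]) (use that in simp)
 show ?thesis
  unfolding carry_comp[OF over_map] unfolding tw_comp_cup one_add_one
  by (rule G.finsum_cong') (simp_all add: e c Pi_iff del: of_nat_diff)
qed

lemma gpull_fa0:
 assumes \<psi>: "\<psi> \<in> mor W (obj U 0)"
 shows "gpull \<psi> (tau U 0 0) (rho U 0 0) fE fE 1 (fa 0) =
  gunfold (f 0) (f 0) \<psi> \<psi> E E 1 (gpull (f 0 oo \<psi>) (tau V 0 0) (rho V 0 0) E E 1 (a 0))"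
 using gpull_carry[OF over_map[of 0] \<psi>, of "a 0" 1] a_closed[of 0] U.id_obj(2)[OF \<psi>] by simp

text \<open>The differential \<open>a 0\<close> lives over identities, so transporting it along
  \<chi> and then along \<psi> is one transport along the composite.\<close>

lemma gpull_a0:
 assumes \<psi>: "\<psi> \<in> mor W (obj V k)" and \<chi>: "\<chi> \<in> mor (obj V k) (obj V 0)"
 shows "gpull \<psi> \<chi> \<chi> E E 1 (gpull \<chi> (tau V 0 0) (rho V 0 0) E E 1 (a 0)) = gpull (\<chi> oo \<psi>) (tau V 0 0) (rho V 0 0) E E 1 (a 0)"
 using gpull_gpull[OF \<psi> \<chi> V.tau0_mor[of 0] V.rho0_mor[of 0] E E, of "a 0" 1] a_closed[of 0] V.id_obj(2)[OF \<chi>]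
 by (simp add: tw_Hom_def)

lemma a1_invertible: "homotopy_invertible (obj V 1)
  (gpullback (tau V 1 0) E) (gpull (tau V 1 0) (tau V 0 0) (rho V 0 0) E E 1 (a 0))
  (gpullback (rho V 1 0) E) (gpull (rho V 1 0) (tau V 0 0) (rho V 0 0) E E 1 (a 0)) (a 1)"
 using twisted unfolding twisted_complex_def prod.case by blast

text \<open>The homotopy equivalence \<open>a 1\<close> is transported twice, by pullback along
  \<open>f 1\<close> and by unfolding over \<open>f 0\<close>. The differentials at the two ends
  become those induced by \<open>fa 0\<close>, because iterated transport is transport along the
  composite.\<close>

lemma invertible: "homotopy_invertible (obj U 1)
  (gpullback (tau U 1 0) fE) (gpull (tau U 1 0) (tau U 0 0) (rho U 0 0) fE fE 1 (fa 0))
  (gpullback (rho U 1 0) fE) (gpull (rho U 1 0) (tau U 0 0) (rho U 0 0) fE fE 1 (fa 0)) (fa 1)"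
proof -
 note m = map_mor[of 1]
 note e = map_tau[of 0 1, OF le0] map_rho[of 0 1, OF le0]
 have "homotopy_invertible (obj U 1) (gpullback (f 0 oo tau U 1 0) E) (gpull (f 0 oo tau U 1 0) (tau V 0 0) (rho V 0 0) E E 1 (a 0))
   (gpullback (f 0 oo rho U 1 0) E) (gpull (f 0 oo rho U 1 0) (tau V 0 0) (rho V 0 0) E E 1 (a 0)) (gpull (f 1) (tau V 1 0) (rho V 1 0) E E 0 (a 1))"
  using homotopy_invertible_gpull[OF m V.tau0_mor[of 1] V.rho0_mor[of 1] E a1_invertible]
  unfolding gpull_a0[OF m V.tau0_mor[of 1]] gpull_a0[OF m V.rho0_mor[of 1]] e .
 from homotopy_invertible_gunfold[OF U.tau0_mor[of 1] U.rho0_mor[of 1] map_mor[of 0] E this]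
 show ?thesis
  unfolding gpull_fa0[OF U.tau0_mor[of 1]] gpull_fa0[OF U.rho0_mor[of 1]] by (simp add: carry_def)
qed

lemma twisted_pullback: "twisted_complex U (fE, \<lambda>k. fa k)"
 unfolding twisted_complex_def prod.case
proof (intro conjI allI)
 show "sheaf_of_modules (obj U 0) (fE n)" for n by (rule sheavesD(1)[OF fE])
 show "(\<lambda>k. fa k) \<in> tw_families U fE fE 1" using fa_closed by (simp add: tw_families_def)
 show "tw_delta U fE fE 1 (\<lambda>k. fa k) k \<oplus>\<^bsub>tw_Hom U fE fE k (2 - int k)\<^esub> tw_comp U fE fE fE 1 1 (\<lambda>k. fa k) (\<lambda>k. fa k) k =
   \<zero>\<^bsub>tw_Hom U fE fE k (2 - int k)\<^esub>" for k
  unfolding delta_map comp_map by (rule carry_maurer_cartan[OF over_map])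
qed (rule invertible)

lemma gunfold_id_fa0: "gunfold_id (obj U 0) fE fE 1 (fa 0) = gpull (f 0) (tau V 0 0) (rho V 0 0) E E 1 (a 0)"
 using gunfold_id_gunfold[OF map_mor[of 0] map_mor[of 0] E E, of "gpull (f 0) (tau V 0 0) (rho V 0 0) E E 1 (a 0)" 1]
  add_group_hom.closed[OF gpull_tw_hom[OF map_mor[of 0]] a_closed[of 0]] V.id_obj(2)[OF map_mor[of 0]]
 by (simp add: carry_def)

end

section \<open>The morphism induced by a simplicial homotopy\<close>

locale twisted_homotopy = homotopy U V f g h + twisted U V E a
 for U :: "('u, 'r) simplicial_rs" and V :: "('v, 's) simplicial_rs" and f g :: "nat \<Rightarrow> ('u, 'r, 'v, 's) rs_mor"
  and h :: "nat \<Rightarrow> nat \<Rightarrow> ('u, 'r, 'v, 's) rs_mor" and E :: "('v, 's, 'm) gmod" and a :: "('v, 's, 'm, 'm) tw_family"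
begin

sublocale F: twisted_map U V f E a ..
sublocale G: twisted_map U V g E a ..

abbreviation "hc k i \<equiv> carry U V E (f 0) (g 0) (Suc k) k (h k i)"
abbreviation "Hm k q \<equiv> tw_Hom U F.fE G.fE k q"
abbreviation "A k i \<equiv> hc k i (- int k) (a (Suc k))"
abbreviation "\<Phi> \<equiv> Phi0 U V f g h (E, a)"

lemma Phi_eq: "\<Phi> k = (altsum (Hm k (- int k)) {0..k} int (A k))"
 by (simp add: Phi0_def carry_def)

text \<open>The last vertex of a prism simplex lies over \<open>f\<close> and the first over
  \<open>g\<close>; this is why \<Phi> leads from the pullback along \<open>f\<close> to the
  pullback along \<open>g\<close>.\<close>

lemma over_h: "i \<le> k \<Longrightarrow> over U V (f 0) (g 0) (Suc k) k (h k i)"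
 unfolding over_def using f.map_mor g.map_mor h_mor tau0_h rho0_h by simp

lemma abelian: "abelian_group (Hm k q)"
 by (rule f.U.abelian_group_tw_Hom[OF F.fE G.fE])

lemma A_closed: "i \<le> k \<Longrightarrow> A k i \<in> carrier (Hm k (- int k))"
 by (rule add_group_hom.closed[OF carry_hom[OF over_h] a_Suc_closed])

lemma Phi_closed: "\<Phi> k \<in> carrier (Hm k (- int k))"
proof -
 interpret H: abelian_group "Hm k (- int k)" by (rule abelian)
 show ?thesis unfolding Phi_eq by (rule H.finsum_closed) (simp add: Pi_iff A_closed)
qed

lemma Phi_hom:
 assumes "add_group_hom (Hm k (- int k)) B t"
 shows "t (\<Phi> k) = (altsum B {0..k} int (\<lambda>i. t (A k i)))"
 unfolding Phi_eq by (rule add_group_hom.lin[OF assms A_closed]) simp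

text \<open>In level \<open>l\<close>, the alternating sum over \<open>i\<close> of the pullbacks along \<open>h l i\<close> of the Maurer-Cartan equation
 in level \<open>l + 1\<close> is \<open>- \<delta>\<Phi> + \<Phi> \<cdot> f\<^sup>*a - g\<^sup>*a \<cdot> \<Phi> = 0\<close>: the terms \<open>\<partial>\<^sub>i h\<^sub>i\<close> cancel in pairs, and a product with
 left factor in level \<open>p\<close> gives a summand of \<open>\<Phi> \<cdot> f\<^sup>*a\<close> if \<open>i < p\<close> and of \<open>g\<^sup>*a \<cdot> \<Phi>\<close> otherwise.\<close>

lemma delta_Phi:
 "(altsum (Hm l (1 - int l)) {0..l} int (\<lambda>i. hc l i (1 - int l) (tw_delta V E E 1 a (Suc l)))) =
  \<ominus>\<^bsub>Hm l (1 - int l)\<^esub> tw_delta U F.fE G.fE 0 \<Phi> l"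
proof -
 interpret H: abelian_group "Hm l (1 - int l)" by (rule abelian)
 define D where "D i j = hc l i (1 - int l)
   (gpull (face V l j) (tau V l 0) (rho V l 0) E E (1 - int l) (a l))" for i j
 have D: "D i j \<in> carrier (Hm l (1 - int l))" if "i \<in> {0..l}" "j \<in> {1..l}" for i j
  unfolding D_def using that by (intro add_group_hom.closed[OF carry_hom[OF over_h] face_closed]) simp_all
 have "(altsum (Hm l (1 - int l)) {0..l} int (\<lambda>i. hc l i (1 - int l) (tw_delta V E E 1 a (Suc l)))) =
  (altsum (Hm l (1 - int l)) {0..l} int (\<lambda>i. altsum (Hm l (1 - int l)) {1..l} int (D i)))"
 proof (rule H.finsum_cong')
  fix i assume "i \<in> {0..l}"
  then show "[sgn_pow (int i)] \<cdot>\<^bsub>Hm l (1 - int l)\<^esub>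
    hc l i (1 - int l) (tw_delta V E E 1 a (Suc l)) =
   [sgn_pow (int i)] \<cdot>\<^bsub>Hm l (1 - int l)\<^esub>
    (altsum (Hm l (1 - int l)) {1..l} int (D i))"
   unfolding D_def by (subst carry_delta[OF over_h]) simp_all
 qed (use D in \<open>auto intro!: H.finsum_closed H.int_mult_closed\<close>)
 also have "\<dots> = lin_ext (Hm l (1 - int l)) (\<lambda>v. v)
   (altfrag {0..l} int (\<lambda>i. altfrag {1..l} int (\<lambda>j. frag_of (D i j))))"
  by (rule H.finsum2_frag(1)[OF _ _ D]) simp_all
 also have "\<dots> = \<ominus>\<^bsub>Hm l (1 - int l)\<^esub> tw_delta U F.fE G.fE 0 \<Phi> l"
 proof (cases l)
  case 0
  \<comment> \<open>In level 0 there are no inner faces, and \<open>tw_delta\<close> is zero there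
    by definition.\<close>
  then show ?thesis using H.lin_ext_0 H.uminus_zero by (simp add: tw_delta_simps)
 next
  case (Suc n)
  define B where "B j i = gpull (face U n j) (tau U n 0) (rho U n 0) F.fE G.fE (- int n) (A n i)" for j i
  have q: "1 - int (Suc n) = - int n" "0 - int n = - int n" by simp_all
  have B: "B j i \<in> carrier (Hm (Suc n) (- int n))" if "j \<in> {1..n}" "i \<in> {0..n}" for j i
   unfolding B_def using that by (intro add_group_hom.closed[OF f.U.face_hom[OF F.fE G.fE] A_closed]) simp_all
  have tri: "tau V (Suc n) 0 oo face V (Suc n) j = tau V (Suc (Suc n)) 0" "rho V (Suc n) 0 oo face V (Suc n) j = rho V (Suc (Suc n)) 0"
   if "1 \<le> j" "j \<le> Suc n" for j
   using f.V.tau_face[of j "Suc n"] f.V.rho_face[of j "Suc n"] that by (simp_all del: tau.simps rho.simps)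
  \<comment> \<open>Neighbouring simplices of the prism share this face, by
    \<open>h_eq\<close>.\<close>
  have diag: "D i i = D (i - 1) i" if i: "1 \<le> i" "i \<le> Suc n" for i
  proof -
   have ch: "face V (Suc n) i \<in> mor (obj V (Suc (Suc n))) (obj V (Suc n))" using i by (simp add: f.V.face_mor)
   have le: "i - 1 \<le> Suc n" using i by simp
   show ?thesis
    unfolding D_def Suc carry_gpull[OF over_h[OF i(2)] ch tri[OF i] a_closed] carry_gpull[OF over_h[OF le] ch tri[OF i] a_closed]
    using h_eq[of i "Suc n"] i by simp
  qed
  \<comment> \<open>The remaining faces move past the homotopy: for \<open>j < i\<close> the index
    of \<open>h\<close> drops, for \<open>j > i + 1\<close> that of the face.\<close>
  have low: "D i j = B j (i - 1)" if j: "1 \<le> j" "j < i" and i: "i \<le> Suc n" for i j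
   unfolding D_def B_def Suc q
   by (rule carry_face[OF over_h over_h j(1) _ j(1) _ h_lt[OF j(2) i] a_Suc_closed]) (use i j in simp_all)
  have high: "D i j = B (j - 1) i" if i: "Suc i < j" and j: "j \<le> Suc n" for i j
   unfolding D_def B_def Suc q
   by (rule carry_face[OF over_h over_h _ j _ _ h_gt[OF i] a_Suc_closed]) (use i j in simp_all)
  have "(altfrag {0..Suc n} int (\<lambda>i. altfrag {1..Suc n} int (\<lambda>j. frag_of (D i j)))) =
    - (altfrag {1..n} int (\<lambda>j. altfrag {0..n} int (\<lambda>i. frag_of (B j i))))"
   by (rule homotopy_delta_sum) (simp_all only: diag low high)
  then have 1: "lin_ext (Hm (Suc n) (- int n)) (\<lambda>v. v)
    (altfrag {0..Suc n} int (\<lambda>i. altfrag {1..Suc n} int (\<lambda>j. frag_of (D i j)))) =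
   lin_ext (Hm (Suc n) (- int n)) (\<lambda>v. v)
    (- (altfrag {1..n} int (\<lambda>j. altfrag {0..n} int (\<lambda>i. frag_of (B j i)))))" by (rule arg_cong)
  interpret H': abelian_group "Hm (Suc n) (- int n)" by (rule abelian)
  have 2: "tw_delta U F.fE G.fE 0 \<Phi> (Suc n) = (altsum (Hm (Suc n) (- int n)) {1..n} int (\<lambda>j. altsum (Hm (Suc n) (- int n)) {0..n} int (B j)))"
   unfolding tw_delta_simps q
  proof (rule H'.finsum_cong')
   fix j assume j: "j \<in> {1..n}"
   show "[sgn_pow (int j)] \<cdot>\<^bsub>Hm (Suc n) (- int n)\<^esub> gpull (face U n j) (tau U n 0) (rho U n 0) F.fE G.fE (- int n) (\<Phi> n) =
    [sgn_pow (int j)] \<cdot>\<^bsub>Hm (Suc n) (- int n)\<^esub>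
    (altsum (Hm (Suc n) (- int n)) {0..n} int (B j))"
    unfolding B_def using j by (subst Phi_hom[OF f.U.face_hom[OF F.fE G.fE]]) simp_all
  qed (use B in \<open>auto intro!: H'.finsum_closed H'.int_mult_closed\<close>)
  have k: "Poly_Mapping.keys (altfrag {1..n} int (\<lambda>j. altfrag {0..n} int (\<lambda>i. frag_of (B j i))))
    \<subseteq> carrier (Hm (Suc n) (- int n))"
   by (rule H'.finsum2_frag(2)[OF _ _ B]) simp_all
  have 3: "tw_delta U F.fE G.fE 0 \<Phi> (Suc n) = lin_ext (Hm (Suc n) (- int n)) (\<lambda>v. v)
    (altfrag {1..n} int (\<lambda>j. altfrag {0..n} int (\<lambda>i. frag_of (B j i))))"
   unfolding 2 by (rule H'.finsum2_frag(1)[OF _ _ B]) simp_all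
  show ?thesis
   unfolding Suc q 1 3 by (rule H'.lin_ext_uminus) (use k in blast)
 qed
 finally show ?thesis .
qed

lemma comp_Phi:
 "(altsum (Hm l (1 - int l)) {0..l} int (\<lambda>i. hc l i (1 - int l) (tw_comp V E E E 1 1 a a (Suc l)))) =
  tw_comp U F.fE F.fE G.fE 0 1 \<Phi> (\<lambda>k. F.fa k) l \<ominus>\<^bsub>Hm l (1 - int l)\<^esub> tw_comp U F.fE G.fE G.fE 1 0 (\<lambda>k. G.fa k) \<Phi> l"
proof -
 let ?H = "Hm l (1 - int l)"
 interpret H: abelian_group ?H by (rule abelian)
 define C where "C i p = hc l i (1 - int l)
   (cup V E E E (Suc l) p (1 - int p) (1 - int (Suc l - p)) (a p) (a (Suc l - p)))" for i p
 define X where "X p i = cup U F.fE F.fE G.fE l p (- int p) (1 - int (l - p)) (A p i) (F.fa (l - p))" for p i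
 define Y where "Y p i = cup U F.fE G.fE G.fE l p (1 - int p) (- int (l - p)) (G.fa p) (A (l - p) i)" for p i
 have q: "2 - int (Suc l) = 1 - int l" "0 + 1 - int l = 1 - int l" "1 + 0 - int l = 1 - int l" by simp_all
 have C: "C i p \<in> carrier ?H" if "i \<in> {0..l}" "p \<in> {0..Suc l}" for i p
  unfolding C_def q(1)[symmetric] using that by (intro add_group_hom.closed[OF carry_hom[OF over_h] cup_closed]) simp_all
 have X: "X p i \<in> carrier ?H" if "p \<in> {0..l}" "i \<in> {0..p}" for p i
  unfolding X_def using that by (intro add_group_hom.closed[OF f.U.cup_hom_left[OF F.fE F.fE G.fE _ _ F.fa_closed] A_closed]) simp_all
 have Y: "Y p i \<in> carrier ?H" if "p \<in> {0..l}" "i \<in> {0..l - p}" for p i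
  unfolding Y_def using that
  by (intro add_group_hom.closed[OF f.U.cup_hom_right[OF F.fE G.fE G.fE _ _ G.fa_closed] A_closed]) simp_all
 \<comment> \<open>The jump lies in the left factor, which becomes a summand of \<Phi>; the right
   factor lies over \<open>f\<close> only and becomes a component of the pullback along
   \<open>f\<close>.\<close>
 have CX: "C i (Suc p) = X p i" if i: "i \<le> p" and p: "p \<le> l" for i p
 proof -
  have d: "1 - int (Suc p) = - int p" "Suc l - Suc p = l - p" by simp_all
  have il: "i \<le> l" "i + (l - p) \<le> l" "l - p \<le> l" "Suc p \<le> Suc l" using i p by simp_all
  have t: "1 - int l = 1 - int (l - p) + - int p" using p by simp
  show ?thesis
   unfolding C_def X_def d
   by (rule carry_cup[where k = "Suc l" and p = "Suc p", unfolded d,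
      OF over_h[OF il(1)] over_h[OF i] F.over_map il(4) p rho_h_high[OF i p] tau_h_low[OF il(2)] a_Suc_closed a_closed t])
 qed
 \<comment> \<open>Now the left factor lies over \<open>g\<close> only, and the right factor, in
   level \<open>Suc (l - p)\<close>, contains the jump.\<close>
 have CY: "C i p = Y p (i - p)" if p: "p \<le> i" and i: "i \<le> l" for i p
 proof -
  have pl: "p \<le> l" "p \<le> Suc l" "i - p \<le> l - p" "p + (l - p) = l" using p i by simp_all
  have d: "Suc l - p = Suc (l - p)" "1 - int (Suc (l - p)) = - int (l - p)" using pl by simp_all
  have t: "1 - int l = - int (l - p) + (1 - int p)" using pl by simp
  show ?thesis
   unfolding C_def Y_def d
   by (rule carry_cup[where k = "Suc l" and p = p, unfolded d(1),
      OF over_h[OF i] G.over_map over_h[OF pl(3)] pl(2,1) rho_h_low[OF p i] tau_h_high[OF pl(4) p i] a_closed a_Suc_closed t])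
 qed
 have "(altsum ?H {0..l} int (\<lambda>i. hc l i (1 - int l) (tw_comp V E E E 1 1 a a (Suc l)))) =
  (altsum ?H {0..l} int (\<lambda>i. altsum ?H {0..Suc l} (\<lambda>p. (1 - int p) * int (Suc l - p)) (C i)))"
 proof (rule H.finsum_cong')
  fix i assume "i \<in> {0..l}"
  then have i: "i \<le> l" by simp
  show "[sgn_pow (int i)] \<cdot>\<^bsub>?H\<^esub> hc l i (1 - int l) (tw_comp V E E E 1 1 a a (Suc l)) =
   [sgn_pow (int i)] \<cdot>\<^bsub>?H\<^esub> (altsum ?H {0..Suc l} (\<lambda>p. (1 - int p) * int (Suc l - p)) (C i))"
   unfolding C_def carry_comp[OF over_h[OF i], unfolded q] ..
 qed (use C in \<open>auto intro!: H.finsum_closed H.int_mult_closed simp del: of_nat_diff\<close>)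
 also have "\<dots> = lin_ext ?H (\<lambda>v. v) (altfrag {0..l} int (\<lambda>i. altfrag {0..Suc l} (\<lambda>p. (1 - int p) * int (Suc l - p)) (\<lambda>p. frag_of (C i p))))"
  by (rule H.finsum2_frag(1)[OF _ _ C]) simp_all
 also have "(altfrag {0..l} int (\<lambda>i. altfrag {0..Suc l} (\<lambda>p. (1 - int p) * int (Suc l - p)) (\<lambda>p. frag_of (C i p)))) =
  (altfrag {0..l} (\<lambda>p. (0 - int p) * int (l - p)) (\<lambda>p. altfrag {0..p} int (\<lambda>i. frag_of (X p i))))
  - (altfrag {0..l} (\<lambda>p. (1 - int p) * int (l - p)) (\<lambda>p. altfrag {0..l - p} int (\<lambda>i. frag_of (Y p i))))"
  by (rule homotopy_product_sum) (simp_all only: CX CY)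
 also have "lin_ext ?H (\<lambda>v. v) \<dots> =
   (altsum ?H {0..l} (\<lambda>p. (0 - int p) * int (l - p)) (\<lambda>p. altsum ?H {0..p} int (X p))) \<ominus>\<^bsub>?H\<^esub>
   (altsum ?H {0..l} (\<lambda>p. (1 - int p) * int (l - p)) (\<lambda>p. altsum ?H {0..l - p} int (Y p)))"
 proof -
  let ?cX = "\<Sum>p\<in>{0..l}. frag_cmul (sgn_pow ((0 - int p) * int (l - p))) (altfrag {0..p} int (\<lambda>i. frag_of (X p i)))"
  let ?cY = "\<Sum>p\<in>{0..l}. frag_cmul (sgn_pow ((1 - int p) * int (l - p))) (altfrag {0..l - p} int (\<lambda>i. frag_of (Y p i)))"
  have "Poly_Mapping.keys ?cX \<subseteq> carrier ?H" by (rule H.finsum2_frag(2)[OF _ _ X]) simp_all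
  moreover have "Poly_Mapping.keys ?cY \<subseteq> carrier ?H" by (rule H.finsum2_frag(2)[OF _ _ Y]) simp_all
  ultimately have "lin_ext ?H (\<lambda>v. v) (?cX - ?cY) = lin_ext ?H (\<lambda>v. v) ?cX \<ominus>\<^bsub>?H\<^esub> lin_ext ?H (\<lambda>v. v) ?cY"
   by (intro H.lin_ext_diff) blast+
  also have "lin_ext ?H (\<lambda>v. v) ?cX =
    (altsum ?H {0..l} (\<lambda>p. (0 - int p) * int (l - p)) (\<lambda>p. altsum ?H {0..p} int (X p)))"
   by (rule H.finsum2_frag(1)[OF _ _ X, symmetric]) simp_all
  also have "lin_ext ?H (\<lambda>v. v) ?cY =
    (altsum ?H {0..l} (\<lambda>p. (1 - int p) * int (l - p)) (\<lambda>p. altsum ?H {0..l - p} int (Y p)))"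
   by (rule H.finsum2_frag(1)[OF _ _ Y, symmetric]) simp_all
  finally show ?thesis .
 qed
 also have "(altsum ?H {0..l} (\<lambda>p. (0 - int p) * int (l - p)) (\<lambda>p. altsum ?H {0..p} int (X p))) =
   tw_comp U F.fE F.fE G.fE 0 1 \<Phi> (\<lambda>k. F.fa k) l"
  unfolding tw_comp_cup q
 proof (rule H.finsum_cong')
  fix p assume "p \<in> {0..l}"
  then have p: "p \<le> l" "1 - int l = 1 - int (l - p) + - int p" by simp_all
  have e: "cup U F.fE F.fE G.fE l p (0 - int p) (1 - int (l - p)) (\<Phi> p) (F.fa (l - p)) = (altsum ?H {0..p} int (X p))"
   unfolding X_def diff_0 by (rule Phi_hom[OF f.U.cup_hom_left[OF F.fE F.fE G.fE p F.fa_closed]])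
  show "[sgn_pow ((0 - int p) * int (l - p))] \<cdot>\<^bsub>?H\<^esub> (altsum ?H {0..p} int (X p)) =
   [sgn_pow ((0 - int p) * int (l - p))] \<cdot>\<^bsub>?H\<^esub> cup U F.fE F.fE G.fE l p (0 - int p) (1 - int (l - p)) (\<Phi> p) (F.fa (l - p))"
   unfolding e ..
 next
  show "(\<lambda>p. [sgn_pow ((0 - int p) * int (l - p))] \<cdot>\<^bsub>?H\<^esub> cup U F.fE F.fE G.fE l p (0 - int p) (1 - int (l - p)) (\<Phi> p) (F.fa (l - p)))
    \<in> {0..l} \<rightarrow> carrier ?H"
  proof (rule funcsetI, rule H.int_mult_closed)
   fix p assume "p \<in> {0..l}"
   then have p: "p \<le> l" "1 - int l = 1 - int (l - p) + - int p" by simp_all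
   show "cup U F.fE F.fE G.fE l p (0 - int p) (1 - int (l - p)) (\<Phi> p) (F.fa (l - p)) \<in> carrier ?H"
    unfolding diff_0 by (rule add_group_hom.closed[OF f.U.cup_hom_left[OF F.fE F.fE G.fE p F.fa_closed] Phi_closed])
  qed
 qed simp
 also have "(altsum ?H {0..l} (\<lambda>p. (1 - int p) * int (l - p)) (\<lambda>p. altsum ?H {0..l - p} int (Y p))) =
   tw_comp U F.fE G.fE G.fE 1 0 (\<lambda>k. G.fa k) \<Phi> l"
  unfolding tw_comp_cup q
 proof (rule H.finsum_cong')
  fix p assume "p \<in> {0..l}"
  then have p: "p \<le> l" "1 - int l = - int (l - p) + (1 - int p)" by simp_all
  have e: "cup U F.fE G.fE G.fE l p (1 - int p) (0 - int (l - p)) (G.fa p) (\<Phi> (l - p)) = (altsum ?H {0..l - p} int (Y p))"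
   unfolding Y_def diff_0 by (rule Phi_hom[OF f.U.cup_hom_right[OF F.fE G.fE G.fE p G.fa_closed]])
  show "[sgn_pow ((1 - int p) * int (l - p))] \<cdot>\<^bsub>?H\<^esub> (altsum ?H {0..l - p} int (Y p)) =
   [sgn_pow ((1 - int p) * int (l - p))] \<cdot>\<^bsub>?H\<^esub> cup U F.fE G.fE G.fE l p (1 - int p) (0 - int (l - p)) (G.fa p) (\<Phi> (l - p))"
   unfolding e ..
 next
  show "(\<lambda>p. [sgn_pow ((1 - int p) * int (l - p))] \<cdot>\<^bsub>?H\<^esub> cup U F.fE G.fE G.fE l p (1 - int p) (0 - int (l - p)) (G.fa p) (\<Phi> (l - p)))
    \<in> {0..l} \<rightarrow> carrier ?H"
  proof (rule funcsetI, rule H.int_mult_closed)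
   fix p assume "p \<in> {0..l}"
   then have p: "p \<le> l" "1 - int l = - int (l - p) + (1 - int p)" by simp_all
   show "cup U F.fE G.fE G.fE l p (1 - int p) (0 - int (l - p)) (G.fa p) (\<Phi> (l - p)) \<in> carrier ?H"
    unfolding diff_0 by (rule add_group_hom.closed[OF f.U.cup_hom_right[OF F.fE G.fE G.fE p G.fa_closed] Phi_closed])
  qed
 qed simp
 finally show ?thesis .
qed

lemma Phi_closed_morphism:
 "tw_diff U (F.fE, \<lambda>k. F.fa k) (G.fE, \<lambda>k. G.fa k) 0 \<Phi> l = \<zero>\<^bsub>Hm l (1 - int l)\<^esub>"
proof -
 let ?H = "Hm l (1 - int l)"
 interpret H: abelian_group ?H by (rule abelian)
 let ?d = "\<lambda>i. hc l i (1 - int l) (tw_delta V E E 1 a (Suc l))"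
 let ?c = "\<lambda>i. hc l i (1 - int l) (tw_comp V E E E 1 1 a a (Suc l))"
 let ?\<delta> = "tw_delta U F.fE G.fE 0 \<Phi> l" and ?x = "tw_comp U F.fE F.fE G.fE 0 1 \<Phi> (\<lambda>k. F.fa k) l"
  and ?y = "tw_comp U F.fE G.fE G.fE 1 0 (\<lambda>k. G.fa k) \<Phi> l"
 have q: "2 - int (Suc l) = 1 - int l" "0 + 1 - int l = 1 - int l" "1 + 0 - int l = 1 - int l" by simp_all
 have dc: "?d i \<in> carrier ?H" "?c i \<in> carrier ?H" "?d i \<oplus>\<^bsub>?H\<^esub> ?c i = \<zero>\<^bsub>?H\<^esub>" if "i \<in> {0..l}" for i
 proof -
  have i: "i \<le> l" using that by simp
  show "?d i \<in> carrier ?H" "?c i \<in> carrier ?H"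
   using add_group_hom.closed[OF carry_hom[OF over_h[OF i]] delta_comp_closed(1)]
    add_group_hom.closed[OF carry_hom[OF over_h[OF i]] delta_comp_closed(2)] unfolding q .
  show "?d i \<oplus>\<^bsub>?H\<^esub> ?c i = \<zero>\<^bsub>?H\<^esub>" using carry_maurer_cartan[OF over_h[OF i]] unfolding q .
 qed
 have \<delta>: "?\<delta> \<in> carrier ?H"
 proof (cases l)
  case 0
  then show ?thesis using H.zero_closed by (simp add: tw_delta_simps)
 next
  case (Suc n)
  have d: "0 - int n = - int n" "1 - int (Suc n) = - int n" by simp_all
  interpret H': abelian_group "Hm (Suc n) (- int n)" by (rule abelian)
  show ?thesis
   unfolding Suc d tw_delta_simps
   by (intro H'.finsum_closed funcsetI H'.int_mult_closed add_group_hom.closed[OF f.U.face_hom[OF F.fE G.fE] Phi_closed]) simp_all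
 qed
 have x: "?x \<in> carrier ?H"
  unfolding tw_comp_cup q diff_0
  by (intro H.finsum_closed funcsetI H.int_mult_closed
    add_group_hom.closed[OF f.U.cup_hom_left[OF F.fE F.fE G.fE _ _ F.fa_closed] Phi_closed]) simp_all
 have y: "?y \<in> carrier ?H"
  unfolding tw_comp_cup q diff_0
  by (intro H.finsum_closed funcsetI H.int_mult_closed
    add_group_hom.closed[OF f.U.cup_hom_right[OF F.fE G.fE G.fE _ _ G.fa_closed] Phi_closed]) simp_all
 have "\<zero>\<^bsub>?H\<^esub> = (\<Oplus>\<^bsub>?H\<^esub>i\<in>{0..l}. [sgn_pow (int i)] \<cdot>\<^bsub>?H\<^esub> ?d i \<oplus>\<^bsub>?H\<^esub> [sgn_pow (int i)] \<cdot>\<^bsub>?H\<^esub> ?c i)"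
 proof -
  have "[sgn_pow (int i)] \<cdot>\<^bsub>?H\<^esub> ?d i \<oplus>\<^bsub>?H\<^esub> [sgn_pow (int i)] \<cdot>\<^bsub>?H\<^esub> ?c i = \<zero>\<^bsub>?H\<^esub>" if "i \<in> {0..l}" for i
   using H.add.int_pow_distrib[OF dc(1,2)[OF that], of "sgn_pow (int i)"] by (simp add: dc(3)[OF that] H.add.int_pow_one)
  then have "(\<Oplus>\<^bsub>?H\<^esub>i\<in>{0..l}. [sgn_pow (int i)] \<cdot>\<^bsub>?H\<^esub> ?d i \<oplus>\<^bsub>?H\<^esub> [sgn_pow (int i)] \<cdot>\<^bsub>?H\<^esub> ?c i) = (\<Oplus>\<^bsub>?H\<^esub>i\<in>{0..l}. \<zero>\<^bsub>?H\<^esub>)"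
   by (intro H.finsum_cong') simp_all
  then show ?thesis by simp
 qed
 also have "\<dots> = (altsum ?H {0..l} int ?d) \<oplus>\<^bsub>?H\<^esub> (altsum ?H {0..l} int ?c)"
  by (rule H.finsum_addf) (use dc in simp_all)
 also have "\<dots> = (\<ominus>\<^bsub>?H\<^esub> ?\<delta>) \<oplus>\<^bsub>?H\<^esub> (?x \<ominus>\<^bsub>?H\<^esub> ?y)"
  unfolding delta_Phi comp_Phi ..
 finally have z: "\<zero>\<^bsub>?H\<^esub> = (\<ominus>\<^bsub>?H\<^esub> ?\<delta>) \<oplus>\<^bsub>?H\<^esub> (?x \<ominus>\<^bsub>?H\<^esub> ?y)" .
 \<comment> \<open>In degree 0 the differential of \<Phi> is the negative of the sum that has just
   been identified with zero.\<close>
 have "(?\<delta> \<oplus>\<^bsub>?H\<^esub> ?y) \<ominus>\<^bsub>?H\<^esub> ?x = \<ominus>\<^bsub>?H\<^esub> ((\<ominus>\<^bsub>?H\<^esub> ?\<delta>) \<oplus>\<^bsub>?H\<^esub> (?x \<ominus>\<^bsub>?H\<^esub> ?y))"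
  using \<delta> x y by (simp add: H.minus_add a_minus_def H.a_ac H.minus_minus)
 then show ?thesis
  unfolding z[symmetric] H.uminus_zero unfolding tw_diff_def prod.case q using x by (simp add: sgn_pow_def)
qed

lemma Phi_quasi_isomorphism:
 "quasi_isomorphism (obj U 0) F.fE (gunfold_id (obj U 0) F.fE F.fE 1 (F.fa 0)) G.fE (gunfold_id (obj U 0) G.fE G.fE 1 (G.fa 0))
   (gunfold_id (obj U 0) F.fE G.fE 0 (\<Phi> 0))"
proof -
 have h0: "h 0 0 \<in> mor (obj U 0) (obj V 1)" using h_mor[of 0 0] by simp
 have e: "tau V 1 0 oo h 0 0 = f 0" "rho V 1 0 oo h 0 0 = g 0"
  using tau0_h[of 0 0] rho0_h[of 0 0] f.U.id_obj(1)[OF f.map_mor[of 0]] f.U.id_obj(1)[OF g.map_mor[of 0]] by simp_all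
 let ?w = "gpull (h 0 0) (tau V 1 0) (rho V 1 0) E E 0 (a 1)"
 have w: "?w \<in> carrier (gHom (obj U 0) F.fE G.fE 0)"
  using add_group_hom.closed[OF gpull_tw_hom[OF h0] a_closed[of 1]] unfolding e by simp
 interpret H: abelian_group "Hm 0 0" by (rule abelian)
 \<comment> \<open>For \<open>k = 0\<close> the alternating sum has the single index
   \<open>i = 0\<close>, with sign 1.\<close>
 have "\<Phi> 0 = A 0 0"
  unfolding Phi_eq
  using A_closed[of 0 0] H.finsum_insert[of "{}" 0 "\<lambda>i. [sgn_pow (int i)] \<cdot>\<^bsub>Hm 0 0\<^esub> A 0 i"] by (simp add: sgn_pow_def)
 also have "\<dots> = gunfold (f 0) (g 0) (id_mor (obj U 0)) (id_mor (obj U 0)) E E 0 ?w"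
  by (simp add: carry_def)
 finally have \<Phi>: "gunfold_id (obj U 0) F.fE G.fE 0 (\<Phi> 0) = ?w"
  using gunfold_id_gunfold[OF f.map_mor g.map_mor E E w] by simp
 have "homotopy_invertible (obj U 0) F.fE (gpull (f 0) (tau V 0 0) (rho V 0 0) E E 1 (a 0))
   G.fE (gpull (g 0) (tau V 0 0) (rho V 0 0) E E 1 (a 0)) ?w"
  using homotopy_invertible_gpull[OF h0 f.V.tau0_mor[of 1] f.V.rho0_mor[of 1] E F.a1_invertible]
  unfolding F.gpull_a0[OF h0 f.V.tau0_mor[of 1]] F.gpull_a0[OF h0 f.V.rho0_mor[of 1]] e .
 then show ?thesis
  unfolding F.gunfold_id_fa0 G.gunfold_id_fa0 \<Phi> by (rule homotopy_invertible_quasi_isomorphism)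
qed

lemma Phi_weak_equivalence: "weak_equivalence U (tw_pullback U V f (E, a)) (tw_pullback U V g (E, a)) \<Phi>"
 unfolding F.pullback_eq G.pullback_eq weak_equivalence_def prod.case
proof (intro conjI allI)
 show "\<Phi> \<in> tw_families U F.fE G.fE 0" using Phi_closed by (simp add: tw_families_def)
qed (rule F.twisted_pullback G.twisted_pullback Phi_closed_morphism Phi_quasi_isomorphism)+

end

theorem proposition3p5:
  fixes U :: "('u, 'r) simplicial_rs" and V :: "('v, 's) simplicial_rs"
    and f g :: "nat \<Rightarrow> ('u, 'r, 'v, 's) rs_mor"
    and h :: "nat \<Rightarrow> nat \<Rightarrow> ('u, 'r, 'v, 's) rs_mor"
    and \<E> :: "('v, 's, 'e) twisted"
  assumes "simplicial_ringed_space U" and "simplicial_ringed_space V"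
    and "simplicial_map U V f" and "simplicial_map U V g"
    and "simplicial_homotopy U V f g h"
    and "twisted_complex V \<E>"
  shows "weak_equivalence U (tw_pullback U V f \<E>) (tw_pullback U V g \<E>) (Phi0 U V f g h \<E>)"
proof -
 obtain E a where \<E>: "\<E> = (E, a)" by (cases \<E>)
 interpret twisted_homotopy U V f g h E a
 proof (unfold_locales)
  show "sheaves (obj V 0) E" using assms(6) by (simp add: \<E> twisted_complex_def sheaves_def)
  show "twisted_complex V (E, a)" using assms(6) by (simp only: \<E>)
 qed (rule assms)+
 show ?thesis unfolding \<E> by (rule Phi_weak_equivalence)
qed

end
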